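(* Let $X=\Gamma\backslash\mathbb{H}$ be a noncompact finite volume hyperbolic Riemann surface of genus $g\ge 2$ with $i\infty$ as its only puncture, $\overline{X}=X\cup\{i\infty\}$ its Satake compactification, $\mu_{\overline{X}}^{\mathrm{hyp}}$ the hyperbolic metric, and $\mu_{\overline{X}}^{\mathrm{Ber},k}$ the Bergman metric associated to the line bundle $\mathcal{L}^{k}=\Omega_{\overline{X}}^{\otimes k}\otimes\mathcal{O}_{\overline{X}}((k-1)i\infty)$. Then, for all sufficiently large integers $k$, $$\sup_{z\in\overline{X}}\left|\frac{\mu_{\overline{X}}^{\mathrm{Ber},k}(z)}{\mu_{\overline{X}}^{\mathrm{hyp}}(z)}\right|=O_{\Gamma}(k^{3}),$$ where the implied constant depends only on the Fuchsian subgroup $\Gamma$ (in particular not on $k$).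
   Context: Setting. $X$ is a noncompact finite volume hyperbolic Riemann surface of genus $g\ge 2$ (the genus of $\overline{X}$), realized by uniformization as $X=\Gamma\backslash\mathbb{H}$, where $\mathbb{H}=\{z=x+iy: y>0\}$ is its universal cover and $\Gamma\subset\mathrm{PSL}_2(\mathbb{R})$ is a cofinite Fuchsian subgroup acting by fractional linear transformations. The only puncture of $X$ is $i\infty$, and its stabilizer is $\Gamma_{i\infty}=\{\begin{pmatrix}1&n\\0&1\end{pmatrix}: n\in\mathbb{Z}\}$. $\overline{X}=X\cup\{i\infty\}$ is the compactification, with local coordinate $q(z)=e^{2\pi i z}$ at $i\infty$. Points of $X$ are locally identified with points $z=x+iy\in\mathbb{H}$. Hyperbolic metric. On $\mathbb{H}$ it is $\frac{i}{2}\frac{dz\wedge d\overline{z}}{y^2}=\frac{dx\,dy}{y^2}$; it descends to $X$ and extends to a singular metric $\mu_{\overline{X}}^{\mathrm{hyp}}$ on $\overline{X}$, singular only at $i\infty$. Line bundle. $\Omega_{\overline{X}}$ is the bundle of holomorphic 1-forms on $\overline{X}$, and $\mathcal{L}^k=\Omega_{\overline{X}}^{\otimes k}\otimes\mathcal{O}_{\overline{X}}((k-1)i\infty)$. A section $\omega\in H^0(\overline{X},\mathcal{L}^k)$ is written $\omega(z)=f(z)\,dz^{\otimes k}$ with $f$ a cusp form of weight $2k$ for $\Gamma$. The pointwise hyperbolic metric is $\|\omega(z)\|_{\mathrm{hyp}}^2=y^{2k}|f(z)|^2$, and for $\omega=f\,dz^{\otimes k}$, $\eta=g\,dz^{\otimes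 k}$ the $L^2$-inner product is $\langle\omega,\eta\rangle_{\mathrm{hyp}}=\int_{\Gamma\backslash\mathbb{H}}y^{2k}f(z)\overline{g(z)}\,\frac{dx\,dy}{y^2}$. Bergman kernel and metric. Let $\{\omega_1,\dots,\omega_{n_k}\}$ be an orthonormal basis of $H^0(\overline{X},\mathcal{L}^k)$ for $\langle\cdot,\cdot\rangle_{\mathrm{hyp}}$. Put $\|\mathcal{B}^k_{\mathcal{L}}(z)\|_{\mathrm{hyp}}=\sum_{j=1}^{n_k}\|\omega_j(z)\|^2_{\mathrm{hyp}}$ (independent of the basis). For $z\in\overline{X}\setminus\{i\infty\}$ the Bergman metric is the $(1,1)$-form $$\mu_{\overline{X}}^{\mathrm{Ber},k}(z)=-\frac{i}{2\pi}\partial_z\partial_{\overline{z}}\log\|\mathcal{B}^k_{\mathcal{L}}(z)\|_{\mathrm{hyp}}.$$ Ratio. $\mu_{\overline{X}}^{\mathrm{Ber},k}/\mu_{\overline{X}}^{\mathrm{hyp}}$ denotes the function $\phi$ with $\mu_{\overline{X}}^{\mathrm{Ber},k}=\phi\,\mu_{\overline{X}}^{\mathrm{hyp}}$ on $\overline{X}\setminus\{i\infty\}$; at $i\infty$, where the Bergman metric itself is not defined, the ratio is understood by its limiting value. *)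

theory Defs
  imports "HOL-Complex_Analysis.Complex_Analysis" "HOL-Homology.Homology"
begin

definition uhp :: "complex set" where
  "uhp = {z. Im z > 0}"

definition SL2R :: "(real^2^2) monoid" where
  "SL2R = \<lparr>carrier = {A. det A = 1}, monoid.mult = (**), one = mat 1\<rparr>"

text \<open>The elements of \<open>PSL2R\<close> are the cosets \<open>{A, -A}\<close>. Hence, for a subgroup \<open>\<Gamma>\<close> of
  \<open>PSL2R\<close>, the union \<open>\<Union>\<Gamma>\<close> is the full preimage of \<open>\<Gamma>\<close> in \<open>SL2R\<close>; the definitions below
  use this set of matrices.\<close>

definition PSL2R :: "(real^2^2) set monoid" where
  "PSL2R = SL2R Mod {mat 1, - mat 1}"

lemma group_SL2R: "group SL2R"
proof (rule groupI)
  fix A assume "A \<in> carrier SL2R"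
  then have "det A = 1" by (simp add: SL2R_def)
  then have "invertible A" by (simp add: invertible_det_nz)
  then obtain B where B: "A ** B = mat 1" "B ** A = mat 1" unfolding invertible_def by blast
  then have "det B = 1" using \<open>det A = 1\<close> det_mul[of A B] by simp
  with B show "\<exists>B\<in>carrier SL2R. B \<otimes>\<^bsub>SL2R\<^esub> A = \<one>\<^bsub>SL2R\<^esub>" by (auto simp: SL2R_def)
qed (auto simp: SL2R_def det_mul matrix_mul_assoc)

lemma uminus_matrix_mult: "(- A) ** B = - (A ** B)" "A ** (- B) = - (A ** B)" for A B :: "real^2^2"
  by (simp_all add: matrix_matrix_mult_def vec_eq_iff sum_negf)

lemma carrier_PSL2R: "carrier PSL2R = (\<lambda>A. {A, - A}) ` {A. det A = 1}"
  unfolding PSL2R_def FactGroup_def RCOSETS_def r_coset_def SL2R_def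
  by (auto simp: uminus_matrix_mult)

lemma group_PSL2R: "group PSL2R"
proof -
  have d: "det (- mat 1 :: real^2^2) = 1" by (simp add: det_2 mat_def)
  interpret group SL2R by (rule group_SL2R)
  have inv: "inv\<^bsub>SL2R\<^esub> (- mat 1) = - mat 1"
    by (rule inv_equality) (auto simp: SL2R_def uminus_matrix_mult d)
  have "subgroup {mat 1, - mat 1} SL2R"
  proof (rule subgroupI)
    show "inv\<^bsub>SL2R\<^esub> a \<in> {mat 1, - mat 1}" if "a \<in> {mat 1, - mat 1}" for a
      using that inv inv_one by (auto simp: SL2R_def)
  qed (auto simp: SL2R_def d uminus_matrix_mult)
  then have "{mat 1, - mat 1} \<lhd> SL2R"
    by (rule normalI) (auto simp: r_coset_def l_coset_def SL2R_def uminus_matrix_mult)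
  then show ?thesis unfolding PSL2R_def by (rule normal.factorgroup_is_group)
qed

definition moebius :: "real^2^2 \<Rightarrow> complex \<Rightarrow> complex" where
  "moebius A z = (of_real (A$1$1) * z + of_real (A$1$2)) / (of_real (A$2$1) * z + of_real (A$2$2))"

definition fuchsian :: "(real^2^2) set set \<Rightarrow> bool" where
  "fuchsian \<Gamma> \<longleftrightarrow> subgroup \<Gamma> PSL2R \<and> discrete (\<Union>\<Gamma>)"

text \<open>No element of \<open>\<Gamma>\<close> other than the identity has a fixed point in the upper half-plane, i.e.
  the upper half-plane is the universal cover of the quotient.\<close>

definition acts_freely :: "(real^2^2) set set \<Rightarrow> bool" where
  "acts_freely \<Gamma> \<longleftrightarrow> (\<forall>A\<in>\<Union>\<Gamma>. \<forall>z\<in>uhp. moebius A z = z \<longrightarrow> A = mat 1 \<or> A = - mat 1)"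

text \<open>The element \<open>A\<close> fixes \<open>i\<infinity>\<close> iff its lower left entry vanishes.\<close>

definition stabilizer_at_infinity :: "(real^2^2) set set \<Rightarrow> (real^2^2) set set" where
  "stabilizer_at_infinity \<Gamma> = {\<gamma>\<in>\<Gamma>. \<forall>A\<in>\<gamma>. A$2$1 = 0}"

definition translation :: "int \<Rightarrow> real^2^2" where
  "translation n = vector [vector [1, of_int n], vector [0, 1]]"

definition integer_translations :: "(real^2^2) set set" where
  "integer_translations = (\<Union>n. {{translation n, - translation n}})"


definition hyp_measure :: "complex measure" where
  "hyp_measure = density lborel (\<lambda>z. ennreal (indicator uhp z / (Im z)\<^sup>2))"

definition fundamental_domain :: "(real^2^2) set set \<Rightarrow> complex set \<Rightarrow> bool" where
  "fundamental_domain \<Gamma> D \<longleftrightarrow>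
     D \<in> sets borel \<and> D \<subseteq> uhp \<and> (\<Union>A\<in>\<Union>\<Gamma>. moebius A ` D) = uhp \<and>
     (\<forall>A\<in>\<Union>\<Gamma>. A \<noteq> mat 1 \<and> A \<noteq> - mat 1 \<longrightarrow> emeasure hyp_measure (D \<inter> moebius A ` D) = 0)"

text \<open>For a discrete group fundamental domains exist, and the integral of an invariant function
  does not depend on which one is chosen.\<close>

definition fund_dom :: "(real^2^2) set set \<Rightarrow> complex set" where
  "fund_dom \<Gamma> = (SOME D. fundamental_domain \<Gamma> D)"

definition finite_covolume :: "(real^2^2) set set \<Rightarrow> bool" where
  "finite_covolume \<Gamma> \<longleftrightarrow> (\<exists>D. fundamental_domain \<Gamma> D) \<and> emeasure hyp_measure (fund_dom \<Gamma>) < \<infinity>"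


definition orbit :: "(real^2^2) set set \<Rightarrow> complex \<Rightarrow> complex set" where
  "orbit \<Gamma> z = (\<lambda>A. moebius A z) ` \<Union>\<Gamma>"

text \<open>\<open>None\<close> is the point \<open>i\<infinity>\<close>. The quotient of the upper half-plane carries the quotient topology,
  and the neighbourhoods of \<open>i\<infinity>\<close> are the sets containing some \<open>{\<bar>q\<bar> < r}\<close>, where \<open>q = exp (2\<pi>iz)\<close>;
  in terms of \<open>z\<close> this is \<open>{Im z > c}\<close>.\<close>

definition Xbar_open :: "(real^2^2) set set \<Rightarrow> complex set option set \<Rightarrow> bool" where
  "Xbar_open \<Gamma> U \<longleftrightarrow>
     U \<subseteq> insert None (Some ` orbit \<Gamma> ` uhp) \<and>
     open {z\<in>uhp. Some (orbit \<Gamma> z) \<in> U} \<and>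
     (None \<in> U \<longrightarrow> (\<exists>c>0. \<forall>z. Im z > c \<longrightarrow> Some (orbit \<Gamma> z) \<in> U))"

lemma istopology_Xbar_open: "istopology (Xbar_open \<Gamma>)"
proof (unfold istopology_def, intro conjI allI impI)
  fix S T assume S: "Xbar_open \<Gamma> S" and T: "Xbar_open \<Gamma> T"
  have "{z\<in>uhp. Some (orbit \<Gamma> z) \<in> S \<inter> T} =
        {z\<in>uhp. Some (orbit \<Gamma> z) \<in> S} \<inter> {z\<in>uhp. Some (orbit \<Gamma> z) \<in> T}"
    by auto
  moreover have "\<exists>c>0. \<forall>z. Im z > c \<longrightarrow> Some (orbit \<Gamma> z) \<in> S \<inter> T" if "None \<in> S \<inter> T"
  proof -
    obtain c d where "c > 0" "\<forall>z. Im z > c \<longrightarrow> Some (orbit \<Gamma> z) \<in> S"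
      and "d > 0" "\<forall>z. Im z > d \<longrightarrow> Some (orbit \<Gamma> z) \<in> T"
      using S T \<open>None \<in> S \<inter> T\<close> unfolding Xbar_open_def by blast
    then show ?thesis by (intro exI[of _ "max c d"]) auto
  qed
  ultimately show "Xbar_open \<Gamma> (S \<inter> T)"
    using S T unfolding Xbar_open_def by auto
next
  fix K assume K: "\<forall>S\<in>K. Xbar_open \<Gamma> S"
  have "{z\<in>uhp. Some (orbit \<Gamma> z) \<in> \<Union>K} = (\<Union>S\<in>K. {z\<in>uhp. Some (orbit \<Gamma> z) \<in> S})"
    by auto
  then have "open {z\<in>uhp. Some (orbit \<Gamma> z) \<in> \<Union>K}"
    using K unfolding Xbar_open_def by auto
  moreover have "\<exists>c>0. \<forall>z. Im z > c \<longrightarrow> Some (orbit \<Gamma> z) \<in> \<Union>K" if "None \<in> \<Union>K"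
    using that K unfolding Xbar_open_def by (meson UnionE UnionI)
  ultimately show "Xbar_open \<Gamma> (\<Union>K)"
    using K unfolding Xbar_open_def by blast
qed

definition Xbar :: "(real^2^2) set set \<Rightarrow> complex set option topology" where
  "Xbar \<Gamma> = topology (Xbar_open \<Gamma>)"

lemma openin_Xbar: "openin (Xbar \<Gamma>) U \<longleftrightarrow> Xbar_open \<Gamma> U"
  unfolding Xbar_def by (simp add: istopology_Xbar_open topology_inverse')

lemma topspace_Xbar: "topspace (Xbar \<Gamma>) = insert None (Some ` orbit \<Gamma> ` uhp)"
proof
  show "topspace (Xbar \<Gamma>) \<subseteq> insert None (Some ` orbit \<Gamma> ` uhp)"
    using openin_topspace[of "Xbar \<Gamma>"] unfolding openin_Xbar Xbar_open_def by blast
  have "{z\<in>uhp. Some (orbit \<Gamma> z) \<in> insert None (Some ` orbit \<Gamma> ` uhp)} = {z. Im z > 0}"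
    by (auto simp: uhp_def)
  then have "Xbar_open \<Gamma> (insert None (Some ` orbit \<Gamma> ` uhp))"
    unfolding Xbar_open_def by (auto simp: open_halfspace_Im_gt uhp_def intro!: exI[of _ 1])
  then show "insert None (Some ` orbit \<Gamma> ` uhp) \<subseteq> topspace (Xbar \<Gamma>)"
    using openin_subset openin_Xbar by metis
qed

text \<open>\<open>i\<infinity>\<close> is the only puncture of the quotient when adjoining this single point yields a compact
  surface.\<close>

definition only_puncture_infinity :: "(real^2^2) set set \<Rightarrow> bool" where
  "only_puncture_infinity \<Gamma> \<longleftrightarrow>
     stabilizer_at_infinity \<Gamma> = integer_translations \<and> compact_space (Xbar \<Gamma>)"

text \<open>The genus of a closed oriented surface is half the rank of its first integral homology.\<close>

definition has_genus :: "'a topology \<Rightarrow> nat \<Rightarrow> bool" where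
  "has_genus S g \<longleftrightarrow> homology_group 1 S \<cong> free_Abelian_group {..<2 * g}"


text \<open>A section \<open>f dz\<^sup>k\<close> of \<open>\<Omega>\<^sup>k \<otimes> O((k-1)i\<infinity>)\<close> is identified with the cusp form \<open>f\<close> of weight \<open>2k\<close>;
  its value off the upper half-plane is normalised to \<open>0\<close>. Holomorphy and vanishing
  at the puncture are expressed through \<open>q = exp (2\<pi>iz)\<close>.\<close>

definition cusp_forms :: "(real^2^2) set set \<Rightarrow> nat \<Rightarrow> (complex \<Rightarrow> complex) set" where
  "cusp_forms \<Gamma> k = {f.
     f holomorphic_on uhp \<and> (\<forall>z. z \<notin> uhp \<longrightarrow> f z = 0) \<and>
     (\<forall>A\<in>\<Union>\<Gamma>. \<forall>z\<in>uhp.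
        f (moebius A z) = (of_real (A$2$1) * z + of_real (A$2$2)) ^ (2 * k) * f z) \<and>
     (\<exists>F. F holomorphic_on ball 0 1 \<and> F 0 = 0 \<and> (\<forall>z\<in>uhp. f z = F (exp (2 * pi * \<i> * z))))}"

definition pointwise_norm_sq :: "nat \<Rightarrow> (complex \<Rightarrow> complex) \<Rightarrow> complex \<Rightarrow> real" where
  "pointwise_norm_sq k f z = (Im z) ^ (2 * k) * (cmod (f z))\<^sup>2"

definition inner_hyp ::
  "(real^2^2) set set \<Rightarrow> nat \<Rightarrow> (complex \<Rightarrow> complex) \<Rightarrow> (complex \<Rightarrow> complex) \<Rightarrow> complex" where
  "inner_hyp \<Gamma> k f g =
     (LINT z:fund_dom \<Gamma>|hyp_measure. of_real ((Im z) ^ (2 * k)) * f z * cnj (g z))"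

definition orthonormal_basis ::
  "(real^2^2) set set \<Rightarrow> nat \<Rightarrow> nat \<Rightarrow> (nat \<Rightarrow> complex \<Rightarrow> complex) \<Rightarrow> bool" where
  "orthonormal_basis \<Gamma> k n \<omega> \<longleftrightarrow>
     (\<forall>j<n. \<omega> j \<in> cusp_forms \<Gamma> k) \<and>
     (\<forall>i<n. \<forall>j<n. inner_hyp \<Gamma> k (\<omega> i) (\<omega> j) = (if i = j then 1 else 0)) \<and>
     (\<forall>f\<in>cusp_forms \<Gamma> k. \<exists>c. \<forall>z. f z = (\<Sum>j<n. c j * \<omega> j z))"

definition bergman_kernel :: "nat \<Rightarrow> nat \<Rightarrow> (nat \<Rightarrow> complex \<Rightarrow> complex) \<Rightarrow> complex \<Rightarrow> real" where
  "bergman_kernel k n \<omega> z = (\<Sum>j<n. pointwise_norm_sq k (\<omega> j) z)"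

definition wirtinger_z :: "(complex \<Rightarrow> complex) \<Rightarrow> complex \<Rightarrow> complex" where
  "wirtinger_z u z =
     (vector_derivative (\<lambda>t::real. u (z + of_real t)) (at 0)
      - \<i> * vector_derivative (\<lambda>t::real. u (z + \<i> * of_real t)) (at 0)) / 2"

definition wirtinger_zbar :: "(complex \<Rightarrow> complex) \<Rightarrow> complex \<Rightarrow> complex" where
  "wirtinger_zbar u z =
     (vector_derivative (\<lambda>t::real. u (z + of_real t)) (at 0)
      + \<i> * vector_derivative (\<lambda>t::real. u (z + \<i> * of_real t)) (at 0)) / 2"

text \<open>A \<open>(1,1)\<close>-form is represented by its coefficient with respect to \<open>dz \<and> d\<bar>z\<close>.\<close>

definition bergman_metric :: "nat \<Rightarrow> nat \<Rightarrow> (nat \<Rightarrow> complex \<Rightarrow> complex) \<Rightarrow> complex \<Rightarrow> complex" where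
  "bergman_metric k n \<omega> z =
     - (\<i> / (2 * of_real pi)) *
       wirtinger_z (wirtinger_zbar (\<lambda>w. of_real (ln (bergman_kernel k n \<omega> w)))) z"

definition hyperbolic_metric :: "complex \<Rightarrow> complex" where
  "hyperbolic_metric z = (\<i> / 2) / of_real ((Im z)\<^sup>2)"

definition metric_ratio :: "nat \<Rightarrow> nat \<Rightarrow> (nat \<Rightarrow> complex \<Rightarrow> complex) \<Rightarrow> complex \<Rightarrow> complex" where
  "metric_ratio k n \<omega> z = bergman_metric k n \<omega> z / hyperbolic_metric z"

text \<open>The ratio is \<open>\<Gamma>\<close>-invariant, so on the quotient any representative of an orbit may be used;
  at \<open>i\<infinity>\<close> it is the limit for \<open>Im z \<longrightarrow> \<infinity>\<close>.\<close>

definition metric_ratio_Xbar ::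
  "nat \<Rightarrow> nat \<Rightarrow> (nat \<Rightarrow> complex \<Rightarrow> complex) \<Rightarrow> complex set option \<Rightarrow> complex" where
  "metric_ratio_Xbar k n \<omega> p =
     (case p of
        Some P \<Rightarrow> metric_ratio k n \<omega> (SOME z. z \<in> P)
      | None \<Rightarrow> Lim (filtercomap Im at_top) (metric_ratio k n \<omega>))"

end

theory Submission
  imports Defs "HOL-Real_Asymp.Real_Asymp"
begin

text \<open>At a point \<open>w\<close> of the half-plane the ratio equals
  \<open>k / (2\<pi>) - (v\<^sup>2 / \<pi>) R / A\<close> with \<open>v = Im w\<close>. Here \<open>A\<close> is the maximum of
  \<open>\<bar>f w\<bar>\<^sup>2\<close> over the cusp forms of norm one, and \<open>R\<close> is the maximum of \<open>\<bar>f' w\<bar>\<^sup>2\<close> over those that vanish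
  at \<open>w\<close>. So it suffices to bound \<open>R\<close> from above and \<open>A\<close> from below. For \<open>w\<close> in a compact set \<open>R\<close> is
  bounded by mean values over discs of radius about \<open>v / sqrt k\<close>, and \<open>A\<close> by a Poincare series built
  from the Bergman kernel of the half-plane. Far up in the cusp the norm dominates the integral over
  a strip of width one, so that Parseval's identity bounds \<open>R\<close> by the Fourier modes, and the Poincare
  series of a power of \<open>q\<close> whose mode peaks near height \<open>v\<close> bounds \<open>A\<close>. Above height \<open>k\<close> the first mode
  dominates all others by an exponential factor, so the ratio tends to \<open>k / (2\<pi>)\<close> at the cusp.\<close>

text \<open>The obstacle is uniformity in k near the cusp. At height v about k/v Fourier modes
  compete, all of them exponentially small, and yet upper and lower bounds must agree up to a power
  of k. Comparing every mode with the largest one makes their sizes cancel. What is lost is the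
  number of modes, at most k, times (n v)^2 < k^2: this is the cube, while compact sets yield only
  k^2. Vanishing of f at w lowers the weight of the m-th mode in f' from m to m - 1, so above height
  k, where the first mode dominates, R becomes exponentially small against A. Two facts on the group
  control the Poincare series: a lower left entry is 0 or at least 1 in modulus, so only
  translations keep a point above height 1; and orbits starting in a compact set are uniformly
  separated, so that sums over the group are dominated by area integrals. The height
  \<open>exp 8\<close> makes the error of the Poincare series about exp (- 16 k), below the smallest
  relevant |q^m|, which is about exp (- 4 pi k). Above height k this fails, since |q| is unbounded
  below, and the Schwarz lemma takes over.\<close>

no_notation fps_nth (infixl "$" 75)

subsection \<open>Moebius transformations and the cusped group\<close>

definition aut_factor :: "real^2^2 \<Rightarrow> complex \<Rightarrow> complex" where
  "aut_factor A z = of_real (A$2$1) * z + of_real (A$2$2)"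

text \<open>The adjugate, which is the inverse on determinant one. Its entries are linear in those
  of the matrix, hence continuous, as the discreteness argument requires.\<close>

definition adj2 :: "real^2^2 \<Rightarrow> real^2^2" where
  "adj2 A = vector [vector [A$2$2, - A$1$2], vector [- A$2$1, A$1$1]]"

lemma mat2_eq_iff: "A = B \<longleftrightarrow> A$1$1 = B$1$1 \<and> A$1$2 = B$1$2 \<and> A$2$1 = B$2$1 \<and> A$2$2 = B$2$2"
  for A B :: "'a^2^2"
  by (auto simp: vec_eq_iff forall_2)

lemma mat2_mult_nth:
  fixes A B :: "real^2^2"
  shows "(A ** B)$i$l = A$i$1 * B$1$l + A$i$2 * B$2$l"
  by (simp add: matrix_matrix_mult_def sum_2)

lemma mat1_nth [simp]:
  "(mat 1 :: real^2^2)$1$1 = 1" "(mat 1 :: real^2^2)$1$2 = 0"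
  "(mat 1 :: real^2^2)$2$1 = 0" "(mat 1 :: real^2^2)$2$2 = 1"
  by (simp_all add: mat_def)

lemma adj2_nth [simp]:
  "adj2 A$1$1 = A$2$2" "adj2 A$1$2 = - A$1$2" "adj2 A$2$1 = - A$2$1" "adj2 A$2$2 = A$1$1"
  by (simp_all add: adj2_def)

lemma translation_nth [simp]:
  "translation n$1$1 = 1" "translation n$1$2 = of_int n" "translation n$2$1 = 0" "translation n$2$2 = 1"
  by (simp_all add: translation_def)

lemma det2: "det A = 1 \<Longrightarrow> A$1$1 * A$2$2 - A$1$2 * A$2$1 = (1::real)" for A :: "real^2^2"
  by (simp add: det_2)

lemma det2_complex:
  "det A = 1 \<Longrightarrow> complex_of_real (A$1$1) * of_real (A$2$2) - of_real (A$1$2) * of_real (A$2$1) = 1" for A :: "real^2^2"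
  using det2[of A] by (metis of_real_1 of_real_diff of_real_mult)

lemma adj2_mult: "det A = 1 \<Longrightarrow> adj2 A ** A = mat 1" "det A = 1 \<Longrightarrow> A ** adj2 A = mat 1"
  using det2[of A] by (auto simp: mat2_eq_iff mat2_mult_nth algebra_simps)

lemma adj2_adj2 [simp]: "adj2 (adj2 A) = A"
  by (simp add: mat2_eq_iff)

lemma det_adj2 [simp]: "det (adj2 A) = det A"
  by (simp add: det_2 algebra_simps)

lemma det_translation [simp]: "det (translation n) = 1"
  by (simp add: det_2)

lemma aut_factor_nz: "det A = 1 \<Longrightarrow> z \<in> uhp \<Longrightarrow> aut_factor A z \<noteq> 0"
proof
  assume d: "det A = 1" and z: "z \<in> uhp" and "aut_factor A z = 0"
  then have "Im (aut_factor A z) = 0" "Re (aut_factor A z) = 0" by auto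
  then have "A$2$1 * Im z = 0" "A$2$1 * Re z + A$2$2 = 0" by (auto simp: aut_factor_def)
  then show False using z d by (auto simp: uhp_def det_2)
qed

lemma moebius_eq: "moebius A z = (of_real (A$1$1) * z + of_real (A$1$2)) / aut_factor A z"
  by (simp add: moebius_def aut_factor_def)

lemma moebius_diff:
  assumes "det A = 1" "z \<in> uhp" "w \<in> uhp"
  shows "moebius A z - moebius A w = (z - w) / (aut_factor A z * aut_factor A w)"
proof -
  note d = det2_complex[OF assms(1)]
  have nz: "aut_factor A z \<noteq> 0" "aut_factor A w \<noteq> 0" using assms by (auto simp: aut_factor_nz)
  have "moebius A z - moebius A w =
     ((of_real (A$1$1) * z + of_real (A$1$2)) * aut_factor A w - (of_real (A$1$1) * w + of_real (A$1$2)) * aut_factor A z)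
       / (aut_factor A z * aut_factor A w)"
    using nz by (simp add: moebius_eq diff_frac_eq)
  also have "(of_real (A$1$1) * z + of_real (A$1$2)) * aut_factor A w - (of_real (A$1$1) * w + of_real (A$1$2)) * aut_factor A z
     = (z - w) * (of_real (A$1$1) * of_real (A$2$2) - of_real (A$1$2) * of_real (A$2$1))"
    by (simp add: aut_factor_def algebra_simps)
  also have "\<dots> = z - w" using d by simp
  finally show ?thesis .
qed

lemma cnj_aut_factor: "cnj (aut_factor A w) = of_real (A$2$1) * cnj w + of_real (A$2$2)"
  by (simp add: aut_factor_def)

text \<open>The difference formula with \<open>w\<close> replaced by its conjugate, possible since
  the entries are real. The case \<open>w = z\<close> is the height formula; the general case
  governs the Bergman kernel of the half-plane.\<close>

lemma moebius_diff_cnj: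
  assumes "det A = 1" "z \<in> uhp" "w \<in> uhp"
  shows "moebius A z - cnj (moebius A w) = (z - cnj w) / (aut_factor A z * cnj (aut_factor A w))"
proof -
  note d = det2_complex[OF assms(1)]
  have nz: "aut_factor A z \<noteq> 0" "cnj (aut_factor A w) \<noteq> 0" using assms by (auto simp: aut_factor_nz)
  have "moebius A z - cnj (moebius A w) =
     ((of_real (A$1$1) * z + of_real (A$1$2)) * cnj (aut_factor A w) - (of_real (A$1$1) * cnj w + of_real (A$1$2)) * aut_factor A z)
       / (aut_factor A z * cnj (aut_factor A w))"
    using nz by (simp add: moebius_eq diff_frac_eq)
  also have "(of_real (A$1$1) * z + of_real (A$1$2)) * cnj (aut_factor A w) - (of_real (A$1$1) * cnj w + of_real (A$1$2)) * aut_factor A z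
     = (z - cnj w) * (of_real (A$1$1) * of_real (A$2$2) - of_real (A$1$2) * of_real (A$2$1))"
    unfolding cnj_aut_factor by (simp add: aut_factor_def algebra_simps)
  also have "\<dots> = z - cnj w" using d by simp
  finally show ?thesis .
qed

lemma Im_moebius:
  assumes "det A = 1" "z \<in> uhp"
  shows "Im (moebius A z) = Im z / (cmod (aut_factor A z))\<^sup>2"
proof -
  have "moebius A z - cnj (moebius A z) = (z - cnj z) / of_real ((cmod (aut_factor A z))\<^sup>2)"
    using moebius_diff_cnj[OF assms assms(2)] by (simp only: complex_norm_square)
  then have "Im (moebius A z - cnj (moebius A z)) = Im ((z - cnj z) / of_real ((cmod (aut_factor A z))\<^sup>2))"
    by (rule arg_cong)
  then show ?thesis by (simp only: Im_divide_of_real) simp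
qed

lemma moebius_in_uhp: "det A = 1 \<Longrightarrow> z \<in> uhp \<Longrightarrow> moebius A z \<in> uhp"
  using Im_moebius[of A z] aut_factor_nz[of A z] by (auto simp: uhp_def)

lemma aut_factor_mult:
  assumes "det B = 1" "z \<in> uhp"
  shows "aut_factor (A ** B) z = aut_factor A (moebius B z) * aut_factor B z"
  using aut_factor_nz[OF assms]
  by (simp add: moebius_eq aut_factor_def[of A] aut_factor_def[of "A ** B"] mat2_mult_nth field_simps)
     (simp add: aut_factor_def algebra_simps)

lemma moebius_mult:
  assumes "det A = 1" "det B = 1" "z \<in> uhp"
  shows "moebius (A ** B) z = moebius A (moebius B z)"
proof -
  have nz: "aut_factor B z \<noteq> 0" "aut_factor A (moebius B z) \<noteq> 0"
    using assms by (auto simp: aut_factor_nz moebius_in_uhp)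
  show ?thesis
    unfolding moebius_eq[of "A ** B"] moebius_eq[of A] aut_factor_mult[OF assms(2,3)]
    using nz by (simp add: moebius_eq[of B] mat2_mult_nth field_simps) (simp add: aut_factor_def algebra_simps)
qed

lemma moebius_one [simp]: "moebius (mat 1) z = z" and aut_factor_one [simp]: "aut_factor (mat 1) z = 1"
  by (simp_all add: moebius_def aut_factor_def)

lemma moebius_uminus [simp]: "moebius (- A) z = moebius A z"
  and aut_factor_uminus [simp]: "aut_factor (- A) z = - aut_factor A z"
proof -
  have "moebius (- A) z = (- (of_real (A$1$1) * z + of_real (A$1$2))) / (- (of_real (A$2$1) * z + of_real (A$2$2)))"
    by (simp add: moebius_def)
  then show "moebius (- A) z = moebius A z"
    unfolding moebius_def by (simp only: minus_divide_divide)
  show "aut_factor (- A) z = - aut_factor A z" by (simp add: aut_factor_def)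
qed

lemma moebius_translation [simp]: "moebius (translation n) z = z + of_int n"
  and aut_factor_translation [simp]: "aut_factor (translation n) z = 1"
  by (simp_all add: moebius_def aut_factor_def)

lemma moebius_adj2: "det A = 1 \<Longrightarrow> z \<in> uhp \<Longrightarrow> moebius (adj2 A) (moebius A z) = z"
  "det A = 1 \<Longrightarrow> z \<in> uhp \<Longrightarrow> moebius A (moebius (adj2 A) z) = z"
  using moebius_mult[of "adj2 A" A z] moebius_mult[of A "adj2 A" z] by (auto simp: adj2_mult)

lemma aut_factor_holomorphic [holomorphic_intros]: "f holomorphic_on S \<Longrightarrow> (\<lambda>z. aut_factor A (f z)) holomorphic_on S"
  unfolding aut_factor_def by (intro holomorphic_intros)

lemma moebius_holomorphic: "det A = 1 \<Longrightarrow> moebius A holomorphic_on uhp"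
  unfolding moebius_eq[abs_def] by (intro holomorphic_intros) (auto simp: aut_factor_nz)

lemma moebius_has_field_derivative:
  assumes "det A = 1" "z \<in> uhp"
  shows "(moebius A has_field_derivative 1 / (aut_factor A z)\<^sup>2) (at z)"
proof -
  note d = det2_complex[OF assms(1)]
  have nz: "of_real (A$2$1) * z + of_real (A$2$2) \<noteq> (0::complex)"
    using aut_factor_nz[OF assms] by (simp add: aut_factor_def)
  have "((\<lambda>z. (of_real (A$1$1) * z + of_real (A$1$2)) / (of_real (A$2$1) * z + of_real (A$2$2))) has_field_derivative
     (of_real (A$1$1) * (of_real (A$2$1) * z + of_real (A$2$2)) - (of_real (A$1$1) * z + of_real (A$1$2)) * of_real (A$2$1)) /
       ((of_real (A$2$1) * z + of_real (A$2$2)) * (of_real (A$2$1) * z + of_real (A$2$2)))) (at z)"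
    using nz by (auto intro!: derivative_eq_intros)
  moreover have "of_real (A$1$1) * (of_real (A$2$1) * z + of_real (A$2$2)) - (of_real (A$1$1) * z + of_real (A$1$2)) * of_real (A$2$1) = (1::complex)"
    using d by (simp add: algebra_simps)
  ultimately show ?thesis
    unfolding moebius_def[abs_def] aut_factor_def by (simp add: power2_eq_square)
qed

lemma open_uhp [simp]: "open uhp"
  by (simp add: uhp_def open_halfspace_Im_gt)

text \<open>With d the hyperbolic distance, the two quotients are 4 sinh(d/2)^2 and 4 cosh(d/2)^2.
  The first measures separation of points, the second is the reciprocal of the kernel ratio.\<close>

lemma hyp_dist_invariant:
  assumes "det A = 1" "z \<in> uhp" "w \<in> uhp"
  shows "(cmod (moebius A z - moebius A w))\<^sup>2 / (Im (moebius A z) * Im (moebius A w)) = (cmod (z - w))\<^sup>2 / (Im z * Im w)"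
    "(cmod (moebius A z - cnj (moebius A w)))\<^sup>2 / (Im (moebius A z) * Im (moebius A w)) = (cmod (z - cnj w))\<^sup>2 / (Im z * Im w)"
  using aut_factor_nz[OF assms(1,2)] aut_factor_nz[OF assms(1,3)] assms
  by (auto simp: moebius_diff moebius_diff_cnj Im_moebius norm_divide norm_mult power_mult_distrib power_divide uhp_def field_simps)

text \<open>All conditions concern the full preimage in \<open>SL2R\<close>, so elements come in
  pairs \<open>A\<close>, \<open>- A\<close> and uniqueness is always up to sign.
  \<open>cocompact_G\<close> is the form in which compactness of \<open>Xbar\<close> enters the
  estimates: what does not rise above a given height is covered by a compact set.\<close>

locale cusped_group =
  fixes G :: "(real^2^2) set"
  assumes det_G: "A \<in> G \<Longrightarrow> det A = 1"
    and one_G: "mat 1 \<in> G"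
    and uminus_G: "A \<in> G \<Longrightarrow> - A \<in> G"
    and mult_G: "A \<in> G \<Longrightarrow> B \<in> G \<Longrightarrow> A ** B \<in> G"
    and adj2_G: "A \<in> G \<Longrightarrow> adj2 A \<in> G"
    and discrete_G: "discrete G"
    and free_G: "A \<in> G \<Longrightarrow> z \<in> uhp \<Longrightarrow> moebius A z = z \<Longrightarrow> A = mat 1 \<or> A = - mat 1"
    and stab_G: "A \<in> G \<Longrightarrow> A$2$1 = 0 \<Longrightarrow> \<exists>n. A = translation n \<or> A = - translation n"
    and translation_G: "translation n \<in> G"
    and cocompact_G: "\<exists>K. compact K \<and> K \<subseteq> uhp \<and> (\<forall>z\<in>uhp. \<exists>A\<in>G. moebius A z \<in> K \<or> Im (moebius A z) > Y)"
begin

lemmas moebius_G_uhp = moebius_in_uhp[OF det_G]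

lemma moebius_G_adj2: "A \<in> G \<Longrightarrow> z \<in> uhp \<Longrightarrow> moebius (adj2 A) (moebius A z) = z"
  "A \<in> G \<Longrightarrow> z \<in> uhp \<Longrightarrow> moebius A (moebius (adj2 A) z) = z"
  by (auto simp: moebius_adj2 det_G)

lemma moebius_G_eqD:
  assumes "A \<in> G" "B \<in> G" "z \<in> uhp" "moebius A z = moebius B z"
  shows "B = A \<or> B = - A"
proof -
  have "moebius (adj2 A ** B) z = z"
    using assms by (simp add: moebius_mult det_G adj2_G moebius_G_adj2 flip: assms(4))
  then have "adj2 A ** B = mat 1 \<or> adj2 A ** B = - mat 1"
    using free_G assms adj2_G mult_G by blast
  then have "A ** (adj2 A ** B) = A \<or> A ** (adj2 A ** B) = - A"
    by (auto simp: uminus_matrix_mult)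
  then show ?thesis using assms by (simp add: matrix_mul_assoc adj2_mult det_G)
qed

lemma norm_mat2_le: "norm A \<le> 4 * R" if "\<And>i j. \<bar>A$i$j\<bar> \<le> R" for A :: "real^2^2"
proof -
  have "norm (A$i) \<le> 2 * R" for i
    using norm_le_l1_cart[of "A$i"] that[of i 1] that[of i 2] by (simp add: sum_2)
  moreover have "norm A \<le> norm (A$1) + norm (A$2)"
    using L2_set_le_sum[of UNIV "\<lambda>i. norm (A$i)"] by (simp add: norm_vec_def sum_2)
  ultimately show ?thesis by (smt (verit))
qed

text \<open>A limit point of a bounded infinite subset need not lie in the group, so isolated points
  alone give no contradiction. But two distinct elements close to the limit have a quotient close to
  the identity, and the identity is isolated.\<close>

lemma finite_bounded_G: "finite {A\<in>G. norm A \<le> R}"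
proof (rule ccontr)
  assume inf: "infinite {A\<in>G. norm A \<le> R}" (is "infinite ?S")
  have "?S \<subseteq> cball 0 R" by auto
  then obtain l where l: "l islimpt ?S"
    using inf compact_cball[of 0 R] by (meson compact_eq_Bolzano_Weierstrass subset_trans islimpt_subset)
  obtain \<delta> where \<delta>: "\<delta> > 0" "ball (mat 1) \<delta> \<inter> G = {mat 1}"
  proof -
    obtain T where T: "open T" "T \<inter> G = {mat 1}"
      using discrete_G one_G unfolding discrete_def isolated_in_def by blast
    then obtain d where "d > 0" "ball (mat 1) d \<subseteq> T" by (metis IntE insertI1 openE)
    then show ?thesis using T one_G by (intro that[of d]) auto
  qed
  \<comment> \<open>Applied at \<open>(l, l)\<close>, where the value is the identity because
    \<open>det l = 1\<close> persists in the limit.\<close>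
  have cont: "continuous_on UNIV (\<lambda>p::(real^2^2)\<times>(real^2^2). fst p ** adj2 (snd p))"
  proof -
    have "continuous_on UNIV (\<lambda>B. adj2 B $ i $ j)" for i j
      using exhaust_2[of i] exhaust_2[of j]
      by (elim disjE) (simp_all add: continuous_on_minus continuous_on_component)
    then have "continuous_on UNIV (\<lambda>B. \<chi> i j. adj2 B $ i $ j)"
      by (intro continuous_on_vec_lambda)
    then have "continuous_on UNIV adj2" by simp
    then have "continuous_on UNIV (\<lambda>p::(real^2^2)\<times>(real^2^2). adj2 (snd p))"
      by (rule continuous_on_compose2) (auto intro!: continuous_intros)
    then show ?thesis
      unfolding matrix_matrix_mult_def by (intro continuous_on_vec_lambda continuous_intros)
  qed
  have dl: "det l = 1"
  proof -
    have "closed {A::real^2^2. A$1$1 * A$2$2 - A$1$2 * A$2$1 = 1}"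
      by (intro closed_Collect_eq continuous_intros)
    moreover have "?S \<subseteq> {A. A$1$1 * A$2$2 - A$1$2 * A$2$1 = 1}" using det_G det2 by auto
    ultimately have "l \<in> {A. A$1$1 * A$2$2 - A$1$2 * A$2$1 = 1}"
      using l by (meson closed_limpt islimpt_subset)
    then show ?thesis by (simp add: det_2)
  qed
  have "\<exists>e>0. \<forall>p. dist p (l, l) < e \<longrightarrow> dist (fst p ** adj2 (snd p)) (fst (l,l) ** adj2 (snd (l,l))) < \<delta>"
    using cont \<delta>(1) unfolding continuous_on_iff by blast
  then obtain e where e0: "e > 0"
      "\<And>p. dist p (l, l) < e \<Longrightarrow> dist (fst p ** adj2 (snd p)) (fst (l, l) ** adj2 (snd (l, l))) < \<delta>"
    by blast
  have e: "e > 0" "\<And>A B. dist (A, B) (l, l) < e \<Longrightarrow> dist (A ** adj2 B) (mat 1) < \<delta>"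
    using e0(1) e0(2)[of "(_, _)"] by (simp_all add: adj2_mult(2)[OF dl])
  have lp: "\<And>r. r > 0 \<Longrightarrow> \<exists>x\<in>?S. x \<noteq> l \<and> dist x l < r"
    using l unfolding islimpt_approachable by blast
  obtain A where A: "A \<in> ?S" "A \<noteq> l" "dist A l < e/2"
    using lp[of "e/2"] e(1) by auto
  \<comment> \<open>Strictly nearer to the limit than \<open>A\<close>, hence different from
    \<open>A\<close>.\<close>
  obtain B where B: "B \<in> ?S" "B \<noteq> l" "dist B l < min (e/2) (dist A l)"
    using lp[of "min (e/2) (dist A l)"] e(1) A(2) by auto
  have "dist (A, B) (l, l) < e"
    using A(3) B(3) sqrt_sum_squares_le_sum[of "dist A l" "dist B l"] by (simp add: dist_Pair_Pair)
  then have "dist (A ** adj2 B) (mat 1) < \<delta>" by (rule e)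
  then have "A ** adj2 B \<in> ball (mat 1) \<delta> \<inter> G" using A B mult_G adj2_G by (auto simp: dist_commute)
  then have "A ** adj2 B = mat 1" using \<delta>(2) by blast
  then have "A ** (adj2 B ** B) = B" by (simp add: matrix_mul_assoc)
  then have "A = B" using B det_G by (auto simp: adj2_mult)
  then show False using B by auto
qed

lemma countable_G: "countable G"
proof -
  have "G = (\<Union>n::nat. {A\<in>G. norm A \<le> real n})"
    using real_arch_simple by blast
  also have "countable \<dots>"
    by (intro countable_UN countableI_type) (auto intro: countable_finite finite_bounded_G)
  finally show ?thesis .
qed

text \<open>Iterating \<open>A \<mapsto> A T A\<^sup>-\<^sup>1\<close>, with \<open>T\<close> the unit translation, replaces \<open>c\<close> by \<open>- c\<^sup>2\<close>; if \<open>\<bar>c\<bar> < 1\<close>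
  the iterates accumulate.\<close>

lemma shimizu:
  assumes A: "A \<in> G" and c: "A$2$1 \<noteq> 0"
  shows "\<bar>A$2$1\<bar> \<ge> 1"
proof (rule ccontr)
  assume "\<not> \<bar>A$2$1\<bar> \<ge> 1"
  then have c1: "\<bar>A$2$1\<bar> < 1" by simp
  define s where "s = (\<lambda>n. ((\<lambda>B. B ** translation 1 ** adj2 B) ^^ n) A)"
  have sG: "s n \<in> G" for n
    by (induction n) (auto simp: s_def A mult_G adj2_G translation_G)
  \<comment> \<open>Only the first column of the old matrix enters, so a bound on that column bounds
    all entries of the next iterate.\<close>
  have step: "s (Suc n)$1$1 = 1 - s n$1$1 * s n$2$1" "s (Suc n)$1$2 = (s n$1$1)\<^sup>2"
     "s (Suc n)$2$1 = - (s n$2$1)\<^sup>2" "s (Suc n)$2$2 = 1 + s n$1$1 * s n$2$1" for n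
    using det2[OF det_G[OF sG[of n]]]
    by (auto simp: s_def mat2_mult_nth power2_eq_square algebra_simps)
  define q where "q = \<bar>A$2$1\<bar>"
  have q: "0 < q" "q < 1" using c c1 by (auto simp: q_def)
  have cn: "\<bar>s n$2$1\<bar> \<le> q ^ Suc n \<and> s n$2$1 \<noteq> 0" for n
  proof (induction n)
    case 0 then show ?case using c by (simp add: s_def q_def)
  next
    case (Suc n)
    have "\<bar>s (Suc n)$2$1\<bar> = \<bar>s n$2$1\<bar> * \<bar>s n$2$1\<bar>" by (simp add: step power2_eq_square abs_mult)
    also have "\<dots> \<le> q ^ Suc n * q ^ Suc n" using Suc by (intro mult_mono) auto
    also have "\<dots> \<le> q ^ Suc n * q" using q by (intro mult_left_mono) (auto simp: mult_left_le power_le_one mult_le_one)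
    finally show ?case using Suc by (simp add: step mult.commute)
  qed
  \<comment> \<open>Strict decrease of the lower left entry in modulus makes the iterates pairwise
    distinct, against the finiteness of bounded subsets of the group.\<close>
  have lt: "\<bar>s (Suc n)$2$1\<bar> < \<bar>s n$2$1\<bar>" for n
  proof -
    have "\<bar>s n$2$1\<bar> < 1" using cn[of n] q by (metis order_le_less_trans power_Suc_less_one)
    then have "\<bar>s n$2$1\<bar> * \<bar>s n$2$1\<bar> < \<bar>s n$2$1\<bar> * 1"
      using cn[of n] by (intro mult_strict_left_mono) auto
    then show ?thesis by (simp add: step power2_eq_square abs_mult)
  qed
  have inj: "inj s"
  proof -
    have "strict_mono (\<lambda>n. - \<bar>s n$2$1\<bar>)" using lt by (intro strict_monoI_Suc) auto
    then have "inj (\<lambda>n. - \<bar>s n$2$1\<bar>)" by (rule strict_mono_imp_inj_on)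
    then show ?thesis by (auto simp: inj_def)
  qed
  \<comment> \<open>The recursion gives |a'| \<le> 1 + |a| q for the upper left entry, so a bound
    \<open>M\<close> with \<open>1 + M * q \<le> M\<close> is preserved. The summand
    \<open>1 / (1 - q)\<close> achieves this; the other one starts the induction.\<close>
  define M where "M = \<bar>A$1$1\<bar> + 1 / (1 - q)"
  have M1: "1 + M * q \<le> M"
  proof -
    have "(1 - q) * (1 / (1 - q)) = 1" using q by simp
    moreover have "(1 - q) * \<bar>A$1$1\<bar> \<ge> 0" using q by simp
    ultimately have "(1 - q) * M \<ge> 1" unfolding M_def by (simp only: distrib_left)
    then show ?thesis by (simp add: algebra_simps)
  qed
  have "1 / (1 - q) \<ge> 1" using q by (simp add: field_simps)
  then have M0: "M \<ge> 1" "M \<ge> 0" unfolding M_def by linarith+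
  have cq: "\<bar>s n$2$1\<bar> \<le> q" for n
    using cn[of n] q by (metis less_eq_real_def mult_left_le order_trans power_Suc power_le_one)
  have an: "\<bar>s n$1$1\<bar> \<le> M" for n
  proof (induction n)
    case 0 then show ?case using q by (simp add: s_def M_def)
  next
    case (Suc n)
    have "\<bar>s (Suc n)$1$1\<bar> \<le> 1 + \<bar>s n$1$1\<bar> * \<bar>s n$2$1\<bar>"
      unfolding step by (metis abs_1 abs_mult abs_triangle_ineq4)
    also have "\<dots> \<le> 1 + M * q" using Suc cq[of n] M0 by (intro add_left_mono mult_mono) auto
    finally show ?case using M1 by simp
  qed
  have bd: "\<bar>s (Suc n)$i$j\<bar> \<le> M\<^sup>2 + M + 1" for n i j
  proof -
    have "\<bar>s n$1$1 * s n$2$1\<bar> \<le> M * q"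
      unfolding abs_mult using an[of n] cq[of n] M0 by (intro mult_mono) auto
    moreover have "(s n$1$1)\<^sup>2 \<le> M\<^sup>2" using an[of n] by (simp add: abs_le_square_iff[symmetric])
    moreover have "\<bar>s (Suc n)$2$1\<bar> \<le> 1" "\<bar>s (Suc n)$1$1\<bar> \<le> M" using cq[of "Suc n"] q an by auto
    moreover have "M\<^sup>2 \<ge> 0" "(s n$1$1)\<^sup>2 \<ge> 0" by auto
    ultimately show ?thesis using exhaust_2[of i] exhaust_2[of j] M0 M1 step[of n]
      by (smt (verit))
  qed
  have "range (\<lambda>n. s (Suc n)) \<subseteq> {A\<in>G. norm A \<le> 4 * (M\<^sup>2 + M + 1)}"
    using bd sG norm_mat2_le by blast
  then have "finite (range (\<lambda>n. s (Suc n)))" using finite_bounded_G finite_subset by blast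
  moreover have "inj (\<lambda>n. s (Suc n))" using inj by (auto simp: inj_def)
  ultimately show False using range_inj_infinite by metis
qed

end

text \<open>The displacement \<open>moebius A w - w\<close> with its denominator cleared: polynomial
  in \<open>w\<close> inside the modulus, hence continuous, and on the half-plane zero exactly at
  fixed points.\<close>

definition disp :: "real^2^2 \<Rightarrow> complex \<Rightarrow> real" where
  "disp A w = cmod (of_real (A$1$1) * w + of_real (A$1$2) - w * aut_factor A w)"

lemma disp_eq:
  assumes "det A = 1" "w \<in> uhp"
  shows "disp A w = cmod (moebius A w - w) * cmod (aut_factor A w)"
proof -
  have "of_real (A$1$1) * w + of_real (A$1$2) - w * aut_factor A w = (moebius A w - w) * aut_factor A w"
    using aut_factor_nz[OF assms] by (simp add: moebius_eq field_simps)
  then show ?thesis by (simp add: disp_def norm_mult)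
qed

text \<open>Squaring and dividing by the squared automorphy factor turns one factor
  \<open>Im w\<close> into \<open>Im (moebius A w)\<close>, which makes the bound symmetric and
  hyperbolically invariant.\<close>

lemma moebius_dist_ge:
  assumes A: "det A = 1" "w \<in> uhp" and e: "disp A w \<ge> \<epsilon> * Im w" "\<epsilon> \<ge> 0"
  shows "(cmod (moebius A w - w))\<^sup>2 \<ge> \<epsilon>\<^sup>2 * Im (moebius A w) * Im w"
proof -
  have j: "cmod (aut_factor A w) > 0" using aut_factor_nz[OF A] by simp
  have "Im w > 0" using A by (simp add: uhp_def)
  then have "(\<epsilon> * Im w)\<^sup>2 \<le> (cmod (moebius A w - w) * cmod (aut_factor A w))\<^sup>2"
    using e A by (intro power_mono) (auto simp: disp_eq)
  then show ?thesis
    using j unfolding Im_moebius[OF A] by (simp add: power_mult_distrib field_simps power2_eq_square)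
qed

section \<open>Uniform separation of orbit points\<close>

context cusped_group begin

text \<open>A small displacement confines the whole matrix: comparing heights bounds the automorphy
  factor and with it the lower row; the numerator then bounds the upper row. By discreteness only
  finitely many such elements remain.\<close>

lemma disp_small_bounded:
  assumes A: "A \<in> G" and w: "w \<in> uhp" "cmod w \<le> R" "Im w \<ge> m" "m > 0" and d: "disp A w < Im w"
  shows "norm A \<le> 4 * ((3*R/m) + 3*R + (3*R/m)*R + 2 + 2/m + (2/m)*R)"
proof (rule norm_mat2_le)
  have R: "R > 0" "Im w \<le> R" using w abs_Im_le_cmod[of w] by linarith+
  define x where "x = cmod (aut_factor A w)"
  have x: "x > 0" using aut_factor_nz[OF det_G[OF A] w(1)] by (simp add: x_def)
  have im: "Im (moebius A w) = Im w / x\<^sup>2" using Im_moebius[OF det_G[OF A] w(1)] by (simp add: x_def)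
  have "cmod (moebius A w - w) * x < Im w" using d disp_eq[OF det_G[OF A] w(1)] by (simp add: x_def)
  moreover have "\<bar>Im (moebius A w) - Im w\<bar> \<le> cmod (moebius A w - w)"
    using abs_Im_le_cmod[of "moebius A w - w"] by simp
  ultimately have "\<bar>Im w / x\<^sup>2 - Im w\<bar> * x < Im w"
    using x im by (smt (verit, best) mult_right_mono)
  \<comment> \<open>Heights differ by at most the distance. With
    \<open>Im (moebius A w) = Im w / x\<^sup>2\<close> this becomes \<open>x - 1 / x < 1\<close>,
    which forces \<open>x < 2\<close>.\<close>
  then have "(Im w - Im w / x\<^sup>2) * x < Im w" using x by (smt (verit, best) mult_right_mono)
  moreover have "(Im w - Im w / x\<^sup>2) * x = Im w * (x - 1 / x)" using x by (simp add: field_simps power2_eq_square)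
  ultimately have "Im w * (x - 1 / x) < Im w * 1" by simp
  then have "x - 1 / x < 1" using w by (simp add: uhp_def)
  then have x2: "x < 2" using x by (smt (verit) divide_le_eq_1)
  have "\<bar>A$2$1\<bar> * Im w = \<bar>Im (aut_factor A w)\<bar>" using w by (simp add: aut_factor_def uhp_def abs_mult)
  also have "\<dots> < 2" using x2 abs_Im_le_cmod[of "aut_factor A w"] by (simp add: x_def)
  finally have "\<bar>A$2$1\<bar> * m < 2" using w by (smt (verit) mult_left_mono)
  then have c: "\<bar>A$2$1\<bar> \<le> 2 / m" using w by (simp add: field_simps)
  have "cmod (of_real (A$2$2)) \<le> cmod (aut_factor A w) + cmod (of_real (A$2$1) * w)"
    using norm_triangle_ineq4[of "aut_factor A w" "of_real (A$2$1) * w"] by (simp add: aut_factor_def)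
  also have "cmod (of_real (A$2$1) * w) \<le> (2/m) * R"
    unfolding norm_mult using c w R by (intro mult_mono) auto
  finally have dd: "\<bar>A$2$2\<bar> \<le> 2 + (2/m) * R" using x2 by (simp add: x_def)
  define u where "u = of_real (A$1$1) * w + of_real (A$1$2)"
  have "cmod u \<le> disp A w + cmod (w * aut_factor A w)"
    using norm_triangle_ineq[of "u - w * aut_factor A w" "w * aut_factor A w"] by (simp add: u_def disp_def)
  also have "cmod (w * aut_factor A w) \<le> R * 2" unfolding norm_mult using w x2 R by (intro mult_mono) (auto simp: x_def)
  finally have u: "cmod u \<le> 3 * R" using d R by simp
  have "\<bar>A$1$1\<bar> * Im w = \<bar>Im u\<bar>" using w by (simp add: u_def uhp_def abs_mult)
  also have "\<dots> \<le> 3 * R" using u abs_Im_le_cmod[of u] by simp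
  finally have "\<bar>A$1$1\<bar> * m \<le> 3 * R" using w by (smt (verit) mult_left_mono)
  then have a: "\<bar>A$1$1\<bar> \<le> 3 * R / m" using w by (simp add: field_simps)
  have "cmod (of_real (A$1$2)) \<le> cmod u + cmod (of_real (A$1$1) * w)"
    using norm_triangle_ineq4[of u "of_real (A$1$1) * w"] by (simp add: u_def)
  also have "cmod (of_real (A$1$1) * w) \<le> (3*R/m) * R"
    unfolding norm_mult using a w R by (intro mult_mono) auto
  finally have b: "\<bar>A$1$2\<bar> \<le> 3*R + (3*R/m) * R" using u by simp
  have pos: "3*R/m \<ge> 0" "(3*R/m)*R \<ge> 0" "2/m \<ge> 0" "(2/m)*R \<ge> 0" using R w by auto
  fix i j
  show "\<bar>A$i$j\<bar> \<le> (3*R/m) + 3*R + (3*R/m)*R + 2 + 2/m + (2/m)*R"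
    using exhaust_2[of i] exhaust_2[of j] a b c dd pos R by (elim disjE) (simp_all only:; linarith)+
qed

text \<open>Only finitely many elements have displacement below \<open>Im w\<close> somewhere on
  \<open>K\<close>. Apart from the identity and its negative, each of them has a positive minimum
  there since the action is free, and all others satisfy the bound with constant 1.\<close>

lemma displacement:
  assumes K: "compact K" "K \<subseteq> uhp"
  obtains \<epsilon> where "\<epsilon> > 0" "\<epsilon> \<le> 1"
    "\<And>w A. w \<in> K \<Longrightarrow> A \<in> G \<Longrightarrow> A \<noteq> mat 1 \<Longrightarrow> A \<noteq> - mat 1 \<Longrightarrow> disp A w \<ge> \<epsilon> * Im w"
proof (cases "K = {}")
  case True then show ?thesis by (intro that[of 1]) auto
next
  case False
  have cI: "continuous_on K Im" by (intro continuous_intros)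
  obtain w0 where w0: "w0 \<in> K" "\<And>w. w \<in> K \<Longrightarrow> Im w0 \<le> Im w"
    using continuous_attains_inf[OF K(1) False cI] by blast
  define m where "m = Im w0"
  have m: "m > 0" using w0 K by (auto simp: m_def uhp_def)
  obtain R where R: "\<And>w. w \<in> K \<Longrightarrow> cmod w \<le> R"
    using compact_imp_bounded[OF K(1)] unfolding bounded_iff by blast
  define S where "S = {A\<in>G. A \<noteq> mat 1 \<and> A \<noteq> - mat 1 \<and> (\<exists>w\<in>K. disp A w < Im w)}"
  have "S \<subseteq> {A\<in>G. norm A \<le> 4 * ((3*R/m) + 3*R + (3*R/m)*R + 2 + 2/m + (2/m)*R)}"
    using disp_small_bounded R w0 m K unfolding S_def m_def by blast
  then have fS: "finite S" using finite_bounded_G finite_subset by blast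
  have "\<exists>e>0. \<forall>w\<in>K. disp A w \<ge> e * Im w" if A: "A \<in> S" for A
  proof -
    have AG: "A \<in> G" using A by (auto simp: S_def)
    have pos: "Im w > 0" if "w \<in> K" for w using that K by (auto simp: uhp_def)
    have "continuous_on K (\<lambda>w. disp A w / Im w)"
      unfolding disp_def aut_factor_def by (intro continuous_intros) (use pos in fastforce)
    then obtain w1 where w1: "w1 \<in> K" "\<And>w. w \<in> K \<Longrightarrow> disp A w1 / Im w1 \<le> disp A w / Im w"
      using continuous_attains_inf[OF K(1) False] by blast
    have "disp A w1 \<noteq> 0"
    proof
      assume "disp A w1 = 0"
      then have "moebius A w1 = w1"
        using disp_eq[OF det_G[OF AG], of w1] aut_factor_nz[OF det_G[OF AG], of w1] w1 K by auto
      then show False using free_G[OF AG] w1 K A by (auto simp: S_def)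
    qed
    then have "disp A w1 / Im w1 > 0" using pos[OF w1(1)] by (simp add: disp_def)
    moreover have "\<forall>w\<in>K. disp A w \<ge> disp A w1 / Im w1 * Im w"
      using w1(2) pos by (simp add: pos_le_divide_eq)
    ultimately show ?thesis by blast
  qed
  then obtain e where e: "\<And>A. A \<in> S \<Longrightarrow> e A > 0" "\<And>A w. A \<in> S \<Longrightarrow> w \<in> K \<Longrightarrow> disp A w \<ge> e A * Im w"
    by metis
  define \<epsilon> where "\<epsilon> = Min (insert 1 (e ` S))"
  have e1: "\<epsilon> > 0" "\<epsilon> \<le> 1" using fS e(1) by (auto simp: \<epsilon>_def)
  have "disp A w \<ge> \<epsilon> * Im w" if "w \<in> K" "A \<in> G" "A \<noteq> mat 1" "A \<noteq> - mat 1" for w A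
  proof (cases "A \<in> S")
    case True
    have "\<epsilon> \<le> e A" using fS True by (auto simp: \<epsilon>_def)
    then show ?thesis using e(2)[OF True that(1)] that(1) K
      by (smt (verit) mult_right_mono mem_Collect_eq subset_iff uhp_def)
  next
    case False
    then have "disp A w \<ge> 1 * Im w" using that by (auto simp: S_def not_less)
    moreover have "\<epsilon> * Im w \<le> 1 * Im w" using e1 that K by (intro mult_right_mono) (auto simp: uhp_def)
    ultimately show ?thesis by linarith
  qed
  then show ?thesis using that e1 by blast
qed

text \<open>Apply the displacement bound to \<open>adj2 B ** A\<close> and move by \<open>B\<close>:
  hyperbolic distances are invariant, so one constant serves the entire orbit although it leaves
  \<open>K\<close>.\<close>

lemma orbit_separated:
  assumes "compact K" "K \<subseteq> uhp"
  obtains \<epsilon> where "\<epsilon> > 0" "\<epsilon> \<le> 1"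
    "\<And>w A B. w \<in> K \<Longrightarrow> A \<in> G \<Longrightarrow> B \<in> G \<Longrightarrow> moebius A w \<noteq> moebius B w \<Longrightarrow>
       (cmod (moebius A w - moebius B w))\<^sup>2 \<ge> \<epsilon>\<^sup>2 * Im (moebius A w) * Im (moebius B w)"
proof -
  obtain \<epsilon> where \<epsilon>: "\<epsilon> > 0" "\<epsilon> \<le> 1"
    "\<And>w A. w \<in> K \<Longrightarrow> A \<in> G \<Longrightarrow> A \<noteq> mat 1 \<Longrightarrow> A \<noteq> - mat 1 \<Longrightarrow> disp A w \<ge> \<epsilon> * Im w"
    using displacement[OF assms] by blast
  show ?thesis
  proof (rule that[OF \<epsilon>(1,2)])
    fix w A B assume w: "w \<in> K" and A: "A \<in> G" and B: "B \<in> G" and ne: "moebius A w \<noteq> moebius B w"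
    have wu: "w \<in> uhp" using w assms by auto
    define C where "C = adj2 B ** A"
    have C: "C \<in> G" using A B by (simp add: C_def mult_G adj2_G)
    have BC: "moebius B (moebius C w) = moebius A w"
      using A B wu by (simp add: C_def moebius_mult det_G adj2_G moebius_G_adj2 moebius_G_uhp)
    then have "C \<noteq> mat 1" "C \<noteq> - mat 1" using ne by auto
    then have "(cmod (moebius C w - w))\<^sup>2 \<ge> \<epsilon>\<^sup>2 * Im (moebius C w) * Im w"
      using moebius_dist_ge[OF det_G[OF C] wu, of \<epsilon>] \<epsilon> w C by auto
    moreover have "Im (moebius C w) > 0" "Im w > 0" "Im (moebius A w) > 0" "Im (moebius B w) > 0"
      using C A B wu moebius_G_uhp by (auto simp: uhp_def)
    moreover have "(cmod (moebius A w - moebius B w))\<^sup>2 / (Im (moebius A w) * Im (moebius B w))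
       = (cmod (moebius C w - w))\<^sup>2 / (Im (moebius C w) * Im w)"
      using hyp_dist_invariant(1)[OF det_G[OF B] moebius_G_uhp[OF C wu] wu] by (simp add: BC)
    ultimately have "(cmod (moebius A w - moebius B w))\<^sup>2 / (Im (moebius A w) * Im (moebius B w)) \<ge> \<epsilon>\<^sup>2"
      by (simp add: pos_le_divide_eq mult.assoc)
    then show "(cmod (moebius A w - moebius B w))\<^sup>2 \<ge> \<epsilon>\<^sup>2 * Im (moebius A w) * Im (moebius B w)"
      using \<open>Im (moebius A w) > 0\<close> \<open>Im (moebius B w) > 0\<close> by (simp add: pos_le_divide_eq mult.assoc)
  qed
qed

end

subsection \<open>Packing of orbits\<close>

lemma borel_measurable_Complex [measurable]:
  "(\<lambda>p. Complex (fst p) (snd p)) \<in> borel_measurable (borel \<Otimes>\<^sub>M borel)"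
proof -
  have "(\<lambda>p. complex_of_real (fst p) + \<i> * of_real (snd p)) \<in> borel_measurable (borel \<Otimes>\<^sub>M borel)"
    by measurable
  then show ?thesis by (simp add: Complex_eq)
qed

lemma Complex_compose_measurable [measurable (raw)]:
  assumes "f \<in> borel_measurable M" "g \<in> borel_measurable M"
  shows "(\<lambda>x. Complex (f x) (g x)) \<in> borel_measurable M"
proof -
  have "(\<lambda>x. complex_of_real (f x) + \<i> * of_real (g x)) \<in> borel_measurable M"
    using assms by measurable
  then show ?thesis by (simp add: Complex_eq)
qed

text \<open>Lebesgue measure is determined by its values on boxes, and boxes in the plane are
  products of intervals.\<close>

lemma lborel_complex: "lborel = distr (lborel \<Otimes>\<^sub>M lborel) borel (\<lambda>p. Complex (fst p) (snd p))"
proof (rule lborel_eqI)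
  have [measurable]: "(\<lambda>p. Complex (fst p) (snd p)) \<in> borel_measurable (lborel \<Otimes>\<^sub>M lborel)" by measurable
  fix l u :: complex assume lu: "\<And>b. b \<in> Basis \<Longrightarrow> l \<bullet> b \<le> u \<bullet> b"
  have le: "Re l \<le> Re u" "Im l \<le> Im u" using lu[of 1] lu[of \<i>] by (auto simp: Basis_complex_def)
  have "(\<lambda>p. Complex (fst p) (snd p)) -` box l u \<inter> space (lborel \<Otimes>\<^sub>M lborel) = {Re l<..<Re u} \<times> {Im l<..<Im u}"
    by (auto simp: box_def Basis_complex_def space_pair_measure)
  then have "emeasure (distr (lborel \<Otimes>\<^sub>M lborel) borel (\<lambda>p. Complex (fst p) (snd p))) (box l u)
     = emeasure (lborel \<Otimes>\<^sub>M lborel) ({Re l<..<Re u} \<times> {Im l<..<Im u})"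
    by (simp add: emeasure_distr)
  also have "\<dots> = ennreal (Re u - Re l) * ennreal (Im u - Im l)"
    using le by (subst lborel.emeasure_pair_measure_Times) auto
  also have "\<dots> = ennreal (\<Prod>b\<in>Basis. (u - l) \<bullet> b)"
    using le by (simp add: Basis_complex_def ennreal_mult)
  finally show "emeasure (distr (lborel \<Otimes>\<^sub>M lborel) borel (\<lambda>p. Complex (fst p) (snd p))) (box l u)
     = ennreal (\<Prod>b\<in>Basis. (u - l) \<bullet> b)" .
qed simp

lemma nn_integral_complex:
  assumes [measurable]: "F \<in> borel_measurable borel"
  shows "(\<integral>\<^sup>+ z. F z \<partial>lborel) = (\<integral>\<^sup>+ y. \<integral>\<^sup>+ x. F (Complex x y) \<partial>lborel \<partial>lborel)"
proof -
  have "(\<integral>\<^sup>+ z. F z \<partial>lborel) = (\<integral>\<^sup>+ p. F (Complex (fst p) (snd p)) \<partial>(lborel \<Otimes>\<^sub>M lborel))"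
    by (subst lborel_complex) (simp add: nn_integral_distr)
  also have "\<dots> = (\<integral>\<^sup>+ y. \<integral>\<^sup>+ x. F (Complex x y) \<partial>lborel \<partial>lborel)"
    by (subst lborel_pair.nn_integral_snd[symmetric]) (auto simp: case_prod_unfold)
  finally show ?thesis .
qed

lemma nn_integral_inverse_square:
  assumes "a > 0"
  shows "(\<integral>\<^sup>+ v. ennreal (1 / (a + v)\<^sup>2) * indicator {0..} v \<partial>lborel) = ennreal (1 / a)"
proof -
  have "((\<lambda>v. - 1 / (a + v)) \<longlongrightarrow> 0) at_top" by real_asymp
  then have "(\<integral>\<^sup>+ v. ennreal (1 / (a + v)\<^sup>2) * indicator {0..} v \<partial>lborel) = ennreal (0 - - 1 / (a + 0))"
    using assms
    by (intro nn_integral_FTC_atLeast) (auto intro!: derivative_eq_intros simp: power2_eq_square field_simps)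
  then show ?thesis by simp
qed

lemma nn_integral_cauchy_le:
  assumes "a > 0"
  shows "(\<integral>\<^sup>+ u. ennreal (1 / ((x - u)\<^sup>2 + a\<^sup>2)) \<partial>lborel) \<le> ennreal (pi / a)"
proof -
  have half: "(\<integral>\<^sup>+ u. ennreal (1 / (u\<^sup>2 + a\<^sup>2)) * indicator {0..} u \<partial>lborel) = ennreal (pi / (2 * a))"
  proof -
    have "((\<lambda>u. arctan (u / a) / a) \<longlongrightarrow> (pi / 2) / a) at_top"
    proof -
      have "((\<lambda>u. arctan (u / a) / a) \<longlongrightarrow> pi * inverse a / 2) at_top"
        using assms by real_asymp
      then show ?thesis by (simp add: field_simps)
    qed
    moreover have "((\<lambda>u. arctan (u / a) / a) has_real_derivative 1 / (u\<^sup>2 + a\<^sup>2)) (at u)" for u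
    proof -
      have "1 + (u / a)\<^sup>2 > 0" by (simp add: add_pos_nonneg)
      then have "inverse (1 + (u / a)\<^sup>2) * (1 / a) / a = 1 / (u\<^sup>2 + a\<^sup>2)"
        using assms by (simp add: power2_eq_square divide_simps)
      then show ?thesis using assms by (auto intro!: derivative_eq_intros)
    qed
    ultimately have "(\<integral>\<^sup>+ u. ennreal (1 / (u\<^sup>2 + a\<^sup>2)) * indicator {0..} u \<partial>lborel)
        = ennreal ((pi / 2) / a - arctan (0 / a) / a)"
      using assms by (intro nn_integral_FTC_atLeast) auto
    then show ?thesis by simp
  qed
  have "(\<integral>\<^sup>+ u. ennreal (1 / ((x - u)\<^sup>2 + a\<^sup>2)) \<partial>lborel) = (\<integral>\<^sup>+ u. ennreal (1 / (u\<^sup>2 + a\<^sup>2)) \<partial>lborel)"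
    by (subst nn_integral_real_affine[where c = 1 and t = x]) auto
  also have "\<dots> \<le> (\<integral>\<^sup>+ u. ennreal (1 / (u\<^sup>2 + a\<^sup>2)) * indicator {0..} u + ennreal (1 / (u\<^sup>2 + a\<^sup>2)) * indicator {0..} (-u) \<partial>lborel)"
    by (intro nn_integral_mono) (auto split: split_indicator)
  also have "\<dots> = (\<integral>\<^sup>+ u. ennreal (1 / (u\<^sup>2 + a\<^sup>2)) * indicator {0..} u \<partial>lborel)
      + (\<integral>\<^sup>+ u. ennreal (1 / (u\<^sup>2 + a\<^sup>2)) * indicator {0..} (-u) \<partial>lborel)"
    by (intro nn_integral_add) auto
  also have "(\<integral>\<^sup>+ u. ennreal (1 / (u\<^sup>2 + a\<^sup>2)) * indicator {0..} (-u) \<partial>lborel)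
     = (\<integral>\<^sup>+ u. ennreal (1 / (u\<^sup>2 + a\<^sup>2)) * indicator {0..} u \<partial>lborel)"
    by (subst nn_integral_real_affine[where c = "-1" and t = 0]) auto
  finally show ?thesis
    unfolding half using assms by (simp flip: ennreal_plus)
qed

text \<open>The variables are separated: one factor |z - cnj \<zeta>|^2 is bounded below by its
  value for \<open>Im \<zeta> = 0\<close>, the other by the squared vertical distance. What remains
  is an arctangent integral times an inverse square integral.\<close>

lemma nn_integral_kernel_le:
  assumes z: "z \<in> uhp"
  shows "(\<integral>\<^sup>+ \<zeta>. ennreal (indicator uhp \<zeta> / cmod (z - cnj \<zeta>) ^ 4) \<partial>lborel) \<le> ennreal (pi / (Im z)\<^sup>2)"
proof -
  define y where "y = Im z"
  have y: "y > 0" using z by (simp add: y_def uhp_def)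
  have um [measurable]: "uhp \<in> sets borel" by (simp add: borel_open)
  have mf [measurable]: "(\<lambda>\<zeta>. indicator uhp \<zeta> / cmod (z - cnj \<zeta>) ^ 4) \<in> borel_measurable borel"
  proof -
    have [measurable]: "cnj \<in> borel_measurable borel"
      by (intro borel_measurable_continuous_onI continuous_intros)
    show ?thesis by measurable
  qed
  have "(\<integral>\<^sup>+ \<zeta>. ennreal (indicator uhp \<zeta> / cmod (z - cnj \<zeta>) ^ 4) \<partial>lborel)
      = (\<integral>\<^sup>+ v. \<integral>\<^sup>+ u. ennreal (indicator uhp (Complex u v) / cmod (z - cnj (Complex u v)) ^ 4) \<partial>lborel \<partial>lborel)"
    by (rule nn_integral_complex) measurable
  also have "\<dots> \<le> (\<integral>\<^sup>+ v. \<integral>\<^sup>+ u. ennreal (1 / ((Re z - u)\<^sup>2 + y\<^sup>2)) * (ennreal (1 / (y + v)\<^sup>2) * indicator {0..} v) \<partial>lborel \<partial>lborel)"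
  proof (intro nn_integral_mono)
    fix u v :: real
    show "ennreal (indicator uhp (Complex u v) / cmod (z - cnj (Complex u v)) ^ 4)
       \<le> ennreal (1 / ((Re z - u)\<^sup>2 + y\<^sup>2)) * (ennreal (1 / (y + v)\<^sup>2) * indicator {0..} v)"
    proof (cases "v > 0")
      case True
      have c4: "cmod (z - cnj (Complex u v)) ^ 4 = ((Re z - u)\<^sup>2 + (y + v)\<^sup>2)\<^sup>2"
        using power_mult[of "cmod (z - cnj (Complex u v))" 2 2] by (simp add: cmod_power2 y_def)
      have "((Re z - u)\<^sup>2 + y\<^sup>2) * (y + v)\<^sup>2 \<le> ((Re z - u)\<^sup>2 + (y + v)\<^sup>2) * ((Re z - u)\<^sup>2 + (y + v)\<^sup>2)"
        using True y by (intro mult_mono add_left_mono power_mono) auto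
      moreover have "((Re z - u)\<^sup>2 + y\<^sup>2) * (y + v)\<^sup>2 > 0" using y True by (simp add: add_nonneg_pos)
      ultimately have "1 / cmod (z - cnj (Complex u v)) ^ 4 \<le> 1 / (((Re z - u)\<^sup>2 + y\<^sup>2) * (y + v)\<^sup>2)"
        unfolding c4 power2_eq_square[of "(Re z - u)\<^sup>2 + (y + v)\<^sup>2"] by (intro divide_left_mono) auto
      then have "1 / cmod (z - cnj (Complex u v)) ^ 4 \<le> 1 / ((Re z - u)\<^sup>2 + y\<^sup>2) * (1 / (y + v)\<^sup>2)" by simp
      moreover have "Complex u v \<in> uhp" using True by (simp add: uhp_def)
      ultimately show ?thesis using True by (simp add: ennreal_mult[symmetric] ennreal_leI)
    next
      case False
      then have "Complex u v \<notin> uhp" by (simp add: uhp_def)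
      then show ?thesis by simp
    qed
  qed
  also have "\<dots> = (\<integral>\<^sup>+ v. (\<integral>\<^sup>+ u. ennreal (1 / ((Re z - u)\<^sup>2 + y\<^sup>2)) \<partial>lborel) * (ennreal (1 / (y + v)\<^sup>2) * indicator {0..} v) \<partial>lborel)"
    by (intro nn_integral_cong nn_integral_multc) auto
  also have "\<dots> = (\<integral>\<^sup>+ u. ennreal (1 / ((Re z - u)\<^sup>2 + y\<^sup>2)) \<partial>lborel) * ennreal (1 / y)"
    by (subst nn_integral_cmult) (auto simp: nn_integral_inverse_square[OF y])
  also have "\<dots> \<le> ennreal (pi / y) * ennreal (1 / y)"
    by (intro mult_right_mono nn_integral_cauchy_le y) auto
  also have "\<dots> = ennreal (pi / (Im z)\<^sup>2)"
    using y by (simp add: ennreal_mult[symmetric] y_def power2_eq_square)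
  finally show ?thesis .
qed

text \<open>This is \<open>pi / \<delta>\<^sup>2\<close> for
  \<open>\<delta> = \<epsilon> / 8\<close>, the half side of the packed squares in units of the
  height.\<close>

definition packing_const :: "real \<Rightarrow> real" where "packing_const \<epsilon> = 64 * pi / \<epsilon>\<^sup>2"

lemma norm_diff_cnj_ge: "w \<in> uhp \<Longrightarrow> z \<in> uhp \<Longrightarrow> cmod (z - cnj w) \<ge> Im z + Im w"
  using abs_Im_le_cmod[of "z - cnj w"] by (simp add: uhp_def)

text \<open>Squares of side proportional to \<open>Im \<zeta>\<close> around the points \<open>\<zeta>\<close> are disjoint, and the kernel is
  comparable to a constant on each of them.\<close>

lemma packing:
  assumes \<epsilon>: "\<epsilon> > 0" "\<epsilon> \<le> 1" and F: "finite F" "F \<subseteq> uhp" and z: "z \<in> uhp"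
    and sep: "\<And>\<zeta> \<zeta>'. \<zeta> \<in> F \<Longrightarrow> \<zeta>' \<in> F \<Longrightarrow> \<zeta> \<noteq> \<zeta>' \<Longrightarrow> (cmod (\<zeta> - \<zeta>'))\<^sup>2 \<ge> \<epsilon>\<^sup>2 * Im \<zeta> * Im \<zeta>'"
  shows "(\<Sum>\<zeta>\<in>F. (Im \<zeta>)\<^sup>2 / cmod (z - cnj \<zeta>) ^ 4) \<le> packing_const \<epsilon> / (Im z)\<^sup>2"
proof -
  \<comment> \<open>Small enough that squares around separated points cannot meet, and at most 1/8
    so that a square stays in the half-plane.\<close>
  define \<delta> where "\<delta> = \<epsilon> / 8"
  have \<delta>: "\<delta> > 0" "\<delta> \<le> 1/8" using \<epsilon> by (auto simp: \<delta>_def)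
  define Q where "Q = (\<lambda>\<zeta>. box (\<zeta> - of_real (\<delta> * Im \<zeta>) * Complex 1 1) (\<zeta> + of_real (\<delta> * Im \<zeta>) * Complex 1 1))"
  have Qim: "\<bar>Re \<xi> - Re \<zeta>\<bar> < \<delta> * Im \<zeta> \<and> \<bar>Im \<xi> - Im \<zeta>\<bar> < \<delta> * Im \<zeta>" if "\<xi> \<in> Q \<zeta>" for \<xi> \<zeta>
    using that by (auto simp: Q_def box_def Basis_complex_def)
  have Qd: "cmod (\<xi> - \<zeta>) < 2 * \<delta> * Im \<zeta>" if "\<xi> \<in> Q \<zeta>" for \<xi> \<zeta>
    using Qim[OF that] cmod_le[of "\<xi> - \<zeta>"] by simp
  have Qu: "\<xi> \<in> uhp" if "\<xi> \<in> Q \<zeta>" "\<zeta> \<in> F" for \<xi> \<zeta>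
  proof -
    have i: "Im \<zeta> > 0" using that F by (auto simp: uhp_def)
    have "\<delta> * Im \<zeta> \<le> 1/8 * Im \<zeta>" using \<delta> i by (intro mult_right_mono) auto
    then have "Im \<xi> > 0" using Qim[OF that(1)] i by linarith
    then show ?thesis by (simp add: uhp_def)
  qed
  have disj: "Q \<zeta> \<inter> Q \<zeta>' = {}" if "\<zeta> \<in> F" "\<zeta>' \<in> F" "\<zeta> \<noteq> \<zeta>'" "Im \<zeta> \<le> Im \<zeta>'" for \<zeta> \<zeta>'
  proof (rule ccontr)
    assume "\<not> ?thesis"
    then obtain \<xi> where \<xi>: "\<xi> \<in> Q \<zeta>" "\<xi> \<in> Q \<zeta>'" by blast
    define a where "a = Im \<zeta>"
    define b where "b = Im \<zeta>'"
    have ab: "a > 0" "b > 0" "a \<le> b" using that F by (auto simp: a_def b_def uhp_def)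
    have d: "cmod (\<zeta> - \<zeta>') < 2 * \<delta> * (a + b)"
      using Qd[OF \<xi>(1)] Qd[OF \<xi>(2)] norm_triangle_ineq[of "\<zeta> - \<xi>" "\<xi> - \<zeta>'"]
      by (simp add: a_def b_def algebra_simps norm_minus_commute)
    \<comment> \<open>Squares that meet have comparable heights, \<open>b < 5/3 * a\<close>. Then
      \<open>(a + b)\<^sup>2 \<le> 16 * (a * b)\<close> and the distance falls below the assumed
      separation.\<close>
    have "2 * \<delta> * (a + b) \<le> 2 * (1/8) * (a + b)" using \<delta> ab by (intro mult_right_mono) auto
    moreover have "b - a \<le> cmod (\<zeta> - \<zeta>')" using abs_Im_le_cmod[of "\<zeta> - \<zeta>'"] by (simp add: a_def b_def)
    ultimately have b53: "b < 5/3 * a" using d by simp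
    have "(cmod (\<zeta> - \<zeta>'))\<^sup>2 < (2 * \<delta> * (a + b))\<^sup>2" using d by (intro power_strict_mono) auto
    also have "\<dots> = 4 * \<delta>\<^sup>2 * (a + b)\<^sup>2" by (simp add: power_mult_distrib)
    also have "(a + b)\<^sup>2 \<le> 16 * (a * b)"
    proof -
      have "b * b \<le> (5/3 * a) * b" using b53 ab by (intro mult_right_mono) auto
      moreover have "a * a \<le> a * b" using ab by (intro mult_left_mono) auto
      moreover have "a * b > 0" using ab by simp
      ultimately show ?thesis by (simp add: power2_eq_square algebra_simps)
    qed
    finally have "(cmod (\<zeta> - \<zeta>'))\<^sup>2 < \<epsilon>\<^sup>2 * a * b"
      using \<delta>(1) by (simp add: \<delta>_def power2_eq_square field_simps)
    then show False using sep[OF that(1-3)] by (simp add: a_def b_def)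
  qed
  have disjF: "disjoint_family_on Q F"
    unfolding disjoint_family_on_def using disj by (metis inf_commute linear)
  \<comment> \<open>The area is \<open>4 * \<delta>\<^sup>2 * (Im \<zeta>)\<^sup>2\<close>. A factor
    4 is lost because on the square the distance to the conjugate point grows by at most 5/4, and
    the fourth power of 5/4 is below 4.\<close>
  have lower: "ennreal (\<delta>\<^sup>2) * ennreal ((Im \<zeta>)\<^sup>2 / cmod (z - cnj \<zeta>) ^ 4)
     \<le> (\<integral>\<^sup>+ \<xi>. ennreal (indicator uhp \<xi> / cmod (z - cnj \<xi>) ^ 4) * indicator (Q \<zeta>) \<xi> \<partial>lborel)" if \<zeta>: "\<zeta> \<in> F" for \<zeta>
  proof -
    have i: "Im \<zeta> > 0" using \<zeta> F by (auto simp: uhp_def)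
    have y: "Im z > 0" using z by (simp add: uhp_def)
    have zz: "cmod (z - cnj \<zeta>) \<ge> Im z + Im \<zeta>" using norm_diff_cnj_ge \<zeta> F z by blast
    have pt: "1/4 / cmod (z - cnj \<zeta>) ^ 4 \<le> 1 / cmod (z - cnj \<xi>) ^ 4" if \<xi>: "\<xi> \<in> Q \<zeta>" for \<xi>
    proof -
      have "cmod (z - cnj \<xi>) \<le> cmod (z - cnj \<zeta>) + cmod (cnj \<zeta> - cnj \<xi>)"
        using norm_triangle_ineq[of "z - cnj \<zeta>" "cnj \<zeta> - cnj \<xi>"] by simp
      also have "cmod (cnj \<zeta> - cnj \<xi>) = cmod (\<xi> - \<zeta>)"
        by (metis complex_cnj_diff complex_mod_cnj norm_minus_commute)
      also have "cmod (\<xi> - \<zeta>) \<le> 1/4 * Im \<zeta>"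
      proof -
        have "2 * \<delta> * Im \<zeta> \<le> 1/4 * Im \<zeta>" using \<delta> i by (intro mult_right_mono) auto
        then show ?thesis using Qd[OF \<xi>] by linarith
      qed
      finally have "cmod (z - cnj \<xi>) \<le> 5/4 * cmod (z - cnj \<zeta>)" using zz y by simp
      then have "cmod (z - cnj \<xi>) ^ 4 \<le> (5/4 * cmod (z - cnj \<zeta>)) ^ 4" by (intro power_mono) auto
      also have "\<dots> \<le> 4 * cmod (z - cnj \<zeta>) ^ 4" unfolding power_mult_distrib by (intro mult_right_mono) (auto simp: power4_eq_xxxx)
      finally have "cmod (z - cnj \<xi>) ^ 4 \<le> 4 * cmod (z - cnj \<zeta>) ^ 4" .
      moreover have "cmod (z - cnj \<xi>) > 0" using norm_diff_cnj_ge[OF Qu[OF \<xi> \<zeta>] z] y Qu[OF \<xi> \<zeta>]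
        unfolding uhp_def mem_Collect_eq by linarith
      moreover have "cmod (z - cnj \<zeta>) > 0" using zz i y by linarith
      ultimately show ?thesis by (simp add: field_simps)
    qed
    have em: "emeasure lborel (Q \<zeta>) = ennreal ((2 * \<delta> * Im \<zeta>)\<^sup>2)"
      unfolding Q_def using \<delta> i
      by (subst emeasure_lborel_box) (auto simp: Basis_complex_def power2_eq_square inner_add_left inner_diff_left)
    have "ennreal (\<delta>\<^sup>2) * ennreal ((Im \<zeta>)\<^sup>2 / cmod (z - cnj \<zeta>) ^ 4) = ennreal (1/4 / cmod (z - cnj \<zeta>) ^ 4) * emeasure lborel (Q \<zeta>)"
      unfolding em by (simp add: ennreal_mult[symmetric] power_mult_distrib)
    also have "\<dots> = (\<integral>\<^sup>+ \<xi>. ennreal (1/4 / cmod (z - cnj \<zeta>) ^ 4) * indicator (Q \<zeta>) \<xi> \<partial>lborel)"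
      by (subst nn_integral_cmult_indicator) (auto simp: Q_def)
    also have "\<dots> \<le> (\<integral>\<^sup>+ \<xi>. ennreal (indicator uhp \<xi> / cmod (z - cnj \<xi>) ^ 4) * indicator (Q \<zeta>) \<xi> \<partial>lborel)"
      using pt Qu[OF _ \<zeta>] by (intro nn_integral_mono) (auto split: split_indicator intro!: ennreal_leI)
    finally show ?thesis .
  qed
  have um [measurable]: "uhp \<in> sets borel" by (simp add: borel_open)
  have [measurable]: "cnj \<in> borel_measurable borel"
    by (intro borel_measurable_continuous_onI continuous_intros)
  have [measurable]: "Q \<zeta> \<in> sets borel" for \<zeta> by (simp add: Q_def)
  have "ennreal (\<delta>\<^sup>2) * (\<Sum>\<zeta>\<in>F. ennreal ((Im \<zeta>)\<^sup>2 / cmod (z - cnj \<zeta>) ^ 4))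
     \<le> (\<Sum>\<zeta>\<in>F. \<integral>\<^sup>+ \<xi>. ennreal (indicator uhp \<xi> / cmod (z - cnj \<xi>) ^ 4) * indicator (Q \<zeta>) \<xi> \<partial>lborel)"
    unfolding sum_distrib_left by (intro sum_mono lower)
  also have "\<dots> = (\<integral>\<^sup>+ \<xi>. (\<Sum>\<zeta>\<in>F. ennreal (indicator uhp \<xi> / cmod (z - cnj \<xi>) ^ 4) * indicator (Q \<zeta>) \<xi>) \<partial>lborel)"
    by (subst nn_integral_sum) auto
  also have "\<dots> \<le> (\<integral>\<^sup>+ \<xi>. ennreal (indicator uhp \<xi> / cmod (z - cnj \<xi>) ^ 4) \<partial>lborel)"
  proof (intro nn_integral_mono)
    fix \<xi>
    have "(\<Sum>\<zeta>\<in>F. indicator (Q \<zeta>) \<xi> :: ennreal) = indicator (\<Union>(Q ` F)) \<xi>"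
      using indicator_UN_disjoint[OF F(1) disjF] by metis
    then have "(\<Sum>\<zeta>\<in>F. indicator (Q \<zeta>) \<xi> :: ennreal) \<le> 1" by (simp add: indicator_def)
    then show "(\<Sum>\<zeta>\<in>F. ennreal (indicator uhp \<xi> / cmod (z - cnj \<xi>) ^ 4) * indicator (Q \<zeta>) \<xi>)
       \<le> ennreal (indicator uhp \<xi> / cmod (z - cnj \<xi>) ^ 4)"
      unfolding sum_distrib_left[symmetric] by (metis mult.right_neutral mult_left_mono zero_le)
  qed
  also have "\<dots> \<le> ennreal (pi / (Im z)\<^sup>2)" by (rule nn_integral_kernel_le[OF z])
  finally have "\<delta>\<^sup>2 * (\<Sum>\<zeta>\<in>F. (Im \<zeta>)\<^sup>2 / cmod (z - cnj \<zeta>) ^ 4) \<le> pi / (Im z)\<^sup>2"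
    by (simp add: sum_ennreal ennreal_mult[symmetric] sum_nonneg)
  then have "(\<Sum>\<zeta>\<in>F. (Im \<zeta>)\<^sup>2 / cmod (z - cnj \<zeta>) ^ 4) \<le> pi / (Im z)\<^sup>2 / \<delta>\<^sup>2"
    using \<delta>(1) by (subst pos_le_divide_eq) (auto simp only: mult.commute zero_less_power)
  then show ?thesis
    by (simp add: packing_const_def \<delta>_def power_divide mult.commute)
qed

subsection \<open>Invariance of the hyperbolic measure\<close>

lemma uhp_borel [measurable, simp]: "uhp \<in> sets borel"
  by (simp add: borel_open)

lemma sets_hyp_measure [measurable_cong, simp]: "sets hyp_measure = sets borel"
  and space_hyp_measure [simp]: "space hyp_measure = UNIV"
  by (simp_all add: hyp_measure_def)

lemma AE_hyp_uhp: "AE z in hyp_measure. z \<in> uhp"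
  unfolding hyp_measure_def by (subst AE_density) (auto simp: indicator_def)

lemma AE_hypI: "(\<And>z. z \<in> uhp \<Longrightarrow> P z) \<Longrightarrow> AE z in hyp_measure. P z"
  using AE_hyp_uhp by (rule AE_mp) (rule AE_I2, blast)

lemma moebius_measurable [measurable]: "moebius A \<in> borel_measurable borel"
  unfolding moebius_def[abs_def] by measurable

text \<open>The substitution is made on the compact intervals of an exhaustion; continuity from
  below of the two density measures gives the limit.\<close>

lemma nn_integral_exp_substitution:
  fixes f :: "real \<Rightarrow> ennreal"
  assumes [measurable]: "f \<in> borel_measurable borel"
  shows "(\<integral>\<^sup>+ y. f y * indicator {0<..} y \<partial>lborel) = (\<integral>\<^sup>+ t. f (exp t) * ennreal (exp t) \<partial>lborel)"
proof -
  have u1: "(\<Union>n::nat. {exp (- real n)..exp (real n)}) = {0<..}"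
  proof safe
    fix y :: real assume y: "y > 0"
    obtain n :: nat where "real n > \<bar>ln y\<bar>" using reals_Archimedean2 by blast
    then have "exp (- real n) \<le> exp (ln y)" "exp (ln y) \<le> exp (real n)" by auto
    then have "y \<in> {exp (- real n)..exp (real n)}" using y by simp
    then show "y \<in> (\<Union>n::nat. {exp (- real n)..exp (real n)})" by blast
  qed (auto intro: less_le_trans[OF exp_gt_zero])
  have u2: "(\<Union>n::nat. {- real n..real n}) = UNIV"
  proof safe
    fix y :: real
    obtain n :: nat where "real n > \<bar>y\<bar>" using reals_Archimedean2 by blast
    then have "y \<in> {- real n..real n}" by auto
    then show "y \<in> (\<Union>n::nat. {- real n..real n})" by blast
  qed simp
  have i1: "incseq (\<lambda>n::nat. {exp (- real n)..exp (real n)})" and i2: "incseq (\<lambda>n::nat. {- real n..real n})"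
    by (auto simp: incseq_def atLeastatMost_subset_iff)
  have "(\<integral>\<^sup>+ y. f y * indicator {0<..} y \<partial>lborel) = emeasure (density lborel f) (\<Union>n::nat. {exp (- real n)..exp (real n)})"
    unfolding u1 by (simp add: emeasure_density)
  also have "\<dots> = (SUP n::nat. emeasure (density lborel f) {exp (- real n)..exp (real n)})"
    by (intro SUP_emeasure_incseq[symmetric] i1) auto
  also have "\<dots> = (SUP n::nat. emeasure (density lborel (\<lambda>t. f (exp t) * ennreal (exp t))) {- real n..real n})"
  proof (intro SUP_cong refl)
    fix n :: nat
    show "emeasure (density lborel f) {exp (- real n)..exp (real n)}
      = emeasure (density lborel (\<lambda>t. f (exp t) * ennreal (exp t))) {- real n..real n}"
    proof (cases "n = 0")
      \<comment> \<open>For \<open>n = 0\<close> the intervals degenerate to points, where the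
        substitution rule does not apply but both sides vanish.\<close>
      case True
      have "emeasure (density lborel g) {c} = 0" if [measurable]: "g \<in> borel_measurable borel" for g and c :: real
      proof -
        have "emeasure (density lborel g) {c} = (\<integral>\<^sup>+ y. g y * indicator {c} y \<partial>lborel)" by (simp add: emeasure_density)
        also have "\<dots> = (\<integral>\<^sup>+ y. 0 \<partial>(lborel :: real measure))"
          by (intro nn_integral_cong_AE) (use AE_lborel_singleton[of c] in \<open>auto simp: indicator_def\<close>)
        finally show ?thesis by simp
      qed
      then show ?thesis using True by simp
    next
      case False
      then show ?thesis
        by (simp add: emeasure_density)
           (subst nn_integral_substitution_aux[where g' = exp], auto intro!: derivative_eq_intros continuous_intros)
    qed
  qed
  also have "\<dots> = emeasure (density lborel (\<lambda>t. f (exp t) * ennreal (exp t))) (\<Union>n::nat. {- real n..real n})"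
    by (intro SUP_emeasure_incseq i2) auto
  also have "\<dots> = (\<integral>\<^sup>+ t. f (exp t) * ennreal (exp t) \<partial>lborel)"
    unfolding u2 by (simp add: emeasure_density)
  finally show ?thesis .
qed

text \<open>In the coordinates \<open>z = exp t * (s + i)\<close> the hyperbolic measure is \<open>ds dt\<close>, and translations,
  dilations and the inversion act by shears and reflections.\<close>

lemma nn_integral_hyp:
  assumes [measurable]: "F \<in> borel_measurable borel"
  shows "(\<integral>\<^sup>+ z. F z \<partial>hyp_measure) = (\<integral>\<^sup>+ t. \<integral>\<^sup>+ s. F (Complex (exp t * s) (exp t)) \<partial>lborel \<partial>lborel)"
proof -
  have "(\<integral>\<^sup>+ z. F z \<partial>hyp_measure) = (\<integral>\<^sup>+ z. ennreal (indicator uhp z / (Im z)\<^sup>2) * F z \<partial>lborel)"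
    unfolding hyp_measure_def by (rule nn_integral_density) simp_all
  also have "\<dots> = (\<integral>\<^sup>+ y. \<integral>\<^sup>+ x. ennreal (indicator uhp (Complex x y) / (Im (Complex x y))\<^sup>2) * F (Complex x y) \<partial>lborel \<partial>lborel)"
    by (rule nn_integral_complex) simp
  also have "\<dots> = (\<integral>\<^sup>+ y. (ennreal (1 / y) * (\<integral>\<^sup>+ s. F (Complex (y * s) y) \<partial>lborel)) * indicator {0<..} y \<partial>lborel)"
  proof (intro nn_integral_cong)
    fix y :: real
    show "(\<integral>\<^sup>+ x. ennreal (indicator uhp (Complex x y) / (Im (Complex x y))\<^sup>2) * F (Complex x y) \<partial>lborel)
      = (ennreal (1 / y) * (\<integral>\<^sup>+ s. F (Complex (y * s) y) \<partial>lborel)) * indicator {0<..} y"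
    proof (cases "y > 0")
      case True
      have "(\<integral>\<^sup>+ x. ennreal (indicator uhp (Complex x y) / (Im (Complex x y))\<^sup>2) * F (Complex x y) \<partial>lborel)
         = ennreal (1 / y\<^sup>2) * (\<integral>\<^sup>+ x. F (Complex x y) \<partial>lborel)"
        using True by (simp add: uhp_def nn_integral_cmult)
      also have "(\<integral>\<^sup>+ x. F (Complex x y) \<partial>lborel) = ennreal y * (\<integral>\<^sup>+ s. F (Complex (y * s) y) \<partial>lborel)"
        using True by (subst nn_integral_real_affine[where c = y and t = 0]) auto
      finally show ?thesis using True
        by (simp add: mult.assoc[symmetric] ennreal_mult[symmetric] power2_eq_square)
    qed (simp add: uhp_def)
  qed
  also have "\<dots> = (\<integral>\<^sup>+ t. ennreal (1 / exp t) * (\<integral>\<^sup>+ s. F (Complex (exp t * s) (exp t)) \<partial>lborel) * ennreal (exp t) \<partial>lborel)"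
    by (rule nn_integral_exp_substitution) measurable
  also have "\<dots> = (\<integral>\<^sup>+ t. \<integral>\<^sup>+ s. F (Complex (exp t * s) (exp t)) \<partial>lborel \<partial>lborel)"
    by (intro nn_integral_cong)
       (simp add: mult.commute mult.assoc[symmetric] ennreal_mult[symmetric])
  finally show ?thesis .
qed

lemma hyp_translation:
  assumes [measurable]: "F \<in> borel_measurable borel"
  shows "(\<integral>\<^sup>+ z. F (z + of_real b) \<partial>hyp_measure) = (\<integral>\<^sup>+ z. F z \<partial>hyp_measure)"
proof -
  have "(\<integral>\<^sup>+ s. F (Complex (exp t * s) (exp t) + of_real b) \<partial>lborel) = (\<integral>\<^sup>+ s. F (Complex (exp t * s) (exp t)) \<partial>lborel)" for t
  proof -
    have "(\<integral>\<^sup>+ s. F (Complex (exp t * s) (exp t)) \<partial>lborel) = (\<integral>\<^sup>+ s. F (Complex (exp t * (b / exp t + 1 * s)) (exp t)) \<partial>lborel)"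
      by (subst nn_integral_real_affine[where c = 1 and t = "b / exp t"]) auto
    also have "\<dots> = (\<integral>\<^sup>+ s. F (Complex (exp t * s) (exp t) + of_real b) \<partial>lborel)"
      by (intro nn_integral_cong arg_cong[where f = F]) (auto simp: complex_eq_iff field_simps)
    finally show ?thesis by simp
  qed
  then show ?thesis by (simp add: nn_integral_hyp)
qed

lemma hyp_dilation:
  assumes [measurable]: "F \<in> borel_measurable borel" and r: "r > 0"
  shows "(\<integral>\<^sup>+ z. F (of_real r * z) \<partial>hyp_measure) = (\<integral>\<^sup>+ z. F z \<partial>hyp_measure)"
proof -
  have "(\<integral>\<^sup>+ z. F z \<partial>hyp_measure) = (\<integral>\<^sup>+ t. \<integral>\<^sup>+ s. F (Complex (exp (ln r + 1 * t) * s) (exp (ln r + 1 * t))) \<partial>lborel \<partial>lborel)"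
    by (subst nn_integral_hyp, simp, subst nn_integral_real_affine[where c = 1 and t = "ln r"]) auto
  also have "\<dots> = (\<integral>\<^sup>+ z. F (of_real r * z) \<partial>hyp_measure)"
    using r by (subst nn_integral_hyp, simp)
      (intro nn_integral_cong arg_cong[where f = F], auto simp: complex_eq_iff exp_add)
  finally show ?thesis by simp
qed

text \<open>In the coordinates \<open>(s, t)\<close> the map is
  \<open>(s, t) \<mapsto> (- s, - t - ln (1 + s\<^sup>2))\<close>. For fixed \<open>s\<close> this
  is a reflection in \<open>t\<close>, so the order of integration is exchanged first.\<close>

lemma hyp_inversion:
  assumes [measurable]: "F \<in> borel_measurable borel"
  shows "(\<integral>\<^sup>+ z. F (- (1 / z)) \<partial>hyp_measure) = (\<integral>\<^sup>+ z. F z \<partial>hyp_measure)"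
proof -
  have eq: "- (1 / Complex (exp t * s) (exp t)) = Complex (exp (- ln (1 + s\<^sup>2) - t) * (- s)) (exp (- ln (1 + s\<^sup>2) - t))" for s t
  proof -
    have p: "1 + s\<^sup>2 > 0" by (simp add: add_pos_nonneg)
    define E where "E = exp (- ln (1 + s\<^sup>2) - t)"
    have E: "E * exp t * (1 + s\<^sup>2) = 1"
      using p by (simp add: E_def exp_diff exp_minus)
    have "E * (- s) * (exp t * s) - E * exp t = - (E * exp t * (1 + s\<^sup>2))"
      by (simp add: algebra_simps power2_eq_square)
    then have "Complex (exp (- ln (1 + s\<^sup>2) - t) * (- s)) (exp (- ln (1 + s\<^sup>2) - t)) * Complex (exp t * s) (exp t) = - 1"
      unfolding E E_def[symmetric] by (simp add: complex_eq_iff)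
    moreover have "Complex (exp t * s) (exp t) \<noteq> 0" by (simp add: complex_eq_iff)
    ultimately show ?thesis by (metis divide_minus_left nonzero_eq_divide_eq)
  qed
  have "(\<integral>\<^sup>+ z. F (- (1 / z)) \<partial>hyp_measure)
     = (\<integral>\<^sup>+ t. \<integral>\<^sup>+ s. F (Complex (exp (- ln (1 + s\<^sup>2) - t) * (- s)) (exp (- ln (1 + s\<^sup>2) - t))) \<partial>lborel \<partial>lborel)"
    by (simp add: nn_integral_hyp eq)
  also have "\<dots> = (\<integral>\<^sup>+ s. \<integral>\<^sup>+ t. F (Complex (exp (- ln (1 + s\<^sup>2) - t) * (- s)) (exp (- ln (1 + s\<^sup>2) - t))) \<partial>lborel \<partial>lborel)"
    by (rule lborel_pair.Fubini') (simp add: case_prod_unfold)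
  also have "\<dots> = (\<integral>\<^sup>+ s. \<integral>\<^sup>+ t. F (Complex (exp t * (- s)) (exp t)) \<partial>lborel \<partial>lborel)"
  proof (rule nn_integral_cong)
    fix s :: real
    show "(\<integral>\<^sup>+ t. F (Complex (exp (- ln (1 + s\<^sup>2) - t) * (- s)) (exp (- ln (1 + s\<^sup>2) - t))) \<partial>lborel)
       = (\<integral>\<^sup>+ t. F (Complex (exp t * (- s)) (exp t)) \<partial>lborel)"
      by (subst (2) nn_integral_real_affine[where c = "-1" and t = "- ln (1 + s\<^sup>2)"]) auto
  qed
  also have "\<dots> = (\<integral>\<^sup>+ s. \<integral>\<^sup>+ t. F (Complex (exp t * s) (exp t)) \<partial>lborel \<partial>lborel)"
    by (subst (2) nn_integral_real_affine[where c = "-1" and t = 0]) auto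
  also have "\<dots> = (\<integral>\<^sup>+ t. \<integral>\<^sup>+ s. F (Complex (exp t * s) (exp t)) \<partial>lborel \<partial>lborel)"
    by (rule lborel_pair.Fubini') (simp add: case_prod_unfold)
  also have "\<dots> = (\<integral>\<^sup>+ z. F z \<partial>hyp_measure)"
    by (simp add: nn_integral_hyp)
  finally show ?thesis .
qed

text \<open>Bruhat decomposition: for \<open>c = 0\<close> the map is affine; otherwise it is
  \<open>a / c - 1 / (c\<^sup>2 * (z + d / c))\<close>, composed of a translation, the inversion, a
  dilation and a translation.\<close>

lemma nn_integral_moebius:
  assumes [measurable]: "F \<in> borel_measurable borel" and A: "det A = 1"
  shows "(\<integral>\<^sup>+ z. F (moebius A z) \<partial>hyp_measure) = (\<integral>\<^sup>+ z. F z \<partial>hyp_measure)"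
proof (cases "A$2$1 = 0")
  case True
  define a where "a = A$1$1"
  have d: "a * A$2$2 = 1" using det2[OF A] True by (simp add: a_def)
  then have a: "a \<noteq> 0" "A$2$2 = 1 / a" by (auto simp: eq_divide_eq mult.commute)
  have "moebius A z = of_real (a\<^sup>2) * z + of_real (a * A$1$2)" for z
  proof -
    have "moebius A z = (of_real a * z + of_real (A$1$2)) / of_real (1 / a)"
      unfolding moebius_def True a(2) by (simp add: a_def)
    then show ?thesis using a(1) by (simp add: power2_eq_square field_simps)
  qed
  then have "(\<integral>\<^sup>+ z. F (moebius A z) \<partial>hyp_measure) = (\<integral>\<^sup>+ z. F (of_real (a\<^sup>2) * z + of_real (a * A$1$2)) \<partial>hyp_measure)"
    by simp
  also have "\<dots> = (\<integral>\<^sup>+ z. F (z + of_real (a * A$1$2)) \<partial>hyp_measure)"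
    using a by (intro hyp_dilation[where F = "\<lambda>z. F (z + of_real (a * A$1$2))"]) auto
  also have "\<dots> = (\<integral>\<^sup>+ z. F z \<partial>hyp_measure)" by (rule hyp_translation) simp
  finally show ?thesis .
next
  case False
  define c where "c = A$2$1"
  have c: "c \<noteq> 0" using False by (simp add: c_def)
  have eq: "moebius A z = of_real (1 / c\<^sup>2) * (- (1 / (z + of_real (A$2$2 / c)))) + of_real (A$1$1 / c)" if z: "z \<in> uhp" for z
  proof -
    have j: "aut_factor A z \<noteq> 0" using aut_factor_nz[OF A z] .
    have j': "z + of_real (A$2$2 / c) = aut_factor A z / of_real c"
      using c by (simp add: aut_factor_def c_def[symmetric] field_simps)
    have "of_real (1 / c\<^sup>2) * (- (1 / (z + of_real (A$2$2 / c)))) + of_real (A$1$1 / c)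
       = (of_real (A$1$1) * aut_factor A z - 1) / (of_real c * aut_factor A z)"
      unfolding j' using c j by (simp add: power2_eq_square field_simps)
    also have "of_real (A$1$1) * aut_factor A z - 1 = of_real c * (of_real (A$1$1) * z + of_real (A$1$2))"
      using det2_complex[OF A] by (simp add: aut_factor_def c_def algebra_simps)
    also have "of_real c * (of_real (A$1$1) * z + of_real (A$1$2)) / (of_real c * aut_factor A z) = moebius A z"
      using c by (simp add: moebius_eq)
    finally show ?thesis by simp
  qed
  have "(\<integral>\<^sup>+ z. F (moebius A z) \<partial>hyp_measure)
     = (\<integral>\<^sup>+ z. F (of_real (1 / c\<^sup>2) * (- (1 / (z + of_real (A$2$2 / c)))) + of_real (A$1$1 / c)) \<partial>hyp_measure)"
    by (intro nn_integral_cong_AE) (rule AE_hypI, simp add: eq)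
  also have "\<dots> = (\<integral>\<^sup>+ z. F (of_real (1 / c\<^sup>2) * (- (1 / z)) + of_real (A$1$1 / c)) \<partial>hyp_measure)"
    by (rule hyp_translation[where F = "\<lambda>z. F (of_real (1 / c\<^sup>2) * (- (1 / z)) + of_real (A$1$1 / c))"]) simp
  also have "\<dots> = (\<integral>\<^sup>+ z. F (of_real (1 / c\<^sup>2) * z + of_real (A$1$1 / c)) \<partial>hyp_measure)"
    by (rule hyp_inversion[where F = "\<lambda>z. F (of_real (1 / c\<^sup>2) * z + of_real (A$1$1 / c))"]) simp
  also have "\<dots> = (\<integral>\<^sup>+ z. F (z + of_real (A$1$1 / c)) \<partial>hyp_measure)"
    using c by (intro hyp_dilation[where F = "\<lambda>z. F (z + of_real (A$1$1 / c))"]) auto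
  also have "\<dots> = (\<integral>\<^sup>+ z. F z \<partial>hyp_measure)"
    by (rule hyp_translation) simp
  finally show ?thesis .
qed

section \<open>The unfolding inequality\<close>

context cusped_group begin

text \<open>One matrix out of each pair \<open>A\<close>, \<open>- A\<close>, selected by the sign
  of the lower row, so that sums run over transformations.\<close>

definition Gpos :: "(real^2^2) set" where
  "Gpos = {A\<in>G. A$2$1 > 0 \<or> A$2$1 = 0 \<and> A$2$2 > 0}"

lemma Gpos_cases: "A \<in> G \<Longrightarrow> A \<in> Gpos \<or> - A \<in> Gpos"
proof -
  assume A: "A \<in> G"
  have "A$2$1 = 0 \<Longrightarrow> A$2$2 \<noteq> 0" using det2[OF det_G[OF A]] by auto
  then show ?thesis using A uminus_G[OF A] by (auto simp: Gpos_def not_less le_less)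
qed

lemma Gpos_neg: "A \<in> Gpos \<Longrightarrow> - A \<notin> Gpos"
  by (auto simp: Gpos_def)

lemma Gpos_enum: obtains e :: "nat \<Rightarrow> real^2^2" where "bij_betw e UNIV Gpos"
proof -
  have "inj translation" by (auto simp: inj_def mat2_eq_iff)
  then have "infinite (range translation)" using finite_imageD infinite_UNIV_int by blast
  moreover have "range translation \<subseteq> Gpos" using translation_G by (auto simp: Gpos_def)
  ultimately have "infinite Gpos" using finite_subset by blast
  moreover have "countable Gpos" using countable_G by (rule countable_subset[rotated]) (auto simp: Gpos_def)
  ultimately show ?thesis using bij_betw_from_nat_into that by blast
qed

text \<open>Cut \<open>E1\<close> according to an element that moves the point into
  \<open>E2\<close> and transport each piece by invariance of measure and integrand; the transported
  pieces overlap only in null sets. Used from the cusp strip to the fundamental domain and back,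
  this bounds norms in both directions.\<close>

lemma unfolding_le:
  assumes F [measurable]: "F \<in> borel_measurable borel"
    and inv: "\<And>A z. A \<in> G \<Longrightarrow> z \<in> uhp \<Longrightarrow> F (moebius A z) = F z"
    and E [measurable]: "E1 \<in> sets borel" "E2 \<in> sets borel"
    and cov: "\<And>z. z \<in> E1 \<Longrightarrow> z \<in> uhp \<Longrightarrow> \<exists>A\<in>G. moebius A z \<in> E2"
    and pack: "\<And>A. A \<in> G \<Longrightarrow> A \<noteq> mat 1 \<Longrightarrow> A \<noteq> - mat 1 \<Longrightarrow> AE z in hyp_measure. \<not> (z \<in> E1 \<and> moebius A z \<in> E1)"
  shows "(\<integral>\<^sup>+ z. F z * indicator E1 z \<partial>hyp_measure) \<le> (\<integral>\<^sup>+ z. F z * indicator E2 z \<partial>hyp_measure)"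
proof -
  obtain e :: "nat \<Rightarrow> real^2^2" where e: "bij_betw e UNIV Gpos" using Gpos_enum .
  have eG: "e n \<in> G" for n using e by (auto simp: bij_betw_def Gpos_def)
  have "(\<integral>\<^sup>+ z. F z * indicator E1 z \<partial>hyp_measure)
     \<le> (\<integral>\<^sup>+ z. (suminf (\<lambda>n. F z * indicator E1 z * indicator E2 (moebius (adj2 (e n)) z))) \<partial>hyp_measure)"
  proof (intro nn_integral_mono_AE AE_hypI)
    fix z assume z: "z \<in> uhp"
    \<comment> \<open>Some element takes \<open>z\<close> into \<open>E2\<close>, so at least one
      summand already equals the left side.\<close>
    show "F z * indicator E1 z \<le> (suminf (\<lambda>n. F z * indicator E1 z * indicator E2 (moebius (adj2 (e n)) z)))"
    proof (cases "z \<in> E1")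
      case True
      obtain A where A: "A \<in> G" "moebius A z \<in> E2" using cov[OF True z] by blast
      have "adj2 A \<in> Gpos \<or> - adj2 A \<in> Gpos" using Gpos_cases A adj2_G by blast
      then obtain n where "e n = adj2 A \<or> e n = - adj2 A" using e unfolding bij_betw_def by (metis imageE)
      moreover have "adj2 (- adj2 A) = - A" by (simp add: mat2_eq_iff)
      ultimately have "moebius (adj2 (e n)) z = moebius A z" by auto
      then have "F z * indicator E1 z = F z * indicator E1 z * indicator E2 (moebius (adj2 (e n)) z)" using A by simp
      also have "\<dots> = sum (\<lambda>i. F z * indicator E1 z * indicator E2 (moebius (adj2 (e i)) z)) {n}"
        by (subst sum.insert) (simp_all only: sum.empty add_0_right finite.emptyI empty_iff simp_thms)
      also have "\<dots> \<le> (suminf (\<lambda>n. F z * indicator E1 z * indicator E2 (moebius (adj2 (e n)) z)))"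
        by (intro sum_le_suminf) auto
      finally show ?thesis .
    qed simp
  qed
  also have "\<dots> = (suminf (\<lambda>n. \<integral>\<^sup>+ z. F z * indicator E1 z * indicator E2 (moebius (adj2 (e n)) z) \<partial>hyp_measure))"
    by (intro nn_integral_suminf) simp
  also have "\<dots> = (suminf (\<lambda>n. \<integral>\<^sup>+ z. F z * indicator E2 z * indicator E1 (moebius (e n) z) \<partial>hyp_measure))"
  proof (intro suminf_cong)
    fix n
    have "(\<integral>\<^sup>+ z. F z * indicator E1 z * indicator E2 (moebius (adj2 (e n)) z) \<partial>hyp_measure)
       = (\<integral>\<^sup>+ z. F (moebius (e n) z) * indicator E1 (moebius (e n) z) * indicator E2 (moebius (adj2 (e n)) (moebius (e n) z)) \<partial>hyp_measure)"
      by (rule nn_integral_moebius[where F = "\<lambda>z. F z * indicator E1 z * indicator E2 (moebius (adj2 (e n)) z)", symmetric])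
         (auto simp: det_G eG)
    also have "\<dots> = (\<integral>\<^sup>+ z. F z * indicator E2 z * indicator E1 (moebius (e n) z) \<partial>hyp_measure)"
      by (intro nn_integral_cong_AE AE_hypI)
         (simp add: inv eG moebius_G_adj2 mult_ac)
    finally show "(\<integral>\<^sup>+ z. F z * indicator E1 z * indicator E2 (moebius (adj2 (e n)) z) \<partial>hyp_measure)
       = (\<integral>\<^sup>+ z. F z * indicator E2 z * indicator E1 (moebius (e n) z) \<partial>hyp_measure)" .
  qed
  also have "\<dots> = (\<integral>\<^sup>+ z. (suminf (\<lambda>n. F z * indicator E2 z * indicator E1 (moebius (e n) z))) \<partial>hyp_measure)"
    by (intro nn_integral_suminf[symmetric]) simp
  also have "\<dots> \<le> (\<integral>\<^sup>+ z. F z * indicator E2 z \<partial>hyp_measure)"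
  proof (intro nn_integral_mono_AE)
    \<comment> \<open>Two different members of \<open>Gpos\<close> differ by an element other than
      \<open>mat 1\<close> and \<open>- mat 1\<close>, so almost every point is moved into
      \<open>E1\<close> by at most one of them.\<close>
    have nul: "AE z in hyp_measure. \<not> (moebius (e m) z \<in> E1 \<and> moebius (e n) z \<in> E1)" if mn: "m \<noteq> n" for m n
    proof -
      define B where "B = e n ** adj2 (e m)"
      have B: "B \<in> G" using eG by (simp add: B_def mult_G adj2_G)
      have Be: "B ** e m = e n" using det_G[OF eG[of m]] by (simp add: B_def matrix_mul_assoc[symmetric] adj2_mult)
      have "B \<noteq> mat 1" using Be mn e by (auto simp: bij_betw_def inj_def)
      moreover have "B \<noteq> - mat 1"
      proof
        assume "B = - mat 1"
        then have "e n = - e m" using Be by (simp add: uminus_matrix_mult)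
        then show False using e Gpos_neg by (metis bij_betw_apply UNIV_I)
      qed
      ultimately have "AE z in hyp_measure. \<not> (z \<in> E1 \<and> moebius B z \<in> E1)" using pack B by blast
      then have "(\<integral>\<^sup>+ z. indicator E1 z * indicator E1 (moebius B z) \<partial>hyp_measure) = 0"
        by (subst nn_integral_0_iff_AE) (auto elim!: AE_mp simp: indicator_def)
      then have "(\<integral>\<^sup>+ z. indicator E1 (moebius (e m) z) * indicator E1 (moebius B (moebius (e m) z)) \<partial>hyp_measure) = 0"
        by (subst nn_integral_moebius[where F = "\<lambda>z. indicator E1 z * indicator E1 (moebius B z)"]) (auto simp: det_G eG)
      then have "AE z in hyp_measure. indicator E1 (moebius (e m) z) * indicator E1 (moebius B (moebius (e m) z)) = (0::ennreal)"
        by (subst (asm) nn_integral_0_iff_AE) auto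
      then show ?thesis
        by (rule AE_mp, intro AE_hypI)
           (auto simp: indicator_def moebius_mult[symmetric] det_G B eG Be split: if_splits)
    qed
    then have "AE z in hyp_measure. \<forall>m n. m \<noteq> n \<longrightarrow> \<not> (moebius (e m) z \<in> E1 \<and> moebius (e n) z \<in> E1)"
      by (simp add: AE_all_countable)
    then show "AE z in hyp_measure. (suminf (\<lambda>n. F z * indicator E2 z * indicator E1 (moebius (e n) z))) \<le> F z * indicator E2 z"
    proof (rule AE_mp, intro AE_I2 impI)
      fix z assume u: "\<forall>m n. m \<noteq> n \<longrightarrow> \<not> (moebius (e m) z \<in> E1 \<and> moebius (e n) z \<in> E1)"
      show "(suminf (\<lambda>n. F z * indicator E2 z * indicator E1 (moebius (e n) z))) \<le> F z * indicator E2 z"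
      proof (cases "\<exists>m. moebius (e m) z \<in> E1")
        case True
        then obtain m where m: "moebius (e m) z \<in> E1" by blast
        have "(suminf (\<lambda>n. F z * indicator E2 z * indicator E1 (moebius (e n) z))) = (\<Sum>n\<in>{m}. F z * indicator E2 z * indicator E1 (moebius (e n) z))"
          using u m by (intro suminf_finite) (auto simp: indicator_def)
        also have "\<dots> = F z * indicator E2 z * indicator E1 (moebius (e m) z)"
          by (subst sum.insert) (simp_all only: sum.empty add_0_right finite.emptyI empty_iff simp_thms)
        finally show ?thesis using m by simp
      qed simp
    qed
  qed
  finally show ?thesis .
qed

end

section \<open>From the compactified quotient to groups of matrices\<close>

lemma moebius_vimage_open:
  assumes "det A = 1" "open W"
  shows "open {z\<in>uhp. moebius A z \<in> W}"
proof -
  have "continuous_on uhp (moebius A)"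
    using moebius_holomorphic[OF assms(1)] by (rule holomorphic_on_imp_continuous_on)
  then have "open (moebius A -` W \<inter> uhp)"
    using assms(2) by (simp add: continuous_on_open_vimage)
  moreover have "moebius A -` W \<inter> uhp = {z\<in>uhp. moebius A z \<in> W}" by auto
  ultimately show ?thesis by simp
qed

text \<open>Every coset is \<open>{A, - A}\<close>, so laws for cosets become laws for matrices up
  to sign, and the preimage is closed under sign. For inverses, any \<open>B\<close> in the inverse
  coset satisfies \<open>A ** B = mat 1\<close> up to sign, hence is \<open>adj2 A\<close> up to
  sign.\<close>

lemma PSL2R_subgroup_Union:
  assumes "subgroup \<Gamma> PSL2R"
  shows "A \<in> \<Union>\<Gamma> \<Longrightarrow> det A = 1" and "mat 1 \<in> \<Union>\<Gamma>"
    and "\<gamma> \<in> \<Gamma> \<Longrightarrow> A \<in> \<gamma> \<Longrightarrow> \<gamma> = {A, - A}"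
    and "A \<in> \<Union>\<Gamma> \<Longrightarrow> - A \<in> \<Union>\<Gamma>"
    and "A \<in> \<Union>\<Gamma> \<Longrightarrow> B \<in> \<Union>\<Gamma> \<Longrightarrow> A ** B \<in> \<Union>\<Gamma>"
    and "A \<in> \<Union>\<Gamma> \<Longrightarrow> adj2 A \<in> \<Union>\<Gamma>"
proof -
  interpret PG: group PSL2R by (rule group_PSL2R)
  interpret S: subgroup \<Gamma> PSL2R by (rule assms)
  have car: "\<exists>A. det A = 1 \<and> \<gamma> = {A, - A}" if "\<gamma> \<in> \<Gamma>" for \<gamma>
    using S.subset that unfolding carrier_PSL2R by blast
  have dneg: "det (- A) = det A" for A :: "real^2^2" by (simp add: det_2)
  show det: "A \<in> \<Union>\<Gamma> \<Longrightarrow> det A = 1" for A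
    using car dneg by fastforce
  show pm: "\<gamma> \<in> \<Gamma> \<Longrightarrow> A \<in> \<gamma> \<Longrightarrow> \<gamma> = {A, - A}" for A \<gamma>
    using car[of \<gamma>] by auto
  show neg: "A \<in> \<Union>\<Gamma> \<Longrightarrow> - A \<in> \<Union>\<Gamma>" for A
  proof -
    assume "A \<in> \<Union>\<Gamma>"
    then obtain \<gamma> where \<gamma>: "\<gamma> \<in> \<Gamma>" "A \<in> \<gamma>" by blast
    have "- A \<in> \<gamma>" unfolding pm[OF \<gamma>] by simp
    then show "- A \<in> \<Union>\<Gamma>" using \<gamma>(1) by (rule UnionI[rotated])
  qed
  have one_eq: "\<one>\<^bsub>PSL2R\<^esub> = {mat 1, - mat 1}"
    by (simp add: PSL2R_def FactGroup_def)
  show "mat 1 \<in> \<Union>\<Gamma>" using S.one_closed unfolding one_eq by blast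
  have mult_mem: "A ** B \<in> \<gamma> \<otimes>\<^bsub>PSL2R\<^esub> \<delta>" if "A \<in> \<gamma>" "B \<in> \<delta>" for A B \<gamma> \<delta>
    using that by (auto simp: PSL2R_def FactGroup_def set_mult_def SL2R_def)
  show "A \<in> \<Union>\<Gamma> \<Longrightarrow> B \<in> \<Union>\<Gamma> \<Longrightarrow> A ** B \<in> \<Union>\<Gamma>" for A B
  proof -
    assume "A \<in> \<Union>\<Gamma>" "B \<in> \<Union>\<Gamma>"
    then obtain \<gamma> \<delta> where g: "\<gamma> \<in> \<Gamma>" "A \<in> \<gamma>" "\<delta> \<in> \<Gamma>" "B \<in> \<delta>" by blast
    show "A ** B \<in> \<Union>\<Gamma>" by (rule UnionI[OF S.m_closed[OF g(1,3)] mult_mem[OF g(2,4)]])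
  qed
  show "A \<in> \<Union>\<Gamma> \<Longrightarrow> adj2 A \<in> \<Union>\<Gamma>" for A
  proof -
    assume A: "A \<in> \<Union>\<Gamma>"
    then obtain \<gamma> where \<gamma>: "\<gamma> \<in> \<Gamma>" "A \<in> \<gamma>" by blast
    have i: "inv\<^bsub>PSL2R\<^esub> \<gamma> \<in> \<Gamma>" by (rule S.m_inv_closed[OF \<gamma>(1)])
    from car[OF i] obtain B where B: "B \<in> inv\<^bsub>PSL2R\<^esub> \<gamma>" by auto
    have "A ** B \<in> \<gamma> \<otimes>\<^bsub>PSL2R\<^esub> inv\<^bsub>PSL2R\<^esub> \<gamma>" by (rule mult_mem[OF \<gamma>(2) B])
    also have "\<dots> = {mat 1, - mat 1}" using PG.r_inv[of \<gamma>] S.subset \<gamma>(1) one_eq by auto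
    finally have AB: "A ** B = mat 1 \<or> A ** B = - mat 1" by blast
    have "adj2 A ** (A ** B) = B" using det[OF A] by (simp add: matrix_mul_assoc adj2_mult)
    then have "B = adj2 A \<or> B = - adj2 A" using AB by (auto simp: uminus_matrix_mult)
    moreover have "B \<in> \<Union>\<Gamma>" by (rule UnionI[OF i B])
    moreover from this have "- B \<in> \<Union>\<Gamma>" by (rule neg)
    ultimately show "adj2 A \<in> \<Union>\<Gamma>" by auto
  qed
qed

lemma self_in_orbit: "mat 1 \<in> \<Union>\<Gamma> \<Longrightarrow> z \<in> orbit \<Gamma> z"
  unfolding orbit_def by (metis image_eqI moebius_one)

lemma orbit_moebius:
  assumes \<Gamma>: "subgroup \<Gamma> PSL2R" and A: "A \<in> \<Union>\<Gamma>" and z: "z \<in> uhp"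
  shows "orbit \<Gamma> (moebius A z) = orbit \<Gamma> z"
proof -
  note S = PSL2R_subgroup_Union[OF \<Gamma>]
  have sub: "orbit \<Gamma> (moebius B w) \<subseteq> orbit \<Gamma> w" if "B \<in> \<Union>\<Gamma>" "w \<in> uhp" for B w
  proof
    fix x assume "x \<in> orbit \<Gamma> (moebius B w)"
    then obtain C where C: "C \<in> \<Union>\<Gamma>" "x = moebius C (moebius B w)" unfolding orbit_def by blast
    then have "x = moebius (C ** B) w" using S(1) that by (simp add: moebius_mult)
    then show "x \<in> orbit \<Gamma> w" using S(5)[OF C(1) that(1)] unfolding orbit_def by blast
  qed
  have "moebius (adj2 A) (moebius A z) = z" using moebius_adj2(1)[OF S(1)[OF A] z] .
  moreover have "moebius A z \<in> uhp" using moebius_in_uhp[OF S(1)[OF A] z] .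
  ultimately show ?thesis
    using sub[OF A z] sub[OF S(6)[OF A], of "moebius A z"] by auto
qed

text \<open>Cover \<open>Xbar\<close> by the images of bounded pieces of the half-plane away from
  the real axis and by one neighbourhood of the cusp. The pieces in a finite subcover all lie in one
  compact set.\<close>

lemma Xbar_compact_cover:
  assumes \<Gamma>: "subgroup \<Gamma> PSL2R" and comp: "compact_space (Xbar \<Gamma>)"
  shows "\<exists>K. compact K \<and> K \<subseteq> uhp \<and> (\<forall>z\<in>uhp. \<exists>A\<in>\<Union>\<Gamma>. moebius A z \<in> K \<or> Im (moebius A z) > Y)"
proof -
  note S = PSL2R_subgroup_Union[OF \<Gamma>]
  define W where "W = (\<lambda>n::nat. {z. Im z > 1 / (real n + 1)} \<inter> ball 0 (real n + 1))"
  define V where "V = (\<lambda>n. Some ` orbit \<Gamma> ` W n)"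
  \<comment> \<open>The maximum keeps the level positive also for \<open>Y \<le> 0\<close>, as
    \<open>Xbar_open\<close> demands.\<close>
  define W0 where "W0 = {z. Im z > max Y 1}"
  define U0 where "U0 = insert None (Some ` orbit \<Gamma> ` W0)"
  have oW: "open (W n)" for n unfolding W_def by (intro open_Int open_halfspace_Im_gt open_ball)
  have Wu: "W n \<subseteq> uhp" for n unfolding W_def uhp_def
    by (auto intro: less_trans[rotated])
  have oW0: "open W0" unfolding W0_def by (rule open_halfspace_Im_gt)
  have W0u: "W0 \<subseteq> uhp" by (auto simp: W0_def uhp_def)
  \<comment> \<open>The saturation of \<open>X\<close> is a union of preimages of \<open>X\<close>
    under group elements, so open sets have open images in the quotient.\<close>
  have pre: "{z\<in>uhp. orbit \<Gamma> z \<in> orbit \<Gamma> ` X} = (\<Union>A\<in>\<Union>\<Gamma>. {z\<in>uhp. moebius A z \<in> X})" if X: "X \<subseteq> uhp" for X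
  proof (rule subset_antisym; rule subsetI)
    fix z assume "z \<in> {z\<in>uhp. orbit \<Gamma> z \<in> orbit \<Gamma> ` X}"
    then obtain w where w: "z \<in> uhp" "w \<in> X" "orbit \<Gamma> z = orbit \<Gamma> w" by blast
    then have "w \<in> orbit \<Gamma> z" using self_in_orbit[OF S(2)] by simp
    then show "z \<in> (\<Union>A\<in>\<Union>\<Gamma>. {z\<in>uhp. moebius A z \<in> X})" using w unfolding orbit_def by blast
  next
    fix z assume "z \<in> (\<Union>A\<in>\<Union>\<Gamma>. {z\<in>uhp. moebius A z \<in> X})"
    then show "z \<in> {z\<in>uhp. orbit \<Gamma> z \<in> orbit \<Gamma> ` X}"
      using orbit_moebius[OF \<Gamma>] by (auto intro!: rev_image_eqI)
  qed
  have op: "open {z\<in>uhp. orbit \<Gamma> z \<in> orbit \<Gamma> ` X}" if "X \<subseteq> uhp" "open X" for X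
    unfolding pre[OF that(1)] using moebius_vimage_open[OF S(1) that(2)] by blast
  have eqV: "{z\<in>uhp. Some (orbit \<Gamma> z) \<in> V n} = {z\<in>uhp. orbit \<Gamma> z \<in> orbit \<Gamma> ` W n}" for n
    by (auto simp: V_def)
  have eq0: "{z\<in>uhp. Some (orbit \<Gamma> z) \<in> U0} = {z\<in>uhp. orbit \<Gamma> z \<in> orbit \<Gamma> ` W0}"
    by (auto simp: U0_def)
  have o1: "openin (Xbar \<Gamma>) (V n)" for n
  proof -
    have "V n \<subseteq> insert None (Some ` orbit \<Gamma> ` uhp)"
      unfolding V_def by (intro subset_insertI2 image_mono Wu)
    moreover have "None \<notin> V n" by (auto simp: V_def)
    ultimately show ?thesis
      unfolding openin_Xbar Xbar_open_def eqV using op[OF Wu oW] by blast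
  qed
  have o2: "openin (Xbar \<Gamma>) U0"
  proof -
    have "U0 \<subseteq> insert None (Some ` orbit \<Gamma> ` uhp)"
      unfolding U0_def by (intro insert_mono image_mono W0u)
    moreover have "\<exists>c>0. \<forall>z. Im z > c \<longrightarrow> Some (orbit \<Gamma> z) \<in> U0"
      by (rule exI[of _ "max Y 1"]) (auto simp: U0_def W0_def)
    ultimately show ?thesis
      unfolding openin_Xbar Xbar_open_def eq0 using op[OF W0u oW0] by blast
  qed
  have cov: "topspace (Xbar \<Gamma>) \<subseteq> \<Union>(insert U0 (range V))"
  proof
    fix p assume p: "p \<in> topspace (Xbar \<Gamma>)"
    show "p \<in> \<Union>(insert U0 (range V))"
    proof (cases p)
      case None then show ?thesis by (simp add: U0_def)
    next
      case (Some P)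
      then obtain z where z: "z \<in> uhp" "P = orbit \<Gamma> z" using p by (auto simp: topspace_Xbar)
      obtain n :: nat where n: "real n > max (cmod z) (1 / Im z)" using reals_Archimedean2 by blast
      have "1 / (real n + 1) < Im z" using n z by (auto simp: uhp_def field_simps)
      then have "z \<in> W n" using n by (simp add: W_def)
      then have "p \<in> V n" using Some z(2) by (simp add: V_def)
      then show ?thesis by blast
    qed
  qed
  have "\<And>U. Ball U (openin (Xbar \<Gamma>)) \<Longrightarrow> topspace (Xbar \<Gamma>) \<subseteq> \<Union>U \<Longrightarrow> \<exists>F. finite F \<and> F \<subseteq> U \<and> topspace (Xbar \<Gamma>) \<subseteq> \<Union>F"
    using comp unfolding compact_space_def compactin_def by simp
  from this[OF _ cov] obtain F where F: "finite F" "F \<subseteq> insert U0 (range V)" "topspace (Xbar \<Gamma>) \<subseteq> \<Union>F"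
    using o1 o2 by auto
  have "F - {U0} \<subseteq> range V" using F by blast
  then obtain I where I': "finite I" "F - {U0} = V ` I"
    using finite_subset_image[of "F - {U0}" V UNIV] F(1) by auto
  then have I: "finite I" "F \<subseteq> insert U0 (V ` I)" by auto
  \<comment> \<open>Zero is inserted to cover the case of empty \<open>I\<close>.\<close>
  define N where "N = Max (insert 0 I)"
  define K where "K = {z. Im z \<ge> 1 / (real N + 1)} \<inter> cball 0 (real N + 1)"
  have WK: "W n \<subseteq> K" if "n \<in> I" for n
  proof -
    have "n \<le> N" using that I by (auto simp: N_def)
    then have "1 / (real N + 1) \<le> 1 / (real n + 1)" "real n + 1 \<le> real N + 1" by (auto simp: frac_le)
    then show ?thesis by (auto simp: W_def K_def)
  qed
  have "compact K" unfolding K_def by (intro closed_Int_compact closed_halfspace_Im_ge compact_cball)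
  moreover have "K \<subseteq> uhp"
  proof
    fix z assume "z \<in> K"
    then have "Im z \<ge> 1 / (real N + 1)" by (simp add: K_def)
    moreover have "1 / (real N + 1) > 0" by simp
    ultimately show "z \<in> uhp" unfolding uhp_def mem_Collect_eq by linarith
  qed
  moreover have "\<exists>A\<in>\<Union>\<Gamma>. moebius A z \<in> K \<or> Im (moebius A z) > Y" if z: "z \<in> uhp" for z
  proof -
    have "Some (orbit \<Gamma> z) \<in> topspace (Xbar \<Gamma>)" using z by (simp add: topspace_Xbar)
    then have "Some (orbit \<Gamma> z) \<in> \<Union>(insert U0 (V ` I))" using F(3) I(2) by (meson Union_mono subsetD)
    then have "\<exists>w. orbit \<Gamma> z = orbit \<Gamma> w \<and> (w \<in> W0 \<or> (\<exists>n\<in>I. w \<in> W n))"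
      by (auto simp: U0_def V_def)
    then have "\<exists>w. orbit \<Gamma> z = orbit \<Gamma> w \<and> (w \<in> W0 \<or> w \<in> K)"
      using WK by (metis subsetD)
    then obtain w where w: "orbit \<Gamma> z = orbit \<Gamma> w" "w \<in> W0 \<or> w \<in> K" by blast
    then have "w \<in> orbit \<Gamma> z" using self_in_orbit[OF S(2)] by simp
    then show ?thesis using w(2) unfolding orbit_def W0_def by auto
  qed
  ultimately show ?thesis by blast
qed

lemma cusped_group_Union:
  assumes "fuchsian \<Gamma>" "acts_freely \<Gamma>" "only_puncture_infinity \<Gamma>"
  shows "cusped_group (\<Union>\<Gamma>)"
proof -
  have \<Gamma>: "subgroup \<Gamma> PSL2R" and disc: "discrete (\<Union>\<Gamma>)" using assms by (auto simp: fuchsian_def)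
  note S = PSL2R_subgroup_Union[OF \<Gamma>]
  have st: "stabilizer_at_infinity \<Gamma> = integer_translations" and comp: "compact_space (Xbar \<Gamma>)"
    using assms by (auto simp: only_puncture_infinity_def)
  show ?thesis
  proof
    fix A assume A: "A \<in> \<Union>\<Gamma>" and c: "A$2$1 = 0"
    then obtain \<gamma> where \<gamma>: "\<gamma> \<in> \<Gamma>" "A \<in> \<gamma>" by blast
    then have "\<gamma> = {A, - A}" by (rule S(3))
    then have "\<gamma> \<in> integer_translations" using c \<gamma> unfolding st[symmetric] stabilizer_at_infinity_def by auto
    then show "\<exists>n. A = translation n \<or> A = - translation n" using \<gamma>(2) unfolding integer_translations_def by blast
  next
    fix n
    have "{translation n, - translation n} \<in> \<Gamma>" using st unfolding stabilizer_at_infinity_def integer_translations_def by blast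
    then show "translation n \<in> \<Union>\<Gamma>" by blast
  next
    fix A z assume "A \<in> \<Union>\<Gamma>" "z \<in> uhp" "moebius A z = z"
    then show "A = mat 1 \<or> A = - mat 1" using assms(2) unfolding acts_freely_def by blast
  qed (fact S disc Xbar_compact_cover[OF \<Gamma> comp])+
qed

subsection \<open>Poincare series\<close>

text \<open>The slash operator of weight \<open>2 * k\<close>. The value 0 off the half-plane makes
  equality of functions the same as equality on the half-plane, which matters because the terms of a
  series are collected in a set of functions.\<close>

definition slash :: "nat \<Rightarrow> real^2^2 \<Rightarrow> (complex \<Rightarrow> complex) \<Rightarrow> complex \<Rightarrow> complex" where
  "slash k A h z = (if z \<in> uhp then h (moebius A z) / aut_factor A z ^ (2 * k) else 0)"

lemma slash_slash:
  assumes "det A = 1" "det B = 1"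
  shows "slash k B (slash k A h) = slash k (A ** B) h"
  using assms moebius_in_uhp
  by (auto simp: slash_def fun_eq_iff moebius_mult aut_factor_mult power_mult_distrib)

lemma slash_uminus [simp]: "slash k (- A) h = slash k A h"
  by (auto simp: slash_def fun_eq_iff)

lemma slash_holomorphic:
  assumes "det A = 1" "h holomorphic_on uhp"
  shows "slash k A h holomorphic_on uhp"
proof -
  have "(h \<circ> moebius A) holomorphic_on uhp"
    using moebius_holomorphic[OF assms(1)] assms moebius_in_uhp
    by (intro holomorphic_on_compose_gen[where t = uhp]) auto
  then have "(\<lambda>z. h (moebius A z) / aut_factor A z ^ (2 * k)) holomorphic_on uhp"
    using assms by (intro holomorphic_intros) (auto simp: o_def aut_factor_nz)
  then show ?thesis by (rule holomorphic_transform) (simp add: slash_def)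
qed

lemma norm_slash:
  assumes "det A = 1" "z \<in> uhp"
  shows "cmod (slash k A h z) * Im z ^ k = cmod (h (moebius A z)) * Im (moebius A z) ^ k"
  using assms aut_factor_nz[OF assms]
  by (simp add: slash_def Im_moebius norm_divide norm_power power_divide power_mult[symmetric] field_simps)

lemma periodic_int:
  assumes per: "\<And>z. z \<in> uhp \<Longrightarrow> f (z + 1) = f z" and z: "z \<in> uhp"
  shows "f (z + of_int n) = f z"
proof -
  have nat: "f (z + of_nat n) = f z" if "z \<in> uhp" for z n
  proof (induction n)
    case (Suc n)
    have "f (z + of_nat (Suc n)) = f ((z + of_nat n) + 1)" by (simp add: algebra_simps)
    also have "\<dots> = f (z + of_nat n)" using that by (intro per) (simp add: uhp_def)
    finally show ?case using Suc by simp
  qed simp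
  show ?thesis
  proof (cases "n \<ge> 0")
    case True then show ?thesis using nat[OF z, of "nat n"] by simp
  next
    case False
    have "z + of_int n \<in> uhp" using z by (simp add: uhp_def)
    from nat[OF this, of "nat (- n)"] show ?thesis using False by simp
  qed
qed

text \<open>The candidate is \<open>f (Ln q / c)\<close>. Periodicity makes it independent of the
  branch of the logarithm, and decay at the cusp removes the singularity at 0 with value 0.\<close>

lemma periodic_q_expansion:
  assumes hol: "f holomorphic_on uhp" and per: "\<And>z. z \<in> uhp \<Longrightarrow> f (z + 1) = f z"
    and lim: "\<And>e. e > 0 \<Longrightarrow> \<exists>Y. \<forall>z\<in>uhp. Im z > Y \<longrightarrow> cmod (f z) < e"
  shows "\<exists>F. F holomorphic_on ball 0 1 \<and> F 0 = 0 \<and> (\<forall>z\<in>uhp. f z = F (exp (2 * pi * \<i> * z)))"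
proof -
  define c where "c = 2 * pi * \<i>"
  have c0: "c \<noteq> 0" by (simp add: c_def)
  define F where "F = (\<lambda>q. if q = 0 then 0 else f (Ln q / c))"
  have Fexp: "F (exp (c * z)) = f z" if z: "z \<in> uhp" for z
  proof -
    have "exp (Ln (exp (c * z))) = exp (c * z)" by simp
    then obtain n :: int where n: "Ln (exp (c * z)) = c * z + of_int (2 * n) * pi * \<i>"
      unfolding exp_eq by blast
    have "Ln (exp (c * z)) / c = z + of_int n"
      using c0 unfolding n by (simp add: c_def field_simps)
    then show ?thesis using periodic_int[where f = f, OF per z, of n] by (simp add: F_def)
  qed
  have Im_div: "Im (w / c) = - Re w / (2 * pi)" for w
    by (simp add: c_def Im_divide power2_eq_square)
  have diff: "F field_differentiable at q0" if q0: "q0 \<noteq> 0" "cmod q0 < 1" for q0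
  proof -
    \<comment> \<open>A neighbourhood of \<open>q0\<close> on which
      \<open>Ln (q / q0) + Ln q0\<close> is a holomorphic logarithm, also when \<open>q0\<close>
      lies on the cut of \<open>Ln\<close>.\<close>
    define N where "N = (ball 0 1 - {0}) \<inter> {q. Re (q / q0) > 0}"
    have oN: "open N" unfolding N_def
      by (intro open_Int open_Diff open_Collect_less continuous_intros) (use q0 in auto)
    have q0N: "q0 \<in> N" using q0 by (simp add: N_def)
    define L where "L = (\<lambda>q. (Ln (q / q0) + Ln q0) / c)"
    have eL: "exp (c * L q) = q" if "q \<in> N" for q
      using that q0 c0 by (simp add: L_def exp_add N_def)
    have Lu: "L q \<in> uhp" if "q \<in> N" for q
    proof -
      have "Im (L q) = - (ln (cmod (q / q0)) + ln (cmod q0)) / (2 * pi)"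
        using that q0 by (simp add: L_def Im_div N_def)
      also have "ln (cmod (q / q0)) + ln (cmod q0) = ln (cmod q)"
        using that q0 by (simp add: N_def norm_divide ln_div)
      finally show ?thesis using that by (simp add: uhp_def N_def divide_less_0_iff)
    qed
    have "L holomorphic_on N"
      unfolding L_def using c0 q0
      by (intro holomorphic_intros) (auto simp: N_def complex_nonpos_Reals_iff)
    then have "(f \<circ> L) holomorphic_on N"
      using hol Lu by (intro holomorphic_on_compose_gen[where t = uhp]) auto
    then have "F holomorphic_on N"
    proof (rule holomorphic_transform)
      fix q assume q: "q \<in> N"
      show "(f \<circ> L) q = F q" using Fexp[OF Lu[OF q]] eL[OF q] by simp
    qed
    then show ?thesis using oN q0N holomorphic_on_imp_differentiable_at by blast
  qed
  have hol1: "F holomorphic_on ball 0 1 - {0}"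
    unfolding holomorphic_on_def using diff by (auto intro: field_differentiable_at_within)
  have cont0: "isCont F 0"
    unfolding continuous_at_eps_delta
  proof (intro allI impI)
    fix e :: real assume "e > 0"
    then obtain Y where Y: "\<And>z. z \<in> uhp \<Longrightarrow> Im z > Y \<Longrightarrow> cmod (f z) < e" using lim by blast
    \<comment> \<open>A modulus of \<open>q\<close> below this value means exactly a height above
      \<open>max Y 1\<close>.\<close>
    define d where "d = exp (- (2 * pi * max Y 1))"
    have "dist (F q) (F 0) < e" if "dist q 0 < d" for q
    proof (cases "q = 0")
      case False
      have "ln (cmod q) < ln d" using that False by (subst ln_less_cancel_iff) (auto simp: d_def)
      then have "ln (cmod q) < - (2 * pi * max Y 1)" by (simp add: d_def)
      then have "max Y 1 * (2 * pi) < - ln (cmod q)" by (simp only: mult.commute[of "max Y 1"])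
      then have "max Y 1 < - ln (cmod q) / (2 * pi)" by (subst pos_less_divide_eq) auto
      then have "max Y 1 < Im (Ln q / c)" by (simp only: Im_div Re_Ln[OF False])
      then have "cmod (f (Ln q / c)) < e" by (intro Y) (auto simp: uhp_def)
      then show ?thesis using False by (simp add: F_def)
    qed (use \<open>e > 0\<close> in simp)
    moreover have "d > 0" by (simp add: d_def)
    ultimately show "\<exists>d>0. \<forall>q. dist q 0 < d \<longrightarrow> dist (F q) (F 0) < e" by blast
  qed
  have "continuous_on (ball 0 1) F"
    unfolding continuous_on_eq_continuous_at[OF open_ball]
  proof
    fix q :: complex assume "q \<in> ball 0 1"
    then show "isCont F q"
      using cont0 field_differentiable_imp_continuous_at[OF diff] by (cases "q = 0") auto
  qed
  then have "F holomorphic_on ball 0 1"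
    by (rule no_isolated_singularity) (use hol1 in auto)
  moreover have "F 0 = 0" by (simp add: F_def)
  moreover have "f z = F (exp (2 * pi * \<i> * z))" if "z \<in> uhp" for z
    by (rule Fexp[OF that, unfolded c_def, symmetric])
  ultimately show ?thesis by (intro exI[of _ F]) simp
qed

context cusped_group begin

text \<open>A set of functions rather than of matrices: elements that differ by a sign or, for
  powers of \<open>q\<close>, by a translation give the same term and count once, without a choice
  of coset representatives. The group permutes the set, so accidental coincidences do no
  harm.\<close>

definition pfam :: "nat \<Rightarrow> (complex \<Rightarrow> complex) \<Rightarrow> (complex \<Rightarrow> complex) set" where
  "pfam k h = (\<lambda>A. slash k A h) ` G"

definition poincare :: "nat \<Rightarrow> (complex \<Rightarrow> complex) \<Rightarrow> complex \<Rightarrow> complex" where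
  "poincare k h z = (\<Sum>\<^sub>\<infinity>\<phi>\<in>pfam k h. \<phi> z)"

text \<open>Weierstrass majorants on compact sets; they yield absolute summability and, for
  holomorphic \<open>h\<close>, holomorphy of the sum.\<close>

definition dominated :: "nat \<Rightarrow> (complex \<Rightarrow> complex) \<Rightarrow> bool" where
  "dominated k h \<longleftrightarrow> (\<forall>C. compact C \<longrightarrow> C \<subseteq> uhp \<longrightarrow>
     (\<exists>M::(complex \<Rightarrow> complex) \<Rightarrow> real. M summable_on pfam k h \<and> (\<forall>\<phi>\<in>pfam k h. \<forall>z\<in>C. cmod (\<phi> z) \<le> M \<phi>)))"

lemma slash_pfam: "A \<in> G \<Longrightarrow> \<phi> \<in> pfam k h \<Longrightarrow> slash k A \<phi> \<in> pfam k h"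
  unfolding pfam_def using mult_G by (auto simp: slash_slash det_G)

lemma slash_cancel:
  assumes "A \<in> G" "\<phi> \<in> pfam k h"
  shows "slash k (adj2 A) (slash k A \<phi>) = \<phi>"
proof -
  obtain B where B: "B \<in> G" "\<phi> = slash k B h" using assms(2) unfolding pfam_def by blast
  have "B ** (A ** adj2 A) = B" using assms by (simp add: adj2_mult det_G)
  then show ?thesis using assms B by (simp add: slash_slash det_G adj2_G mult_G matrix_mul_assoc)
qed

lemma bij_slash:
  assumes "A \<in> G"
  shows "bij_betw (slash k A) (pfam k h) (pfam k h)"
proof (rule bij_betw_byWitness[where f' = "slash k (adj2 A)"])
  show "\<forall>\<phi>\<in>pfam k h. slash k (adj2 A) (slash k A \<phi>) = \<phi>" using slash_cancel[OF assms] by blast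
  show "\<forall>\<phi>\<in>pfam k h. slash k A (slash k (adj2 A) \<phi>) = \<phi>" using slash_cancel[OF adj2_G[OF assms]] by simp
qed (use slash_pfam assms adj2_G in auto)

lemma poincare_off: "z \<notin> uhp \<Longrightarrow> poincare k h z = 0"
  unfolding poincare_def by (rule infsum_0) (auto simp: pfam_def slash_def)

text \<open>Slashing by \<open>A\<close> permutes the terms, so reindexing the sum is the
  transformation law.\<close>

lemma poincare_weight:
  assumes A: "A \<in> G" and z: "z \<in> uhp"
  shows "poincare k h (moebius A z) = aut_factor A z ^ (2 * k) * poincare k h z"
proof -
  have j: "aut_factor A z \<noteq> 0" using aut_factor_nz[OF det_G[OF A] z] .
  have "poincare k h z = (\<Sum>\<^sub>\<infinity>\<phi>\<in>pfam k h. slash k A \<phi> z)"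
    unfolding poincare_def by (rule infsum_reindex_bij_betw[OF bij_slash[OF A], symmetric])
  also have "\<dots> = (\<Sum>\<^sub>\<infinity>\<phi>\<in>pfam k h. \<phi> (moebius A z) * inverse (aut_factor A z ^ (2 * k)))"
    using z by (simp add: slash_def divide_inverse)
  also have "\<dots> = poincare k h (moebius A z) * inverse (aut_factor A z ^ (2 * k))"
    unfolding poincare_def by (rule infsum_cmult_left')
  finally show ?thesis using j by (simp add: field_simps)
qed

lemma dominated_abs_summable:
  assumes "dominated k h"
  shows "(\<lambda>\<phi>. cmod (\<phi> z)) summable_on pfam k h"
proof (cases "z \<in> uhp")
  case True
  then obtain M :: "(complex \<Rightarrow> complex) \<Rightarrow> real" where M: "M summable_on pfam k h" "\<And>\<phi>. \<phi> \<in> pfam k h \<Longrightarrow> cmod (\<phi> z) \<le> M \<phi>"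
    using assms unfolding dominated_def by (metis compact_sing empty_subsetI insert_subset singletonI)
  then show ?thesis by (rule summable_on_comparison_test) auto
next
  case False
  have "(\<lambda>\<phi>. cmod (\<phi> z)) summable_on pfam k h \<longleftrightarrow> (\<lambda>\<phi>. 0::real) summable_on pfam k h"
    using False by (intro summable_on_cong) (auto simp: pfam_def slash_def)
  then show ?thesis by simp
qed

lemma poincare_holomorphic:
  assumes dom: "dominated k h" and h: "h holomorphic_on uhp"
  shows "poincare k h holomorphic_on uhp"
proof -
  have "poincare k h field_differentiable at z" if z: "z \<in> uhp" for z
  proof -
    obtain r where r: "r > 0" "cball z r \<subseteq> uhp"
      using z open_uhp open_contains_cball by blast
    obtain M :: "(complex \<Rightarrow> complex) \<Rightarrow> real" where M: "M summable_on pfam k h"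
      "\<And>\<phi> z'. \<phi> \<in> pfam k h \<Longrightarrow> z' \<in> cball z r \<Longrightarrow> cmod (\<phi> z') \<le> M \<phi>"
      using dom r(2) unfolding dominated_def by (metis compact_cball)
    have ul: "uniform_limit (cball z r) (\<lambda>X y. \<Sum>\<phi>\<in>X. \<phi> y) (\<lambda>y. \<Sum>\<^sub>\<infinity>\<phi>\<in>pfam k h. \<phi> y) (finite_subsets_at_top (pfam k h))"
      by (rule Weierstrass_m_test_general[where f = "\<lambda>\<phi> y. \<phi> y", OF M(2,1)])
    have hol\<phi>: "\<phi> holomorphic_on uhp" if "\<phi> \<in> pfam k h" for \<phi>
      using that slash_holomorphic[OF det_G h] by (auto simp: pfam_def)
    have ev: "eventually (\<lambda>X. continuous_on (cball z r) (\<lambda>y. \<Sum>\<phi>\<in>X. \<phi> y) \<and> (\<lambda>y. \<Sum>\<phi>\<in>X. \<phi> y) holomorphic_on ball z r)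
       (finite_subsets_at_top (pfam k h))"
    proof (rule eventually_finite_subsets_at_top_weakI)
      fix X assume X: "finite X" "X \<subseteq> pfam k h"
      have "(\<lambda>y. \<Sum>\<phi>\<in>X. \<phi> y) holomorphic_on uhp" using X hol\<phi> by (intro holomorphic_on_sum) auto
      moreover have "ball z r \<subseteq> uhp" using r(2) ball_subset_cball by blast
      ultimately show "continuous_on (cball z r) (\<lambda>y. \<Sum>\<phi>\<in>X. \<phi> y) \<and> (\<lambda>y. \<Sum>\<phi>\<in>X. \<phi> y) holomorphic_on ball z r"
        using r(2) by (metis holomorphic_on_subset holomorphic_on_imp_continuous_on)
    qed
    have "(\<lambda>y. \<Sum>\<^sub>\<infinity>\<phi>\<in>pfam k h. \<phi> y) holomorphic_on ball z r"
      by (rule holomorphic_uniform_limit[OF ev ul]) simp_all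
    then have "poincare k h holomorphic_on ball z r" by (simp add: poincare_def[abs_def])
    then show ?thesis using r(1) holomorphic_on_imp_differentiable_at[of _ "ball z r" z] by simp
  qed
  then show ?thesis by (auto simp: holomorphic_on_def intro: field_differentiable_at_within)
qed

text \<open>A bounded invariant norm forces decay like \<open>Im z ^ (- k)\<close> towards the cusp,
  so the constant Fourier coefficient vanishes.\<close>

lemma poincare_cusp_form:
  assumes G: "G = \<Union>\<Gamma>" and dom: "dominated k h" and h: "h holomorphic_on uhp" and k: "k \<ge> 1"
    and bd: "\<And>z. z \<in> uhp \<Longrightarrow> cmod (poincare k h z) * Im z ^ k \<le> B"
  shows "poincare k h \<in> cusp_forms \<Gamma> k"
proof -
  note hol = poincare_holomorphic[OF dom h]
  have per: "poincare k h (z + 1) = poincare k h z" if "z \<in> uhp" for z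
    using poincare_weight[OF translation_G[of 1] that, of k h] by simp
  have "\<exists>F. F holomorphic_on ball 0 1 \<and> F 0 = 0 \<and> (\<forall>z\<in>uhp. poincare k h z = F (exp (2 * pi * \<i> * z)))"
  proof (rule periodic_q_expansion[OF hol per])
    fix e :: real assume e: "e > 0"
    have "cmod (poincare k h z) < e" if z: "z \<in> uhp" "Im z > max 1 (\<bar>B\<bar> / e + 1)" for z
    proof -
      have "Im z \<le> Im z ^ k" using z(2) k self_le_power[of "Im z" k] by simp
      then have "cmod (poincare k h z) * Im z \<le> cmod (poincare k h z) * Im z ^ k" by (intro mult_left_mono) auto
      also have "\<dots> \<le> \<bar>B\<bar>" using bd[OF z(1)] by linarith
      also have "\<dots> < e * Im z"
      proof -
        have "\<bar>B\<bar> / e < Im z" using z(2) by simp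
        then show ?thesis using e by (simp add: pos_divide_less_eq mult.commute)
      qed
      finally show ?thesis using z by (simp add: uhp_def)
    qed
    then show "\<exists>Y. \<forall>z\<in>uhp. Im z > Y \<longrightarrow> cmod (poincare k h z) < e" by blast
  qed
  then show ?thesis
    unfolding cusp_forms_def using hol poincare_off poincare_weight[unfolded aut_factor_def]
    by (auto simp: G[symmetric])
qed

end

definition qpar :: "complex \<Rightarrow> complex" where
  "qpar z = exp (2 * pi * \<i> * z)"

lemma norm_qpar: "cmod (qpar z) = exp (- 2 * pi * Im z)"
  by (simp add: qpar_def)

lemma qpar_holomorphic [holomorphic_intros]: "f holomorphic_on S \<Longrightarrow> (\<lambda>z. qpar (f z)) holomorphic_on S"
  unfolding qpar_def by (intro holomorphic_intros)

lemma qpar_periodic [simp]: "qpar (z + of_int n) = qpar z"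
proof -
  have "exp (2 * pi * \<i> * (z + of_int n)) = exp (2 * pi * \<i> * z) * exp (of_int n * (2 * of_real pi * \<i>))"
    by (simp add: exp_add[symmetric] algebra_simps)
  also have "exp (of_int n * (2 * of_real pi * \<i>)) = (1::complex)"
    using exp_integer_2pi[of "of_int n"] by (simp add: mult_ac)
  finally show ?thesis by (simp add: qpar_def)
qed

lemma norm_qpar_power_le: "z \<in> uhp \<Longrightarrow> cmod (qpar z ^ m) \<le> 1"
  by (simp add: norm_power norm_qpar power_le_one uhp_def)

text \<open>The Bergman kernel of the half-plane in weight \<open>2 * k\<close> with second argument
  \<open>w\<close>, up to a constant factor; its pole \<open>cnj w\<close> lies in the lower
  half-plane.\<close>

definition kerh :: "nat \<Rightarrow> complex \<Rightarrow> complex \<Rightarrow> complex" where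
  "kerh k w z = 1 / (z - cnj w) ^ (2 * k)"

lemma uhp_minus_cnj_nz: "z \<in> uhp \<Longrightarrow> w \<in> uhp \<Longrightarrow> z \<noteq> cnj w"
  by (auto simp: uhp_def)

lemma kerh_holomorphic: "w \<in> uhp \<Longrightarrow> kerh k w holomorphic_on uhp"
  unfolding kerh_def[abs_def] by (intro holomorphic_intros) (auto simp: uhp_minus_cnj_nz)

lemma compact_bounded_above:
  fixes g :: "'a::topological_space \<Rightarrow> real"
  assumes "compact C" "continuous_on C g"
  obtains B where "B \<ge> 0" "\<And>z. z \<in> C \<Longrightarrow> g z \<le> B"
proof -
  have "bounded (g ` C)" using assms compact_continuous_image compact_imp_bounded by blast
  then obtain B where "\<And>z. z \<in> C \<Longrightarrow> \<bar>g z\<bar> \<le> B" unfolding bounded_iff by auto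
  then show ?thesis by (intro that[of "max B 0"]) (auto simp: abs_le_iff le_max_iff_disj)
qed

text \<open>The packing bound does not depend on the finite set, so it passes to infinite sums.
  Injectivity of \<open>\<zeta>\<close> lets functions index the points.\<close>

lemma packing_sum:
  assumes \<epsilon>: "\<epsilon> > 0" "\<epsilon> \<le> 1" and z: "z \<in> uhp" and inj: "inj_on \<zeta> U" and \<zeta>: "\<And>\<phi>. \<phi> \<in> U \<Longrightarrow> \<zeta> \<phi> \<in> uhp"
    and sep: "\<And>\<phi> \<psi>. \<phi> \<in> U \<Longrightarrow> \<psi> \<in> U \<Longrightarrow> \<zeta> \<phi> \<noteq> \<zeta> \<psi> \<Longrightarrow> (cmod (\<zeta> \<phi> - \<zeta> \<psi>))\<^sup>2 \<ge> \<epsilon>\<^sup>2 * Im (\<zeta> \<phi>) * Im (\<zeta> \<psi>)"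
  shows "(\<lambda>\<phi>. (Im (\<zeta> \<phi>))\<^sup>2 / cmod (z - cnj (\<zeta> \<phi>)) ^ 4) summable_on U"
    "(\<Sum>\<^sub>\<infinity>\<phi>\<in>U. (Im (\<zeta> \<phi>))\<^sup>2 / cmod (z - cnj (\<zeta> \<phi>)) ^ 4) \<le> packing_const \<epsilon> / (Im z)\<^sup>2"
proof -
  have fin: "(\<Sum>\<phi>\<in>F. (Im (\<zeta> \<phi>))\<^sup>2 / cmod (z - cnj (\<zeta> \<phi>)) ^ 4) \<le> packing_const \<epsilon> / (Im z)\<^sup>2"
    if F: "finite F" "F \<subseteq> U" for F
  proof -
    have "inj_on \<zeta> F" using inj F by (rule_tac inj_on_subset)
    then have "(\<Sum>\<phi>\<in>F. (Im (\<zeta> \<phi>))\<^sup>2 / cmod (z - cnj (\<zeta> \<phi>)) ^ 4) = (\<Sum>x\<in>\<zeta> ` F. (Im x)\<^sup>2 / cmod (z - cnj x) ^ 4)"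
      by (simp add: sum.reindex)
    also have "\<dots> \<le> packing_const \<epsilon> / (Im z)\<^sup>2"
    proof (rule packing[OF \<epsilon> _ _ z])
      show "finite (\<zeta> ` F)" using F by simp
      show "\<zeta> ` F \<subseteq> uhp" using \<zeta> F by auto
      fix x y assume "x \<in> \<zeta> ` F" "y \<in> \<zeta> ` F" "x \<noteq> y"
      then show "(cmod (x - y))\<^sup>2 \<ge> \<epsilon>\<^sup>2 * Im x * Im y" using sep F by auto
    qed
    finally show ?thesis .
  qed
  show s: "(\<lambda>\<phi>. (Im (\<zeta> \<phi>))\<^sup>2 / cmod (z - cnj (\<zeta> \<phi>)) ^ 4) summable_on U"
    by (rule nonneg_bdd_above_summable_on)
       (auto intro!: bdd_aboveI2[where M = "packing_const \<epsilon> / (Im z)\<^sup>2"] fin)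
  show "(\<Sum>\<^sub>\<infinity>\<phi>\<in>U. (Im (\<zeta> \<phi>))\<^sup>2 / cmod (z - cnj (\<zeta> \<phi>)) ^ 4) \<le> packing_const \<epsilon> / (Im z)\<^sup>2"
    by (rule infsum_le_finite_sums[OF s fin])
qed

section \<open>Poincare series of powers of q\<close>

context cusped_group begin

lemma Im_moebius_stab: "A \<in> G \<Longrightarrow> A$2$1 = 0 \<Longrightarrow> Im (moebius A z) = Im z"
  using stab_G[of A] by auto

lemma aut_factor_ge:
  assumes "A \<in> G" "A$2$1 \<noteq> 0" "z \<in> uhp"
  shows "cmod (aut_factor A z) \<ge> Im z"
proof -
  have z: "Im z > 0" using assms by (simp add: uhp_def)
  have "1 * Im z \<le> \<bar>A$2$1\<bar> * Im z" using shimizu[OF assms(1,2)] z by (intro mult_right_mono) auto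
  also have "\<dots> = \<bar>Im (aut_factor A z)\<bar>" using z by (simp add: aut_factor_def abs_mult)
  also have "\<dots> \<le> cmod (aut_factor A z)" by (rule abs_Im_le_cmod)
  finally show ?thesis by simp
qed

text \<open>By \<open>shimizu\<close> the automorphy factor has modulus at least
  \<open>Im z\<close>. Hence above height 1 only translations keep a point above height 1.\<close>

lemma Im_moebius_le:
  assumes "A \<in> G" "A$2$1 \<noteq> 0" "z \<in> uhp"
  shows "Im (moebius A z) \<le> 1 / Im z"
proof -
  have z: "Im z > 0" using assms by (simp add: uhp_def)
  have "(Im z)\<^sup>2 \<le> (cmod (aut_factor A z))\<^sup>2" using aut_factor_ge[OF assms] z by (intro power_mono) auto
  then have "Im z / (cmod (aut_factor A z))\<^sup>2 \<le> Im z / (Im z)\<^sup>2"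
    using z aut_factor_nz[OF det_G[OF assms(1)] assms(3)] by (intro divide_left_mono) auto
  then show ?thesis using Im_moebius[OF det_G[OF assms(1)] assms(3)] z by (simp add: power2_eq_square)
qed

lemma slash_qpar_translation:
  assumes "A \<in> G"
  shows "slash k (translation n ** A) (\<lambda>z. qpar z ^ m) = slash k A (\<lambda>z. qpar z ^ m)"
  using det_G[OF assms] by (auto simp: slash_def fun_eq_iff moebius_mult aut_factor_mult)

lemma slash_qpar_stab:
  assumes "A \<in> G" "A$2$1 = 0"
  shows "slash k A (\<lambda>z. qpar z ^ m) = slash k (mat 1) (\<lambda>z. qpar z ^ m)"
  using stab_G[OF assms] slash_qpar_translation[OF one_G, of k _ m] by auto

text \<open>Powers of \<open>q\<close> are periodic, so each representative may be translated until
  the image of \<open>z\<close> has real part at most 1 in modulus. The images then lie in a bounded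
  region, and packing as seen from \<open>\<i>\<close> controls the sum of their squared heights,
  uniformly in \<open>k\<close> and \<open>m\<close>.\<close>

lemma strip_reps:
  assumes K: "compact K" "K \<subseteq> uhp"
  obtains C where "C > 0"
    "\<And>z k m U. z \<in> K \<Longrightarrow> U \<subseteq> pfam k (\<lambda>z. qpar z ^ m) \<Longrightarrow>
       (\<And>\<phi>. \<phi> \<in> U \<Longrightarrow> \<exists>A\<in>G. \<phi> = slash k A (\<lambda>z. qpar z ^ m) \<and> Im (moebius A z) \<le> 1) \<Longrightarrow>
       \<exists>\<rho>. (\<forall>\<phi>\<in>U. \<rho> \<phi> \<in> G \<and> \<phi> = slash k (\<rho> \<phi>) (\<lambda>z. qpar z ^ m) \<and> Im (moebius (\<rho> \<phi>) z) \<le> 1) \<and>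
         (\<lambda>\<phi>. (Im (moebius (\<rho> \<phi>) z))\<^sup>2) summable_on U \<and> (\<Sum>\<^sub>\<infinity>\<phi>\<in>U. (Im (moebius (\<rho> \<phi>) z))\<^sup>2) \<le> C"
proof -
  obtain \<epsilon> where \<epsilon>: "\<epsilon> > 0" "\<epsilon> \<le> 1"
    "\<And>w A B. w \<in> K \<Longrightarrow> A \<in> G \<Longrightarrow> B \<in> G \<Longrightarrow> moebius A w \<noteq> moebius B w \<Longrightarrow>
       (cmod (moebius A w - moebius B w))\<^sup>2 \<ge> \<epsilon>\<^sup>2 * Im (moebius A w) * Im (moebius B w)"
    using orbit_separated[OF K] by blast
  show ?thesis
  proof (rule that)
    show "25 * packing_const \<epsilon> > 0" using \<epsilon>(1) by (simp add: packing_const_def)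
    fix z k m U
    let ?h = "\<lambda>z. qpar z ^ m"
    assume z: "z \<in> K" and U: "U \<subseteq> pfam k ?h"
      and rep: "\<And>\<phi>. \<phi> \<in> U \<Longrightarrow> \<exists>A\<in>G. \<phi> = slash k A ?h \<and> Im (moebius A z) \<le> 1"
    have zu: "z \<in> uhp" using z K by auto
    have "\<exists>A\<in>G. \<phi> = slash k A ?h \<and> Im (moebius A z) \<le> 1 \<and> \<bar>Re (moebius A z)\<bar> \<le> 1" if \<phi>: "\<phi> \<in> U" for \<phi>
    proof -
      obtain A where A: "A \<in> G" "\<phi> = slash k A ?h" "Im (moebius A z) \<le> 1" using rep[OF \<phi>] by blast
      define n where "n = - \<lfloor>Re (moebius A z)\<rfloor>"
      have "moebius (translation n ** A) z = moebius A z + of_int n"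
        using zu A by (simp add: moebius_mult det_G)
      moreover have "\<bar>Re (moebius A z) + of_int n\<bar> \<le> 1" unfolding n_def by linarith
      ultimately show ?thesis
        using A slash_qpar_translation[OF A(1)] mult_G[OF translation_G A(1)]
        by (intro bexI[of _ "translation n ** A"]) auto
    qed
    then obtain \<rho> where \<rho>: "\<And>\<phi>. \<phi> \<in> U \<Longrightarrow> \<rho> \<phi> \<in> G \<and> \<phi> = slash k (\<rho> \<phi>) ?h \<and> Im (moebius (\<rho> \<phi>) z) \<le> 1 \<and> \<bar>Re (moebius (\<rho> \<phi>) z)\<bar> \<le> 1"
      by metis
    define \<zeta> where "\<zeta> = (\<lambda>\<phi>. moebius (\<rho> \<phi>) z)"
    have \<zeta>u: "\<zeta> \<phi> \<in> uhp" if "\<phi> \<in> U" for \<phi> using \<rho>[OF that] zu moebius_G_uhp by (simp add: \<zeta>_def)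
    have inj: "inj_on \<zeta> U"
    proof (rule inj_onI)
      fix \<phi> \<psi> assume p: "\<phi> \<in> U" "\<psi> \<in> U" "\<zeta> \<phi> = \<zeta> \<psi>"
      then have "\<rho> \<psi> = \<rho> \<phi> \<or> \<rho> \<psi> = - \<rho> \<phi>"
        using moebius_G_eqD[of "\<rho> \<phi>" "\<rho> \<psi>" z] \<rho> zu by (auto simp: \<zeta>_def)
      then have "slash k (\<rho> \<psi>) ?h = slash k (\<rho> \<phi>) ?h" by auto
      then show "\<phi> = \<psi>" using \<rho> p by metis
    qed
    have iu: "\<i> \<in> uhp" by (simp add: uhp_def)
    have sep: "(cmod (\<zeta> \<phi> - \<zeta> \<psi>))\<^sup>2 \<ge> \<epsilon>\<^sup>2 * Im (\<zeta> \<phi>) * Im (\<zeta> \<psi>)" if "\<phi> \<in> U" "\<psi> \<in> U" "\<zeta> \<phi> \<noteq> \<zeta> \<psi>" for \<phi> \<psi>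
      using that \<epsilon>(3)[OF z] \<rho> by (auto simp: \<zeta>_def)
    note ps = packing_sum[OF \<epsilon>(1,2) iu inj \<zeta>u sep]
    \<comment> \<open>Horizontal distance at most 1 and vertical distance at most 2 give squared
      distance at most 5; the constant 25 is its square.\<close>
    have le: "(Im (\<zeta> \<phi>))\<^sup>2 \<le> 25 * ((Im (\<zeta> \<phi>))\<^sup>2 / cmod (\<i> - cnj (\<zeta> \<phi>)) ^ 4)" if \<phi>: "\<phi> \<in> U" for \<phi>
    proof -
      have i: "0 < Im (\<zeta> \<phi>)" "Im (\<zeta> \<phi>) \<le> 1" "\<bar>Re (\<zeta> \<phi>)\<bar> \<le> 1" using \<zeta>u[OF \<phi>] \<rho>[OF \<phi>] by (auto simp: \<zeta>_def uhp_def)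
      have "(Re (\<zeta> \<phi>))\<^sup>2 \<le> 1\<^sup>2" using i(3) by (subst abs_le_square_iff[symmetric]) simp
      moreover have "(1 + Im (\<zeta> \<phi>))\<^sup>2 \<le> 2\<^sup>2" using i by (intro power_mono) auto
      ultimately have "(cmod (\<i> - cnj (\<zeta> \<phi>)))\<^sup>2 \<le> 5" by (simp add: cmod_power2)
      then have "((cmod (\<i> - cnj (\<zeta> \<phi>)))\<^sup>2)\<^sup>2 \<le> 5\<^sup>2" by (intro power_mono) auto
      then have "cmod (\<i> - cnj (\<zeta> \<phi>)) ^ 4 \<le> 25" by (simp flip: power_mult)
      moreover have "\<i> \<noteq> cnj (\<zeta> \<phi>)" using uhp_minus_cnj_nz[OF iu \<zeta>u[OF \<phi>]] .
      ultimately have "(Im (\<zeta> \<phi>))\<^sup>2 * cmod (\<i> - cnj (\<zeta> \<phi>)) ^ 4 \<le> (Im (\<zeta> \<phi>))\<^sup>2 * 25" "cmod (\<i> - cnj (\<zeta> \<phi>)) ^ 4 > 0"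
        by (auto intro!: mult_left_mono)
      then show ?thesis by (simp add: pos_le_divide_eq mult.commute)
    qed
    have s25: "(\<lambda>\<phi>. 25 * ((Im (\<zeta> \<phi>))\<^sup>2 / cmod (\<i> - cnj (\<zeta> \<phi>)) ^ 4)) summable_on U"
      using ps(1) by (intro summable_on_cmult_right)
    then have s: "(\<lambda>\<phi>. (Im (\<zeta> \<phi>))\<^sup>2) summable_on U"
      by (rule summable_on_comparison_test) (use le in auto)
    have "(\<Sum>\<^sub>\<infinity>\<phi>\<in>U. (Im (\<zeta> \<phi>))\<^sup>2) \<le> (\<Sum>\<^sub>\<infinity>\<phi>\<in>U. 25 * ((Im (\<zeta> \<phi>))\<^sup>2 / cmod (\<i> - cnj (\<zeta> \<phi>)) ^ 4))"
      by (rule infsum_mono[OF s s25 le])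
    also have "\<dots> = 25 * (\<Sum>\<^sub>\<infinity>\<phi>\<in>U. (Im (\<zeta> \<phi>))\<^sup>2 / cmod (\<i> - cnj (\<zeta> \<phi>)) ^ 4)"
      by (rule infsum_cmult_right')
    also have "\<dots> \<le> 25 * packing_const \<epsilon>" using ps(2) by simp
    finally show "\<exists>\<rho>. (\<forall>\<phi>\<in>U. \<rho> \<phi> \<in> G \<and> \<phi> = slash k (\<rho> \<phi>) ?h \<and> Im (moebius (\<rho> \<phi>) z) \<le> 1) \<and>
         (\<lambda>\<phi>. (Im (moebius (\<rho> \<phi>) z))\<^sup>2) summable_on U \<and> (\<Sum>\<^sub>\<infinity>\<phi>\<in>U. (Im (moebius (\<rho> \<phi>) z))\<^sup>2) \<le> 25 * packing_const \<epsilon>"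
      using \<rho> s unfolding \<zeta>_def by blast
  qed
qed

text \<open>On a compact set the automorphy factor at \<open>\<i>\<close> is at most a constant
  times that at \<open>z\<close>, so it suffices to sum at \<open>\<i>\<close>. Its orbit stays at
  height at most 1, and \<open>k \<ge> 2\<close> reduces the sum to squared heights.\<close>

lemma dominated_qpar:
  assumes k: "k \<ge> 2"
  shows "dominated k (\<lambda>z. qpar z ^ m)"
  unfolding dominated_def
proof (intro allI impI)
  let ?h = "\<lambda>z. qpar z ^ m"
  fix C assume C: "compact C" "C \<subseteq> uhp"
  have Ki: "compact {\<i>}" "{\<i>} \<subseteq> uhp" by (auto simp: uhp_def)
  have Iml: "Im (moebius A \<i>) \<le> 1" if "A \<in> G" for A
    using Im_moebius_le[OF that, of \<i>] Im_moebius_stab[OF that, of \<i>] by (cases "A$2$1 = 0") (auto simp: uhp_def)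
  obtain \<rho> where \<rho>: "\<And>\<phi>. \<phi> \<in> pfam k ?h \<Longrightarrow> \<rho> \<phi> \<in> G \<and> \<phi> = slash k (\<rho> \<phi>) ?h \<and> Im (moebius (\<rho> \<phi>) \<i>) \<le> 1"
    and s: "(\<lambda>\<phi>. (Im (moebius (\<rho> \<phi>) \<i>))\<^sup>2) summable_on pfam k ?h"
  proof -
    obtain C' where "C' > 0" and C': "\<And>z k m U. z \<in> {\<i>} \<Longrightarrow> U \<subseteq> pfam k (\<lambda>z. qpar z ^ m) \<Longrightarrow>
       (\<And>\<phi>. \<phi> \<in> U \<Longrightarrow> \<exists>A\<in>G. \<phi> = slash k A (\<lambda>z. qpar z ^ m) \<and> Im (moebius A z) \<le> 1) \<Longrightarrow>
       \<exists>\<rho>. (\<forall>\<phi>\<in>U. \<rho> \<phi> \<in> G \<and> \<phi> = slash k (\<rho> \<phi>) (\<lambda>z. qpar z ^ m) \<and> Im (moebius (\<rho> \<phi>) z) \<le> 1) \<and>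
         (\<lambda>\<phi>. (Im (moebius (\<rho> \<phi>) z))\<^sup>2) summable_on U \<and> (\<Sum>\<^sub>\<infinity>\<phi>\<in>U. (Im (moebius (\<rho> \<phi>) z))\<^sup>2) \<le> C'"
      using strip_reps[OF Ki] by blast
    have "\<exists>A\<in>G. \<phi> = slash k A ?h \<and> Im (moebius A \<i>) \<le> 1" if "\<phi> \<in> pfam k ?h" for \<phi>
      using that Iml unfolding pfam_def by auto
    from C'[OF singletonI subset_refl this] show ?thesis using that by blast
  qed
  define b where "b = (\<lambda>z. (1 + cmod (z - \<i>) / Im z) ^ (2 * k))"
  have "continuous_on C b" unfolding b_def
    by (intro continuous_intros) (use C in \<open>auto simp: uhp_def\<close>)
  then obtain B where B: "B \<ge> 0" "\<And>z. z \<in> C \<Longrightarrow> b z \<le> B" using compact_bounded_above C(1) by blast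
  have "cmod (\<phi> z) \<le> B * (Im (moebius (\<rho> \<phi>) \<i>))\<^sup>2" if \<phi>: "\<phi> \<in> pfam k ?h" and z: "z \<in> C" for \<phi> z
  proof -
    have zu: "z \<in> uhp" using z C by auto
    then have y: "Im z > 0" by (simp add: uhp_def)
    define A where "A = \<rho> \<phi>"
    have A: "A \<in> G" "\<phi> = slash k A ?h" using \<rho>[OF \<phi>] by (auto simp: A_def)
    have iu: "\<i> \<in> uhp" by (simp add: uhp_def)
    have jz: "cmod (aut_factor A z) > 0" "cmod (aut_factor A \<i>) > 0"
      using aut_factor_nz[OF det_G[OF A(1)]] zu iu by auto
    have "\<bar>A$2$1\<bar> * Im z \<le> cmod (aut_factor A z)"
      using abs_Im_le_cmod[of "aut_factor A z"] y by (simp add: aut_factor_def abs_mult)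
    then have c: "\<bar>A$2$1\<bar> \<le> cmod (aut_factor A z) / Im z" using y by (simp add: pos_le_divide_eq)
    have "aut_factor A \<i> = aut_factor A z - of_real (A$2$1) * (z - \<i>)" by (simp add: aut_factor_def algebra_simps)
    then have "cmod (aut_factor A \<i>) \<le> cmod (aut_factor A z) + \<bar>A$2$1\<bar> * cmod (z - \<i>)"
      using norm_triangle_ineq4[of "aut_factor A z" "of_real (A$2$1) * (z - \<i>)"] by (simp add: norm_mult)
    also have "\<bar>A$2$1\<bar> * cmod (z - \<i>) \<le> cmod (aut_factor A z) / Im z * cmod (z - \<i>)"
      using c by (intro mult_right_mono) auto
    finally have "cmod (aut_factor A \<i>) \<le> (1 + cmod (z - \<i>) / Im z) * cmod (aut_factor A z)"
      by (simp add: algebra_simps)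
    then have "cmod (aut_factor A \<i>) ^ (2 * k) \<le> ((1 + cmod (z - \<i>) / Im z) * cmod (aut_factor A z)) ^ (2 * k)"
      by (intro power_mono) auto
    then have p: "cmod (aut_factor A \<i>) ^ (2 * k) \<le> b z * cmod (aut_factor A z) ^ (2 * k)"
      by (simp only: b_def power_mult_distrib)
    have "cmod (\<phi> z) = cmod (qpar (moebius A z) ^ m) / cmod (aut_factor A z) ^ (2 * k)"
      using zu by (simp add: A(2) slash_def norm_divide norm_power)
    also have "\<dots> \<le> 1 / cmod (aut_factor A z) ^ (2 * k)"
      using norm_qpar_power_le moebius_G_uhp[OF A(1) zu] by (intro divide_right_mono) auto
    also have "\<dots> \<le> b z / cmod (aut_factor A \<i>) ^ (2 * k)"
      using p jz by (simp add: field_simps)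
    also have "\<dots> = b z * Im (moebius A \<i>) ^ k"
      using Im_moebius[OF det_G[OF A(1)] iu] by (simp add: power_divide power_mult)
    also have "\<dots> \<le> B * (Im (moebius A \<i>))\<^sup>2"
    proof (intro mult_mono B(2)[OF z] B(1))
      have "0 \<le> Im (moebius A \<i>)" using moebius_G_uhp[OF A(1) iu] by (simp add: uhp_def)
      then show "Im (moebius A \<i>) ^ k \<le> (Im (moebius A \<i>))\<^sup>2" "0 \<le> Im (moebius A \<i>) ^ k"
        using Iml[OF A(1)] k by (auto intro: power_decreasing)
    qed
    finally show ?thesis by (simp add: A_def)
  qed
  moreover have "(\<lambda>\<phi>. B * (Im (moebius (\<rho> \<phi>) \<i>))\<^sup>2) summable_on pfam k ?h"
    using s by (intro summable_on_cmult_right)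
  ultimately show "\<exists>M::(complex \<Rightarrow> complex) \<Rightarrow> real. M summable_on pfam k ?h \<and> (\<forall>\<phi>\<in>pfam k ?h. \<forall>z\<in>C. cmod (\<phi> z) \<le> M \<phi>)"
    by blast
qed

end

lemma power_exp_le:
  fixes y :: real
  assumes "y \<ge> 0"
  shows "y ^ k * exp (- y) \<le> fact k"
proof -
  have "y ^ k / fact k \<le> exp y"
    using sum_le_suminf[OF summable_exp[of y], of "{k}"] assms
    by (simp add: exp_def divide_inverse mult.commute)
  then show ?thesis by (simp add: exp_minus field_simps)
qed

context cusped_group begin

lemma norm_poincare_diff_le:
  assumes dom: "dominated k h" and M: "M summable_on (pfam k h - {slash k (mat 1) h})"
    and le: "\<And>\<phi>. \<phi> \<in> pfam k h \<Longrightarrow> \<phi> \<noteq> slash k (mat 1) h \<Longrightarrow> cmod (\<phi> z) \<le> M \<phi>"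
  shows "cmod (poincare k h z - slash k (mat 1) h z) \<le> (\<Sum>\<^sub>\<infinity>\<phi>\<in>pfam k h - {slash k (mat 1) h}. M \<phi>)"
proof -
  define h0 where "h0 = slash k (mat 1) h"
  define U where "U = pfam k h - {h0}"
  have h0: "h0 \<in> pfam k h" using one_G by (auto simp: pfam_def h0_def)
  have T: "pfam k h = insert h0 U" "h0 \<notin> U" using h0 by (auto simp: U_def)
  have sT: "(\<lambda>\<phi>. cmod (\<phi> z)) summable_on pfam k h" by (rule dominated_abs_summable[OF dom])
  have sU: "(\<lambda>\<phi>. cmod (\<phi> z)) summable_on U"
    by (rule summable_on_subset_banach[OF sT]) (auto simp: U_def)
  have "poincare k h z = h0 z + (\<Sum>\<^sub>\<infinity>\<phi>\<in>U. \<phi> z)"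
    unfolding poincare_def T(1) using abs_summable_summable[OF sU] T(2) by (rule infsum_insert)
  then have "cmod (poincare k h z - h0 z) \<le> (\<Sum>\<^sub>\<infinity>\<phi>\<in>U. cmod (\<phi> z))"
    using norm_infsum_bound[OF sU] by simp
  also have "\<dots> \<le> (\<Sum>\<^sub>\<infinity>\<phi>\<in>U. M \<phi>)"
    by (rule infsum_mono[OF sU]) (use M le in \<open>auto simp: U_def h0_def\<close>)
  finally show ?thesis by (simp add: U_def h0_def)
qed

lemma norm_poincare_le:
  assumes dom: "dominated k h" and M: "M summable_on pfam k h"
    and le: "\<And>\<phi>. \<phi> \<in> pfam k h \<Longrightarrow> cmod (\<phi> z) \<le> M \<phi>"
  shows "cmod (poincare k h z) \<le> (\<Sum>\<^sub>\<infinity>\<phi>\<in>pfam k h. M \<phi>)"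
proof -
  have s: "(\<lambda>\<phi>. cmod (\<phi> z)) summable_on pfam k h" by (rule dominated_abs_summable[OF dom])
  have "cmod (poincare k h z) \<le> (\<Sum>\<^sub>\<infinity>\<phi>\<in>pfam k h. cmod (\<phi> z))"
    unfolding poincare_def by (rule norm_infsum_bound[OF s])
  also have "\<dots> \<le> (\<Sum>\<^sub>\<infinity>\<phi>\<in>pfam k h. M \<phi>)" by (rule infsum_mono[OF s M le])
  finally show ?thesis .
qed

text \<open>All terms but \<open>qpar z ^ m\<close> come from elements with nonzero lower left
  entry. For these the automorphy factor at \<open>z\<close> is at least \<open>Im z\<close>, and at
  least its value at the point \<open>w\<close> with the same real part and height 1. Four of the
  \<open>2 * k\<close> factors are spent on the convergent sum at \<open>w\<close>; the others give
  the power of the height.\<close>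

lemma poincare_qpar_high:
  obtains C where "C > 0"
    "\<And>k m z. k \<ge> 2 \<Longrightarrow> Im z \<ge> 1 \<Longrightarrow> cmod (poincare k (\<lambda>z. qpar z ^ m) z - qpar z ^ m) \<le> C * Im z ^ 4 / Im z ^ (2 * k)"
proof -
  define K where "K = cbox (Complex 0 1) (Complex 1 1)"
  have K: "compact K" "K \<subseteq> uhp" by (auto simp: K_def uhp_def in_cbox_complex_iff)
  obtain C where C: "C > 0" "\<And>z k m U. z \<in> K \<Longrightarrow> U \<subseteq> pfam k (\<lambda>z. qpar z ^ m) \<Longrightarrow>
       (\<And>\<phi>. \<phi> \<in> U \<Longrightarrow> \<exists>A\<in>G. \<phi> = slash k A (\<lambda>z. qpar z ^ m) \<and> Im (moebius A z) \<le> 1) \<Longrightarrow>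
       \<exists>\<rho>. (\<forall>\<phi>\<in>U. \<rho> \<phi> \<in> G \<and> \<phi> = slash k (\<rho> \<phi>) (\<lambda>z. qpar z ^ m) \<and> Im (moebius (\<rho> \<phi>) z) \<le> 1) \<and>
         (\<lambda>\<phi>. (Im (moebius (\<rho> \<phi>) z))\<^sup>2) summable_on U \<and> (\<Sum>\<^sub>\<infinity>\<phi>\<in>U. (Im (moebius (\<rho> \<phi>) z))\<^sup>2) \<le> C"
    using strip_reps[OF K] by blast
  have main: "cmod (poincare k (\<lambda>z. qpar z ^ m) z - qpar z ^ m) \<le> C * Im z ^ 4 / Im z ^ (2 * k)"
    if k: "k \<ge> 2" and z: "Im z \<ge> 1" "0 \<le> Re z" "Re z \<le> 1" for k m z
  proof -
    let ?h = "\<lambda>z. qpar z ^ m"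
    define y where "y = Im z"
    define w where "w = Complex (Re z) 1"
    define U where "U = pfam k ?h - {slash k (mat 1) ?h}"
    have zu: "z \<in> uhp" and wu: "w \<in> uhp" and y: "y \<ge> 1" using z by (auto simp: uhp_def w_def y_def)
    have wK: "w \<in> K" using z by (auto simp: K_def w_def in_cbox_complex_iff)
    have Iml: "Im (moebius A w) \<le> 1" if "A \<in> G" for A
      using Im_moebius_le[OF that _ wu] Im_moebius_stab[OF that, of w] by (cases "A$2$1 = 0") (auto simp: w_def)
    have "\<exists>A\<in>G. \<phi> = slash k A ?h \<and> Im (moebius A w) \<le> 1" if "\<phi> \<in> U" for \<phi>
      using that Iml unfolding U_def pfam_def by blast
    moreover have "U \<subseteq> pfam k ?h" by (auto simp: U_def)
    ultimately obtain \<rho> where \<rho>: "\<And>\<phi>. \<phi> \<in> U \<Longrightarrow> \<rho> \<phi> \<in> G \<and> \<phi> = slash k (\<rho> \<phi>) ?h"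
      and s: "(\<lambda>\<phi>. (Im (moebius (\<rho> \<phi>) w))\<^sup>2) summable_on U" "(\<Sum>\<^sub>\<infinity>\<phi>\<in>U. (Im (moebius (\<rho> \<phi>) w))\<^sup>2) \<le> C"
      using C(2)[OF wK] by metis
    have le: "cmod (\<phi> z) \<le> y ^ 4 / y ^ (2 * k) * (Im (moebius (\<rho> \<phi>) w))\<^sup>2" if \<phi>: "\<phi> \<in> U" for \<phi>
    proof -
      define A where "A = \<rho> \<phi>"
      have A: "A \<in> G" "\<phi> = slash k A ?h" using \<rho>[OF \<phi>] by (auto simp: A_def)
      have c: "A$2$1 \<noteq> 0" using slash_qpar_stab[OF A(1)] A(2) \<phi> by (auto simp: U_def)
      have jy: "cmod (aut_factor A z) \<ge> y" using aut_factor_ge[OF A(1) c zu] by (simp add: y_def)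
      have "(cmod (aut_factor A w))\<^sup>2 \<le> (cmod (aut_factor A z))\<^sup>2"
        using y one_le_power[OF y, of 2] mult_left_mono[of 1 "y\<^sup>2" "(A$2$1)\<^sup>2"]
        by (simp add: cmod_power2 aut_factor_def w_def y_def power_mult_distrib)
      then have jw: "cmod (aut_factor A w) \<le> cmod (aut_factor A z)" by (rule power2_le_imp_le) simp
      have jwp: "cmod (aut_factor A w) > 0" using aut_factor_nz[OF det_G[OF A(1)] wu] by simp
      have "cmod (aut_factor A w) ^ 4 * y ^ (2 * k - 4) \<le> cmod (aut_factor A z) ^ 4 * cmod (aut_factor A z) ^ (2 * k - 4)"
        using y jy jw by (intro mult_mono power_mono) auto
      also have "\<dots> = cmod (aut_factor A z) ^ (2 * k)" using k by (simp flip: power_add)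
      finally have p: "cmod (aut_factor A w) ^ 4 * y ^ (2 * k - 4) \<le> cmod (aut_factor A z) ^ (2 * k)" .
      have pp: "cmod (aut_factor A w) ^ 4 * y ^ (2 * k - 4) > 0" using jwp y by simp
      have "cmod (\<phi> z) = cmod (qpar (moebius A z) ^ m) / cmod (aut_factor A z) ^ (2 * k)"
        using zu by (simp add: A(2) slash_def norm_divide norm_power)
      also have "\<dots> \<le> 1 / cmod (aut_factor A z) ^ (2 * k)"
        using norm_qpar_power_le moebius_G_uhp[OF A(1) zu] by (intro divide_right_mono) auto
      also have "\<dots> \<le> 1 / (cmod (aut_factor A w) ^ 4 * y ^ (2 * k - 4))"
        using p pp by (intro divide_left_mono) auto
      also have "\<dots> = 1 / y ^ (2 * k - 4) * (1 / (cmod (aut_factor A w))\<^sup>2)\<^sup>2"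
        by (simp add: power_divide flip: power_mult)
      also have "1 / (cmod (aut_factor A w))\<^sup>2 = Im (moebius A w)"
        using Im_moebius[OF det_G[OF A(1)] wu] by (simp add: w_def)
      also have "1 / y ^ (2 * k - 4) = y ^ 4 / y ^ (2 * k)"
      proof -
        have "y ^ (2 * k) = y ^ 4 * y ^ (2 * k - 4)" using k by (simp flip: power_add)
        then show ?thesis using y by simp
      qed
      finally show ?thesis by (simp add: A_def)
    qed
    have sc: "(\<lambda>\<phi>. y ^ 4 / y ^ (2 * k) * (Im (moebius (\<rho> \<phi>) w))\<^sup>2) summable_on U"
      using s(1) by (intro summable_on_cmult_right)
    have "cmod (poincare k ?h z - slash k (mat 1) ?h z) \<le> (\<Sum>\<^sub>\<infinity>\<phi>\<in>U. y ^ 4 / y ^ (2 * k) * (Im (moebius (\<rho> \<phi>) w))\<^sup>2)"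
      unfolding U_def by (rule norm_poincare_diff_le[OF dominated_qpar[OF k]]) (use sc le in \<open>auto simp: U_def\<close>)
    also have "\<dots> = y ^ 4 / y ^ (2 * k) * (\<Sum>\<^sub>\<infinity>\<phi>\<in>U. (Im (moebius (\<rho> \<phi>) w))\<^sup>2)"
      by (rule infsum_cmult_right')
    also have "\<dots> \<le> y ^ 4 / y ^ (2 * k) * C" using s(2) y by (intro mult_left_mono) auto
    finally show ?thesis using zu by (simp add: slash_def y_def mult.commute)
  qed
  show ?thesis
  proof (rule that[OF C(1)])
    fix k m :: nat and z :: complex assume k: "k \<ge> 2" and z: "Im z \<ge> 1"
    \<comment> \<open>Both sides have period 1, so base points on a compact segment suffice.\<close>
    define n where "n = - \<lfloor>Re z\<rfloor>"
    have "0 \<le> Re (z + of_int n)" "Re (z + of_int n) \<le> 1" unfolding n_def by (simp_all, linarith+)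
    then have "cmod (poincare k (\<lambda>z. qpar z ^ m) (z + of_int n) - qpar (z + of_int n) ^ m) \<le> C * Im z ^ 4 / Im z ^ (2 * k)"
      using main[OF k, of "z + of_int n" m] z by simp
    moreover have "poincare k (\<lambda>z. qpar z ^ m) (z + of_int n) = poincare k (\<lambda>z. qpar z ^ m) z"
      using poincare_weight[OF translation_G[of n], of z k "\<lambda>z. qpar z ^ m"] z by (simp add: uhp_def)
    ultimately show "cmod (poincare k (\<lambda>z. qpar z ^ m) z - qpar z ^ m) \<le> C * Im z ^ 4 / Im z ^ (2 * k)" by simp
  qed
qed

text \<open>On an orbit that never rises above height 1 no term stands out: in invariant norm each
  is at most \<open>Im (moebius A z) ^ k\<close>, and \<open>k - 2\<close> of these factors may be
  dropped.\<close>

lemma poincare_qpar_low: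
  assumes K: "compact K" "K \<subseteq> uhp"
  obtains C where "C > 0"
    "\<And>k m z. k \<ge> 2 \<Longrightarrow> z \<in> K \<Longrightarrow> (\<And>A. A \<in> G \<Longrightarrow> Im (moebius A z) \<le> 1) \<Longrightarrow>
        cmod (poincare k (\<lambda>z. qpar z ^ m) z) * Im z ^ k \<le> C"
proof -
  obtain C where C: "C > 0" "\<And>z k m U. z \<in> K \<Longrightarrow> U \<subseteq> pfam k (\<lambda>z. qpar z ^ m) \<Longrightarrow>
       (\<And>\<phi>. \<phi> \<in> U \<Longrightarrow> \<exists>A\<in>G. \<phi> = slash k A (\<lambda>z. qpar z ^ m) \<and> Im (moebius A z) \<le> 1) \<Longrightarrow>
       \<exists>\<rho>. (\<forall>\<phi>\<in>U. \<rho> \<phi> \<in> G \<and> \<phi> = slash k (\<rho> \<phi>) (\<lambda>z. qpar z ^ m) \<and> Im (moebius (\<rho> \<phi>) z) \<le> 1) \<and>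
         (\<lambda>\<phi>. (Im (moebius (\<rho> \<phi>) z))\<^sup>2) summable_on U \<and> (\<Sum>\<^sub>\<infinity>\<phi>\<in>U. (Im (moebius (\<rho> \<phi>) z))\<^sup>2) \<le> C"
    using strip_reps[OF K] by blast
  show ?thesis
  proof (rule that[OF C(1)])
    fix k m :: nat and z :: complex
    assume k: "k \<ge> 2" and z: "z \<in> K" and low: "\<And>A. A \<in> G \<Longrightarrow> Im (moebius A z) \<le> 1"
    let ?h = "\<lambda>z. qpar z ^ m"
    have zu: "z \<in> uhp" using z K by auto
    have "\<exists>A\<in>G. \<phi> = slash k A ?h \<and> Im (moebius A z) \<le> 1" if "\<phi> \<in> pfam k ?h" for \<phi>
      using that low unfolding pfam_def by blast
    then obtain \<rho> where \<rho>: "\<And>\<phi>. \<phi> \<in> pfam k ?h \<Longrightarrow> \<rho> \<phi> \<in> G \<and> \<phi> = slash k (\<rho> \<phi>) ?h"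
      and s: "(\<lambda>\<phi>. (Im (moebius (\<rho> \<phi>) z))\<^sup>2) summable_on pfam k ?h" "(\<Sum>\<^sub>\<infinity>\<phi>\<in>pfam k ?h. (Im (moebius (\<rho> \<phi>) z))\<^sup>2) \<le> C"
      using C(2)[OF z subset_refl] by metis
    have yk: "Im z ^ k > 0" using zu by (simp add: uhp_def)
    have le: "cmod (\<phi> z) \<le> 1 / Im z ^ k * (Im (moebius (\<rho> \<phi>) z))\<^sup>2" if \<phi>: "\<phi> \<in> pfam k ?h" for \<phi>
    proof -
      define A where "A = \<rho> \<phi>"
      have A: "A \<in> G" "\<phi> = slash k A ?h" using \<rho>[OF \<phi>] by (auto simp: A_def)
      have i: "0 \<le> Im (moebius A z)" "Im (moebius A z) \<le> 1" using moebius_G_uhp[OF A(1) zu] low[OF A(1)] by (auto simp: uhp_def)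
      have "cmod (\<phi> z) * Im z ^ k = cmod (qpar (moebius A z) ^ m) * Im (moebius A z) ^ k"
        unfolding A(2) by (rule norm_slash[OF det_G[OF A(1)] zu])
      also have "\<dots> \<le> 1 * (Im (moebius A z))\<^sup>2"
        using norm_qpar_power_le[OF moebius_G_uhp[OF A(1) zu]] i k
        by (intro mult_mono power_decreasing) auto
      finally show ?thesis using yk by (simp add: A_def pos_le_divide_eq)
    qed
    have sc: "(\<lambda>\<phi>. 1 / Im z ^ k * (Im (moebius (\<rho> \<phi>) z))\<^sup>2) summable_on pfam k ?h"
      using s(1) by (intro summable_on_cmult_right)
    have "cmod (poincare k ?h z) \<le> (\<Sum>\<^sub>\<infinity>\<phi>\<in>pfam k ?h. 1 / Im z ^ k * (Im (moebius (\<rho> \<phi>) z))\<^sup>2)"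
      by (rule norm_poincare_le[OF dominated_qpar[OF k] sc le])
    also have "\<dots> = 1 / Im z ^ k * (\<Sum>\<^sub>\<infinity>\<phi>\<in>pfam k ?h. (Im (moebius (\<rho> \<phi>) z))\<^sup>2)"
      by (rule infsum_cmult_right')
    also have "\<dots> \<le> 1 / Im z ^ k * C" using s(2) yk by (intro mult_left_mono) auto
    finally show "cmod (poincare k ?h z) * Im z ^ k \<le> C" using yk by (simp add: pos_le_divide_eq)
  qed
qed

lemma norm_poincare_invariant:
  assumes "A \<in> G" "z \<in> uhp"
  shows "cmod (poincare k h (moebius A z)) * Im (moebius A z) ^ k = cmod (poincare k h z) * Im z ^ k"
  using poincare_weight[OF assms, of k h] aut_factor_nz[OF det_G[OF assms(1)] assms(2)] Im_moebius[OF det_G[OF assms(1)] assms(2)]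
  by (simp add: norm_mult norm_power power_divide power_mult)

text \<open>The invariant norm is bounded on orbits that rise above height 1 and on those that do
  not. On the former the error contributes \<open>Im z ^ 4 / Im z ^ k\<close>, hence
  \<open>k \<ge> 4\<close>, and the main term at most \<open>fact k\<close>; dependence on
  \<open>k\<close> is harmless here.\<close>

lemma poincare_qpar_cusp_form:
  assumes G: "G = \<Union>\<Gamma>" and k4: "k \<ge> 4" and m: "m \<ge> 1"
  shows "poincare k (\<lambda>z. qpar z ^ m) \<in> cusp_forms \<Gamma> k"
proof -
  let ?h = "\<lambda>z. qpar z ^ m"
  have k: "k \<ge> 2" using k4 by simp
  obtain K where K: "compact K" "K \<subseteq> uhp" "\<And>z. z \<in> uhp \<Longrightarrow> \<exists>A\<in>G. moebius A z \<in> K \<or> Im (moebius A z) > 1"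
    using cocompact_G[of 1] by blast
  obtain C1 where C1: "C1 > 0"
    "\<And>k m z. k \<ge> 2 \<Longrightarrow> z \<in> K \<Longrightarrow> (\<And>A. A \<in> G \<Longrightarrow> Im (moebius A z) \<le> 1) \<Longrightarrow>
        cmod (poincare k (\<lambda>z. qpar z ^ m) z) * Im z ^ k \<le> C1"
    using poincare_qpar_low[OF K(1,2)] by blast
  obtain C2 where C2: "C2 > 0"
    "\<And>k m z. k \<ge> 2 \<Longrightarrow> Im z \<ge> 1 \<Longrightarrow> cmod (poincare k (\<lambda>z. qpar z ^ m) z - qpar z ^ m) \<le> C2 * Im z ^ 4 / Im z ^ (2 * k)"
    using poincare_qpar_high by blast
  have high: "cmod (poincare k ?h z) * Im z ^ k \<le> fact k + C2" if z: "Im z > 1" for z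
  proof -
    have y: "Im z > 1" "Im z > 0" using z by auto
    have "cmod (poincare k ?h z) \<le> cmod (qpar z ^ m) + C2 * Im z ^ 4 / Im z ^ (2 * k)"
      using C2(2)[OF k, of z m] norm_triangle_ineq2[of "poincare k ?h z" "qpar z ^ m"] z by simp
    then have "cmod (poincare k ?h z) * Im z ^ k \<le> (cmod (qpar z ^ m) + C2 * Im z ^ 4 / Im z ^ (2 * k)) * Im z ^ k"
      using y by (intro mult_right_mono) auto
    also have "\<dots> = Im z ^ k * cmod (qpar z ^ m) + C2 * (Im z ^ 4 / Im z ^ k)"
    proof -
      have "Im z ^ (2 * k) = Im z ^ k * Im z ^ k" by (simp add: power_add[symmetric] mult_2)
      then show ?thesis using y by (simp add: field_simps)
    qed
    also have "\<dots> \<le> Im z ^ k * exp (- Im z) + C2 * 1"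
    proof (intro add_mono mult_left_mono)
      have "cmod (qpar z ^ m) \<le> cmod (qpar z) ^ 1"
        unfolding norm_power using m y by (intro power_decreasing) (auto simp: norm_qpar)
      also have "\<dots> \<le> exp (- Im z)"
        using pi_gt3 y mult_right_mono[of 1 "2 * pi" "Im z"] by (simp add: norm_qpar)
      finally show "cmod (qpar z ^ m) \<le> exp (- Im z)" .
      have "Im z ^ 4 \<le> Im z ^ k" using k4 y by (intro power_increasing) auto
      then show "Im z ^ 4 / Im z ^ k \<le> 1" using y by simp
    qed (use y C2 in auto)
    also have "\<dots> \<le> fact k + C2" using power_exp_le[of "Im z" k] y by simp
    finally show ?thesis .
  qed
  have "cmod (poincare k ?h z) * Im z ^ k \<le> fact k + C2 + C1" if z: "z \<in> uhp" for z
  proof (cases "\<exists>A\<in>G. Im (moebius A z) > 1")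
    case True
    then obtain A where A: "A \<in> G" "Im (moebius A z) > 1" by blast
    then show ?thesis using high[OF A(2)] norm_poincare_invariant[OF A(1) z, of k ?h] C1(1) by simp
  next
    case False
    then obtain A where A: "A \<in> G" "moebius A z \<in> K" using K(3)[OF z] by blast
    have "Im (moebius B (moebius A z)) \<le> 1" if B: "B \<in> G" for B
    proof -
      have "B ** A \<in> G" using A B by (simp add: mult_G)
      then have "Im (moebius (B ** A) z) \<le> 1" using False by (auto simp: not_less)
      then show ?thesis using A B z by (simp add: moebius_mult det_G)
    qed
    then have "cmod (poincare k ?h (moebius A z)) * Im (moebius A z) ^ k \<le> C1"
      by (rule C1(2)[OF k A(2)])
    then show ?thesis using norm_poincare_invariant[OF A(1) z, of k ?h] C2(1)
      by (simp add: add_increasing)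
  qed
  then show ?thesis
    using k by (intro poincare_cusp_form[OF G dominated_qpar[OF k]] holomorphic_intros) auto
qed

text \<open>In invariant form a term depends only on the hyperbolic distance d from \<open>z\<close>
  to the orbit point \<open>\<zeta>\<close> of \<open>w\<close>: it is the k-th power of the
  reciprocal of 4 cosh(d/2)^2.\<close>

lemma kernel_term:
  assumes A: "A \<in> G" and z: "z \<in> uhp" and w: "w \<in> uhp"
  defines "\<zeta> \<equiv> moebius (adj2 A) w"
  shows "cmod (slash k A (kerh k w) z) * Im z ^ k * Im w ^ k = (Im z * Im \<zeta> / (cmod (z - cnj \<zeta>))\<^sup>2) ^ k"
proof -
  have \<zeta>: "\<zeta> \<in> uhp" "moebius A \<zeta> = w" using A w by (auto simp: \<zeta>_def moebius_G_uhp adj2_G moebius_G_adj2)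
  have Az: "moebius A z \<in> uhp" using moebius_G_uhp[OF A z] .
  have "(cmod (moebius A z - cnj w))\<^sup>2 / (Im (moebius A z) * Im w) = (cmod (z - cnj \<zeta>))\<^sup>2 / (Im z * Im \<zeta>)"
    using hyp_dist_invariant(2)[OF det_G[OF A] z \<zeta>(1)] by (simp add: \<zeta>(2))
  then have "inverse ((cmod (moebius A z - cnj w))\<^sup>2 / (Im (moebius A z) * Im w)) = inverse ((cmod (z - cnj \<zeta>))\<^sup>2 / (Im z * Im \<zeta>))"
    by (rule arg_cong)
  then have eq: "Im (moebius A z) * Im w / (cmod (moebius A z - cnj w))\<^sup>2 = Im z * Im \<zeta> / (cmod (z - cnj \<zeta>))\<^sup>2"
    by (simp only: inverse_divide)
  have "cmod (slash k A (kerh k w) z) * Im z ^ k * Im w ^ k = cmod (kerh k w (moebius A z)) * Im (moebius A z) ^ k * Im w ^ k"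
    using norm_slash[OF det_G[OF A] z] by simp
  also have "\<dots> = (Im (moebius A z) * Im w / (cmod (moebius A z - cnj w))\<^sup>2) ^ k"
    by (simp add: kerh_def norm_divide norm_power power_divide power_mult_distrib power_mult)
  finally show ?thesis unfolding eq .
qed

end

subsection \<open>Peak forms on compact sets\<close>

lemma power_split2: "k \<ge> 2 \<Longrightarrow> x ^ k = x ^ (k - 2) * x\<^sup>2" for x :: "'a::monoid_mult"
  by (metis le_add_diff_inverse2 power_add)

text \<open>Arithmetic-geometric mean of the two heights; the value 1/4 is attained at
  \<open>\<zeta> = z\<close>.\<close>

lemma kernel_ratio_le:
  assumes "z \<in> uhp" "\<zeta> \<in> uhp"
  shows "0 \<le> Im z * Im \<zeta> / (cmod (z - cnj \<zeta>))\<^sup>2" "Im z * Im \<zeta> / (cmod (z - cnj \<zeta>))\<^sup>2 \<le> 1/4"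
proof -
  have p: "Im z > 0" "Im \<zeta> > 0" using assms by (auto simp: uhp_def)
  then show "0 \<le> Im z * Im \<zeta> / (cmod (z - cnj \<zeta>))\<^sup>2" by simp
  have "(Im z + Im \<zeta>)\<^sup>2 \<le> (cmod (z - cnj \<zeta>))\<^sup>2"
    using norm_diff_cnj_ge[OF assms(2,1)] p by (intro power_mono) auto
  moreover have "4 * (Im z * Im \<zeta>) \<le> (Im z + Im \<zeta>)\<^sup>2"
    using sum_squares_ge_zero[of "Im z - Im \<zeta>" 0] by (simp add: power2_eq_square algebra_simps)
  moreover have "(cmod (z - cnj \<zeta>))\<^sup>2 > 0" using uhp_minus_cnj_nz[OF assms] by simp
  ultimately show "Im z * Im \<zeta> / (cmod (z - cnj \<zeta>))\<^sup>2 \<le> 1/4" by (simp add: pos_divide_le_eq)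
qed

text \<open>Replaces the base point \<open>z\<close> by the fixed point \<open>\<i>\<close> at the
  price of a factor that is bounded on compact sets.\<close>

lemma kernel_compare:
  assumes "z \<in> uhp" "\<zeta> \<in> uhp"
  shows "1 / cmod (z - cnj \<zeta>) ^ 4 \<le> (1 + cmod (\<i> - z) / Im z) ^ 4 * (1 / cmod (\<i> - cnj \<zeta>) ^ 4)"
proof -
  have p: "Im z > 0" "Im \<zeta> > 0" using assms by (auto simp: uhp_def)
  have g: "cmod (z - cnj \<zeta>) \<ge> Im z" using norm_diff_cnj_ge[OF assms(2,1)] p by linarith
  have iz: "\<i> \<in> uhp" by (simp add: uhp_def)
  have n: "cmod (z - cnj \<zeta>) > 0" "cmod (\<i> - cnj \<zeta>) > 0"
    using uhp_minus_cnj_nz[OF assms] uhp_minus_cnj_nz[OF iz assms(2)] by auto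
  have "cmod (\<i> - cnj \<zeta>) \<le> cmod (z - cnj \<zeta>) + cmod (\<i> - z)"
    using norm_triangle_ineq[of "z - cnj \<zeta>" "\<i> - z"] by simp
  also have "cmod (\<i> - z) \<le> cmod (\<i> - z) / Im z * cmod (z - cnj \<zeta>)"
    using g p mult_left_mono[OF g, of "cmod (\<i> - z)"] by (simp add: field_simps)
  finally have "cmod (\<i> - cnj \<zeta>) \<le> (1 + cmod (\<i> - z) / Im z) * cmod (z - cnj \<zeta>)" by (simp add: algebra_simps)
  then have "cmod (\<i> - cnj \<zeta>) ^ 4 \<le> ((1 + cmod (\<i> - z) / Im z) * cmod (z - cnj \<zeta>)) ^ 4"
    by (intro power_mono) auto
  then have le: "cmod (\<i> - cnj \<zeta>) ^ 4 \<le> (1 + cmod (\<i> - z) / Im z) ^ 4 * cmod (z - cnj \<zeta>) ^ 4"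
    by (simp only: power_mult_distrib)
  have n4: "cmod (z - cnj \<zeta>) ^ 4 > 0" "cmod (\<i> - cnj \<zeta>) ^ 4 > 0" using n by (auto simp only: zero_less_power)
  show ?thesis using le n4 by (simp add: divide_simps mult.commute)
qed

context cusped_group begin

text \<open>Reindexes the series of \<open>kerh k w\<close> by orbit points of \<open>w\<close>.
  Packing makes the squared ratios summable, and separation keeps all but the identity term away
  from \<open>w\<close>; the constants do not depend on \<open>k\<close>.\<close>

lemma kernel_points:
  assumes K: "compact K" "K \<subseteq> uhp"
  obtains \<epsilon> C where "\<epsilon> > 0" "\<epsilon> \<le> 1" "C > 0"
    "\<And>k w. w \<in> K \<Longrightarrow> \<exists>\<zeta>. (\<forall>\<phi>\<in>pfam k (kerh k w). \<zeta> \<phi> \<in> uhp \<and>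
        (\<forall>z\<in>uhp. cmod (\<phi> z) * Im z ^ k * Im w ^ k = (Im z * Im (\<zeta> \<phi>) / (cmod (z - cnj (\<zeta> \<phi>)))\<^sup>2) ^ k) \<and>
        (\<phi> \<noteq> slash k (mat 1) (kerh k w) \<longrightarrow> (cmod (\<zeta> \<phi> - w))\<^sup>2 \<ge> \<epsilon>\<^sup>2 * Im (\<zeta> \<phi>) * Im w)) \<and>
        (\<forall>z\<in>uhp. (\<lambda>\<phi>. (Im (\<zeta> \<phi>))\<^sup>2 / cmod (z - cnj (\<zeta> \<phi>)) ^ 4) summable_on pfam k (kerh k w) \<and>
          (\<Sum>\<^sub>\<infinity>\<phi>\<in>pfam k (kerh k w). (Im (\<zeta> \<phi>))\<^sup>2 / cmod (z - cnj (\<zeta> \<phi>)) ^ 4) \<le> C / (Im z)\<^sup>2)"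
proof -
  obtain \<epsilon> where \<epsilon>: "\<epsilon> > 0" "\<epsilon> \<le> 1"
    "\<And>w A B. w \<in> K \<Longrightarrow> A \<in> G \<Longrightarrow> B \<in> G \<Longrightarrow> moebius A w \<noteq> moebius B w \<Longrightarrow>
       (cmod (moebius A w - moebius B w))\<^sup>2 \<ge> \<epsilon>\<^sup>2 * Im (moebius A w) * Im (moebius B w)"
    using orbit_separated[OF K] by blast
  show ?thesis
  proof (rule that[OF \<epsilon>(1,2)])
    show "packing_const \<epsilon> > 0" using \<epsilon>(1) by (simp add: packing_const_def)
    fix k w assume w: "w \<in> K"
    let ?h = "kerh k w"
    have wu: "w \<in> uhp" using w K by auto
    have "\<exists>A\<in>G. \<phi> = slash k A ?h" if "\<phi> \<in> pfam k ?h" for \<phi> using that unfolding pfam_def by blast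
    then obtain \<rho> where \<rho>: "\<And>\<phi>. \<phi> \<in> pfam k ?h \<Longrightarrow> \<rho> \<phi> \<in> G \<and> \<phi> = slash k (\<rho> \<phi>) ?h" by metis
    define \<zeta> where "\<zeta> = (\<lambda>\<phi>. moebius (adj2 (\<rho> \<phi>)) w)"
    have adjG: "adj2 (\<rho> \<phi>) \<in> G" if "\<phi> \<in> pfam k ?h" for \<phi> using \<rho>[OF that] adj2_G by simp
    have \<zeta>u: "\<zeta> \<phi> \<in> uhp" if "\<phi> \<in> pfam k ?h" for \<phi> using adjG[OF that] wu moebius_G_uhp by (simp add: \<zeta>_def)
    have pm: "A = B \<or> A = - B" if "adj2 A = adj2 B \<or> adj2 A = - adj2 B" for A B
      using that by (auto simp: mat2_eq_iff)
    have eqD: "\<rho> \<psi> = \<rho> \<phi> \<or> \<rho> \<psi> = - \<rho> \<phi>" if "\<phi> \<in> pfam k ?h" "\<psi> \<in> pfam k ?h" "\<zeta> \<phi> = \<zeta> \<psi>" for \<phi> \<psi>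
      by (rule pm, rule moebius_G_eqD[OF adjG[OF that(1)] adjG[OF that(2)] wu]) (use that(3) in \<open>simp add: \<zeta>_def\<close>)
    have inj: "inj_on \<zeta> (pfam k ?h)"
    proof (rule inj_onI)
      fix \<phi> \<psi> assume p: "\<phi> \<in> pfam k ?h" "\<psi> \<in> pfam k ?h" "\<zeta> \<phi> = \<zeta> \<psi>"
      then have "slash k (\<rho> \<psi>) ?h = slash k (\<rho> \<phi>) ?h" using eqD[OF p] by auto
      then show "\<phi> = \<psi>" using \<rho>[OF p(1)] \<rho>[OF p(2)] by simp
    qed
    have sep: "(cmod (\<zeta> \<phi> - \<zeta> \<psi>))\<^sup>2 \<ge> \<epsilon>\<^sup>2 * Im (\<zeta> \<phi>) * Im (\<zeta> \<psi>)" if "\<phi> \<in> pfam k ?h" "\<psi> \<in> pfam k ?h" "\<zeta> \<phi> \<noteq> \<zeta> \<psi>" for \<phi> \<psi>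
      using that \<epsilon>(3)[OF w adjG[OF that(1)] adjG[OF that(2)]] by (simp add: \<zeta>_def)
    have sep_w: "(cmod (\<zeta> \<phi> - w))\<^sup>2 \<ge> \<epsilon>\<^sup>2 * Im (\<zeta> \<phi>) * Im w"
      if p: "\<phi> \<in> pfam k ?h" and ne: "\<phi> \<noteq> slash k (mat 1) ?h" for \<phi>
    proof -
      have "\<zeta> \<phi> \<noteq> moebius (mat 1) w"
      proof
        assume "\<zeta> \<phi> = moebius (mat 1) w"
        then have "adj2 (\<rho> \<phi>) = mat 1 \<or> adj2 (\<rho> \<phi>) = - mat 1"
          using moebius_G_eqD[OF one_G adjG[OF p] wu] by (simp add: \<zeta>_def)
        then have "\<rho> \<phi> = mat 1 \<or> \<rho> \<phi> = - mat 1" by (auto simp: mat2_eq_iff)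
        then have "slash k (\<rho> \<phi>) ?h = slash k (mat 1) ?h" by auto
        then show False using \<rho>[OF p] ne by simp
      qed
      then show ?thesis using \<epsilon>(3)[OF w adjG[OF p] one_G] by (simp add: \<zeta>_def)
    qed
    have trm: "cmod (\<phi> z) * Im z ^ k * Im w ^ k = (Im z * Im (\<zeta> \<phi>) / (cmod (z - cnj (\<zeta> \<phi>)))\<^sup>2) ^ k"
      if p: "\<phi> \<in> pfam k ?h" and z: "z \<in> uhp" for \<phi> z
    proof -
      have "\<rho> \<phi> \<in> G" "\<phi> = slash k (\<rho> \<phi>) ?h" using \<rho>[OF p] by auto
      then show ?thesis using kernel_term[of "\<rho> \<phi>" z w k] z wu by (simp add: \<zeta>_def)
    qed
    note ps = packing_sum[OF \<epsilon>(1,2) _ inj \<zeta>u sep]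
    show "\<exists>\<zeta>. (\<forall>\<phi>\<in>pfam k ?h. \<zeta> \<phi> \<in> uhp \<and>
        (\<forall>z\<in>uhp. cmod (\<phi> z) * Im z ^ k * Im w ^ k = (Im z * Im (\<zeta> \<phi>) / (cmod (z - cnj (\<zeta> \<phi>)))\<^sup>2) ^ k) \<and>
        (\<phi> \<noteq> slash k (mat 1) ?h \<longrightarrow> (cmod (\<zeta> \<phi> - w))\<^sup>2 \<ge> \<epsilon>\<^sup>2 * Im (\<zeta> \<phi>) * Im w)) \<and>
        (\<forall>z\<in>uhp. (\<lambda>\<phi>. (Im (\<zeta> \<phi>))\<^sup>2 / cmod (z - cnj (\<zeta> \<phi>)) ^ 4) summable_on pfam k ?h \<and>
          (\<Sum>\<^sub>\<infinity>\<phi>\<in>pfam k ?h. (Im (\<zeta> \<phi>))\<^sup>2 / cmod (z - cnj (\<zeta> \<phi>)) ^ 4) \<le> packing_const \<epsilon> / (Im z)\<^sup>2)"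
      by (rule exI[of _ \<zeta>]) (use \<zeta>u trm sep_w ps in simp)
  qed
qed

text \<open>At \<open>z = w\<close> the identity term is exactly \<open>(1/4) ^ k\<close>, while the
  ratios of all others are at most a fixed \<open>\<tau> < 1/4\<close>; for large \<open>k\<close>
  their sum is at most half the peak. At other points \<open>k - 2\<close> factors are at most 1/4
  and the remaining square is summable.\<close>

lemma kernel_peak:
  assumes K: "compact K" "K \<subseteq> uhp" and G: "G = \<Union>\<Gamma>"
  obtains C k0 where "C > 0"
    "\<And>k w z. k \<ge> k0 \<Longrightarrow> w \<in> K \<Longrightarrow> z \<in> uhp \<Longrightarrow> cmod (poincare k (kerh k w) z) * Im z ^ k * Im w ^ k \<le> C * (1/4) ^ k"
    "\<And>k w. k \<ge> k0 \<Longrightarrow> w \<in> K \<Longrightarrow> cmod (poincare k (kerh k w) w) * Im w ^ (2 * k) \<ge> (1/2) * (1/4) ^ k"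
    "\<And>k w. k \<ge> k0 \<Longrightarrow> w \<in> K \<Longrightarrow> poincare k (kerh k w) \<in> cusp_forms \<Gamma> k"
proof -
  obtain \<epsilon> C where \<epsilon>: "\<epsilon> > 0" "\<epsilon> \<le> 1" "C > 0" and pts:
    "\<And>k w. w \<in> K \<Longrightarrow> \<exists>\<zeta>. (\<forall>\<phi>\<in>pfam k (kerh k w). \<zeta> \<phi> \<in> uhp \<and>
        (\<forall>z\<in>uhp. cmod (\<phi> z) * Im z ^ k * Im w ^ k = (Im z * Im (\<zeta> \<phi>) / (cmod (z - cnj (\<zeta> \<phi>)))\<^sup>2) ^ k) \<and>
        (\<phi> \<noteq> slash k (mat 1) (kerh k w) \<longrightarrow> (cmod (\<zeta> \<phi> - w))\<^sup>2 \<ge> \<epsilon>\<^sup>2 * Im (\<zeta> \<phi>) * Im w)) \<and>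
        (\<forall>z\<in>uhp. (\<lambda>\<phi>. (Im (\<zeta> \<phi>))\<^sup>2 / cmod (z - cnj (\<zeta> \<phi>)) ^ 4) summable_on pfam k (kerh k w) \<and>
          (\<Sum>\<^sub>\<infinity>\<phi>\<in>pfam k (kerh k w). (Im (\<zeta> \<phi>))\<^sup>2 / cmod (z - cnj (\<zeta> \<phi>)) ^ 4) \<le> C / (Im z)\<^sup>2)"
    by (rule kernel_points[OF K]) (rule that)
  \<comment> \<open>The kernel ratio at the minimal separation: |w - cnj \<zeta>|^2 equals |\<zeta>
    - w|^2 plus 4 times the product of the heights.\<close>
  define \<tau> where "\<tau> = 1 / (4 + \<epsilon>\<^sup>2)"
  have \<tau>: "0 < \<tau>" "4 * \<tau> < 1" "\<tau> \<le> 1/4" using \<epsilon> by (auto simp: \<tau>_def field_simps add_pos_pos)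
  obtain k1 :: nat where k1: "(4 * \<tau>) ^ k1 < \<tau>\<^sup>2 / (2 * C)"
    using real_arch_pow_inv[OF _ \<tau>(2), of "\<tau>\<^sup>2 / (2 * C)"] \<tau> \<epsilon> by auto
  define k0 where "k0 = max k1 2"
  have all: "(\<forall>z\<in>uhp. cmod (poincare k (kerh k w) z) * Im z ^ k * Im w ^ k \<le> (16 * C) * (1/4) ^ k) \<and>
      cmod (poincare k (kerh k w) w) * Im w ^ (2 * k) \<ge> (1/2) * (1/4) ^ k \<and>
      poincare k (kerh k w) \<in> cusp_forms \<Gamma> k" if k: "k \<ge> k0" and w: "w \<in> K" for k w
  proof -
    let ?h = "kerh k w"
    have k2: "k \<ge> 2" "k \<ge> k1" using k by (auto simp: k0_def)
    have wu: "w \<in> uhp" and v: "Im w > 0" using w K by (auto simp: uhp_def)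
    obtain \<zeta> where \<zeta>: "\<And>\<phi>. \<phi> \<in> pfam k ?h \<Longrightarrow> \<zeta> \<phi> \<in> uhp"
      "\<And>\<phi> z. \<phi> \<in> pfam k ?h \<Longrightarrow> z \<in> uhp \<Longrightarrow> cmod (\<phi> z) * Im z ^ k * Im w ^ k = (Im z * Im (\<zeta> \<phi>) / (cmod (z - cnj (\<zeta> \<phi>)))\<^sup>2) ^ k"
      "\<And>\<phi>. \<phi> \<in> pfam k ?h \<Longrightarrow> \<phi> \<noteq> slash k (mat 1) ?h \<Longrightarrow> (cmod (\<zeta> \<phi> - w))\<^sup>2 \<ge> \<epsilon>\<^sup>2 * Im (\<zeta> \<phi>) * Im w"
      "\<And>z. z \<in> uhp \<Longrightarrow> (\<lambda>\<phi>. (Im (\<zeta> \<phi>))\<^sup>2 / cmod (z - cnj (\<zeta> \<phi>)) ^ 4) summable_on pfam k ?h"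
      "\<And>z. z \<in> uhp \<Longrightarrow> (\<Sum>\<^sub>\<infinity>\<phi>\<in>pfam k ?h. (Im (\<zeta> \<phi>))\<^sup>2 / cmod (z - cnj (\<zeta> \<phi>)) ^ 4) \<le> C / (Im z)\<^sup>2"
      using pts[OF w, of k] by auto
    define t where "t = (\<lambda>z \<phi>. Im z * Im (\<zeta> \<phi>) / (cmod (z - cnj (\<zeta> \<phi>)))\<^sup>2)"
    have t01: "0 \<le> t z \<phi>" "t z \<phi> \<le> 1/4" if "\<phi> \<in> pfam k ?h" "z \<in> uhp" for \<phi> z
      using kernel_ratio_le[OF that(2) \<zeta>(1)[OF that(1)]] by (auto simp: t_def)
    have t2: "(t z \<phi>)\<^sup>2 = (Im z)\<^sup>2 * ((Im (\<zeta> \<phi>))\<^sup>2 / cmod (z - cnj (\<zeta> \<phi>)) ^ 4)" for z \<phi>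
      by (simp add: t_def power_divide power_mult_distrib flip: power_mult)
    have st2: "(\<lambda>\<phi>. (t z \<phi>)\<^sup>2) summable_on pfam k ?h" "(\<Sum>\<^sub>\<infinity>\<phi>\<in>pfam k ?h. (t z \<phi>)\<^sup>2) \<le> C" if z: "z \<in> uhp" for z
    proof -
      show "(\<lambda>\<phi>. (t z \<phi>)\<^sup>2) summable_on pfam k ?h"
        unfolding t2 by (intro summable_on_cmult_right \<zeta>(4) z)
      have "(\<Sum>\<^sub>\<infinity>\<phi>\<in>pfam k ?h. (t z \<phi>)\<^sup>2) = (Im z)\<^sup>2 * (\<Sum>\<^sub>\<infinity>\<phi>\<in>pfam k ?h. (Im (\<zeta> \<phi>))\<^sup>2 / cmod (z - cnj (\<zeta> \<phi>)) ^ 4)"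
        unfolding t2 by (rule infsum_cmult_right')
      also have "\<dots> \<le> (Im z)\<^sup>2 * (C / (Im z)\<^sup>2)" by (intro mult_left_mono \<zeta>(5) z) auto
      also have "\<dots> = C" using z by (simp add: uhp_def)
      finally show "(\<Sum>\<^sub>\<infinity>\<phi>\<in>pfam k ?h. (t z \<phi>)\<^sup>2) \<le> C" .
    qed
    have tk: "(t z \<phi>) ^ k \<le> s ^ (k - 2) * (t z \<phi>)\<^sup>2" if "0 \<le> t z \<phi>" "t z \<phi> \<le> s" for z \<phi> s
    proof -
      have "(t z \<phi>) ^ k = (t z \<phi>) ^ (k - 2) * (t z \<phi>)\<^sup>2" by (rule power_split2[OF k2(1)])
      then show ?thesis using that by (auto intro!: mult_right_mono power_mono)
    qed
    have nphi: "cmod (\<phi> z) \<le> 1 / (Im z ^ k * Im w ^ k) * (s ^ (k - 2) * (t z \<phi>)\<^sup>2)"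
      if "\<phi> \<in> pfam k ?h" "z \<in> uhp" "t z \<phi> \<le> s" for \<phi> z s
    proof -
      have "cmod (\<phi> z) * (Im z ^ k * Im w ^ k) = (t z \<phi>) ^ k" using \<zeta>(2)[OF that(1,2)] by (simp add: t_def mult.assoc)
      also have "\<dots> \<le> s ^ (k - 2) * (t z \<phi>)\<^sup>2" by (rule tk[OF t01(1)[OF that(1,2)] that(3)])
      finally have "cmod (\<phi> z) * (Im z ^ k * Im w ^ k) \<le> s ^ (k - 2) * (t z \<phi>)\<^sup>2" .
      moreover have "Im z ^ k * Im w ^ k > 0" using that v by (simp add: uhp_def)
      ultimately show ?thesis by (simp add: pos_le_divide_eq)
    qed
    have dom: "dominated k ?h"
      unfolding dominated_def
    proof (intro allI impI)
      fix C0 assume C0: "compact C0" "C0 \<subseteq> uhp"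
      have iu: "\<i> \<in> uhp" by (simp add: uhp_def)
      define b where "b = (\<lambda>z. 1 / (Im z ^ k * Im w ^ k) * (Im z)\<^sup>2 * (1 + cmod (\<i> - z) / Im z) ^ 4)"
      have "continuous_on C0 b" unfolding b_def
        by (intro continuous_intros) (use C0 v in \<open>auto simp: uhp_def\<close>)
      then obtain B where B: "B \<ge> 0" "\<And>z. z \<in> C0 \<Longrightarrow> b z \<le> B" using compact_bounded_above C0(1) by blast
      have "cmod (\<phi> z) \<le> B * ((Im (\<zeta> \<phi>))\<^sup>2 / cmod (\<i> - cnj (\<zeta> \<phi>)) ^ 4)" if p: "\<phi> \<in> pfam k ?h" and z: "z \<in> C0" for \<phi> z
      proof -
        have zu: "z \<in> uhp" using z C0 by auto
        have pos: "1 / (Im z ^ k * Im w ^ k) \<ge> 0" using zu v by (simp add: uhp_def)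
        have "cmod (\<phi> z) \<le> 1 / (Im z ^ k * Im w ^ k) * (1 ^ (k - 2) * (t z \<phi>)\<^sup>2)"
          using nphi[OF p zu, of 1] t01(2)[OF p zu] by simp
        also have "\<dots> = 1 / (Im z ^ k * Im w ^ k) * (Im z)\<^sup>2 * (Im (\<zeta> \<phi>))\<^sup>2 * (1 / cmod (z - cnj (\<zeta> \<phi>)) ^ 4)"
          by (simp add: t2)
        also have "\<dots> \<le> 1 / (Im z ^ k * Im w ^ k) * (Im z)\<^sup>2 * (Im (\<zeta> \<phi>))\<^sup>2 * ((1 + cmod (\<i> - z) / Im z) ^ 4 * (1 / cmod (\<i> - cnj (\<zeta> \<phi>)) ^ 4))"
          using pos by (intro mult_left_mono kernel_compare zu \<zeta>(1) p) auto
        also have "\<dots> = b z * ((Im (\<zeta> \<phi>))\<^sup>2 / cmod (\<i> - cnj (\<zeta> \<phi>)) ^ 4)" by (simp add: b_def)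
        also have "\<dots> \<le> B * ((Im (\<zeta> \<phi>))\<^sup>2 / cmod (\<i> - cnj (\<zeta> \<phi>)) ^ 4)"
          using B(2)[OF z] by (intro mult_right_mono) auto
        finally show ?thesis .
      qed
      moreover have "(\<lambda>\<phi>. B * ((Im (\<zeta> \<phi>))\<^sup>2 / cmod (\<i> - cnj (\<zeta> \<phi>)) ^ 4)) summable_on pfam k ?h"
        by (intro summable_on_cmult_right \<zeta>(4) iu)
      ultimately show "\<exists>M::(complex \<Rightarrow> complex) \<Rightarrow> real. M summable_on pfam k ?h \<and> (\<forall>\<phi>\<in>pfam k ?h. \<forall>z\<in>C0. cmod (\<phi> z) \<le> M \<phi>)"
        by blast
    qed
    have up: "cmod (poincare k ?h z) * Im z ^ k * Im w ^ k \<le> (16 * C) * (1/4) ^ k" if z: "z \<in> uhp" for z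
    proof -
      have pos: "Im z ^ k * Im w ^ k > 0" using z v by (simp add: uhp_def)
      have s: "(\<lambda>\<phi>. 1 / (Im z ^ k * Im w ^ k) * ((1/4) ^ (k - 2) * (t z \<phi>)\<^sup>2)) summable_on pfam k ?h"
        by (intro summable_on_cmult_right st2(1) z)
      have "cmod (poincare k ?h z) \<le> (\<Sum>\<^sub>\<infinity>\<phi>\<in>pfam k ?h. 1 / (Im z ^ k * Im w ^ k) * ((1/4) ^ (k - 2) * (t z \<phi>)\<^sup>2))"
        by (rule norm_poincare_le[OF dom s]) (rule nphi[OF _ z t01(2)[OF _ z]])
      also have "\<dots> = 1 / (Im z ^ k * Im w ^ k) * ((1/4) ^ (k - 2) * (\<Sum>\<^sub>\<infinity>\<phi>\<in>pfam k ?h. (t z \<phi>)\<^sup>2))"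
        by (simp only: infsum_cmult_right')
      also have "\<dots> \<le> 1 / (Im z ^ k * Im w ^ k) * ((1/4) ^ (k - 2) * C)"
        using pos by (intro mult_left_mono st2(2) z) auto
      finally have "cmod (poincare k ?h z) * (Im z ^ k * Im w ^ k) \<le> (1/4) ^ (k - 2) * C"
        using pos by (simp add: pos_le_divide_eq)
      moreover have "(1/4::real) ^ (k - 2) = 16 * (1/4) ^ k"
        using power_split2[OF k2(1), of "1/4::real"] by (simp only: power2_eq_square)
      ultimately show ?thesis by (simp add: mult_ac)
    qed
    have low: "cmod (poincare k ?h w) * Im w ^ (2 * k) \<ge> (1/2) * (1/4) ^ k"
    proof -
      let ?U = "pfam k ?h - {slash k (mat 1) ?h}"
      have vk: "Im w ^ k * Im w ^ k = Im w ^ (2 * k)" by (simp add: mult_2 power_add)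
      have pos: "Im w ^ (2 * k) > 0" using v by simp
      have t\<tau>: "t w \<phi> \<le> \<tau>" if p: "\<phi> \<in> pfam k ?h" and ne: "\<phi> \<noteq> slash k (mat 1) ?h" for \<phi>
      proof -
        have i: "Im (\<zeta> \<phi>) > 0" using \<zeta>(1)[OF p] by (simp add: uhp_def)
        have "(cmod (w - cnj (\<zeta> \<phi>)))\<^sup>2 = (cmod (\<zeta> \<phi> - w))\<^sup>2 + 4 * (Im w * Im (\<zeta> \<phi>))"
          unfolding cmod_power2 by (simp add: power2_eq_square algebra_simps)
        also have "\<dots> \<ge> (4 + \<epsilon>\<^sup>2) * (Im w * Im (\<zeta> \<phi>))"
          using \<zeta>(3)[OF p ne] by (simp add: algebra_simps)
        finally have ge: "(cmod (w - cnj (\<zeta> \<phi>)))\<^sup>2 \<ge> (4 + \<epsilon>\<^sup>2) * (Im w * Im (\<zeta> \<phi>))" .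
        have gt: "(4 + \<epsilon>\<^sup>2) * (Im w * Im (\<zeta> \<phi>)) > 0" using v i by (simp add: add_pos_nonneg)
        have "t w \<phi> \<le> Im w * Im (\<zeta> \<phi>) / ((4 + \<epsilon>\<^sup>2) * (Im w * Im (\<zeta> \<phi>)))"
          unfolding t_def by (rule frac_le[OF _ order_refl gt ge]) (use v i in simp)
        also have "\<dots> = \<tau>" using v i by (simp add: \<tau>_def)
        finally show ?thesis .
      qed
      have s: "(\<lambda>\<phi>. 1 / (Im w ^ k * Im w ^ k) * (\<tau> ^ (k - 2) * (t w \<phi>)\<^sup>2)) summable_on pfam k ?h"
        by (intro summable_on_cmult_right st2(1) wu)
      have sU: "(\<lambda>\<phi>. 1 / (Im w ^ k * Im w ^ k) * (\<tau> ^ (k - 2) * (t w \<phi>)\<^sup>2)) summable_on ?U"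
        by (rule summable_on_subset_banach[OF s]) auto
      have "cmod (poincare k ?h w - slash k (mat 1) ?h w) \<le> (\<Sum>\<^sub>\<infinity>\<phi>\<in>?U. 1 / (Im w ^ k * Im w ^ k) * (\<tau> ^ (k - 2) * (t w \<phi>)\<^sup>2))"
        by (rule norm_poincare_diff_le[OF dom sU]) (rule nphi[OF _ wu t\<tau>])
      also have "\<dots> \<le> (\<Sum>\<^sub>\<infinity>\<phi>\<in>pfam k ?h. 1 / (Im w ^ k * Im w ^ k) * (\<tau> ^ (k - 2) * (t w \<phi>)\<^sup>2))"
        by (rule infsum_mono_neutral[OF sU s]) (use v \<tau> in auto)
      also have "\<dots> = 1 / (Im w ^ k * Im w ^ k) * (\<tau> ^ (k - 2) * (\<Sum>\<^sub>\<infinity>\<phi>\<in>pfam k ?h. (t w \<phi>)\<^sup>2))"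
        by (simp only: infsum_cmult_right')
      also have "\<dots> \<le> 1 / (Im w ^ k * Im w ^ k) * (\<tau> ^ (k - 2) * C)"
        using v \<tau> by (intro mult_left_mono st2(2) wu) auto
      finally have d: "cmod (poincare k ?h w - slash k (mat 1) ?h w) * Im w ^ (2 * k) \<le> \<tau> ^ (k - 2) * C"
        unfolding vk using pos by (simp add: pos_le_divide_eq)
      have "w - cnj w = of_real (2 * Im w) * \<i>" by (simp add: complex_eq_iff)
      then have cw: "cmod (w - cnj w) = 2 * Im w" using v by (simp add: norm_mult)
      have h0: "cmod (slash k (mat 1) ?h w) * Im w ^ (2 * k) = (1/4) ^ k"
        using wu v by (simp add: slash_def kerh_def norm_divide norm_power cw power_mult_distrib power_mult power_divide)
      \<comment> \<open>A rearrangement of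
        \<open>(4 * \<tau>) ^ k \<le> \<tau>\<^sup>2 / (2 * C)\<close>, which holds by the choice of
        \<open>k1\<close>.\<close>
      have "\<tau> ^ (k - 2) * C \<le> (1/2) * (1/4) ^ k"
      proof -
        have "(4 * \<tau>) ^ k \<le> (4 * \<tau>) ^ k1" using \<tau> k2 by (intro power_decreasing) auto
        then have "(4 * \<tau>) ^ k * (2 * C) \<le> \<tau>\<^sup>2" using k1 \<epsilon>(3) by (simp add: pos_less_divide_eq)
            (smt (verit, best) mult_right_mono)
        moreover have "(4 * \<tau>) ^ k = 4 ^ k * (\<tau> ^ (k - 2) * \<tau>\<^sup>2)" using power_split2[OF k2(1), of \<tau>] by (simp only: power_mult_distrib)
        ultimately have "(4 ^ k * \<tau> ^ (k - 2) * (2 * C)) * \<tau>\<^sup>2 \<le> 1 * \<tau>\<^sup>2" by (simp add: mult_ac)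
        then have "4 ^ k * \<tau> ^ (k - 2) * (2 * C) \<le> 1" using \<tau>(1) by (simp only: mult_le_cancel_right) auto
        then show ?thesis by (simp add: power_divide field_simps)
      qed
      moreover have "cmod (slash k (mat 1) ?h w) * Im w ^ (2 * k) \<le> cmod (poincare k ?h w) * Im w ^ (2 * k) + cmod (poincare k ?h w - slash k (mat 1) ?h w) * Im w ^ (2 * k)"
        unfolding distrib_right[symmetric] using pos norm_triangle_sub[of "slash k (mat 1) ?h w" "poincare k ?h w"]
        by (intro mult_right_mono) (auto simp: norm_minus_commute)
      ultimately show ?thesis using d h0 by linarith
    qed
    have "poincare k ?h \<in> cusp_forms \<Gamma> k"
    proof (rule poincare_cusp_form[OF G dom kerh_holomorphic[OF wu]])
      show "k \<ge> 1" using k2 by simp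
      fix z assume z: "z \<in> uhp"
      show "cmod (poincare k ?h z) * Im z ^ k \<le> (16 * C) * (1/4) ^ k / Im w ^ k"
        using up[OF z] v by (simp add: pos_le_divide_eq)
    qed
    then show ?thesis using up low by blast
  qed
  show ?thesis
    by (rule that[of "16 * C" k0]) (use all \<epsilon>(3) in auto)
qed

end

subsection \<open>Upper bounds for the derivative\<close>

definition ecirc :: "real \<Rightarrow> complex" where "ecirc x = exp (2 * of_real pi * \<i> * of_real x)"

lemma ecirc_cis: "ecirc x = cis (2 * pi * x)"
  by (simp add: ecirc_def cis_conv_exp mult_ac)

lemma norm_ecirc [simp]: "cmod (ecirc x) = 1"
  by (simp add: ecirc_cis)

lemma continuous_ecirc [continuous_intros]: "continuous_on S f \<Longrightarrow> continuous_on S (\<lambda>x. ecirc (f x))"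
  unfolding ecirc_def by (intro continuous_intros)

lemma ecirc_measurable [measurable]: "ecirc \<in> borel_measurable borel"
  by (intro borel_measurable_continuous_onI continuous_intros)

lemma ecirc_nz [simp]: "ecirc x \<noteq> 0"
  by (simp add: ecirc_def)

lemma ecirc_mult_cnj [simp]: "ecirc x * cnj (ecirc x) = 1"
  by (simp add: complex_norm_square[symmetric])

text \<open>Cauchy's formula on the unit circle: for \<open>u = ecirc x\<close> the differential of
  \<open>u\<close> is \<open>2 * pi * \<i> * u\<close> times that of \<open>x\<close>, which cancels
  one power of the denominator.\<close>

lemma circle_coeff:
  assumes G: "G holomorphic_on ball 0 R" and R: "R > 1"
  shows "((\<lambda>x. G (ecirc x) * cnj (ecirc x) ^ m) has_integral (deriv ^^ m) G 0 / fact m) {0..1}"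
proof -
  have sub: "cball (0::complex) 1 \<subseteq> ball 0 R" using R by auto
  have "((\<lambda>u. G u / (u - 0) ^ Suc m) has_contour_integral ((2 * pi * \<i>) / fact m * (deriv ^^ m) G 0)) (circlepath 0 1)"
  proof (rule Cauchy_has_contour_integral_higher_derivative_circlepath)
    show "continuous_on (cball 0 1) G" using holomorphic_on_subset[OF G sub] holomorphic_on_imp_continuous_on by blast
    show "G holomorphic_on ball 0 1" using holomorphic_on_subset[OF G] sub ball_subset_cball by blast
  qed simp
  then have "((\<lambda>x. G (circlepath 0 1 x) / (circlepath 0 1 x) ^ Suc m * vector_derivative (circlepath 0 1) (at x within {0..1}))
     has_integral ((2 * pi * \<i>) / fact m * (deriv ^^ m) G 0)) {0..1}"
    by (simp add: has_contour_integral_def)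
  then have "((\<lambda>x. G (ecirc x) * cnj (ecirc x) ^ m * (2 * pi * \<i>)) has_integral ((2 * pi * \<i>) / fact m * (deriv ^^ m) G 0)) {0..1}"
  proof (rule has_integral_eq[rotated])
    fix x :: real assume x: "x \<in> {0..1}"
    have c: "circlepath 0 1 x = ecirc x" by (simp add: circlepath ecirc_def)
    have vd: "vector_derivative (circlepath 0 1) (at x within {0..1}) = 2 * pi * \<i> * ecirc x"
      using x by (simp add: vector_derivative_circlepath01 ecirc_def)
    have ci: "cnj (ecirc x) = inverse (ecirc x)"
      using ecirc_mult_cnj[of x] by (metis inverse_unique)
    show "G (circlepath 0 1 x) / (circlepath 0 1 x) ^ Suc m * vector_derivative (circlepath 0 1) (at x within {0..1})
        = G (ecirc x) * cnj (ecirc x) ^ m * (2 * pi * \<i>)"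
      unfolding c vd ci by (simp add: field_simps)
  qed
  from has_integral_mult_left[OF this, of "1 / (2 * pi * \<i>)"] show ?thesis
    by (simp add: field_simps)
qed

text \<open>For \<open>m < n\<close> this is the coefficient formula for the monomial of degree
  \<open>n - m\<close>; the opposite case follows by conjugation.\<close>

lemma circle_orthogonal:
  "((\<lambda>x. ecirc x ^ n * cnj (ecirc x) ^ m) has_integral (if n = m then 1 else 0)) {0..1}"
proof -
  have gt: "((\<lambda>x. ecirc x ^ n * cnj (ecirc x) ^ m) has_integral 0) {0..1}" if "m < n" for m n
  proof -
    have "((\<lambda>x. ecirc x ^ (n - m) * cnj (ecirc x) ^ 0) has_integral (deriv ^^ 0) (\<lambda>u. u ^ (n - m)) 0 / fact 0) {0..1}"
      by (rule circle_coeff[where R = 2]) (auto intro!: holomorphic_intros)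
    then have "((\<lambda>x. ecirc x ^ (n - m)) has_integral 0) {0..1}" using that by (simp add: power_0_left)
    moreover have "ecirc x ^ n * cnj (ecirc x) ^ m = ecirc x ^ (n - m)" for x
    proof -
      have "ecirc x ^ n = ecirc x ^ (n - m) * ecirc x ^ m" using that by (simp flip: power_add)
      then have "ecirc x ^ n * cnj (ecirc x) ^ m = ecirc x ^ (n - m) * (ecirc x * cnj (ecirc x)) ^ m"
        by (simp only: power_mult_distrib mult.assoc)
      then show ?thesis by simp
    qed
    ultimately show ?thesis by simp
  qed
  consider "m < n" | "n < m" | "n = m" by linarith
  then show ?thesis
  proof cases
    case 2
    from has_integral_cnj[THEN iffD2, OF gt[OF 2]]
    show ?thesis using 2 by (simp add: mult.commute o_def)
  next
    case 3
    have "ecirc x ^ n * cnj (ecirc x) ^ n = 1" for x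
      by (simp flip: power_mult_distrib)
    then show ?thesis using 3 has_integral_const_real[of "1::complex" 0 1] by simp
  qed (use gt in simp)
qed

text \<open>Expand the nonnegative integral of |g - p|^2, where \<open>p\<close> is the part of the
  Taylor series with exponents in \<open>M\<close>. Both the cross term and the square of
  \<open>p\<close> integrate to \<open>S\<close>.\<close>

lemma bessel_circle:
  assumes G: "G holomorphic_on ball 0 R" and R: "R > 1" and M: "finite M"
  shows "(\<Sum>m\<in>M. (cmod ((deriv ^^ m) G 0 / fact m))\<^sup>2) \<le> integral {0..1} (\<lambda>x. (cmod (G (ecirc x)))\<^sup>2)"
proof -
  define a where "a = (\<lambda>m. (deriv ^^ m) G 0 / fact m)"
  define p where "p = (\<lambda>x. \<Sum>m\<in>M. a m * ecirc x ^ m)"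
  define g where "g = (\<lambda>x. G (ecirc x))"
  define S where "S = (\<Sum>m\<in>M. (cmod (a m))\<^sup>2)"
  have Sc: "complex_of_real S = (\<Sum>m\<in>M. cnj (a m) * a m)"
    unfolding S_def of_real_sum by (intro sum.cong refl) (simp only: complex_norm_square mult.commute)
  have cp: "cnj (p x) = (\<Sum>m\<in>M. cnj (a m) * cnj (ecirc x) ^ m)" for x by (simp add: p_def)
  have "((\<lambda>x. \<Sum>m\<in>M. cnj (a m) * (g x * cnj (ecirc x) ^ m)) has_integral (\<Sum>m\<in>M. cnj (a m) * a m)) {0..1}"
    unfolding g_def a_def by (intro has_integral_sum M has_integral_mult_right circle_coeff[OF G R])
  then have gp: "((\<lambda>x. g x * cnj (p x)) has_integral of_real S) {0..1}"
    unfolding Sc cp by (simp add: sum_distrib_left mult_ac)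
  have pe: "((\<lambda>x. p x * cnj (ecirc x) ^ m) has_integral a m) {0..1}" if m: "m \<in> M" for m
  proof -
    have "((\<lambda>x. \<Sum>n\<in>M. a n * (ecirc x ^ n * cnj (ecirc x) ^ m)) has_integral (\<Sum>n\<in>M. a n * (if n = m then 1 else 0))) {0..1}"
      by (intro has_integral_sum M has_integral_mult_right circle_orthogonal)
    moreover have "(\<Sum>n\<in>M. a n * (if n = m then 1 else 0)) = a m"
      using m M by (subst sum.cong[OF refl, of M _ "\<lambda>n. if n = m then a n else 0"]) auto
    ultimately show ?thesis by (simp add: p_def sum_distrib_right mult.assoc)
  qed
  have "((\<lambda>x. \<Sum>m\<in>M. cnj (a m) * (p x * cnj (ecirc x) ^ m)) has_integral (\<Sum>m\<in>M. cnj (a m) * a m)) {0..1}"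
    by (intro has_integral_sum M has_integral_mult_right pe)
  then have pp: "((\<lambda>x. p x * cnj (p x)) has_integral of_real S) {0..1}"
    unfolding Sc cp by (simp add: sum_distrib_left mult_ac)
  have gpr: "((\<lambda>x. Re (g x * cnj (p x))) has_integral S) {0..1}" and ppr: "((\<lambda>x. Re (p x * cnj (p x))) has_integral S) {0..1}"
    using has_integral_Re[OF gp] has_integral_Re[OF pp] by simp_all
  have cg: "continuous_on {0..1} g"
  proof -
    have "continuous_on (ball 0 R) G" using G by (rule holomorphic_on_imp_continuous_on)
    then show ?thesis unfolding g_def
      by (rule continuous_on_compose2) (use R in \<open>auto intro!: continuous_intros\<close>)
  qed
  have gi: "((\<lambda>x. (cmod (g x))\<^sup>2) has_integral integral {0..1} (\<lambda>x. (cmod (g x))\<^sup>2)) {0..1}"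
    by (intro integrable_integral integrable_continuous_real continuous_intros cg)
  have "((\<lambda>x. (cmod (g x))\<^sup>2 - 2 * Re (g x * cnj (p x)) + Re (p x * cnj (p x))) has_integral
      integral {0..1} (\<lambda>x. (cmod (g x))\<^sup>2) - 2 * S + S) {0..1}"
    by (intro has_integral_add has_integral_diff has_integral_mult_right gi gpr ppr)
  moreover have "0 \<le> (cmod (g x))\<^sup>2 - 2 * Re (g x * cnj (p x)) + Re (p x * cnj (p x))" for x
  proof -
    have "(cmod (g x - p x))\<^sup>2 = (cmod (g x))\<^sup>2 - 2 * Re (g x * cnj (p x)) + Re (p x * cnj (p x))"
      unfolding cmod_power2 by (simp add: power2_eq_square algebra_simps)
    then show ?thesis by (metis zero_le_power2)
  qed
  ultimately have "0 \<le> integral {0..1} (\<lambda>x. (cmod (g x))\<^sup>2) - 2 * S + S"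
    by (rule has_integral_nonneg)
  then show ?thesis by (simp add: S_def a_def g_def)
qed

lemma bessel_circle_nn:
  assumes G: "G holomorphic_on ball 0 R" and R: "R > 1" and M: "finite M"
  shows "ennreal (\<Sum>m\<in>M. (cmod ((deriv ^^ m) G 0 / fact m))\<^sup>2)
     \<le> (\<integral>\<^sup>+ x. ennreal ((cmod (G (ecirc x)))\<^sup>2) * indicator {0..1} x \<partial>lborel)"
proof -
  define g where "g = (\<lambda>x. (cmod (G (ecirc x)))\<^sup>2)"
  have cg: "continuous_on UNIV g"
  proof -
    have "continuous_on (ball 0 R) G" using G by (rule holomorphic_on_imp_continuous_on)
    then have "continuous_on UNIV (\<lambda>x. G (ecirc x))"
      by (rule continuous_on_compose2) (use R in \<open>auto intro!: continuous_intros\<close>)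
    then show ?thesis unfolding g_def by (intro continuous_intros)
  qed
  then have [measurable]: "g \<in> borel_measurable borel" by (rule borel_measurable_continuous_onI)
  have "g integrable_on {0..1}" using cg by (intro integrable_continuous_real) (rule continuous_on_subset, auto)
  then have "(g has_integral integral {0..1} g) {0..1}" by (rule integrable_integral)
  then have hi: "((\<lambda>x. if x \<in> {0..1} then g x else 0) has_integral integral {0..1} g) UNIV"
    by (simp only: has_integral_restrict_UNIV)
  have nn: "(\<integral>\<^sup>+ x. ennreal (if x \<in> {0..1} then g x else 0) \<partial>lborel) = ennreal (integral {0..1} g)"
    by (rule nn_integral_has_integral_lborel[OF _ _ hi]) (auto simp: g_def)
  have "(\<integral>\<^sup>+ x. ennreal (g x) * indicator {0..1} x \<partial>lborel) = (\<integral>\<^sup>+ x. ennreal (if x \<in> {0..1} then g x else 0) \<partial>lborel)"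
    by (intro nn_integral_cong) auto
  then show ?thesis using bessel_circle[OF assms] nn by (simp add: g_def ennreal_leI)
qed

section \<open>Rotations and mean values over discs\<close>

lemma nn_integral_shear:
  assumes [measurable]: "F \<in> borel_measurable borel"
  shows "(\<integral>\<^sup>+ z. F (Complex (Re z + a * Im z) (Im z)) \<partial>lborel) = (\<integral>\<^sup>+ z. F z \<partial>lborel)"
    and "(\<integral>\<^sup>+ z. F (Complex (Re z) (Im z + a * Re z)) \<partial>lborel) = (\<integral>\<^sup>+ z. F z \<partial>lborel)"
proof -
  have [measurable]: "Re \<in> borel_measurable borel" "Im \<in> borel_measurable borel"
    by (intro borel_measurable_continuous_onI continuous_intros)+
  have 1: "(\<integral>\<^sup>+ x. F (Complex (x + a * y) y) \<partial>lborel) = (\<integral>\<^sup>+ x. F (Complex x y) \<partial>lborel)" for y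
    by (subst (2) nn_integral_real_affine[where c = 1 and t = "a * y"]) (auto simp: add.commute)
  show "(\<integral>\<^sup>+ z. F (Complex (Re z + a * Im z) (Im z)) \<partial>lborel) = (\<integral>\<^sup>+ z. F z \<partial>lborel)"
    by (simp add: nn_integral_complex 1)
  have 2: "(\<integral>\<^sup>+ y. F (Complex x (y + a * x)) \<partial>lborel) = (\<integral>\<^sup>+ y. F (Complex x y) \<partial>lborel)" for x
    by (subst (2) nn_integral_real_affine[where c = 1 and t = "a * x"]) (auto simp: add.commute)
  have "(\<integral>\<^sup>+ z. F (Complex (Re z) (Im z + a * Re z)) \<partial>lborel) = (\<integral>\<^sup>+ y. \<integral>\<^sup>+ x. F (Complex x (y + a * x)) \<partial>lborel \<partial>lborel)"
    by (simp add: nn_integral_complex)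
  also have "\<dots> = (\<integral>\<^sup>+ x. \<integral>\<^sup>+ y. F (Complex x (y + a * x)) \<partial>lborel \<partial>lborel)"
    by (rule lborel_pair.Fubini') (simp add: case_prod_unfold)
  also have "\<dots> = (\<integral>\<^sup>+ x. \<integral>\<^sup>+ y. F (Complex x y) \<partial>lborel \<partial>lborel)" by (simp add: 2)
  also have "\<dots> = (\<integral>\<^sup>+ y. \<integral>\<^sup>+ x. F (Complex x y) \<partial>lborel \<partial>lborel)"
    by (rule lborel_pair.Fubini') (simp add: case_prod_unfold)
  also have "\<dots> = (\<integral>\<^sup>+ z. F z \<partial>lborel)" by (simp add: nn_integral_complex)
  finally show "(\<integral>\<^sup>+ z. F (Complex (Re z) (Im z + a * Re z)) \<partial>lborel) = (\<integral>\<^sup>+ z. F z \<partial>lborel)" .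
qed

text \<open>A rotation is a product of three shears.\<close>

lemma nn_integral_rotation:
  assumes F [measurable]: "F \<in> borel_measurable borel" and u: "cmod u = 1" "Im u \<noteq> 0"
  shows "(\<integral>\<^sup>+ z. F (u * z) \<partial>lborel) = (\<integral>\<^sup>+ z. F z \<partial>lborel)"
proof -
  have [measurable]: "Re \<in> borel_measurable borel" "Im \<in> borel_measurable borel"
    by (intro borel_measurable_continuous_onI continuous_intros)+
  define c where "c = Re u"
  define s where "s = Im u"
  \<comment> \<open>For \<open>u = cis \<theta>\<close> this is \<open>- tan (\<theta> / 2)\<close>,
    the parameter of the two outer shears; the middle one has parameter \<open>s\<close>.\<close>
  define a where "a = (c - 1) / s"
  have s: "s \<noteq> 0" using u by (simp add: s_def)
  have cs: "c * c + s * s = 1" using u(1) cmod_power2[of u] by (simp add: c_def s_def power2_eq_square)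
  have as: "a * s = c - 1" using s by (simp add: a_def)
  have ac: "a * c + a = - s"
  proof -
    have "s * (a * c + a) = (a * s) * c + a * s" by (simp add: algebra_simps)
    also have "\<dots> = s * (- s)" unfolding as using cs by (simp add: algebra_simps)
    finally have "s * (a * c + a) = s * (- s)" .
    then show ?thesis using mult_left_cancel[OF s] by blast
  qed
  define S1 where "S1 = (\<lambda>z. Complex (Re z + a * Im z) (Im z))"
  define S2 where "S2 = (\<lambda>z. Complex (Re z) (Im z + s * Re z))"
  have [measurable]: "S1 \<in> borel_measurable borel" "S2 \<in> borel_measurable borel"
    unfolding S1_def S2_def by measurable
  have eq: "u * z = S1 (S2 (S1 z))" for z
  proof -
    define x where "x = Re z"
    define y where "y = Im z"
    have i: "y + s * (x + a * y) = s * x + c * y"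
    proof -
      have "y + s * (x + a * y) = s * x + (a * s) * y + y" by (simp add: algebra_simps)
      then show ?thesis unfolding as by (simp add: algebra_simps)
    qed
    have r: "x + a * y + a * (s * x + c * y) = c * x - s * y"
    proof -
      have "x + a * y + a * (s * x + c * y) = x + (a * s) * x + (a * c + a) * y" by (simp add: algebra_simps)
      also have "\<dots> = c * x - s * y" unfolding as ac by (simp add: algebra_simps)
      finally show ?thesis .
    qed
    have "S1 (S2 (S1 z)) = Complex (x + a * y + a * (y + s * (x + a * y))) (y + s * (x + a * y))"
      by (simp add: S1_def S2_def x_def y_def)
    also have "\<dots> = Complex (c * x - s * y) (s * x + c * y)" unfolding i r ..
    also have "\<dots> = u * z" by (simp add: complex_eq_iff c_def s_def x_def y_def)
    finally show ?thesis by simp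
  qed
  have "(\<integral>\<^sup>+ z. F (u * z) \<partial>lborel) = (\<integral>\<^sup>+ z. F (S1 (S2 (S1 z))) \<partial>lborel)" by (simp add: eq)
  also have "\<dots> = (\<integral>\<^sup>+ z. F (S1 (S2 z)) \<partial>lborel)"
    unfolding S1_def by (rule nn_integral_shear(1)[where F = "\<lambda>z. F (Complex (Re (S2 z) + a * Im (S2 z)) (Im (S2 z)))"]) measurable
  also have "\<dots> = (\<integral>\<^sup>+ z. F (S1 z) \<partial>lborel)"
    unfolding S2_def by (rule nn_integral_shear(2)[where F = "\<lambda>z. F (S1 z)"]) measurable
  also have "\<dots> = (\<integral>\<^sup>+ z. F z \<partial>lborel)"
    unfolding S1_def by (rule nn_integral_shear(1)) measurable
  finally show ?thesis .
qed

text \<open>Averaging over rotations takes the place of polar coordinates: on each circle Bessel's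
  inequality for the mode of degree 1 bounds |G'(0)|^2 |\<zeta>|^2 by the mean of |G|^2, and
  rotations preserve the integral over the disc.\<close>

lemma area_derivative_bound:
  assumes G: "G holomorphic_on ball 0 R" and R: "0 < \<rho>" "\<rho> < R"
  shows "ennreal ((cmod (deriv G 0))\<^sup>2 * (\<rho> ^ 4 / 128)) \<le> (\<integral>\<^sup>+ \<zeta>. ennreal ((cmod (G \<zeta>))\<^sup>2) * indicator (ball 0 \<rho>) \<zeta> \<partial>lborel)"
proof -
  define d where "d = deriv G 0"
  \<comment> \<open>Extended by 0 to be measurable on the whole plane.\<close>
  define H where "H = (\<lambda>\<zeta>. if \<zeta> \<in> ball 0 R then G \<zeta> else 0)"
  have Hm [measurable]: "H \<in> borel_measurable borel"
    unfolding H_def using holomorphic_on_imp_continuous_on[OF G]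
    by (intro borel_measurable_continuous_on_if) auto
  have [measurable]: "ball (0::complex) \<rho> \<in> sets borel" by simp
  define F where "F = (\<lambda>\<zeta>. ennreal ((cmod (H \<zeta>))\<^sup>2) * indicator (ball 0 \<rho>) \<zeta>)"
  have Fm [measurable]: "F \<in> borel_measurable borel" unfolding F_def by measurable
  have [measurable]: "(\<lambda>p. F (ecirc (fst p) * snd p)) \<in> borel_measurable (borel \<Otimes>\<^sub>M borel)" by measurable
  have inner: "ennreal ((cmod d)\<^sup>2 * (cmod \<zeta>)\<^sup>2) * indicator (ball 0 \<rho>) \<zeta> \<le> (\<integral>\<^sup>+ x. F (ecirc x * \<zeta>) * indicator {0..1} x \<partial>lborel)" for \<zeta>
  proof (cases "\<zeta> \<in> ball 0 \<rho> \<and> \<zeta> \<noteq> 0")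
    case True
    define R' where "R' = R / cmod \<zeta>"
    have R': "R' > 1" using True R by (simp add: R'_def field_simps)
    have hol: "(\<lambda>u. G (\<zeta> * u)) holomorphic_on ball 0 R'"
    proof -
      have "(\<lambda>u. \<zeta> * u) ` ball 0 R' \<subseteq> ball 0 R" using True by (auto simp: R'_def norm_mult field_simps)
      then have "(G \<circ> (\<lambda>u. \<zeta> * u)) holomorphic_on ball 0 R'"
        by (intro holomorphic_on_compose_gen[OF _ G] holomorphic_intros)
      then show ?thesis by (simp add: o_def)
    qed
    have "(G has_field_derivative d) (at 0)"
      unfolding d_def using G R by (intro holomorphic_derivI[OF G open_ball]) auto
    then have "((\<lambda>u. G (\<zeta> * u)) has_field_derivative d * \<zeta>) (at 0)"
      by (intro DERIV_chain2[where g = "\<lambda>u. \<zeta> * u"]) (auto intro!: derivative_eq_intros)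
    then have "deriv (\<lambda>u. G (\<zeta> * u)) 0 = d * \<zeta>" by (rule DERIV_imp_deriv)
    then have "ennreal ((cmod d)\<^sup>2 * (cmod \<zeta>)\<^sup>2) = ennreal (\<Sum>m\<in>{1::nat}. (cmod ((deriv ^^ m) (\<lambda>u. G (\<zeta> * u)) 0 / fact m))\<^sup>2)"
      by (simp add: norm_mult power_mult_distrib)
    also have "\<dots> \<le> (\<integral>\<^sup>+ x. ennreal ((cmod (G (\<zeta> * ecirc x)))\<^sup>2) * indicator {0..1} x \<partial>lborel)"
      by (rule bessel_circle_nn[OF hol R']) simp
    also have "\<dots> = (\<integral>\<^sup>+ x. F (ecirc x * \<zeta>) * indicator {0..1} x \<partial>lborel)"
      using True R by (intro nn_integral_cong) (simp add: F_def H_def norm_mult mult.commute)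
    finally show ?thesis using True by simp
  next
    case False
    then show ?thesis by (auto simp: indicator_def)
  qed
  \<comment> \<open>In the unit interval the excluded values are those where the rotation is real, a
    null set.\<close>
  have rot: "(\<integral>\<^sup>+ \<zeta>. F (ecirc x * \<zeta>) \<partial>lborel) = (\<integral>\<^sup>+ \<zeta>. F \<zeta> \<partial>lborel)" if "x \<in> {0<..<1}" "x \<noteq> 1/2" for x
  proof (rule nn_integral_rotation[OF Fm norm_ecirc])
    have "sin (2 * pi * x) \<noteq> 0"
    proof
      assume "sin (2 * pi * x) = 0"
      then obtain i :: int where i: "2 * pi * x = of_int i * pi" using sin_zero_iff_int2 by blast
      then have "2 * x = of_int i" by simp
      then have "0 < real_of_int i" "real_of_int i < 2" using that(1) by auto
      then have "i = 1" by linarith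
      then show False using \<open>2 * x = of_int i\<close> that(2) by simp
    qed
    then show "Im (ecirc x) \<noteq> 0" by (simp add: ecirc_cis)
  qed
  \<comment> \<open>A box inside the disc, of area \<rho>^2 / 8, on which |\<zeta>|^2 is at least
    \<rho>^2 / 16; the product is \<rho>^4 / 128.\<close>
  define B where "B = box (Complex (\<rho>/4) 0) (Complex (\<rho>/2) (\<rho>/2))"
  have B1: "B \<subseteq> ball 0 \<rho>" and B2: "\<And>\<zeta>. \<zeta> \<in> B \<Longrightarrow> \<rho>\<^sup>2 / 16 \<le> (cmod \<zeta>)\<^sup>2"
  proof
    fix \<zeta> assume "\<zeta> \<in> B"
    then have z: "\<rho>/4 < Re \<zeta>" "Re \<zeta> < \<rho>/2" "0 < Im \<zeta>" "Im \<zeta> < \<rho>/2" by (auto simp: B_def box_def Basis_complex_def)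
    then have "cmod \<zeta> < \<rho>" using cmod_le[of \<zeta>] R by linarith
    then show "\<zeta> \<in> ball 0 \<rho>" by simp
  next
    fix \<zeta> assume "\<zeta> \<in> B"
    then have z: "\<rho>/4 < Re \<zeta>" by (auto simp: B_def box_def Basis_complex_def)
    then have "(\<rho>/4)\<^sup>2 \<le> (Re \<zeta>)\<^sup>2" using R by (intro power_mono) auto
    then show "\<rho>\<^sup>2 / 16 \<le> (cmod \<zeta>)\<^sup>2" unfolding cmod_power2 by (simp add: power_divide add_increasing2)
  qed
  have eB: "emeasure lborel B = ennreal (\<rho>\<^sup>2 / 8)"
    unfolding B_def using R by (subst emeasure_lborel_box) (auto simp: Basis_complex_def power2_eq_square)
  have "ennreal ((cmod d)\<^sup>2 * (\<rho> ^ 4 / 128)) = ennreal ((cmod d)\<^sup>2 * (\<rho>\<^sup>2 / 16)) * emeasure lborel B"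
    unfolding eB by (simp add: ennreal_mult[symmetric] power4_eq_xxxx power2_eq_square mult.assoc)
  also have "\<dots> = (\<integral>\<^sup>+ \<zeta>. ennreal ((cmod d)\<^sup>2 * (\<rho>\<^sup>2 / 16)) * indicator B \<zeta> \<partial>lborel)"
    by (subst nn_integral_cmult_indicator) (auto simp: B_def)
  also have "\<dots> \<le> (\<integral>\<^sup>+ \<zeta>. ennreal ((cmod d)\<^sup>2 * (cmod \<zeta>)\<^sup>2) * indicator (ball 0 \<rho>) \<zeta> \<partial>lborel)"
  proof (rule nn_integral_mono)
    fix \<zeta>
    show "ennreal ((cmod d)\<^sup>2 * (\<rho>\<^sup>2 / 16)) * indicator B \<zeta> \<le> ennreal ((cmod d)\<^sup>2 * (cmod \<zeta>)\<^sup>2) * indicator (ball 0 \<rho>) \<zeta>"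
    proof (cases "\<zeta> \<in> B")
      case True
      have "ennreal ((cmod d)\<^sup>2 * (\<rho>\<^sup>2 / 16)) \<le> ennreal ((cmod d)\<^sup>2 * (cmod \<zeta>)\<^sup>2)"
        using B2[OF True] by (intro ennreal_leI mult_left_mono) auto
      moreover have "indicator B \<zeta> = (1::ennreal)" "indicator (ball 0 \<rho>) \<zeta> = (1::ennreal)"
        using True B1 by (auto simp: indicator_def)
      ultimately show ?thesis by (simp only: mult_1_right)
    qed simp
  qed
  also have "\<dots> \<le> (\<integral>\<^sup>+ \<zeta>. \<integral>\<^sup>+ x. F (ecirc x * \<zeta>) * indicator {0..1} x \<partial>lborel \<partial>lborel)"
    by (intro nn_integral_mono inner)
  also have "\<dots> = (\<integral>\<^sup>+ x. \<integral>\<^sup>+ \<zeta>. F (ecirc x * \<zeta>) * indicator {0..1} x \<partial>lborel \<partial>lborel)"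
    by (rule lborel_pair.Fubini'[symmetric]) (simp add: case_prod_unfold)
  also have "\<dots> = (\<integral>\<^sup>+ x. (\<integral>\<^sup>+ \<zeta>. F \<zeta> \<partial>lborel) * indicator {0..1} (x::real) \<partial>lborel)"
  proof (intro nn_integral_cong_AE)
    have "AE x in lborel. x \<noteq> (0::real) \<and> x \<noteq> 1 \<and> x \<noteq> 1/2"
      using AE_lborel_singleton[of "0::real"] AE_lborel_singleton[of "1::real"] AE_lborel_singleton[of "1/2::real"] by auto
    then show "AE x in lborel. (\<integral>\<^sup>+ \<zeta>. F (ecirc x * \<zeta>) * indicator {0..1} x \<partial>lborel) = (\<integral>\<^sup>+ \<zeta>. F \<zeta> \<partial>lborel) * indicator {0..1} x"
    proof (rule AE_mp, intro AE_I2 impI)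
      fix x :: real assume x: "x \<noteq> 0 \<and> x \<noteq> 1 \<and> x \<noteq> 1/2"
      show "(\<integral>\<^sup>+ \<zeta>. F (ecirc x * \<zeta>) * indicator {0..1} x \<partial>lborel) = (\<integral>\<^sup>+ \<zeta>. F \<zeta> \<partial>lborel) * indicator {0..1} x"
        using rot[of x] x by (cases "x \<in> {0..1}") auto
    qed
  qed
  also have "\<dots> = (\<integral>\<^sup>+ \<zeta>. F \<zeta> \<partial>lborel)"
    by (simp add: nn_integral_cmult)
  also have "\<dots> = (\<integral>\<^sup>+ \<zeta>. ennreal ((cmod (G \<zeta>))\<^sup>2) * indicator (ball 0 \<rho>) \<zeta> \<partial>lborel)"
    using R by (intro nn_integral_cong) (auto simp: F_def H_def split: split_indicator)
  finally show ?thesis by (simp add: d_def)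
qed

section \<open>Cusp forms and their norms\<close>

locale cusped_surface = cusped_group G for G +
  fixes \<Gamma> :: "(real^2^2) set set"
  assumes G_eq: "G = \<Union>\<Gamma>"
    and fund: "fundamental_domain \<Gamma> (fund_dom \<Gamma>)"
    and finite_vol: "emeasure hyp_measure (fund_dom \<Gamma>) < \<infinity>"
begin

abbreviation "D \<equiv> fund_dom \<Gamma>"

text \<open>The squared hyperbolic norm as an extended nonnegative integral, so that it can be
  estimated before integrability is known.\<close>

definition normsq :: "nat \<Rightarrow> (complex \<Rightarrow> complex) \<Rightarrow> ennreal" where
  "normsq k f = (\<integral>\<^sup>+ z. ennreal (pointwise_norm_sq k f z) * indicator D z \<partial>hyp_measure)"

lemma D_borel [measurable]: "D \<in> sets borel" and D_uhp: "D \<subseteq> uhp"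
  using fund by (auto simp: fundamental_domain_def)

lemma D_cover:
  assumes "z \<in> uhp"
  shows "\<exists>A\<in>G. moebius A z \<in> D"
proof -
  have "(\<Union>A\<in>G. moebius A ` D) = uhp" using fund unfolding fundamental_domain_def G_eq[symmetric] by blast
  then obtain A d where A: "A \<in> G" "d \<in> D" "z = moebius A d" using assms by blast
  then have "moebius (adj2 A) z = d" using D_uhp by (auto simp: moebius_G_adj2)
  then show ?thesis using A adj2_G by (intro bexI[of _ "adj2 A"]) auto
qed

text \<open>The overlap condition on images, applied to the inverse of \<open>A\<close>, becomes a
  condition on a point and its image, the form that unfolding uses.\<close>

lemma D_pack:
  assumes A: "A \<in> G" "A \<noteq> mat 1" "A \<noteq> - mat 1"
  shows "AE z in hyp_measure. \<not> (z \<in> D \<and> moebius A z \<in> D)"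
proof -
  have B: "adj2 A \<in> G" "adj2 A \<noteq> mat 1" "adj2 A \<noteq> - mat 1"
    using A adj2_G by (auto simp: mat2_eq_iff)
  then have z0: "emeasure hyp_measure (D \<inter> moebius (adj2 A) ` D) = 0"
    using fund unfolding fundamental_domain_def G_eq[symmetric] by blast
  have eq: "D \<inter> moebius (adj2 A) ` D = {z. z \<in> D \<and> moebius A z \<in> D}"
  proof (rule subset_antisym; rule subsetI)
    fix z assume "z \<in> D \<inter> moebius (adj2 A) ` D"
    then show "z \<in> {z. z \<in> D \<and> moebius A z \<in> D}" using A(1) D_uhp by (auto simp: moebius_G_adj2)
  next
    fix z assume z: "z \<in> {z. z \<in> D \<and> moebius A z \<in> D}"
    then have "moebius (adj2 A) (moebius A z) = z" using A(1) D_uhp by (auto simp: moebius_G_adj2)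
    then have "z \<in> moebius (adj2 A) ` D" using z by (intro rev_image_eqI[of "moebius A z"]) auto
    then show "z \<in> D \<inter> moebius (adj2 A) ` D" using z by auto
  qed
  have "{z. z \<in> D \<and> moebius A z \<in> D} \<in> null_sets hyp_measure"
    using z0 unfolding eq by (intro null_setsI) auto
  then show ?thesis by (rule AE_I') auto
qed

lemma cusp_formD:
  assumes "f \<in> cusp_forms \<Gamma> k"
  shows "f holomorphic_on uhp" "\<And>z. z \<notin> uhp \<Longrightarrow> f z = 0"
    "\<And>A z. A \<in> G \<Longrightarrow> z \<in> uhp \<Longrightarrow> f (moebius A z) = aut_factor A z ^ (2 * k) * f z"
    "\<exists>F. F holomorphic_on ball 0 1 \<and> F 0 = 0 \<and> (\<forall>z\<in>uhp. f z = F (qpar z))"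
  using assms unfolding cusp_forms_def G_eq[symmetric] aut_factor_def qpar_def by blast+

lemma cusp_form_measurable:
  assumes "f \<in> cusp_forms \<Gamma> k"
  shows "f \<in> borel_measurable borel"
proof -
  have "(\<lambda>z. if z \<in> uhp then f z else 0) \<in> borel_measurable borel"
    using holomorphic_on_imp_continuous_on[OF cusp_formD(1)[OF assms]]
    by (intro borel_measurable_continuous_on_if) auto
  also have "(\<lambda>z. if z \<in> uhp then f z else 0) = f" using cusp_formD(2)[OF assms] by auto
  finally show ?thesis .
qed

lemma Im_measurable [measurable]: "Im \<in> borel_measurable borel"
  by (intro borel_measurable_continuous_onI continuous_intros)

lemma pointwise_measurable:
  assumes "f \<in> cusp_forms \<Gamma> k"
  shows "(\<lambda>z. ennreal (pointwise_norm_sq k f z)) \<in> borel_measurable borel"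
proof -
  have [measurable]: "f \<in> borel_measurable borel" by (rule cusp_form_measurable[OF assms])
  show ?thesis unfolding pointwise_norm_sq_def by measurable
qed

lemma pointwise_norm_sq_alt: "z \<in> uhp \<Longrightarrow> pointwise_norm_sq k f z = (cmod (f z) * Im z ^ k)\<^sup>2"
  by (simp add: pointwise_norm_sq_def power_mult_distrib mult.commute flip: power_mult)

lemma pointwise_nonneg: "pointwise_norm_sq k f z \<ge> 0"
  by (simp add: pointwise_norm_sq_def power_mult)

lemma cusp_norm_invariant:
  assumes "f \<in> cusp_forms \<Gamma> k" "A \<in> G" "z \<in> uhp"
  shows "cmod (f (moebius A z)) * Im (moebius A z) ^ k = cmod (f z) * Im z ^ k"
  using cusp_formD(3)[OF assms] aut_factor_nz[OF det_G[OF assms(2)] assms(3)] Im_moebius[OF det_G[OF assms(2)] assms(3)]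
  by (simp add: norm_mult norm_power power_divide power_mult)

lemma pointwise_invariant:
  assumes "f \<in> cusp_forms \<Gamma> k" "A \<in> G" "z \<in> uhp"
  shows "pointwise_norm_sq k f (moebius A z) = pointwise_norm_sq k f z"
  using cusp_norm_invariant[OF assms] moebius_G_uhp[OF assms(2,3)] assms(3) by (simp add: pointwise_norm_sq_alt)

text \<open>A region that meets every orbit at most once unfolds into part of the fundamental
  domain.\<close>

lemma normsq_ge:
  assumes f: "f \<in> cusp_forms \<Gamma> k" and E: "E \<in> sets borel" "E \<subseteq> uhp"
    and pack: "\<And>A z. A \<in> G \<Longrightarrow> A \<noteq> mat 1 \<Longrightarrow> A \<noteq> - mat 1 \<Longrightarrow> z \<in> E \<Longrightarrow> moebius A z \<notin> E"
  shows "(\<integral>\<^sup>+ z. ennreal (pointwise_norm_sq k f z) * indicator E z \<partial>hyp_measure) \<le> normsq k f"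
  unfolding normsq_def
proof (rule unfolding_le[OF pointwise_measurable[OF f]])
  show "AE z in hyp_measure. \<not> (z \<in> E \<and> moebius A z \<in> E)" if "A \<in> G" "A \<noteq> mat 1" "A \<noteq> - mat 1" for A
    using pack[OF that] by auto
qed (use E D_cover pointwise_invariant[OF f] in auto)

text \<open>On a disc of radius \<rho> about \<open>v / sqrt k\<close> the weight
  \<open>Im z ^ (2 * k)\<close> is, up to constants, the squared modulus of an exponential, so
  \<open>f\<close> times that exponential can be treated with plain area measure. The squared
  derivative costs \<rho>^2 and the area another \<rho>^2, whence \<open>k\<^sup>2\<close>.\<close>

lemma local_derivative_bound:
  assumes K: "compact K" "K \<subseteq> uhp"
  obtains C where "C > 0"
    "\<And>k w f. k \<ge> 1 \<Longrightarrow> w \<in> K \<Longrightarrow> f \<in> cusp_forms \<Gamma> k \<Longrightarrow> f w = 0 \<Longrightarrow>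
       ennreal ((cmod (deriv f w))\<^sup>2 * Im w ^ (2 * k + 2)) \<le> ennreal (C * real k ^ 2) * normsq k f"
proof (cases "K = {}")
  case True then show ?thesis by (intro that[of 1]) auto
next
  case False
  have cI: "continuous_on K Im" by (intro continuous_intros)
  obtain w0 where w0: "w0 \<in> K" "\<And>w. w \<in> K \<Longrightarrow> Im w0 \<le> Im w"
    using continuous_attains_inf[OF K(1) False cI] by blast
  define m where "m = Im w0"
  have m: "m > 0" using w0 K by (auto simp: m_def uhp_def)
  obtain R where R: "\<And>w. w \<in> K \<Longrightarrow> cmod w \<le> R"
    using compact_imp_bounded[OF K(1)] unfolding bounded_iff by blast
  \<comment> \<open>Contains the discs around all points of \<open>K\<close>, so that one separation
    constant is valid on them.\<close>
  define K' where "K' = {z. Im z \<ge> m / 2} \<inter> cball 0 (2 * R)"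
  have K': "compact K'" "K' \<subseteq> uhp"
    unfolding K'_def by (intro closed_Int_compact closed_halfspace_Im_ge compact_cball) (use m in \<open>auto simp: uhp_def\<close>)
  obtain \<epsilon> where \<epsilon>: "\<epsilon> > 0" "\<epsilon> \<le> 1"
    "\<And>w A B. w \<in> K' \<Longrightarrow> A \<in> G \<Longrightarrow> B \<in> G \<Longrightarrow> moebius A w \<noteq> moebius B w \<Longrightarrow>
       (cmod (moebius A w - moebius B w))\<^sup>2 \<ge> \<epsilon>\<^sup>2 * Im (moebius A w) * Im (moebius B w)"
    using orbit_separated[OF K'] by blast
  \<comment> \<open>Two points of a disc are closer than \<open>\<epsilon> * v / 2\<close>, whereas
    equivalent points at heights at least \<open>3/4 * v\<close> are at least
    \<open>3/4 * \<epsilon> * v\<close> apart.\<close>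
  define \<delta> where "\<delta> = \<epsilon> / 4"
  have \<delta>: "\<delta> > 0" "\<delta> \<le> 1/4" using \<epsilon> by (auto simp: \<delta>_def)
  show ?thesis
  proof (rule that[of "1536 / \<delta> ^ 4"])
    \<comment> \<open>The constant is 128 times 12: 128 from \<open>area_derivative_bound\<close>, 3
      from flattening the weight, and 4 from
      \<open>(Im z)\<^sup>2 \<le> 4 * v\<^sup>2\<close>.\<close>
    show "1536 / \<delta> ^ 4 > 0" using \<delta> by simp
    fix k :: nat and w f assume k: "k \<ge> 1" and w: "w \<in> K" and f: "f \<in> cusp_forms \<Gamma> k" and fw: "f w = 0"
    define v where "v = Im w"
    have v: "v > 0" using w K by (auto simp: v_def uhp_def)
    have sk: "sqrt (real k) \<ge> 1" using k by simp
    define \<rho> where "\<rho> = \<delta> * v / sqrt (real k)"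
    have \<rho>0: "\<rho> > 0" using \<delta> v sk by (simp add: \<rho>_def)
    have \<rho>le: "\<rho> \<le> \<delta> * v"
    proof -
      have "\<delta> * v / sqrt (real k) \<le> \<delta> * v / 1" using sk \<delta> v by (intro divide_left_mono) auto
      then show ?thesis by (simp add: \<rho>_def)
    qed
    have "\<delta> * v \<le> 1/4 * v" using \<delta> v by (intro mult_right_mono) auto
    then have \<rho>v: "\<rho> \<le> v / 4" using \<rho>le by linarith
    have vR: "v \<le> R" "m \<le> v" using R[OF w] abs_Im_le_cmod[of w] w0(2)[OF w] by (auto simp: v_def m_def)
    have Eim: "3/4 * v \<le> Im z \<and> Im z \<le> 5/4 * v" if "z \<in> ball w \<rho>" for z
      using that abs_Im_le_cmod[of "w - z"] \<rho>v by (auto simp: dist_norm v_def)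
    have Eu: "ball w \<rho> \<subseteq> uhp" using Eim v by (force simp: uhp_def)
    have EK': "z \<in> K'" if "z \<in> ball w \<rho>" for z
    proof -
      have "cmod z \<le> cmod w + cmod (w - z)" using norm_triangle_sub[of z w] by (simp add: norm_minus_commute)
      also have "\<dots> \<le> R + v" using R[OF w] that \<rho>v v by (auto simp: dist_norm)
      finally have "cmod z \<le> 2 * R" using vR by simp
      moreover have "Im z \<ge> m / 2" using Eim[OF that] vR v by linarith
      ultimately show ?thesis by (simp add: K'_def)
    qed
    have pack: "moebius A z \<notin> ball w \<rho>" if A: "A \<in> G" "A \<noteq> mat 1" "A \<noteq> - mat 1" and z: "z \<in> ball w \<rho>" for A z
    proof
      assume Az: "moebius A z \<in> ball w \<rho>"
      have zu: "z \<in> uhp" using z Eu by auto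
      have "moebius A z \<noteq> moebius (mat 1) z" using free_G[OF A(1) zu] A by auto
      then have "(cmod (moebius A z - z))\<^sup>2 \<ge> \<epsilon>\<^sup>2 * Im (moebius A z) * Im z"
        using \<epsilon>(3)[OF EK'[OF z] A(1) one_G] by simp
      moreover have "\<epsilon>\<^sup>2 * Im (moebius A z) * Im z \<ge> \<epsilon>\<^sup>2 * (3/4 * v) * (3/4 * v)"
        using Eim[OF z] Eim[OF Az] v by (intro mult_mono mult_left_mono) auto
      moreover have "cmod (moebius A z - z) < 2 * \<rho>"
        using z Az dist_triangle_less_add[of "moebius A z" w \<rho> z \<rho>] by (simp add: dist_norm norm_minus_commute)
      then have "(cmod (moebius A z - z))\<^sup>2 \<le> (2 * (\<delta> * v))\<^sup>2"
        using \<rho>le by (intro power_mono) auto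
      moreover have "(2 * (\<delta> * v))\<^sup>2 = \<epsilon>\<^sup>2 * v\<^sup>2 / 4" by (simp add: \<delta>_def power2_eq_square)
      moreover have "\<epsilon>\<^sup>2 * (3/4 * v) * (3/4 * v) = 9/16 * (\<epsilon>\<^sup>2 * v\<^sup>2)" by (simp add: power2_eq_square)
      moreover have "\<epsilon>\<^sup>2 * v\<^sup>2 > 0" using \<epsilon> v by simp
      ultimately show False by linarith
    qed
    \<comment> \<open>The squared modulus of the exponential is
      \<open>exp (2 * k * (Im z - v) / v)\<close>, which agrees with
      \<open>(Im z / v) ^ (2 * k)\<close> to first order at \<open>w\<close>. Since
      \<open>f w = 0\<close>, the derivative at the centre is unchanged.\<close>
    define H where "H = (\<lambda>\<zeta>. f (w + \<zeta>) * exp (- \<i> * of_real (real k / v) * \<zeta>))"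
    have Hhol: "H holomorphic_on ball 0 v"
    proof -
      have "(\<lambda>\<zeta>. w + \<zeta>) ` ball 0 v \<subseteq> uhp"
      proof safe
        fix \<zeta> :: complex assume "\<zeta> \<in> ball 0 v"
        then show "w + \<zeta> \<in> uhp" using abs_Im_le_cmod[of \<zeta>] by (auto simp: uhp_def v_def)
      qed
      then have "(f \<circ> (\<lambda>\<zeta>. w + \<zeta>)) holomorphic_on ball 0 v"
        by (intro holomorphic_on_compose_gen[OF _ cusp_formD(1)[OF f]] holomorphic_intros)
      then show ?thesis unfolding H_def o_def by (intro holomorphic_intros)
    qed
    have dH: "deriv H 0 = deriv f w"
    proof -
      have wu: "w \<in> uhp" using w K by auto
      have "(f has_field_derivative deriv f w) (at (0 + w))"
        using holomorphic_derivI[OF cusp_formD(1)[OF f] open_uhp wu] by simp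
      then have d1: "((\<lambda>\<zeta>. f (w + \<zeta>)) has_field_derivative deriv f w) (at 0)"
        unfolding DERIV_shift by (simp add: add.commute)
      have d2: "((\<lambda>\<zeta>. exp (- \<i> * of_real (real k / v) * \<zeta>)) has_field_derivative
          exp (- \<i> * of_real (real k / v) * 0) * (- \<i> * of_real (real k / v))) (at 0)"
        by (rule derivative_eq_intros | simp)+
      have "(H has_field_derivative deriv f w) (at 0)"
        unfolding H_def by (rule DERIV_cong[OF DERIV_mult[OF d1 d2]]) (simp add: fw)
      then show ?thesis by (rule DERIV_imp_deriv)
    qed
    \<comment> \<open>The second order error in the exponent is at most
      \<open>4 * k * s\<^sup>2 \<le> 1/4\<close>; bounding it by 1 costs the factor
      \<open>exp 1 \<le> 3\<close>.\<close>
    have flat: "(cmod (H (z - w)))\<^sup>2 * v ^ (2 * k) \<le> 3 * pointwise_norm_sq k f z" if z: "z \<in> ball w \<rho>" for z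
    proof -
      define s where "s = (Im z - v) / v"
      have "\<bar>Im z - v\<bar> < \<rho>" using z abs_Im_le_cmod[of "w - z"] by (auto simp: dist_norm v_def)
      then have "\<bar>s\<bar> \<le> \<rho> / v" using v by (simp add: s_def abs_divide divide_right_mono)
      also have "\<rho> / v = \<delta> / sqrt (real k)" using v by (simp add: \<rho>_def)
      finally have s1: "\<bar>s\<bar> \<le> \<delta> / sqrt (real k)" .
      also have "\<dots> \<le> \<delta> / 1" using sk \<delta> by (intro divide_left_mono) auto
      finally have s2: "\<bar>s\<bar> \<le> 1/4" using \<delta> by simp
      have "s\<^sup>2 \<le> (\<delta> / sqrt (real k))\<^sup>2" using s1 by (metis abs_ge_zero power2_abs power_mono)
      then have "real k * s\<^sup>2 \<le> real k * (\<delta> / sqrt (real k))\<^sup>2" by (intro mult_left_mono) auto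
      also have "\<dots> = \<delta>\<^sup>2" using k by (simp add: power_divide)
      also have "\<dots> \<le> (1/4)\<^sup>2" using \<delta> by (intro power_mono) auto
      finally have ks: "real k * s\<^sup>2 \<le> 1/16" by (simp add: power_divide)
      have "\<bar>ln (1 + s) - s\<bar> \<le> 2 * s\<^sup>2" using s2 by (intro abs_ln_one_plus_x_minus_x_bound) auto
      then have "s \<le> ln (1 + s) + 2 * s\<^sup>2" by linarith
      then have "real k * s \<le> real k * (ln (1 + s) + 2 * s\<^sup>2)" by (intro mult_left_mono) auto
      then have "2 * (real k * s) \<le> real (2 * k) * ln (1 + s) + 4 * (real k * s\<^sup>2)" by (simp add: algebra_simps)
      also have "\<dots> \<le> real (2 * k) * ln (1 + s) + 1" using ks by simp
      finally have "exp (2 * (real k * s)) \<le> exp (real (2 * k) * ln (1 + s) + 1)" by simp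
      also have "\<dots> = (1 + s) ^ (2 * k) * exp 1"
      proof -
        have "exp (real (2 * k) * ln (1 + s)) = exp (ln (1 + s)) ^ (2 * k)" by (rule exp_of_nat_mult)
        moreover have "exp (ln (1 + s)) = 1 + s" using s2 by simp
        ultimately show ?thesis by (simp only: exp_add)
      qed
      also have "\<dots> \<le> (1 + s) ^ (2 * k) * 3" using s2 exp_le by (intro mult_left_mono) auto
      finally have ex: "exp (2 * (real k * s)) \<le> (1 + s) ^ (2 * k) * 3" .
      have nexp: "cmod (exp (- \<i> * of_real (real k / v) * (z - w))) = exp (real k * s)"
        by (simp add: s_def v_def)
      have "cmod (H (z - w)) = cmod (f (w + (z - w))) * cmod (exp (- \<i> * of_real (real k / v) * (z - w)))"
        unfolding H_def by (rule norm_mult)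
      also have "w + (z - w) = z" by simp
      finally have "(cmod (H (z - w)))\<^sup>2 = (cmod (f z))\<^sup>2 * exp (2 * (real k * s))"
        unfolding nexp by (simp only: power_mult_distrib exp_double)
      also have "\<dots> * v ^ (2 * k) \<le> (cmod (f z))\<^sup>2 * ((1 + s) ^ (2 * k) * 3) * v ^ (2 * k)"
        using ex v by (intro mult_right_mono mult_left_mono) auto
      also have "\<dots> = 3 * ((cmod (f z))\<^sup>2 * ((1 + s) * v) ^ (2 * k))" by (simp add: power_mult_distrib)
      also have "(1 + s) * v = Im z" using v by (simp add: s_def field_simps)
      finally show ?thesis by (simp add: pointwise_norm_sq_def mult.commute)
    qed
    have [measurable]: "f \<in> borel_measurable borel" by (rule cusp_form_measurable[OF f])
    have [measurable]: "H \<in> borel_measurable borel" unfolding H_def by measurable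
    have [measurable]: "ball w \<rho> \<in> sets borel" "ball (0::complex) \<rho> \<in> sets borel" by simp_all
    have pm [measurable]: "(\<lambda>z. ennreal (pointwise_norm_sq k f z)) \<in> borel_measurable borel" by (rule pointwise_measurable[OF f])
    have "ennreal ((cmod (deriv f w))\<^sup>2 * (\<rho> ^ 4 / 128)) \<le> (\<integral>\<^sup>+ \<zeta>. ennreal ((cmod (H \<zeta>))\<^sup>2) * indicator (ball 0 \<rho>) \<zeta> \<partial>lborel)"
      using area_derivative_bound[OF Hhol \<rho>0] \<rho>v v unfolding dH by simp
    also have "\<dots> = (\<integral>\<^sup>+ z. ennreal ((cmod (H (z - w)))\<^sup>2) * indicator (ball w \<rho>) z \<partial>lborel)"
    proof -
      have "(\<integral>\<^sup>+ z. ennreal ((cmod (H (z - w)))\<^sup>2) * indicator (ball w \<rho>) z \<partial>lborel)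
        = (\<integral>\<^sup>+ z. ennreal ((cmod (H (z - w)))\<^sup>2) * indicator (ball w \<rho>) z \<partial>(distr lborel borel ((+) w)))"
        by (simp add: lborel_distr_plus)
      also have "\<dots> = (\<integral>\<^sup>+ \<zeta>. ennreal ((cmod (H \<zeta>))\<^sup>2) * indicator (ball 0 \<rho>) \<zeta> \<partial>lborel)"
        by (subst nn_integral_distr) (auto intro!: nn_integral_cong simp: dist_norm split: split_indicator)
      finally show ?thesis by simp
    qed
    finally have "ennreal (v ^ (2 * k)) * ennreal ((cmod (deriv f w))\<^sup>2 * (\<rho> ^ 4 / 128))
       \<le> ennreal (v ^ (2 * k)) * (\<integral>\<^sup>+ z. ennreal ((cmod (H (z - w)))\<^sup>2) * indicator (ball w \<rho>) z \<partial>lborel)"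
      by (rule mult_left_mono) simp
    also have "\<dots> = (\<integral>\<^sup>+ z. ennreal ((cmod (H (z - w)))\<^sup>2 * v ^ (2 * k)) * indicator (ball w \<rho>) z \<partial>lborel)"
      using v by (subst nn_integral_cmult[symmetric]) (auto intro!: nn_integral_cong simp: ennreal_mult mult_ac)
    also have "\<dots> \<le> (\<integral>\<^sup>+ z. ennreal (12 * v\<^sup>2) * (ennreal (indicator uhp z / (Im z)\<^sup>2) * (ennreal (pointwise_norm_sq k f z) * indicator (ball w \<rho>) z)) \<partial>lborel)"
    proof (rule nn_integral_mono)
      fix z
      show "ennreal ((cmod (H (z - w)))\<^sup>2 * v ^ (2 * k)) * indicator (ball w \<rho>) z
         \<le> ennreal (12 * v\<^sup>2) * (ennreal (indicator uhp z / (Im z)\<^sup>2) * (ennreal (pointwise_norm_sq k f z) * indicator (ball w \<rho>) z))"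
      proof (cases "z \<in> ball w \<rho>")
        case True
        have zu: "z \<in> uhp" using True Eu by auto
        have y: "0 < Im z" "Im z \<le> 2 * v" using Eim[OF True] v by auto
        have "(Im z)\<^sup>2 \<le> (2 * v)\<^sup>2" using y by (intro power_mono) auto
        then have "1 \<le> 4 * v\<^sup>2 * (1 / (Im z)\<^sup>2)" using y by (simp add: field_simps)
        then have "3 * pointwise_norm_sq k f z * 1 \<le> 3 * pointwise_norm_sq k f z * (4 * v\<^sup>2 * (1 / (Im z)\<^sup>2))"
          using pointwise_nonneg by (intro mult_left_mono) auto
        then have "(cmod (H (z - w)))\<^sup>2 * v ^ (2 * k) \<le> 12 * v\<^sup>2 * (1 / (Im z)\<^sup>2 * pointwise_norm_sq k f z)"
          using flat[OF True] by (simp add: mult_ac)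
        then show ?thesis using True zu pointwise_nonneg
          by (simp add: ennreal_mult[symmetric] ennreal_leI)
      qed simp
    qed
    also have "\<dots> = ennreal (12 * v\<^sup>2) * (\<integral>\<^sup>+ z. ennreal (pointwise_norm_sq k f z) * indicator (ball w \<rho>) z \<partial>hyp_measure)"
      unfolding hyp_measure_def by (subst nn_integral_density) (auto simp: nn_integral_cmult)
    also have "\<dots> \<le> ennreal (12 * v\<^sup>2) * normsq k f"
      using Eu pack by (intro mult_left_mono normsq_ge[OF f]) auto
    finally have fin: "ennreal (v ^ (2 * k)) * ennreal ((cmod (deriv f w))\<^sup>2 * (\<rho> ^ 4 / 128)) \<le> ennreal (12 * v\<^sup>2) * normsq k f" .
    have "\<rho> ^ 4 = \<delta> ^ 4 * v ^ 4 / real k ^ 2"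
    proof -
      have "sqrt (real k) ^ 4 = real k ^ 2" using power_mult[of "sqrt (real k)" 2 2] by simp
      then show ?thesis by (simp add: \<rho>_def power_divide power_mult_distrib)
    qed
    then have "(cmod (deriv f w))\<^sup>2 * v ^ (2 * k + 2) = (128 * real k ^ 2 / (\<delta> ^ 4 * v\<^sup>2)) * (v ^ (2 * k) * ((cmod (deriv f w))\<^sup>2 * (\<rho> ^ 4 / 128)))"
      using \<delta> v k by (simp add: power_add field_simps power4_eq_xxxx power2_eq_square)
    then have "ennreal ((cmod (deriv f w))\<^sup>2 * v ^ (2 * k + 2)) = ennreal (128 * real k ^ 2 / (\<delta> ^ 4 * v\<^sup>2)) * (ennreal (v ^ (2 * k)) * ennreal ((cmod (deriv f w))\<^sup>2 * (\<rho> ^ 4 / 128)))"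
      using \<delta> v \<rho>0 by (simp add: ennreal_mult[symmetric])
    also have "\<dots> \<le> ennreal (128 * real k ^ 2 / (\<delta> ^ 4 * v\<^sup>2)) * (ennreal (12 * v\<^sup>2) * normsq k f)"
      by (intro mult_left_mono fin) simp
    also have "\<dots> = ennreal (1536 / \<delta> ^ 4 * real k ^ 2) * normsq k f"
      using \<delta> v by (simp add: mult.assoc[symmetric] ennreal_mult[symmetric])
    finally show "ennreal ((cmod (deriv f w))\<^sup>2 * Im w ^ (2 * k + 2)) \<le> ennreal (1536 / \<delta> ^ 4 * real k ^ 2) * normsq k f"
      by (simp add: v_def)
  qed
qed

end

subsection \<open>The cusp\<close>

text \<open>An upper incomplete gamma integral. For \<open>j = 2 * k - 2\<close> and
  \<open>c = 4 * pi * m\<close> it is the squared norm of the m-th power of \<open>q\<close> over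
  the strip of width one above height 1.\<close>

definition igam :: "nat \<Rightarrow> real \<Rightarrow> real" where
  "igam j c = (LINT y:{1..}|lborel. y ^ j * exp (- c * y))"

text \<open>Half of the exponential absorbs the power.\<close>

lemma igam_integrable:
  fixes c :: real
  assumes c: "c > 0"
  shows "set_integrable lborel {1..} (\<lambda>y. y ^ j * exp (- c * y))"
proof -
  define a where "a = c / 2"
  have a: "a > 0" using c by (simp add: a_def)
  have lim: "((\<lambda>y. - exp (- a * y) / a) \<longlongrightarrow> 0) at_top" using a by real_asymp
  have "(\<integral>\<^sup>+ y. ennreal (exp (- a * y)) * indicator {1..} y \<partial>lborel) = ennreal (0 - (- exp (- a * 1) / a))"
    using a by (intro nn_integral_FTC_atLeast[OF _ _ _ lim]) (auto intro!: derivative_eq_intros)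
  then have fin: "(\<integral>\<^sup>+ y. ennreal (exp (- a * y)) * indicator {1..} y \<partial>lborel) < \<infinity>" by simp
  have e: "set_integrable lborel {1..} (\<lambda>y. exp (- a * y))"
    unfolding set_integrable_def
  proof (rule integrableI_bounded)
    have "(\<integral>\<^sup>+ y. ennreal (norm (indicator {1..} y *\<^sub>R exp (- a * y))) \<partial>lborel) = (\<integral>\<^sup>+ y. ennreal (exp (- a * y)) * indicator {1..} y \<partial>lborel)"
      by (intro nn_integral_cong) (auto split: split_indicator)
    then show "(\<integral>\<^sup>+ y. ennreal (norm (indicator {1..} y *\<^sub>R exp (- a * y))) \<partial>lborel) < \<infinity>" using fin by simp
  qed simp
  have "set_integrable lborel {1..} (\<lambda>y. (fact j / a ^ j) * exp (- a * y))"
    using e by (rule set_integrable_mult_right)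
  then show ?thesis
  proof (rule set_integrable_bound)
    show "AE y\<in>{1..} in lborel. norm (y ^ j * exp (- c * y)) \<le> norm (fact j / a ^ j * exp (- a * y))"
    proof (intro AE_I2 impI)
      fix y :: real assume y: "y \<in> {1..}"
      have "(a * y) ^ j * exp (- (a * y)) \<le> fact j" using a y by (intro power_exp_le) auto
      then have "y ^ j * exp (- (a * y)) \<le> fact j / a ^ j"
        using a by (simp add: power_mult_distrib pos_le_divide_eq mult_ac)
      then have "y ^ j * exp (- (a * y)) * exp (- (a * y)) \<le> fact j / a ^ j * exp (- (a * y))"
        by (intro mult_right_mono) auto
      also have "y ^ j * exp (- (a * y)) * exp (- (a * y)) = y ^ j * exp (- c * y)"
        by (simp add: a_def mult.assoc flip: exp_add)
      finally show "norm (y ^ j * exp (- c * y)) \<le> norm (fact j / a ^ j * exp (- a * y))" using a y by simp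
    qed
  qed (simp add: set_borel_measurable_def)
qed

lemma igam_nn:
  assumes c: "c > 0"
  shows "(\<integral>\<^sup>+ y. ennreal (y ^ j * exp (- c * y)) * indicator {1..} y \<partial>lborel) = ennreal (igam j c)"
proof -
  have "(\<integral>\<^sup>+ y. ennreal (y ^ j * exp (- c * y)) * indicator {1..} y \<partial>lborel)
     = (\<integral>\<^sup>+ y. ennreal (indicator {1..} y *\<^sub>R (y ^ j * exp (- c * y))) \<partial>lborel)"
    by (intro nn_integral_cong) (auto split: split_indicator)
  also have "\<dots> = ennreal (igam j c)"
    unfolding igam_def set_lebesgue_integral_def
    using igam_integrable[OF c, of j] unfolding set_integrable_def
    by (intro nn_integral_eq_integral) (auto simp: indicator_def)
  finally show ?thesis .
qed

lemma igam_ge: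
  assumes c: "c > 0" and Y: "Y \<ge> 1"
  shows "igam j c \<ge> Y ^ j * exp (- c * (Y + 1))"
proof -
  have "ennreal (Y ^ j * exp (- c * (Y + 1))) = (\<integral>\<^sup>+ y. ennreal (Y ^ j * exp (- c * (Y + 1))) * indicator {Y..Y + 1} y \<partial>lborel)"
    by (subst nn_integral_cmult_indicator) (auto simp: emeasure_lborel_Icc_eq)
  also have "\<dots> \<le> (\<integral>\<^sup>+ y. ennreal (y ^ j * exp (- c * y)) * indicator {1..} y \<partial>lborel)"
    using Y c by (intro nn_integral_mono)
      (auto split: split_indicator intro!: ennreal_leI mult_mono power_mono)
  also have "\<dots> = ennreal (igam j c)" by (rule igam_nn[OF c])
  finally show ?thesis
    by (subst (asm) ennreal_le_iff) (auto simp: igam_def set_lebesgue_integral_def indicator_def intro!: integral_nonneg_AE AE_I2)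
qed

lemma igam_pos: "c > 0 \<Longrightarrow> igam j c > 0"
  using igam_ge[of c 1 j] by (smt (verit) exp_gt_zero mult_pos_pos power_one)

text \<open>Integrating the derivative of \<open>y ^ Suc j * exp (- c * y)\<close> leaves the
  boundary term \<open>exp (- c)\<close>, which \<open>c * igam j c\<close> dominates. In other
  words, the mean height for the weight \<open>y ^ j * exp (- c * y)\<close> is at most
  \<open>Suc j / c + 1\<close>.\<close>

lemma igam_mean:
  assumes c: "c > 0"
  shows "c * igam (Suc j) c \<le> (real (Suc j) + c) * igam j c"
proof -
  define f where "f = (\<lambda>y::real. c * (y ^ Suc j * exp (- c * y)) - real (Suc j) * (y ^ j * exp (- c * y)))"
  have fi: "set_integrable lborel {1..} f"
    unfolding f_def by (intro set_integral_diff set_integrable_mult_right igam_integrable c)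
  have lim: "((\<lambda>b. LINT y:{1..b}|lborel. f y) \<longlongrightarrow> (LINT y:{1..}|lborel. f y)) at_top"
    by (rule tendsto_set_lebesgue_integral_at_top[OF _ fi]) simp
  have bd: "(LINT y:{1..b}|lborel. f y) \<le> exp (- c)" if b: "b \<ge> 1" for b
  proof -
    have "(LINT y:{1..b}|lborel. f y) = (\<integral>y. f y * indicator {1..b} y \<partial>lborel)"
      unfolding set_lebesgue_integral_def by (simp add: mult.commute)
    also have "\<dots> = (\<lambda>y. - (y ^ Suc j * exp (- c * y))) b - (\<lambda>y. - (y ^ Suc j * exp (- c * y))) 1"
    proof (rule integral_FTC_Icc_real[OF b])
      show "((\<lambda>y. - (y ^ Suc j * exp (- c * y))) has_real_derivative f y) (at y)" for y
      proof -
        have p: "((\<lambda>y. y ^ Suc j) has_real_derivative real (Suc j) * y ^ j) (at y)"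
          using DERIV_pow[of "Suc j" y] by simp
        have e: "((\<lambda>y. exp (- c * y)) has_real_derivative - c * exp (- c * y)) (at y)"
          by (auto intro!: derivative_eq_intros)
        show ?thesis
          by (rule DERIV_cong[OF DERIV_minus[OF DERIV_mult[OF p e]]]) (simp add: f_def algebra_simps)
      qed
      show "isCont f y" for y unfolding f_def by (intro continuous_intros)
    qed
    also have "\<dots> \<le> exp (- c)" using b by simp
    finally show ?thesis .
  qed
  have "(LINT y:{1..}|lborel. f y) \<le> exp (- c)"
    by (rule tendsto_upperbound[OF lim]) (auto intro: eventually_mono[OF eventually_ge_at_top[of 1]] bd)
  moreover have "(LINT y:{1..}|lborel. f y) = c * igam (Suc j) c - real (Suc j) * igam j c"
    unfolding f_def igam_def
    by (simp only: set_integral_diff set_integrable_mult_right igam_integrable c set_integral_mult_right)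
  moreover have "exp (- c) \<le> c * igam j c"
  proof -
    have l0: "((\<lambda>y. - exp (- c * y)) \<longlongrightarrow> 0) at_top" using c by real_asymp
    have "ennreal (exp (- c)) = ennreal (0 - (- exp (- c * 1)))" by simp
    also have "\<dots> = (\<integral>\<^sup>+ y. ennreal (c * exp (- c * y)) * indicator {1..} y \<partial>lborel)"
      using c by (intro nn_integral_FTC_atLeast[OF _ _ _ l0, symmetric]) (auto intro!: derivative_eq_intros)
    also have "\<dots> \<le> (\<integral>\<^sup>+ y. ennreal c * (ennreal (y ^ j * exp (- c * y)) * indicator {1..} y) \<partial>lborel)"
    proof (intro nn_integral_mono)
      fix y :: real
      show "ennreal (c * exp (- c * y)) * indicator {1..} y \<le> ennreal c * (ennreal (y ^ j * exp (- c * y)) * indicator {1..} y)"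
      proof (cases "y \<ge> 1")
        case True
        then have "1 * exp (- c * y) \<le> y ^ j * exp (- c * y)" by (intro mult_right_mono one_le_power) auto
        then have "c * exp (- c * y) \<le> c * (y ^ j * exp (- c * y))" using c by simp
        then show ?thesis using True c by (simp add: ennreal_mult[symmetric] ennreal_leI)
      qed simp
    qed
    also have "\<dots> = ennreal c * ennreal (igam j c)"
      unfolding igam_nn[OF c, symmetric] by (rule nn_integral_cmult) measurable
    finally show ?thesis
      using c igam_pos[OF c, of j] by (simp add: ennreal_mult[symmetric])
  qed
  ultimately show ?thesis by (simp add: algebra_simps)
qed

text \<open>Jensen's inequality for \<open>exp (- d y)\<close>, through the tangent line at \<open>t\<close>.\<close>

lemma igam_shift_ge:
  assumes c: "c > 0" and d: "d \<ge> 0" and t: "real (Suc j) / c + 1 \<le> t"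
  shows "igam j (c + d) \<ge> exp (- d * t) * igam j c"
proof -
  have cd: "c + d > 0" using c d by simp
  have i1: "set_integrable lborel {1..} (\<lambda>y. (1 + d * t) * (y ^ j * exp (- c * y)) - d * (y ^ Suc j * exp (- c * y)))"
    by (intro set_integral_diff set_integrable_mult_right igam_integrable c)
  have "c * (real (Suc j) / c + 1) \<le> c * t" using t c by (intro mult_left_mono) auto
  moreover have "c * (real (Suc j) / c + 1) = real (Suc j) + c" using c by (simp add: distrib_left del: of_nat_Suc)
  ultimately have "real (Suc j) + c \<le> c * t" by simp
  then have "(real (Suc j) + c) * igam j c \<le> (c * t) * igam j c"
    using igam_pos[OF c, of j] by (intro mult_right_mono) auto
  with igam_mean[OF c, of j] have "c * igam (Suc j) c \<le> c * (t * igam j c)" by (simp add: mult.assoc)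
  \<comment> \<open>The mean height is at most \<open>t\<close>, so the decreasing tangent line at
    \<open>t\<close> has a mean no smaller than its value there.\<close>
  then have m: "igam (Suc j) c \<le> t * igam j c" using c by simp
  have "exp (- d * t) * igam j c \<le> exp (- d * t) * ((1 + d * t) * igam j c - d * igam (Suc j) c)"
    using mult_left_mono[OF m d] by (intro mult_left_mono) (auto simp: algebra_simps)
  also have "(1 + d * t) * igam j c - d * igam (Suc j) c = (LINT y:{1..}|lborel. (1 + d * t) * (y ^ j * exp (- c * y)) - d * (y ^ Suc j * exp (- c * y)))"
    unfolding igam_def by (simp only: set_integral_diff set_integrable_mult_right igam_integrable c set_integral_mult_right)
  also have "exp (- d * t) * \<dots> = (LINT y:{1..}|lborel. exp (- d * t) * ((1 + d * t) * (y ^ j * exp (- c * y)) - d * (y ^ Suc j * exp (- c * y))))"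
    by (rule set_integral_mult_right[symmetric])
  also have "\<dots> \<le> (LINT y:{1..}|lborel. y ^ j * exp (- (c + d) * y))"
  proof (rule set_integral_mono)
    fix y :: real assume y: "y \<in> {1..}"
    have "1 + (- d * (y - t)) \<le> exp (- d * (y - t))" by (rule exp_ge_add_one_self)
    then have "exp (- d * t) * (1 + (- d * (y - t))) \<le> exp (- d * t) * exp (- d * (y - t))" by (intro mult_left_mono) auto
    also have "\<dots> = exp (- d * y)" by (simp add: algebra_simps flip: exp_add)
    finally have "(y ^ j * exp (- c * y)) * (exp (- d * t) * (1 + (- d * (y - t)))) \<le> (y ^ j * exp (- c * y)) * exp (- d * y)"
      using y by (intro mult_left_mono) auto
    also have "\<dots> = y ^ j * exp (- (c + d) * y)" by (simp add: algebra_simps flip: exp_add)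
    finally show "exp (- d * t) * ((1 + d * t) * (y ^ j * exp (- c * y)) - d * (y ^ Suc j * exp (- c * y))) \<le> y ^ j * exp (- (c + d) * y)"
      by (simp add: algebra_simps)
  qed (use i1 igam_integrable[OF cd] in \<open>auto intro: set_integrable_mult_right\<close>)
  finally show ?thesis by (simp add: igam_def)
qed

section \<open>Fourier expansion over the cusp strip\<close>

context cusped_surface begin

definition strip :: "complex set" where
  "strip = {z. 0 \<le> Re z \<and> Re z < 1 \<and> 1 < Im z}"

lemma strip_uhp: "strip \<subseteq> uhp" and strip_borel [measurable]: "strip \<in> sets borel"
proof -
  show "strip \<subseteq> uhp" by (auto simp: strip_def uhp_def)
  have [measurable]: "Re \<in> borel_measurable borel"
    by (intro borel_measurable_continuous_onI continuous_intros)
  show "strip \<in> sets borel" unfolding strip_def by measurable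
qed

text \<open>Translations are excluded by the width of the strip, all other elements because they
  send heights above 1 below 1.\<close>

lemma strip_pack:
  assumes A: "A \<in> G" "A \<noteq> mat 1" "A \<noteq> - mat 1" and z: "z \<in> strip"
  shows "moebius A z \<notin> strip"
proof
  assume Az: "moebius A z \<in> strip"
  have zu: "z \<in> uhp" and y: "Im z > 1" using z strip_uhp by (auto simp: strip_def)
  show False
  proof (cases "A$2$1 = 0")
    case True
    then obtain n where n: "A = translation n \<or> A = - translation n" using stab_G[OF A(1)] by blast
    then have "moebius A z = z + of_int n" by auto
    then have "\<bar>of_int n\<bar> < (1::real)" using z Az by (auto simp: strip_def)
    then have "n = 0" by linarith
    then have "A = mat 1 \<or> A = - mat 1" using n by (auto simp: mat2_eq_iff)
    then show False using A by blast
  next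
    case False
    have "Im (moebius A z) \<le> 1 / Im z" by (rule Im_moebius_le[OF A(1) False zu])
    also have "\<dots> < 1" using y by simp
    finally show False using Az by (simp add: strip_def)
  qed
qed

lemma nn_integral_strip:
  assumes [measurable]: "F \<in> borel_measurable borel"
  shows "(\<integral>\<^sup>+ z. F z * indicator strip z \<partial>hyp_measure)
    = (\<integral>\<^sup>+ y. ennreal (1 / y\<^sup>2) * (\<integral>\<^sup>+ x. F (Complex x y) * indicator {0..1} x \<partial>lborel) * indicator {1..} y \<partial>lborel)"
proof -
  have "(\<integral>\<^sup>+ z. F z * indicator strip z \<partial>hyp_measure) = (\<integral>\<^sup>+ z. ennreal (indicator uhp z / (Im z)\<^sup>2) * (F z * indicator strip z) \<partial>lborel)"
    unfolding hyp_measure_def by (rule nn_integral_density) simp_all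
  also have "\<dots> = (\<integral>\<^sup>+ y. \<integral>\<^sup>+ x. ennreal (indicator uhp (Complex x y) / (Im (Complex x y))\<^sup>2) * (F (Complex x y) * indicator strip (Complex x y)) \<partial>lborel \<partial>lborel)"
    by (rule nn_integral_complex) simp
  also have "\<dots> = (\<integral>\<^sup>+ y. ennreal (1 / y\<^sup>2) * (\<integral>\<^sup>+ x. F (Complex x y) * indicator {0..1} x \<partial>lborel) * indicator {1..} y \<partial>lborel)"
  proof (rule nn_integral_cong_AE)
    show "AE y in lborel. (\<integral>\<^sup>+ x. ennreal (indicator uhp (Complex x y) / (Im (Complex x y))\<^sup>2) * (F (Complex x y) * indicator strip (Complex x y)) \<partial>lborel)
       = ennreal (1 / y\<^sup>2) * (\<integral>\<^sup>+ x. F (Complex x y) * indicator {0..1} x \<partial>lborel) * indicator {1..} y"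
      using AE_lborel_singleton[of "1::real"]
    proof (rule AE_mp, intro AE_I2 impI)
      fix y :: real assume y1: "y \<noteq> 1"
      show "(\<integral>\<^sup>+ x. ennreal (indicator uhp (Complex x y) / (Im (Complex x y))\<^sup>2) * (F (Complex x y) * indicator strip (Complex x y)) \<partial>lborel)
       = ennreal (1 / y\<^sup>2) * (\<integral>\<^sup>+ x. F (Complex x y) * indicator {0..1} x \<partial>lborel) * indicator {1..} y"
      proof (cases "y > 1")
        case True
        have "(\<integral>\<^sup>+ x. ennreal (indicator uhp (Complex x y) / (Im (Complex x y))\<^sup>2) * (F (Complex x y) * indicator strip (Complex x y)) \<partial>lborel)
          = (\<integral>\<^sup>+ x. ennreal (1 / y\<^sup>2) * (F (Complex x y) * indicator {0..1} x) \<partial>lborel)"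
        proof (rule nn_integral_cong_AE)
          show "AE x in lborel. ennreal (indicator uhp (Complex x y) / (Im (Complex x y))\<^sup>2) * (F (Complex x y) * indicator strip (Complex x y))
             = ennreal (1 / y\<^sup>2) * (F (Complex x y) * indicator {0..1} x)"
            using AE_lborel_singleton[of "1::real"]
            by (rule AE_mp, intro AE_I2 impI) (use True in \<open>auto simp: uhp_def strip_def indicator_def\<close>)
        qed
        also have "\<dots> = ennreal (1 / y\<^sup>2) * (\<integral>\<^sup>+ x. F (Complex x y) * indicator {0..1} x \<partial>lborel)"
          by (rule nn_integral_cmult) simp
        finally show ?thesis using True by simp
      next
        case False
        then show ?thesis using y1 by (simp add: strip_def)
      qed
    qed
  qed
  finally show ?thesis .
qed

lemma Complex_qpar: "qpar (Complex x y) = of_real (exp (- 2 * pi * y)) * ecirc x"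
  by (simp add: qpar_def ecirc_def exp_of_real[symmetric] exp_add[symmetric] complex_eq_iff[of "_ * _"] Complex_eq algebra_simps
      del: exp_of_real)

text \<open>Bessel's inequality on each circle |q| = exp (- 2 pi y), integrated over y against
  \<open>y ^ (2 * k - 2)\<close>. The strip meets every orbit at most once, so its share is at most
  the full norm.\<close>

lemma cusp_bessel:
  assumes f: "f \<in> cusp_forms \<Gamma> k" and k: "k \<ge> 1" and F: "F holomorphic_on ball 0 1" "\<And>z. z \<in> uhp \<Longrightarrow> f z = F (qpar z)"
    and M: "finite M" "0 \<notin> M"
  shows "ennreal (\<Sum>m\<in>M. (cmod ((deriv ^^ m) F 0 / fact m))\<^sup>2 * igam (2 * k - 2) (4 * pi * real m)) \<le> normsq k f"
proof -
  define a where "a = (\<lambda>m. (cmod ((deriv ^^ m) F 0 / fact m))\<^sup>2)"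
  have c: "4 * pi * real m > 0" if "m \<in> M" for m
  proof -
    have "m > 0" using that M by (cases m) auto
    then show ?thesis by simp
  qed
  have row: "ennreal (\<Sum>m\<in>M. a m * exp (- (4 * pi * real m) * y))
     \<le> (\<integral>\<^sup>+ x. ennreal ((cmod (f (Complex x y)))\<^sup>2) * indicator {0..1} x \<partial>lborel)" if y: "y \<ge> 1" for y
  proof -
    \<comment> \<open>The modulus of \<open>q\<close> at height \<open>y\<close>; scaling by it
      moves that circle to the unit circle.\<close>
    define r where "r = exp (- 2 * pi * y)"
    have r: "0 < r" "r < 1" using y by (auto simp: r_def)
    have maps: "complex_of_real r * u \<in> ball 0 1" if "u \<in> ball 0 (1 / r)" for u
      using that r by (simp add: norm_mult field_simps)
    have "(F \<circ> (\<lambda>u. of_real r * u)) holomorphic_on ball 0 (1 / r)"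
      using maps by (intro holomorphic_on_compose_gen[OF _ F(1)] holomorphic_intros) blast
    then have hol: "(\<lambda>u. F (of_real r * u)) holomorphic_on ball 0 (1 / r)" by (simp add: o_def)
    have hd: "(deriv ^^ m) (\<lambda>u. F (of_real r * u)) 0 = of_real r ^ m * (deriv ^^ m) F 0" for m
      using higher_deriv_compose_linear[OF F(1), of "ball 0 (1 / r)" 0 "of_real r" m] maps r by simp
    have "ennreal (\<Sum>m\<in>M. (cmod ((deriv ^^ m) (\<lambda>u. F (of_real r * u)) 0 / fact m))\<^sup>2)
      \<le> (\<integral>\<^sup>+ x. ennreal ((cmod (F (of_real r * ecirc x)))\<^sup>2) * indicator {0..1} x \<partial>lborel)"
      using r by (intro bessel_circle_nn[OF hol _ M(1)]) simp
    moreover have "(cmod ((deriv ^^ m) (\<lambda>u. F (of_real r * u)) 0 / fact m))\<^sup>2 = a m * exp (- (4 * pi * real m) * y)" for m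
    proof -
      have "(r ^ m)\<^sup>2 = exp (- (4 * pi * real m) * y)"
        by (simp add: r_def flip: exp_of_nat_mult power_mult)
      then show ?thesis using r by (simp add: hd a_def norm_mult norm_divide norm_power power_mult_distrib power_divide)
    qed
    moreover have "F (of_real r * ecirc x) = f (Complex x y)" for x
      using F(2)[of "Complex x y"] y by (simp add: Complex_qpar r_def uhp_def)
    ultimately show ?thesis by simp
  qed
  have igm: "igam (2 * k - 2) (4 * pi * real m) \<ge> 0" if "m \<in> M" for m using igam_pos[OF c[OF that], of "2 * k - 2"] by simp
  have "ennreal (\<Sum>m\<in>M. a m * igam (2 * k - 2) (4 * pi * real m)) = (\<Sum>m\<in>M. ennreal (a m) * ennreal (igam (2 * k - 2) (4 * pi * real m)))"
    using igm by (subst sum_ennreal[symmetric]) (auto simp: a_def ennreal_mult)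
  also have "\<dots> = (\<Sum>m\<in>M. \<integral>\<^sup>+ y. ennreal (a m) * (ennreal (y ^ (2 * k - 2) * exp (- (4 * pi * real m) * y)) * indicator {1..} y) \<partial>lborel)"
    using igam_nn[OF c] by (intro sum.cong refl) (simp add: nn_integral_cmult)
  also have "\<dots> = (\<integral>\<^sup>+ y. (\<Sum>m\<in>M. ennreal (a m) * (ennreal (y ^ (2 * k - 2) * exp (- (4 * pi * real m) * y)) * indicator {1..} y)) \<partial>lborel)"
    by (intro nn_integral_sum[symmetric]) simp
  also have "\<dots> \<le> (\<integral>\<^sup>+ y. ennreal (1 / y\<^sup>2) * (\<integral>\<^sup>+ x. ennreal (pointwise_norm_sq k f (Complex x y)) * indicator {0..1} x \<partial>lborel) * indicator {1..} y \<partial>lborel)"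
  proof (rule nn_integral_mono)
    fix y :: real
    have [measurable]: "f \<in> borel_measurable borel" by (rule cusp_form_measurable[OF f])
    show "(\<Sum>m\<in>M. ennreal (a m) * (ennreal (y ^ (2 * k - 2) * exp (- (4 * pi * real m) * y)) * indicator {1..} y))
       \<le> ennreal (1 / y\<^sup>2) * (\<integral>\<^sup>+ x. ennreal (pointwise_norm_sq k f (Complex x y)) * indicator {0..1} x \<partial>lborel) * indicator {1..} y"
    proof (cases "y \<ge> 1")
      case True
      have yk: "1 / y\<^sup>2 * y ^ (2 * k) = y ^ (2 * k - 2)"
        using True k power_split2[of "2 * k" y] by simp
      have "(\<Sum>m\<in>M. ennreal (a m) * (ennreal (y ^ (2 * k - 2) * exp (- (4 * pi * real m) * y)) * indicator {1..} y))
         = ennreal (y ^ (2 * k - 2)) * ennreal (\<Sum>m\<in>M. a m * exp (- (4 * pi * real m) * y))"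
        using True by (simp add: a_def sum_ennreal[symmetric] sum_distrib_left ennreal_mult mult_ac)
      also have "\<dots> \<le> ennreal (y ^ (2 * k - 2)) * (\<integral>\<^sup>+ x. ennreal ((cmod (f (Complex x y)))\<^sup>2) * indicator {0..1} x \<partial>lborel)"
        by (intro mult_left_mono row True) simp
      also have "ennreal (y ^ (2 * k - 2)) = ennreal (1 / y\<^sup>2) * ennreal (y ^ (2 * k))"
        unfolding yk[symmetric] using True by (intro ennreal_mult) auto
      also have "ennreal (1 / y\<^sup>2) * ennreal (y ^ (2 * k)) * (\<integral>\<^sup>+ x. ennreal ((cmod (f (Complex x y)))\<^sup>2) * indicator {0..1} x \<partial>lborel)
         = ennreal (1 / y\<^sup>2) * (\<integral>\<^sup>+ x. ennreal (y ^ (2 * k)) * (ennreal ((cmod (f (Complex x y)))\<^sup>2) * indicator {0..1} x) \<partial>lborel)"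
        by (subst nn_integral_cmult) (auto simp: mult.assoc)
      also have "(\<integral>\<^sup>+ x. ennreal (y ^ (2 * k)) * (ennreal ((cmod (f (Complex x y)))\<^sup>2) * indicator {0..1} x) \<partial>lborel)
         = (\<integral>\<^sup>+ x. ennreal (pointwise_norm_sq k f (Complex x y)) * indicator {0..1} x \<partial>lborel)"
        using True by (intro nn_integral_cong) (simp add: pointwise_norm_sq_def ennreal_mult mult.assoc)
      finally show ?thesis using True by simp
    qed simp
  qed
  also have "\<dots> = (\<integral>\<^sup>+ z. ennreal (pointwise_norm_sq k f z) * indicator strip z \<partial>hyp_measure)"
    by (rule nn_integral_strip[symmetric, OF pointwise_measurable[OF f]])
  also have "\<dots> \<le> normsq k f"
    by (rule normsq_ge[OF f strip_borel strip_uhp strip_pack])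
  finally show ?thesis by (simp add: a_def)
qed

end

text \<open>The value of |q^m|^2 at height \<open>v\<close> over its squared strip norm, with
  \<open>m = Suc n\<close>: cusp forms have no zeroth coefficient, and after the shift
  \<open>n\<close> is the weight of the mode in the derivative at a zero.\<close>

definition cmode :: "nat \<Rightarrow> real \<Rightarrow> nat \<Rightarrow> real" where
  "cmode k v n = exp (- (4 * pi * real (Suc n)) * v) / igam (2 * k - 2) (4 * pi * real (Suc n))"

lemma cmode_pos: "cmode k v n > 0"
  using igam_pos[of "4 * pi * real (Suc n)" "2 * k - 2"] by (simp add: cmode_def)

text \<open>Passing to the next mode multiplies the numerator by \<open>exp (- 4 * pi * v)\<close>,
  but by Jensen \<open>igam\<close> at worst by \<open>exp (- 2 * pi * v)\<close>: from mode
  \<open>k / v\<close> on, the mean height of a mode is at most \<open>v / 4 + 1\<close>, which is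
  at most \<open>v / 2\<close>.\<close>

lemma cmode_decay:
  assumes k: "k \<ge> 1" and v: "v \<ge> 4" and n: "real k / v \<le> real (Suc n)"
  shows "cmode k v (Suc n) \<le> exp (- 2 * pi * v) * cmode k v n"
proof -
  define c where "c = 4 * pi * real (Suc n)"
  have c: "c > 0" by (simp add: c_def)
  have kn: "real k \<le> real (Suc n) * v" using n v by (simp add: pos_divide_le_eq)
  have "real (Suc (2 * k - 2)) \<le> 2 * real k" using k by simp
  also have "\<dots> \<le> 2 * (real (Suc n) * v)" using kn by simp
  also have "\<dots> \<le> pi * (real (Suc n) * v)" using pi_gt3 v by (intro mult_right_mono) auto
  also have "\<dots> = v / 4 * c" by (simp add: c_def)
  finally have "real (Suc (2 * k - 2)) / c \<le> v / 4" using c by (simp add: pos_divide_le_eq del: of_nat_Suc)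
  then have t: "real (Suc (2 * k - 2)) / c + 1 \<le> v / 2" using v by linarith
  have c': "4 * pi * real (Suc (Suc n)) = c + 4 * pi" by (simp add: c_def algebra_simps)
  have "igam (2 * k - 2) (c + 4 * pi) \<ge> exp (- (4 * pi) * (v / 2)) * igam (2 * k - 2) c"
    by (rule igam_shift_ge[OF c _ t]) simp
  then have g: "igam (2 * k - 2) (c + 4 * pi) \<ge> exp (- 2 * pi * v) * igam (2 * k - 2) c" by (simp add: mult.assoc)
  have p: "exp (- 2 * pi * v) * igam (2 * k - 2) c > 0" using igam_pos[OF c] by simp
  have "cmode k v (Suc n) = exp (- (c + 4 * pi) * v) / igam (2 * k - 2) (c + 4 * pi)"
    unfolding cmode_def c' ..
  also have "\<dots> \<le> exp (- (c + 4 * pi) * v) / (exp (- 2 * pi * v) * igam (2 * k - 2) c)"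
    by (rule frac_le[OF _ order_refl p g]) simp
  also have "\<dots> = exp (- (c + 4 * pi) * v) / exp (- 2 * pi * v) / igam (2 * k - 2) c" by simp
  also have "exp (- (c + 4 * pi) * v) / exp (- 2 * pi * v) = exp (- 2 * pi * v) * exp (- c * v)"
    by (simp add: algebra_simps flip: exp_diff exp_add)
  finally show ?thesis by (simp add: cmode_def c_def)
qed

lemma sum_half_power_le: "(\<Sum>i<M. (1/2::real) ^ i) \<le> 2"
proof -
  have "(\<Sum>i<M. (1/2::real) ^ i) = 2 - 2 * (1/2) ^ M" by (induction M) auto
  then show ?thesis by simp
qed

lemma sum_lessThan_add: "(\<Sum>n<a + b. f n) = (\<Sum>n<a. f n) + (\<Sum>i<b. f (a + i))"
  for f :: "nat \<Rightarrow> 'a::comm_monoid_add"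
  by (induction b) (auto simp: add.assoc)

lemma square_le_power2: "real (Suc i) ^ 2 \<le> 2 * 2 ^ Suc i"
proof (induction i)
  case (Suc i)
  show ?case
  proof (cases "i < 2")
    case True
    then consider "i = 0" | "i = 1" by linarith
    then show ?thesis by cases (auto simp: power2_eq_square)
  next
    case False
    then have "real i * real i \<ge> 2 * 2" by (intro mult_mono) auto
    then have "real (Suc (Suc i)) ^ 2 \<le> 2 * real (Suc i) ^ 2" using False by (simp add: power2_eq_square algebra_simps)
    then show ?thesis using Suc by simp
  qed
qed simp

lemma cusp_modes:
  assumes k: "k \<ge> 2" and v: "v \<ge> 4"
  obtains n0 where "real n0 * v < real k"
    "\<And>M. v\<^sup>2 * (\<Sum>n<M. (real n)\<^sup>2 * cmode k v n) \<le> 17 * real k ^ 3 * cmode k v n0"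
    "\<And>M. v \<ge> real k \<Longrightarrow> (\<Sum>n<M. (real n)\<^sup>2 * cmode k v n) \<le> 8 * exp (- 2 * pi * v) * cmode k v n0"
proof -
  define L where "L = nat \<lceil>real k / v\<rceil> - 1"
  have kv: "real k / v > 0" using k v by simp
  have L1: "real L < real k / v" and L2: "real k / v \<le> real (Suc L)"
  proof -
    have "\<lceil>real k / v\<rceil> \<ge> 1" using kv by linarith
    then have "nat \<lceil>real k / v\<rceil> \<ge> 1" "real (nat \<lceil>real k / v\<rceil>) = of_int \<lceil>real k / v\<rceil>" by linarith+
    then have "real L = of_int \<lceil>real k / v\<rceil> - 1" by (simp add: L_def of_nat_diff)
    then show "real L < real k / v" "real k / v \<le> real (Suc L)" by linarith+
  qed
  define \<beta> where "\<beta> = cmode k v"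
  have \<beta>0: "\<beta> n > 0" for n by (simp add: \<beta>_def cmode_pos)
  \<comment> \<open>The decay factor beyond \<open>L\<close>. The bound
    \<open>v\<^sup>2 * r \<le> 2\<close> keeps the tail below \<open>16 * k\<^sup>2\<close>, and
    \<open>r \<le> 1/4\<close> lets it beat the doubling in \<open>square_le_power2\<close>.\<close>
  define r where "r = exp (- 2 * pi * v)"
  have "r \<le> exp (- v)" using pi_gt3 v mult_right_mono[of 1 "2 * pi" v] by (simp add: r_def)
  then have "v\<^sup>2 * r \<le> v\<^sup>2 * exp (- v)" by (intro mult_left_mono) auto
  also have "\<dots> \<le> fact 2" using v by (intro power_exp_le) auto
  finally have rv: "v\<^sup>2 * r \<le> 2" by (simp only: fact_2)
  have "16 * r \<le> v\<^sup>2 * r" using v power_mono[of 4 v 2] by (intro mult_right_mono) (auto simp: r_def)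
  then have "16 * r \<le> 2" using rv by (rule order_trans)
  then have r: "0 < r" "r \<le> 1/4" by (simp_all add: r_def)
  have fin: "finite (\<beta> ` {..L})" "\<beta> ` {..L} \<noteq> {}" by auto
  obtain n0 where n0: "n0 \<le> L" "\<beta> n0 = Max (\<beta> ` {..L})"
    using Max_in[OF fin] by (metis imageE atMost_iff)
  have mx: "\<beta> n \<le> \<beta> n0" if "n \<le> L" for n using that fin unfolding n0(2) by (intro Max_ge) auto
  have dec: "\<beta> (L + i) \<le> r ^ i * \<beta> n0" for i
  proof (induction i)
    case 0 then show ?case using mx[of L] by simp
  next
    case (Suc i)
    have "real k / v \<le> real (Suc (L + i))" using L2 by simp
    then have "\<beta> (Suc (L + i)) \<le> r * \<beta> (L + i)"
      unfolding \<beta>_def r_def using k by (intro cmode_decay v) auto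
    also have "\<dots> \<le> r * (r ^ i * \<beta> n0)" using Suc r by (intro mult_left_mono) auto
    finally show ?case by (simp add: mult.assoc)
  qed
  have S: "(\<Sum>n<M. (real n)\<^sup>2 * \<beta> n) \<le> (real (Suc L) * (real L)\<^sup>2 + 8 * r * (real (Suc L))\<^sup>2) * \<beta> n0" for M
  proof -
    have "(\<Sum>n<M. (real n)\<^sup>2 * \<beta> n) \<le> (\<Sum>n<Suc L + M. (real n)\<^sup>2 * \<beta> n)"
      using \<beta>0 by (intro sum_mono2) (auto simp: less_imp_le)
    also have "\<dots> = (\<Sum>n<Suc L. (real n)\<^sup>2 * \<beta> n) + (\<Sum>i<M. (real (Suc L + i))\<^sup>2 * \<beta> (Suc L + i))"
      by (rule sum_lessThan_add)
    also have "(\<Sum>n<Suc L. (real n)\<^sup>2 * \<beta> n) \<le> (\<Sum>n<Suc L. (real L)\<^sup>2 * \<beta> n0)"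
      using mx \<beta>0 by (intro sum_mono mult_mono power_mono) (auto simp: less_imp_le)
    also have "\<dots> = real (Suc L) * (real L)\<^sup>2 * \<beta> n0" by simp
    also have "(\<Sum>i<M. (real (Suc L + i))\<^sup>2 * \<beta> (Suc L + i)) \<le> (\<Sum>i<M. 4 * r * (real (Suc L))\<^sup>2 * \<beta> n0 * (1/2) ^ i)"
    proof (rule sum_mono)
      fix i
      have "Suc L + i \<le> Suc L * Suc i" by simp
      then have "real (Suc L + i) \<le> real (Suc L) * real (Suc i)" by (metis of_nat_le_iff of_nat_mult)
      then have "(real (Suc L + i))\<^sup>2 \<le> (real (Suc L) * real (Suc i))\<^sup>2" by (intro power_mono) auto
      also have "\<dots> = (real (Suc L))\<^sup>2 * (real (Suc i))\<^sup>2" by (rule power_mult_distrib)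
      also have "\<dots> \<le> (real (Suc L))\<^sup>2 * (2 * 2 ^ Suc i)" by (intro mult_left_mono square_le_power2) auto
      finally have "(real (Suc L + i))\<^sup>2 \<le> (real (Suc L))\<^sup>2 * (2 * 2 ^ Suc i)" .
      moreover have "\<beta> (Suc L + i) \<le> r ^ Suc i * \<beta> n0" using dec[of "Suc i"] by simp
      ultimately have "(real (Suc L + i))\<^sup>2 * \<beta> (Suc L + i) \<le> (real (Suc L))\<^sup>2 * (2 * 2 ^ Suc i) * (r ^ Suc i * \<beta> n0)"
        using \<beta>0[of "Suc L + i"] by (intro mult_mono) auto
      also have "\<dots> = 4 * r * (real (Suc L))\<^sup>2 * \<beta> n0 * (2 * r) ^ i" by (simp add: power_mult_distrib mult_ac)
      also have "\<dots> \<le> 4 * r * (real (Suc L))\<^sup>2 * \<beta> n0 * (1/2) ^ i"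
        using r \<beta>0[of n0] by (intro mult_left_mono power_mono) auto
      finally show "(real (Suc L + i))\<^sup>2 * \<beta> (Suc L + i) \<le> 4 * r * (real (Suc L))\<^sup>2 * \<beta> n0 * (1/2) ^ i" .
    qed
    also have "\<dots> = 4 * r * (real (Suc L))\<^sup>2 * \<beta> n0 * (\<Sum>i<M. (1/2) ^ i)" by (simp add: sum_distrib_left)
    also have "\<dots> \<le> 4 * r * (real (Suc L))\<^sup>2 * \<beta> n0 * 2"
      using r \<beta>0[of n0] by (intro mult_left_mono sum_half_power_le) auto
    finally show ?thesis by (simp add: algebra_simps)
  qed
  show ?thesis
  proof (rule that[of n0])
    have Lv: "real L * v < real k" using L1 v by (simp add: pos_less_divide_eq)
    have "real n0 * v \<le> real L * v" using n0 v by (intro mult_right_mono) auto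
    then show "real n0 * v < real k" using Lv by linarith
    have Lk: "real (Suc L) \<le> real k"
    proof -
      have "real L * 4 \<le> real L * v" using v by (intro mult_left_mono) auto
      then have "real L * 4 < real k" using Lv by linarith
      then show ?thesis using k by linarith
    qed
    show "v\<^sup>2 * (\<Sum>n<M. (real n)\<^sup>2 * cmode k v n) \<le> 17 * real k ^ 3 * cmode k v n0" for M
    proof -
      have "v\<^sup>2 * (\<Sum>n<M. (real n)\<^sup>2 * \<beta> n) \<le> v\<^sup>2 * ((real (Suc L) * (real L)\<^sup>2 + 8 * r * (real (Suc L))\<^sup>2) * \<beta> n0)"
        by (intro mult_left_mono S) simp
      also have "\<dots> = (real (Suc L) * (real L * v)\<^sup>2 + 8 * (v\<^sup>2 * r) * (real (Suc L))\<^sup>2) * \<beta> n0"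
        by (simp add: power_mult_distrib algebra_simps)
      also have "\<dots> \<le> (real k * (real k)\<^sup>2 + 8 * 2 * (real k)\<^sup>2) * \<beta> n0"
        using Lk Lv rv v r \<beta>0[of n0] by (intro mult_right_mono add_mono mult_mono power_mono) auto
      also have "\<dots> \<le> (17 * real k ^ 3) * \<beta> n0"
      proof (rule mult_right_mono)
        have "(real k)\<^sup>2 \<le> real k ^ 3" using k by (intro power_increasing) auto
        then show "real k * (real k)\<^sup>2 + 8 * 2 * (real k)\<^sup>2 \<le> 17 * real k ^ 3" by (simp add: power3_eq_cube power2_eq_square)
      qed (use \<beta>0[of n0] in simp)
      finally show ?thesis by (simp add: \<beta>_def)
    qed
    show "(\<Sum>n<M. (real n)\<^sup>2 * cmode k v n) \<le> 8 * exp (- 2 * pi * v) * cmode k v n0" if vk: "v \<ge> real k" for M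
    proof -
      have "real k / v \<le> 1" using vk v by simp
      then have "L = 0" using L1 by simp
      then show ?thesis using S[of M] by (simp add: \<beta>_def r_def)
    qed
  qed
qed

section \<open>The derivative at a zero in the cusp\<close>

context cusped_surface begin

lemma qpar_has_derivative: "(qpar has_field_derivative 2 * pi * \<i> * qpar z) (at z)"
  unfolding qpar_def[abs_def] by (auto intro!: derivative_eq_intros)

text \<open>Subtracting the vanishing series of \<open>f w\<close> from that of
  \<open>q * deriv F q\<close> lowers the weight of the m-th mode to \<open>m - 1\<close>.
  Cauchy-Schwarz then separates the coefficients, controlled by \<open>cusp_bessel\<close>, from the
  sizes of the modes at \<open>w\<close>.\<close>

lemma cusp_derivative_bound:
  assumes f: "f \<in> cusp_forms \<Gamma> k" and k: "k \<ge> 1" and w: "w \<in> uhp" and fw: "f w = 0"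
    and S: "\<And>M. (\<Sum>n<M. (real n)\<^sup>2 * cmode k (Im w) n) \<le> S" and N: "normsq k f \<le> ennreal N" "N \<ge> 0"
  shows "(cmod (deriv f w))\<^sup>2 \<le> 4 * pi\<^sup>2 * S * N"
proof -
  obtain F where F: "F holomorphic_on ball 0 1" "F 0 = 0" "\<And>z. z \<in> uhp \<Longrightarrow> f z = F (qpar z)"
    using cusp_formD(4)[OF f] by blast
  define a where "a = (\<lambda>n. (deriv ^^ n) F 0 / fact n)"
  define q where "q = qpar w"
  have q1: "q \<in> ball 0 1" using w by (simp add: q_def norm_qpar uhp_def)
  have "(\<lambda>n. a n * q ^ n) sums F q"
    using holomorphic_power_series[OF F(1) q1] by (simp add: a_def)
  moreover have "F q = 0" using F(3)[OF w] fw by (simp add: q_def)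
  moreover have "a 0 = 0" using F(2) by (simp add: a_def)
  \<comment> \<open>The shift of the index uses that the zeroth coefficient vanishes.\<close>
  ultimately have s0: "(\<lambda>n. a (Suc n) * q ^ Suc n) sums 0"
    using sums_Suc_iff[of "\<lambda>n. a n * q ^ n" 0] by simp
  have dF: "deriv F holomorphic_on ball 0 1" by (rule holomorphic_deriv[OF F(1) open_ball])
  have "(\<lambda>n. (deriv ^^ n) (deriv F) 0 / fact n * q ^ n) sums deriv F q"
    using holomorphic_power_series[OF dF q1] by simp
  moreover have "(deriv ^^ n) (deriv F) 0 / fact n = of_nat (Suc n) * a (Suc n)" for n
    by (simp add: a_def funpow_swap1 fact_Suc del: of_nat_Suc)
  ultimately have "(\<lambda>n. of_nat (Suc n) * a (Suc n) * q ^ n) sums deriv F q" by simp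
  from sums_mult[OF this, of q] have "(\<lambda>n. of_nat (Suc n) * a (Suc n) * q ^ Suc n) sums (q * deriv F q)"
    by (simp add: mult_ac)
  from sums_diff[OF this s0] have sm: "(\<lambda>n. of_nat n * a (Suc n) * q ^ Suc n) sums (q * deriv F q)"
    by (simp add: algebra_simps)
  have "(F has_field_derivative deriv F q) (at q)"
    by (rule holomorphic_derivI[OF F(1) open_ball q1])
  then have "((\<lambda>z. F (qpar z)) has_field_derivative deriv F q * (2 * pi * \<i> * qpar w)) (at w)"
    unfolding q_def by (rule DERIV_chain2[OF _ qpar_has_derivative])
  then have "(f has_field_derivative deriv F q * (2 * pi * \<i> * qpar w)) (at w)"
    by (rule has_field_derivative_transform_within_open[OF _ open_uhp w]) (simp add: F(3))
  then have df: "deriv f w = 2 * pi * \<i> * (q * deriv F q)"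
    by (subst DERIV_imp_deriv) (auto simp: q_def mult_ac)
  define J where "J = (\<lambda>n. igam (2 * k - 2) (4 * pi * real (Suc n)))"
  have J: "J n > 0" for n unfolding J_def by (intro igam_pos) simp
  have partial: "cmod (\<Sum>n<M. of_nat n * a (Suc n) * q ^ Suc n) \<le> sqrt (S * N)" for M
  proof -
    have eq: "(\<Sum>m\<in>Suc ` {..<M}. (cmod ((deriv ^^ m) F 0 / fact m))\<^sup>2 * igam (2 * k - 2) (4 * pi * real m))
        = (\<Sum>n<M. (cmod (a (Suc n)))\<^sup>2 * J n)"
      by (subst sum.reindex) (simp_all add: a_def J_def)
    have "ennreal (\<Sum>m\<in>Suc ` {..<M}. (cmod ((deriv ^^ m) F 0 / fact m))\<^sup>2 * igam (2 * k - 2) (4 * pi * real m)) \<le> normsq k f"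
      by (rule cusp_bessel[OF f k F(1,3)]) auto
    also note N(1)
    finally have b: "(\<Sum>n<M. (cmod (a (Suc n)))\<^sup>2 * J n) \<le> N"
      unfolding eq ennreal_le_iff[OF N(2)] .
    have "cmod (\<Sum>n<M. of_nat n * a (Suc n) * q ^ Suc n) \<le> (\<Sum>n<M. cmod (of_nat n * a (Suc n) * q ^ Suc n))"
      by (rule norm_sum)
    also have "\<dots> = (\<Sum>n<M. (real n * cmod q ^ Suc n / sqrt (J n)) * (cmod (a (Suc n)) * sqrt (J n)))"
    proof (rule sum.cong[OF refl])
      fix n
      have "sqrt (J n) \<noteq> 0" using J[of n] by simp
      then show "cmod (of_nat n * a (Suc n) * q ^ Suc n) = (real n * cmod q ^ Suc n / sqrt (J n)) * (cmod (a (Suc n)) * sqrt (J n))"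
        by (simp add: norm_mult norm_power)
    qed
    finally have "(cmod (\<Sum>n<M. of_nat n * a (Suc n) * q ^ Suc n))\<^sup>2
        \<le> (\<Sum>n<M. (real n * cmod q ^ Suc n / sqrt (J n)) * (cmod (a (Suc n)) * sqrt (J n)))\<^sup>2"
      by (intro power_mono) auto
    also have "\<dots> \<le> (\<Sum>n<M. (real n * cmod q ^ Suc n / sqrt (J n))\<^sup>2) * (\<Sum>n<M. (cmod (a (Suc n)) * sqrt (J n))\<^sup>2)"
      by (rule Cauchy_Schwarz_ineq_sum)
    also have "(\<Sum>n<M. (cmod (a (Suc n)) * sqrt (J n))\<^sup>2) = (\<Sum>n<M. (cmod (a (Suc n)))\<^sup>2 * J n)"
      using J by (intro sum.cong refl) (simp add: power_mult_distrib less_imp_le)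
    also have "(\<Sum>n<M. (real n * cmod q ^ Suc n / sqrt (J n))\<^sup>2) = (\<Sum>n<M. (real n)\<^sup>2 * cmode k (Im w) n)"
    proof (rule sum.cong[OF refl])
      fix n
      have "(cmod q ^ Suc n)\<^sup>2 = exp (- (4 * pi * real (Suc n)) * Im w)"
        unfolding q_def norm_qpar by (simp add: algebra_simps flip: exp_of_nat_mult power_mult exp_add)
      then show "(real n * cmod q ^ Suc n / sqrt (J n))\<^sup>2 = (real n)\<^sup>2 * cmode k (Im w) n"
        using J[of n] by (simp add: cmode_def J_def power_mult_distrib power_divide del: of_nat_Suc power_Suc)
    qed
    also have "(\<Sum>n<M. (real n)\<^sup>2 * cmode k (Im w) n) * (\<Sum>n<M. (cmod (a (Suc n)))\<^sup>2 * J n) \<le> S * N"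
      using cmode_pos J S[of 0] by (intro mult_mono S b sum_nonneg) (auto simp: less_imp_le)
    finally show ?thesis by (rule real_le_rsqrt)
  qed
  have "cmod (q * deriv F q) \<le> sqrt (S * N)"
    by (rule tendsto_upperbound[OF tendsto_norm[OF sm[unfolded sums_def]]])
       (intro always_eventually allI partial, rule sequentially_bot)
  then have "(cmod (q * deriv F q))\<^sup>2 \<le> (sqrt (S * N))\<^sup>2" by (intro power_mono) auto
  moreover have "S * N \<ge> 0" using S[of 0] N by simp
  ultimately have "(cmod (q * deriv F q))\<^sup>2 \<le> S * N" by simp
  then have "4 * pi\<^sup>2 * (cmod (q * deriv F q))\<^sup>2 \<le> 4 * pi\<^sup>2 * (S * N)" by (intro mult_left_mono) auto
  then show ?thesis unfolding df by (simp add: norm_mult power_mult_distrib mult_ac)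
qed

end

section \<open>Norms of the Poincare series in the cusp\<close>

context cusped_surface begin

lemma poincare_qpar_norm:
  obtains C where "C > 0"
    "\<And>k m. k \<ge> 4 \<Longrightarrow> m \<ge> 1 \<Longrightarrow> real (m - 1) * exp 8 \<le> real k \<Longrightarrow>
       normsq k (poincare k (\<lambda>z. qpar z ^ m)) \<le> ennreal (C * igam (2 * k - 2) (4 * pi * real m))"
proof -
  obtain K where K: "compact K" "K \<subseteq> uhp" "\<And>z. z \<in> uhp \<Longrightarrow> \<exists>A\<in>G. moebius A z \<in> K \<or> Im (moebius A z) > 1"
    using cocompact_G[of 1] by blast
  obtain C1 where C1: "C1 > 0"
    "\<And>k m z. k \<ge> 2 \<Longrightarrow> z \<in> K \<Longrightarrow> (\<And>A. A \<in> G \<Longrightarrow> Im (moebius A z) \<le> 1) \<Longrightarrow>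
        cmod (poincare k (\<lambda>z. qpar z ^ m) z) * Im z ^ k \<le> C1"
    using poincare_qpar_low[OF K(1,2)] by blast
  obtain C2 where C2: "C2 > 0"
    "\<And>k m z. k \<ge> 2 \<Longrightarrow> Im z \<ge> 1 \<Longrightarrow> cmod (poincare k (\<lambda>z. qpar z ^ m) z - qpar z ^ m) \<le> C2 * Im z ^ 4 / Im z ^ (2 * k)"
    using poincare_qpar_high by blast
  define vol where "vol = enn2real (emeasure hyp_measure D)"
  have vol: "emeasure hyp_measure D = ennreal vol" "vol \<ge> 0" using finite_vol by (simp_all add: vol_def)
  define Y :: real where "Y = exp 8"
  have Y9: "Y \<ge> 9" using exp_ge_add_one_self[of 8] by (simp add: Y_def)
  define c0 where "c0 = exp (- 16 - 4 * pi * (Y + 1))"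
  have c0: "c0 > 0" by (simp add: c0_def)
  define C where "C = 2 + (2 * C2\<^sup>2 + C1\<^sup>2 * vol) / c0"
  have Wopen: "open (\<Union>A\<in>G. {z\<in>uhp. moebius A z \<in> {z. Im z > 1}})"
    by (intro open_UN ballI moebius_vimage_open det_G open_halfspace_Im_gt)
  define W where "W = (\<Union>A\<in>G. {z\<in>uhp. moebius A z \<in> {z. Im z > 1}})"
  have W [measurable]: "W \<in> sets borel" using Wopen by (simp add: W_def borel_open)
  have main: "normsq k (poincare k (\<lambda>z. qpar z ^ m)) \<le> ennreal (C * igam (2 * k - 2) (4 * pi * real m))"
    if k4: "k \<ge> 4" and m: "m \<ge> 1" and mk: "real (m - 1) * Y \<le> real k" for k m
  proof -
    let ?P = "poincare k (\<lambda>z. qpar z ^ m)"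
    have k: "k \<ge> 2" using k4 by simp
    define c where "c = 4 * pi * real m"
    have c: "c > 0" using m by (simp add: c_def)
    define g where "g = igam (2 * k - 2) c"
    have g0: "g > 0" unfolding g_def by (rule igam_pos[OF c])
    have gc: "c0 \<le> g"
    proof -
      have "real m \<le> real k / Y + 1"
      proof -
        have "real m * Y \<le> real k + Y" using mk m by (simp add: of_nat_diff algebra_simps)
        then have "real m \<le> (real k + Y) / Y" using Y9 by (subst pos_le_divide_eq) auto
        then show ?thesis using Y9 by (simp add: add_divide_distrib)
      qed
      then have "c * (Y + 1) \<le> 4 * pi * (real k / Y + 1) * (Y + 1)"
        unfolding c_def using Y9 by (intro mult_right_mono mult_left_mono) auto
      also have "\<dots> = 4 * pi * (1 + 1 / Y) * real k + 4 * pi * (Y + 1)"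
        using Y9 by (simp add: field_simps)
      also have "4 * pi * (1 + 1 / Y) * real k \<le> 16 * real k"
      proof (rule mult_right_mono)
        have "1 / Y \<le> 1 / 9" using Y9 by (intro divide_left_mono) auto
        then have "4 * pi * (1 + 1 / Y) \<le> 4 * pi * (10 / 9)" by (intro mult_left_mono) auto
        also have "\<dots> \<le> 16" using pi_less_4 pi_approx by simp
        finally show "4 * pi * (1 + 1 / Y) \<le> 16" .
      qed simp
      finally have ex: "c * (Y + 1) \<le> 16 * real k + 4 * pi * (Y + 1)" by simp
      have "Y ^ (2 * k - 2) = exp (8 * real (2 * k - 2))"
        unfolding Y_def by (simp add: exp_of_nat_mult[symmetric] mult.commute)
      also have "8 * real (2 * k - 2) = 16 * real k - 16" using k by (simp add: of_nat_diff)
      finally have "Y ^ (2 * k - 2) * exp (- c * (Y + 1)) = exp (16 * real k - 16 - c * (Y + 1))"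
        by (simp flip: exp_add)
      then have "c0 \<le> Y ^ (2 * k - 2) * exp (- c * (Y + 1))" using ex by (simp add: c0_def)
      also have "\<dots> \<le> g" unfolding g_def using Y9 by (intro igam_ge[OF c]) auto
      finally show ?thesis .
    qed
    have P: "?P \<in> cusp_forms \<Gamma> k" by (rule poincare_qpar_cusp_form[OF G_eq k4 m])
    have Pm [measurable]: "(\<lambda>z. ennreal (pointwise_norm_sq k ?P z)) \<in> borel_measurable borel"
      by (rule pointwise_measurable[OF P])
    have split: "normsq k ?P = (\<integral>\<^sup>+ z. ennreal (pointwise_norm_sq k ?P z) * indicator (D \<inter> W) z \<partial>hyp_measure)
        + (\<integral>\<^sup>+ z. ennreal (pointwise_norm_sq k ?P z) * indicator (D - W) z \<partial>hyp_measure)"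
      unfolding normsq_def by (subst nn_integral_add[symmetric]) (auto intro!: nn_integral_cong split: split_indicator)
    have "(\<integral>\<^sup>+ z. ennreal (pointwise_norm_sq k ?P z) * indicator (D \<inter> W) z \<partial>hyp_measure)
       \<le> (\<integral>\<^sup>+ z. ennreal (pointwise_norm_sq k ?P z) * indicator strip z \<partial>hyp_measure)"
    proof (rule unfolding_le[OF Pm])
      fix z assume z: "z \<in> D \<inter> W" "z \<in> uhp"
      then obtain A where A: "A \<in> G" "Im (moebius A z) > 1" unfolding W_def by blast
      define n where "n = - \<lfloor>Re (moebius A z)\<rfloor>"
      have "moebius (translation n ** A) z = moebius A z + of_int n"
        using A z by (simp add: moebius_mult det_G)
      moreover have "0 \<le> Re (moebius A z) + of_int n" "Re (moebius A z) + of_int n < 1" unfolding n_def by linarith+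
      ultimately show "\<exists>A\<in>G. moebius A z \<in> strip"
        using A mult_G[OF translation_G A(1)] by (intro bexI[of _ "translation n ** A"]) (auto simp: strip_def)
    next
      fix A assume "A \<in> G" "A \<noteq> mat 1" "A \<noteq> - mat 1"
      then show "AE z in hyp_measure. \<not> (z \<in> D \<inter> W \<and> moebius A z \<in> D \<inter> W)"
        using D_pack[of A] by (auto elim!: AE_mp)
    qed (auto simp: pointwise_invariant[OF P])
    also have "\<dots> \<le> (\<integral>\<^sup>+ z. ennreal (2 * (exp (- c * Im z) * \<bar>Im z\<bar> ^ (2 * k)) + 2 * C2\<^sup>2) * indicator strip z \<partial>hyp_measure)"
    proof (rule nn_integral_mono)
      fix z
      show "ennreal (pointwise_norm_sq k ?P z) * indicator strip z
         \<le> ennreal (2 * (exp (- c * Im z) * \<bar>Im z\<bar> ^ (2 * k)) + 2 * C2\<^sup>2) * indicator strip z"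
      proof (cases "z \<in> strip")
        case True
        then have y: "Im z > 1" by (simp add: strip_def)
        \<comment> \<open>In invariant norm the error is at most \<open>C2\<close>, since
          \<open>Im z ^ 4 \<le> Im z ^ k\<close>.\<close>
        define d where "d = ?P z - qpar z ^ m"
        have "cmod d * Im z ^ k \<le> C2 * Im z ^ 4 / Im z ^ (2 * k) * Im z ^ k"
          unfolding d_def using C2(2)[OF k, of z m] y by (intro mult_right_mono) auto
        also have "\<dots> = C2 * (Im z ^ 4 / Im z ^ k)"
          using y by (simp add: mult_2 power_add)
        also have "\<dots> \<le> C2 * 1"
        proof (rule mult_left_mono)
          have "Im z ^ 4 \<le> Im z ^ k" using k4 y by (intro power_increasing) auto
          then show "Im z ^ 4 / Im z ^ k \<le> 1" using y by simp
        qed (use C2 in simp)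
        finally have "cmod d * Im z ^ k \<le> C2" by simp
        then have d2: "(cmod d * Im z ^ k)\<^sup>2 \<le> C2\<^sup>2" using y by (intro power_mono) auto
        have "cmod (?P z) \<le> cmod (qpar z ^ m) + cmod d"
          unfolding d_def using norm_triangle_sub[of "?P z" "qpar z ^ m"] by simp
        then have "(cmod (?P z) * Im z ^ k)\<^sup>2 \<le> (cmod (qpar z ^ m) * Im z ^ k + cmod d * Im z ^ k)\<^sup>2"
          using y by (intro power_mono) (auto simp flip: distrib_right)
        also have "\<dots> \<le> 2 * (cmod (qpar z ^ m) * Im z ^ k)\<^sup>2 + 2 * (cmod d * Im z ^ k)\<^sup>2"
          using sum_squares_ge_zero[of "cmod (qpar z ^ m) * Im z ^ k - cmod d * Im z ^ k" 0]
          by (simp add: power2_eq_square algebra_simps)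
        also have "(cmod (qpar z ^ m) * Im z ^ k)\<^sup>2 = exp (- c * Im z) * \<bar>Im z\<bar> ^ (2 * k)"
        proof -
          have "(cmod (qpar z ^ m))\<^sup>2 = exp (- c * Im z)"
            unfolding norm_power norm_qpar c_def by (simp add: algebra_simps flip: exp_of_nat_mult power_mult)
          then show ?thesis using y by (simp add: power_mult_distrib power_mult mult.commute[of 2] flip: power_mult)
        qed
        finally have "(cmod (?P z) * Im z ^ k)\<^sup>2 \<le> 2 * (exp (- c * Im z) * \<bar>Im z\<bar> ^ (2 * k)) + 2 * C2\<^sup>2" using d2 by linarith
        moreover have "z \<in> uhp" using y by (simp add: uhp_def)
        ultimately show ?thesis using True by (simp add: pointwise_norm_sq_alt ennreal_leI del: ennreal_plus)
      qed simp
    qed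
    also have "\<dots> = (\<integral>\<^sup>+ y. ennreal (1 / y\<^sup>2) * (\<integral>\<^sup>+ x. ennreal (2 * (exp (- c * Im (Complex x y)) * \<bar>Im (Complex x y)\<bar> ^ (2 * k)) + 2 * C2\<^sup>2) * indicator {0..1} x \<partial>lborel) * indicator {1..} y \<partial>lborel)"
      by (rule nn_integral_strip) measurable
    also have "\<dots> = (\<integral>\<^sup>+ y. 2 * (ennreal (y ^ (2 * k - 2) * exp (- c * y)) * indicator {1..} y) + ennreal (2 * C2\<^sup>2) * (ennreal (1 / (1 + (y - 1))\<^sup>2) * indicator {0..} (y - 1)) \<partial>lborel)"
    proof (rule nn_integral_cong)
      fix y :: real
      show "ennreal (1 / y\<^sup>2) * (\<integral>\<^sup>+ x. ennreal (2 * (exp (- c * Im (Complex x y)) * \<bar>Im (Complex x y)\<bar> ^ (2 * k)) + 2 * C2\<^sup>2) * indicator {0..1} x \<partial>lborel) * indicator {1..} y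
         = 2 * (ennreal (y ^ (2 * k - 2) * exp (- c * y)) * indicator {1..} y) + ennreal (2 * C2\<^sup>2) * (ennreal (1 / (1 + (y - 1))\<^sup>2) * indicator {0..} (y - 1))"
      proof (cases "y \<ge> 1")
        case True
        have "y ^ (2 * k) = y ^ (2 * k - 2) * y\<^sup>2" using k by (intro power_split2) simp
        then have yk: "\<bar>y\<bar> ^ (2 * k) = y ^ (2 * k - 2) * y\<^sup>2" using True by simp
        have "1 / y\<^sup>2 * (2 * (exp (- c * y) * \<bar>y\<bar> ^ (2 * k)) + 2 * C2\<^sup>2) = 2 * (y ^ (2 * k - 2) * exp (- c * y)) + 2 * C2\<^sup>2 * (1 / (1 + (y - 1))\<^sup>2)"
          using True unfolding yk by (simp add: field_simps)
        moreover have "(\<integral>\<^sup>+ x. ennreal (2 * (exp (- c * Im (Complex x y)) * \<bar>Im (Complex x y)\<bar> ^ (2 * k)) + 2 * C2\<^sup>2) * indicator {0..1} x \<partial>lborel)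
            = ennreal (2 * (exp (- c * y) * \<bar>y\<bar> ^ (2 * k)) + 2 * C2\<^sup>2)"
          unfolding complex.sel by (subst nn_integral_cmult_indicator) auto
        ultimately have "ennreal (1 / y\<^sup>2) * (\<integral>\<^sup>+ x. ennreal (2 * (exp (- c * Im (Complex x y)) * \<bar>Im (Complex x y)\<bar> ^ (2 * k)) + 2 * C2\<^sup>2) * indicator {0..1} x \<partial>lborel)
            = ennreal (2 * (y ^ (2 * k - 2) * exp (- c * y)) + 2 * C2\<^sup>2 * (1 / (1 + (y - 1))\<^sup>2))"
          by (simp only:) (subst ennreal_mult[symmetric], auto)
        also have "\<dots> = ennreal (2 * (y ^ (2 * k - 2) * exp (- c * y))) + ennreal (2 * C2\<^sup>2 * (1 / (1 + (y - 1))\<^sup>2))"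
          using True by (intro ennreal_plus) auto
        also have "ennreal (2 * (y ^ (2 * k - 2) * exp (- c * y))) = 2 * ennreal (y ^ (2 * k - 2) * exp (- c * y))"
          using True by (subst ennreal_mult) auto
        also have "ennreal (2 * C2\<^sup>2 * (1 / (1 + (y - 1))\<^sup>2)) = ennreal (2 * C2\<^sup>2) * ennreal (1 / (1 + (y - 1))\<^sup>2)"
          by (rule ennreal_mult) auto
        finally show ?thesis using True by simp
      qed simp
    qed
    also have "\<dots> = 2 * (\<integral>\<^sup>+ y. ennreal (y ^ (2 * k - 2) * exp (- c * y)) * indicator {1..} y \<partial>lborel)
        + ennreal (2 * C2\<^sup>2) * (\<integral>\<^sup>+ y. ennreal (1 / (1 + (y - 1))\<^sup>2) * indicator {0..} (y - 1) \<partial>lborel)"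
      by (subst nn_integral_add) (auto simp: nn_integral_cmult)
    also have "(\<integral>\<^sup>+ y. ennreal (1 / (1 + (y - 1))\<^sup>2) * indicator {0..} (y - 1) \<partial>lborel) = (\<integral>\<^sup>+ y. ennreal (1 / (1 + y)\<^sup>2) * indicator {0..} y \<partial>lborel)"
      by (subst nn_integral_real_affine[where c = 1 and t = 1]) auto
    also have "\<dots> = 1" using nn_integral_inverse_square[of 1] by simp
    also have "2 * (\<integral>\<^sup>+ y. ennreal (y ^ (2 * k - 2) * exp (- c * y)) * indicator {1..} y \<partial>lborel) + ennreal (2 * C2\<^sup>2) * 1 = ennreal (2 * g + 2 * C2\<^sup>2)"
    proof -
      have "ennreal (2 * g + 2 * C2\<^sup>2) = ennreal 2 * ennreal g + ennreal (2 * C2\<^sup>2)"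
        using g0 by (subst ennreal_plus) (auto simp: ennreal_mult)
      then show ?thesis unfolding igam_nn[OF c] g_def by simp
    qed
    finally have high: "(\<integral>\<^sup>+ z. ennreal (pointwise_norm_sq k ?P z) * indicator (D \<inter> W) z \<partial>hyp_measure) \<le> ennreal (2 * g + 2 * C2\<^sup>2)" .
    have lowpt: "pointwise_norm_sq k ?P z \<le> C1\<^sup>2" if z: "z \<in> D - W" for z
    proof -
      have zu: "z \<in> uhp" using z D_uhp by auto
      have nW: "Im (moebius A z) \<le> 1" if "A \<in> G" for A using z zu that by (auto simp: W_def not_less)
      obtain A where A: "A \<in> G" "moebius A z \<in> K" using K(3)[OF zu] nW by (meson not_less)
      have "Im (moebius B (moebius A z)) \<le> 1" if B: "B \<in> G" for B
        using nW[OF mult_G[OF B A(1)]] A B zu by (simp add: moebius_mult det_G)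
      then have "cmod (?P (moebius A z)) * Im (moebius A z) ^ k \<le> C1" by (rule C1(2)[OF k A(2)])
      then have "cmod (?P z) * Im z ^ k \<le> C1" using norm_poincare_invariant[OF A(1) zu, of k] by simp
      then have "(cmod (?P z) * Im z ^ k)\<^sup>2 \<le> C1\<^sup>2" using zu by (intro power_mono) (auto simp: uhp_def)
      then show ?thesis using zu by (simp add: pointwise_norm_sq_alt)
    qed
    have "(\<integral>\<^sup>+ z. ennreal (pointwise_norm_sq k ?P z) * indicator (D - W) z \<partial>hyp_measure)
       \<le> (\<integral>\<^sup>+ z. ennreal (C1\<^sup>2) * indicator D z \<partial>hyp_measure)"
      using lowpt by (intro nn_integral_mono) (auto split: split_indicator intro!: ennreal_leI)
    also have "\<dots> = ennreal (C1\<^sup>2) * emeasure hyp_measure D" by (rule nn_integral_cmult_indicator) simp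
    also have "\<dots> = ennreal (C1\<^sup>2 * vol)" unfolding vol(1) by (rule ennreal_mult[symmetric]) (auto simp: vol(2))
    finally have low: "(\<integral>\<^sup>+ z. ennreal (pointwise_norm_sq k ?P z) * indicator (D - W) z \<partial>hyp_measure) \<le> ennreal (C1\<^sup>2 * vol)" .
    have "normsq k ?P \<le> ennreal (2 * g + 2 * C2\<^sup>2) + ennreal (C1\<^sup>2 * vol)"
      unfolding split by (intro add_mono high low)
    also have "\<dots> = ennreal (2 * g + (2 * C2\<^sup>2 + C1\<^sup>2 * vol))"
      using g0 vol by (subst ennreal_plus[symmetric]) (auto simp: add.assoc)
    also have "\<dots> \<le> ennreal (C * g)"
    proof (rule ennreal_leI)
      have "(2 * C2\<^sup>2 + C1\<^sup>2 * vol) / c0 * c0 \<le> (2 * C2\<^sup>2 + C1\<^sup>2 * vol) / c0 * g"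
        using gc c0 vol by (intro mult_left_mono) auto
      moreover have "(2 * C2\<^sup>2 + C1\<^sup>2 * vol) / c0 * c0 = 2 * C2\<^sup>2 + C1\<^sup>2 * vol" using c0 by simp
      ultimately show "2 * g + (2 * C2\<^sup>2 + C1\<^sup>2 * vol) \<le> C * g" unfolding C_def distrib_right by linarith
    qed
    finally show ?thesis by (simp add: g_def c_def)
  qed
  have "C > 0" unfolding C_def using c0 vol by (intro add_pos_nonneg) auto
  then show ?thesis using that[of C] main unfolding Y_def by blast
qed

end

subsection \<open>The curvature bound\<close>

context cusped_surface begin

text \<open>The witness is the Poincare series of the power \<open>m = Suc n\<close> of
  \<open>q\<close>, which keeps at least half of |q^m| at \<open>w\<close>. For
  \<open>v \<le> k\<close> the error is smaller by mere size, as \<open>m * v \<le> 2 * k\<close>.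
  Above height \<open>k\<close> the value |q| may be arbitrarily small; there \<open>m = 1\<close>,
  and the Schwarz lemma supplies the missing factor \<open>q\<close> in the error.\<close>

lemma cusp_lower:
  obtains C k0 where "C > 0" "k0 \<ge> (4::nat)"
    "\<And>k w n. k \<ge> k0 \<Longrightarrow> Im w \<ge> exp 8 \<Longrightarrow> real n * Im w < real k \<Longrightarrow>
       \<exists>g\<in>cusp_forms \<Gamma> k. \<exists>N>0. normsq k g \<le> ennreal N \<and> (cmod (g w))\<^sup>2 \<ge> cmode k (Im w) n * N / C"
proof -
  obtain C1 where C1: "C1 > 0"
    "\<And>k m. k \<ge> 4 \<Longrightarrow> m \<ge> 1 \<Longrightarrow> real (m - 1) * exp 8 \<le> real k \<Longrightarrow>
       normsq k (poincare k (\<lambda>z. qpar z ^ m)) \<le> ennreal (C1 * igam (2 * k - 2) (4 * pi * real m))"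
    using poincare_qpar_norm by blast
  obtain C2 where C2: "C2 > 0"
    "\<And>k m z. k \<ge> 2 \<Longrightarrow> Im z \<ge> 1 \<Longrightarrow> cmod (poincare k (\<lambda>z. qpar z ^ m) z - qpar z ^ m) \<le> C2 * Im z ^ 4 / Im z ^ (2 * k)"
    using poincare_qpar_high by blast
  \<comment> \<open>The second entry lets \<open>exp (3 * k)\<close> absorb the constants of the
    error, the third puts heights above \<open>k\<close> above \<open>exp 8\<close>.\<close>
  define k0 where "k0 = max 4 (max (nat \<lceil>4 * C2 * exp 32\<rceil>) (nat \<lceil>exp (8::real)\<rceil>))"
  have pi4: "4 * pi \<le> 13" using pi_approx by simp
  have main: "\<exists>g\<in>cusp_forms \<Gamma> k. \<exists>N>0. normsq k g \<le> ennreal N \<and> (cmod (g w))\<^sup>2 \<ge> cmode k (Im w) n * N / (4 * C1)"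
    if k: "k \<ge> k0" and w: "Im w \<ge> exp 8" and n: "real n * Im w < real k" for k w n
  proof -
    have k4: "k \<ge> 4" and k2: "k \<ge> 2" using k by (auto simp: k0_def)
    have kc: "4 * C2 * exp 32 \<le> real k" "exp 8 \<le> real k"
    proof -
      have "nat \<lceil>4 * C2 * exp 32\<rceil> \<le> k" "nat \<lceil>exp (8::real)\<rceil> \<le> k" using k by (auto simp: k0_def)
      then show "4 * C2 * exp 32 \<le> real k" "exp 8 \<le> real k" by linarith+
    qed
    define v where "v = Im w"
    have v: "v \<ge> exp 8" "v \<ge> 9" "v > 0" using w exp_ge_add_one_self[of 8] exp_gt_zero[of 8] unfolding v_def by linarith+
    have wu: "w \<in> uhp" using v by (simp add: uhp_def v_def)
    define m where "m = Suc n"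
    let ?P = "poincare k (\<lambda>z. qpar z ^ m)"
    define Mx where "Mx = C2 * exp (32 - 16 * real k)"
    have Mx0: "Mx > 0" using C2 by (simp add: Mx_def)
    have Mxle: "4 * Mx \<le> exp (- 13 * real k)"
    proof -
      have "4 * C2 * exp 32 \<le> real k" by (rule kc(1))
      also have "\<dots> \<le> exp (3 * real k)" using exp_ge_add_one_self[of "3 * real k"] by linarith
      finally have "4 * C2 * exp 32 * exp (- 16 * real k) \<le> exp (3 * real k) * exp (- 16 * real k)" by (intro mult_right_mono) auto
      moreover have "exp (3 * real k) * exp (- 16 * real k) = exp (- 13 * real k)" by (simp flip: exp_add)
      moreover have "4 * C2 * exp 32 * exp (- 16 * real k) = 4 * Mx" by (simp add: Mx_def exp_diff exp_minus divide_inverse)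
      ultimately show ?thesis by (simp only:)
    qed
    have far: "cmod (?P z - qpar z ^ m) \<le> Mx" if z: "Im z \<ge> exp 8" for z
    proof -
      have z1: "Im z \<ge> 1" using z exp_ge_add_one_self[of 8] by linarith
      have "exp 8 ^ (2 * k - 4) \<le> Im z ^ (2 * k - 4)" using z by (intro power_mono) auto
      moreover have "exp 8 ^ (2 * k - 4) = exp (16 * real k - 32)"
        using k2 by (simp add: of_nat_diff algebra_simps flip: exp_of_nat_mult)
      ultimately have p: "exp (16 * real k - 32) \<le> Im z ^ (2 * k - 4)" by simp
      have "Im z ^ (2 * k) = Im z ^ 4 * Im z ^ (2 * k - 4)" using k2 by (simp flip: power_add)
      then have "C2 * Im z ^ 4 / Im z ^ (2 * k) = C2 / Im z ^ (2 * k - 4)" using z1 by simp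
      also have "\<dots> \<le> C2 / exp (16 * real k - 32)"
        using C2(1) by (intro frac_le p) auto
      also have "\<dots> = Mx" by (simp add: Mx_def exp_diff field_simps flip: exp_add)
      finally show ?thesis using C2(2)[OF k2 z1, of m] by linarith
    qed
    have close: "cmod (?P w - qpar w ^ m) \<le> cmod (qpar w ^ m) / 2"
    proof (cases "v \<le> real k")
      case True
      have "real m * v \<le> 2 * real k" using True n by (simp add: m_def v_def algebra_simps)
      then have "2 * pi * (real m * v) \<le> 2 * pi * (2 * real k)" by (intro mult_left_mono) auto
      also have "\<dots> = 4 * pi * real k" by simp
      also have "\<dots> \<le> 13 * real k" by (rule mult_right_mono[OF pi4]) simp
      finally have "exp (- 13 * real k) \<le> exp (- (2 * pi * (real m * v)))" by simp
      also have "\<dots> = cmod (qpar w ^ m)"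
        unfolding norm_power norm_qpar v_def by (simp add: mult_ac flip: exp_of_nat_mult)
      finally show ?thesis using far[of w] Mxle v Mx0 by (simp add: v_def)
    next
      case False
      have "n = 0"
      proof (rule ccontr)
        assume "n \<noteq> 0"
        then have "1 * v \<le> real n * v" using v by (intro mult_right_mono) auto
        then show False using n False by (simp add: v_def)
      qed
      then have m1: "m = 1" by (simp add: m_def)
      have P: "?P \<in> cusp_forms \<Gamma> k" by (rule poincare_qpar_cusp_form[OF G_eq k4]) (simp add: m_def)
      obtain F where F: "F holomorphic_on ball 0 1" "F 0 = 0" "\<And>z. z \<in> uhp \<Longrightarrow> ?P z = F (qpar z)"
        using cusp_formD(4)[OF P] by blast
      define r where "r = exp (- 2 * pi * real k)"
      have r: "0 < r" "r < 1" using k4 by (auto simp: r_def)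
      define R where "R = (\<lambda>u. F u - u)"
      have Rb: "cmod (R u) \<le> Mx" if u: "cmod u < r" for u
      proof (cases "u = 0")
        case True then show ?thesis using F(2) Mx0 by (simp add: R_def)
      next
        case False
        define z where "z = Ln u / (2 * pi * \<i>)"
        have qz: "qpar z = u" using False by (simp add: qpar_def z_def)
        have "exp (- 2 * pi * Im z) < exp (- 2 * pi * real k)" using u norm_qpar[of z] by (simp add: qz r_def)
        then have "2 * pi * real k < 2 * pi * Im z" by simp
        then have zk: "real k < Im z" by simp
        then have z8: "Im z \<ge> exp 8" using kc(2) by linarith
        have zu: "z \<in> uhp" using zk by (simp add: uhp_def)
        show ?thesis using far[OF z8] F(3)[OF zu] by (simp add: R_def qz m1)
      qed
      \<comment> \<open>Scaled to map the unit disc into itself; the factor 2 makes the bound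
        strict, as the Schwarz lemma requires.\<close>
      define h where "h = (\<lambda>u. R (of_real r * u) / of_real (2 * Mx))"
      have maps: "complex_of_real r * u \<in> ball 0 1" if "u \<in> ball 0 1" for u
      proof -
        have "r * cmod u < 1 * 1" using that r by (intro mult_strict_mono) auto
        then show ?thesis using r by (simp add: norm_mult)
      qed
      have "(F \<circ> (\<lambda>u. of_real r * u)) holomorphic_on ball 0 1"
        using maps by (intro holomorphic_on_compose_gen[OF _ F(1)] holomorphic_intros) blast
      then have "h holomorphic_on ball 0 1"
        unfolding h_def R_def using Mx0 by (intro holomorphic_intros) (auto simp: o_def)
      moreover have "h 0 = 0" using F(2) by (simp add: h_def R_def)
      moreover have "cmod (h u) < 1" if "cmod u < 1" for u
      proof -
        have "cmod (of_real r * u) < r" using that r by (simp add: norm_mult)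
        then have "cmod (R (of_real r * u)) < 2 * Mx" using Rb Mx0 by (smt (verit))
        then show ?thesis using Mx0 by (simp add: h_def norm_divide)
      qed
      ultimately have S: "cmod (h u) \<le> cmod u" if "cmod u < 1" for u
        using Schwarz_Lemma(1)[of h u] that by blast
      define u where "u = qpar w / of_real r"
      have "cmod (qpar w) < r" using False unfolding norm_qpar r_def v_def by simp
      then have u1: "cmod u < 1" using r by (simp add: u_def norm_divide)
      have "of_real r * u = qpar w" using r by (simp add: u_def)
      then have "cmod (R (qpar w)) / (2 * Mx) \<le> cmod (qpar w) / r"
        using S[OF u1] Mx0 r by (simp add: h_def norm_divide) (simp add: u_def norm_divide)
      then have "cmod (R (qpar w)) \<le> 2 * Mx * cmod (qpar w) / r"
        using Mx0 by (simp add: pos_divide_le_eq mult_ac)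
      also have "\<dots> = (4 * Mx / r) * (cmod (qpar w) / 2)" by simp
      also have "\<dots> \<le> 1 * (cmod (qpar w) / 2)"
      proof (rule mult_right_mono)
        have "2 * pi * real k \<le> 13 * real k" using pi4 by (intro mult_right_mono) auto
        then have "exp (- 13 * real k) \<le> r" by (simp add: r_def)
        then show "4 * Mx / r \<le> 1" using Mxle r by simp
      qed simp
      finally show ?thesis using F(3)[OF wu] by (simp add: R_def m1)
    qed
    define N where "N = C1 * igam (2 * k - 2) (4 * pi * real m)"
    have ig: "igam (2 * k - 2) (4 * pi * real m) > 0" by (rule igam_pos) (simp add: m_def)
    have "N > 0" using C1(1) ig by (simp add: N_def)
    moreover have "normsq k ?P \<le> ennreal N"
      unfolding N_def
    proof (rule C1(2)[OF k4])
      have "real n * exp 8 \<le> real n * v" using v by (intro mult_left_mono) auto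
      then show "real (m - 1) * exp 8 \<le> real k" using n by (simp add: m_def v_def)
    qed (simp add: m_def)
    moreover have "(cmod (?P w))\<^sup>2 \<ge> cmode k (Im w) n * N / (4 * C1)"
    proof -
      have "cmod (qpar w ^ m) \<le> cmod (?P w) + cmod (?P w - qpar w ^ m)"
        using norm_triangle_sub[of "qpar w ^ m" "?P w"] by (simp add: norm_minus_commute)
      then have "cmod (qpar w ^ m) / 2 \<le> cmod (?P w)" using close by linarith
      then have "(cmod (qpar w ^ m) / 2)\<^sup>2 \<le> (cmod (?P w))\<^sup>2" by (intro power_mono) auto
      moreover have h2: "(cmod (qpar w ^ m))\<^sup>2 = exp (- (4 * pi * real m) * Im w)"
        unfolding norm_power norm_qpar by (simp add: algebra_simps flip: exp_of_nat_mult power_mult)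
      moreover have h3: "cmode k (Im w) n * N / (4 * C1) = exp (- (4 * pi * real m) * Im w) / 4"
        using C1(1) ig by (simp add: cmode_def N_def m_def del: of_nat_Suc)
      ultimately show ?thesis unfolding h3 power_divide h2 by simp
    qed
    moreover have "?P \<in> cusp_forms \<Gamma> k" by (rule poincare_qpar_cusp_form[OF G_eq k4]) (simp add: m_def)
    ultimately show ?thesis by blast
  qed
  show ?thesis
    by (rule that[of "4 * C1" k0]) (use C1(1) main in \<open>auto simp: k0_def\<close>)
qed

text \<open>\<open>\<beta>\<close> bounds from below the maximal invariant |g w|^2 over forms of
  norm one, and \<open>M * \<beta>\<close> bounds from above the analogous maximum of the derivative
  over forms vanishing at \<open>w\<close>. No basis enters, so the condition is invariant under the
  group and may be checked at a convenient point of each orbit. Norms occur through real bounds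
  \<open>N\<close>, as \<open>normsq\<close> is extended-valued.\<close>

definition curvature_bound :: "nat \<Rightarrow> real \<Rightarrow> complex \<Rightarrow> bool" where
  "curvature_bound k M w \<longleftrightarrow> (\<exists>\<beta>>0.
     (\<forall>f\<in>cusp_forms \<Gamma> k. \<forall>N\<ge>0. f w = 0 \<longrightarrow> normsq k f \<le> ennreal N \<longrightarrow> (cmod (deriv f w))\<^sup>2 * Im w ^ (2 * k + 2) \<le> M * \<beta> * N) \<and>
     (\<exists>g\<in>cusp_forms \<Gamma> k. \<exists>N>0. normsq k g \<le> ennreal N \<and> (cmod (g w))\<^sup>2 * Im w ^ (2 * k) \<ge> \<beta> * N))"

text \<open>At a zero the term with the derivative of the automorphy factor drops out, so the
  derivative transforms there like a form of weight \<open>2 * k + 2\<close>.\<close>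

lemma cusp_deriv_invariant:
  assumes f: "f \<in> cusp_forms \<Gamma> k" and A: "A \<in> G" and w: "w \<in> uhp" and fw: "f w = 0"
  shows "(cmod (deriv f w))\<^sup>2 * Im w ^ (2 * k + 2) = (cmod (deriv f (moebius A w)))\<^sup>2 * Im (moebius A w) ^ (2 * k + 2)"
proof -
  define j where "j = aut_factor A w"
  have j: "j \<noteq> 0" using aut_factor_nz[OF det_G[OF A] w] by (simp add: j_def)
  have "(f has_field_derivative deriv f (moebius A w)) (at (moebius A w))"
    by (rule holomorphic_derivI[OF cusp_formD(1)[OF f] open_uhp moebius_G_uhp[OF A w]])
  from DERIV_chain2[OF this moebius_has_field_derivative[OF det_G[OF A] w]]
  have d1: "((\<lambda>z. f (moebius A z)) has_field_derivative deriv f (moebius A w) * (1 / j\<^sup>2)) (at w)" by (simp add: j_def)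
  have fd: "(f has_field_derivative deriv f w) (at w)"
    by (rule holomorphic_derivI[OF cusp_formD(1)[OF f] open_uhp w])
  have jd: "((\<lambda>z. aut_factor A z ^ (2 * k)) has_field_derivative deriv (\<lambda>z. aut_factor A z ^ (2 * k)) w) (at w)"
    by (rule holomorphic_derivI[OF _ open_uhp w]) (intro holomorphic_intros)
  have "((\<lambda>z. aut_factor A z ^ (2 * k) * f z) has_field_derivative j ^ (2 * k) * deriv f w) (at w)"
    by (rule DERIV_cong[OF DERIV_mult[OF jd fd]]) (simp add: fw j_def)
  then have "((\<lambda>z. f (moebius A z)) has_field_derivative j ^ (2 * k) * deriv f w) (at w)"
    by (rule has_field_derivative_transform_within_open[OF _ open_uhp w]) (simp add: cusp_formD(3)[OF f A])
  with d1 have "deriv f (moebius A w) * (1 / j\<^sup>2) = j ^ (2 * k) * deriv f w" by (rule DERIV_unique)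
  then have "deriv f (moebius A w) = j ^ (2 * k + 2) * deriv f w"
    using j by (simp add: power_add field_simps power2_eq_square)
  then show ?thesis
    using j Im_moebius[OF det_G[OF A] w]
    by (simp add: j_def norm_mult norm_power power_mult_distrib power_divide power_mult[symmetric] mult.commute)
qed

lemma curvature_bound_invariant:
  assumes A: "A \<in> G" and w: "w \<in> uhp" and cb: "curvature_bound k M (moebius A w)"
  shows "curvature_bound k M w"
proof -
  obtain \<beta> g N where \<beta>: "\<beta> > 0"
     "\<And>f N. f \<in> cusp_forms \<Gamma> k \<Longrightarrow> N \<ge> 0 \<Longrightarrow> f (moebius A w) = 0 \<Longrightarrow> normsq k f \<le> ennreal N \<Longrightarrow>
        (cmod (deriv f (moebius A w)))\<^sup>2 * Im (moebius A w) ^ (2 * k + 2) \<le> M * \<beta> * N"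
     and g: "g \<in> cusp_forms \<Gamma> k" "N > 0" "normsq k g \<le> ennreal N" "(cmod (g (moebius A w)))\<^sup>2 * Im (moebius A w) ^ (2 * k) \<ge> \<beta> * N"
    using cb unfolding curvature_bound_def by blast
  have sq: "(cmod (h z))\<^sup>2 * Im z ^ (2 * k) = (cmod (h z) * Im z ^ k)\<^sup>2" for h :: "complex \<Rightarrow> complex" and z
    by (simp add: power_mult_distrib mult.commute[of 2] flip: power_mult)
  have "(cmod (g w))\<^sup>2 * Im w ^ (2 * k) \<ge> \<beta> * N"
    using g(4) unfolding sq cusp_norm_invariant[OF g(1) A w] .
  moreover have "(cmod (deriv f w))\<^sup>2 * Im w ^ (2 * k + 2) \<le> M * \<beta> * N"
    if f: "f \<in> cusp_forms \<Gamma> k" "N \<ge> 0" "f w = 0" "normsq k f \<le> ennreal N" for f N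
  proof -
    have "f (moebius A w) = 0" using cusp_formD(3)[OF f(1) A w] f(3) by simp
    then show ?thesis using \<beta>(2)[OF f(1,2) _ f(4)] cusp_deriv_invariant[OF f(1) A w f(3)] by simp
  qed
  ultimately show ?thesis unfolding curvature_bound_def using \<beta>(1) g(1-3) by blast
qed

text \<open>The peak form has invariant supremum and invariant value at \<open>w\<close> of the same
  order. Supremum and finite volume bound its norm, and the powers of 4 cancel in the
  quotient.\<close>

lemma curvature_bound_compact:
  assumes K: "compact K" "K \<subseteq> uhp"
  obtains C k0 where "C > 0" "\<And>k w. k \<ge> k0 \<Longrightarrow> w \<in> K \<Longrightarrow> curvature_bound k (C * real k ^ 2) w"
proof -
  obtain C1 where C1: "C1 > 0"
    "\<And>k w f. k \<ge> 1 \<Longrightarrow> w \<in> K \<Longrightarrow> f \<in> cusp_forms \<Gamma> k \<Longrightarrow> f w = 0 \<Longrightarrow>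
       ennreal ((cmod (deriv f w))\<^sup>2 * Im w ^ (2 * k + 2)) \<le> ennreal (C1 * real k ^ 2) * normsq k f"
    using local_derivative_bound[OF K] by blast
  obtain C2 k0 where C2: "C2 > 0"
    "\<And>k w z. k \<ge> k0 \<Longrightarrow> w \<in> K \<Longrightarrow> z \<in> uhp \<Longrightarrow> cmod (poincare k (kerh k w) z) * Im z ^ k * Im w ^ k \<le> C2 * (1/4) ^ k"
    "\<And>k w. k \<ge> k0 \<Longrightarrow> w \<in> K \<Longrightarrow> cmod (poincare k (kerh k w) w) * Im w ^ (2 * k) \<ge> (1/2) * (1/4) ^ k"
    "\<And>k w. k \<ge> k0 \<Longrightarrow> w \<in> K \<Longrightarrow> poincare k (kerh k w) \<in> cusp_forms \<Gamma> k"
    by (rule kernel_peak[OF K G_eq]) (rule that)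
  define vol where "vol = enn2real (emeasure hyp_measure D)"
  have vol: "emeasure hyp_measure D = ennreal vol" "vol \<ge> 0" using finite_vol by (simp_all add: vol_def)
  \<comment> \<open>\<open>vol + 1\<close> keeps the denominator positive without a separate
    case.\<close>
  define \<beta> where "\<beta> = 1 / (4 * C2\<^sup>2 * (vol + 1))"
  have \<beta>: "\<beta> > 0" using C2(1) vol by (simp add: \<beta>_def add_nonneg_pos)
  show ?thesis
  proof (rule that[of "C1 / \<beta>" "max k0 1"])
    show "C1 / \<beta> > 0" using C1(1) \<beta> by simp
    fix k w assume k: "k \<ge> max k0 1" and w: "w \<in> K"
    have wu: "w \<in> uhp" and v: "Im w > 0" using w K by (auto simp: uhp_def)
    let ?g = "poincare k (kerh k w)"
    define b where "b = C2 * (1/4) ^ k / Im w ^ k"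
    have b0: "b > 0" using C2(1) v by (simp add: b_def)
    define N where "N = b\<^sup>2 * (vol + 1)"
    have N0: "N > 0" using b0 vol by (simp add: N_def add_nonneg_pos)
    have g: "?g \<in> cusp_forms \<Gamma> k" using C2(4) k w by simp
    have "pointwise_norm_sq k ?g z \<le> b\<^sup>2" if z: "z \<in> uhp" for z
    proof -
      have "cmod (?g z) * Im z ^ k * Im w ^ k \<le> C2 * (1/4) ^ k" using C2(2)[OF _ w z] k by simp
      then have "cmod (?g z) * Im z ^ k \<le> b" unfolding b_def using v by (subst pos_le_divide_eq) auto
      then have "(cmod (?g z) * Im z ^ k)\<^sup>2 \<le> b\<^sup>2" using z by (intro power_mono) (auto simp: uhp_def)
      then show ?thesis using z by (simp add: pointwise_norm_sq_alt)
    qed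
    then have "normsq k ?g \<le> (\<integral>\<^sup>+ z. ennreal (b\<^sup>2) * indicator D z \<partial>hyp_measure)"
      unfolding normsq_def using D_uhp
      by (intro nn_integral_mono) (auto split: split_indicator intro!: ennreal_leI)
    also have "\<dots> = ennreal (b\<^sup>2) * emeasure hyp_measure D" by (rule nn_integral_cmult_indicator) simp
    also have "\<dots> = ennreal (b\<^sup>2 * vol)" unfolding vol(1) by (rule ennreal_mult[symmetric]) (auto simp: vol(2))
    also have "\<dots> \<le> ennreal N" unfolding N_def by (intro ennreal_leI mult_left_mono) auto
    finally have nN: "normsq k ?g \<le> ennreal N" .
    have "(cmod (?g w))\<^sup>2 * Im w ^ (2 * k) \<ge> \<beta> * N"
    proof -
      have "((1/2) * (1/4) ^ k)\<^sup>2 \<le> (cmod (?g w) * Im w ^ (2 * k))\<^sup>2"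
        using C2(3)[OF _ w] k by (intro power_mono) auto
      also have "\<dots> = (cmod (?g w))\<^sup>2 * Im w ^ (2 * k) * (Im w ^ k)\<^sup>2"
        by (simp add: power_mult_distrib power2_eq_square mult_2 power_add)
      finally have "((1/2) * (1/4) ^ k)\<^sup>2 / (Im w ^ k)\<^sup>2 \<le> (cmod (?g w))\<^sup>2 * Im w ^ (2 * k)"
        using v by (subst pos_divide_le_eq) auto
      moreover have "\<beta> * N = ((1/2) * (1/4) ^ k)\<^sup>2 / (Im w ^ k)\<^sup>2"
        using C2(1) vol v by (simp add: \<beta>_def N_def b_def power_mult_distrib power_divide add_nonneg_pos field_simps)
          (simp add: add_nonneg_eq_0_iff)
      ultimately show ?thesis by simp
    qed
    moreover have "(cmod (deriv f w))\<^sup>2 * Im w ^ (2 * k + 2) \<le> C1 / \<beta> * real k ^ 2 * \<beta> * N'"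
      if f: "f \<in> cusp_forms \<Gamma> k" "N' \<ge> 0" "f w = 0" "normsq k f \<le> ennreal N'" for f N'
    proof -
      have "ennreal ((cmod (deriv f w))\<^sup>2 * Im w ^ (2 * k + 2)) \<le> ennreal (C1 * real k ^ 2) * normsq k f"
        using C1(2)[OF _ w f(1,3)] k by simp
      also have "\<dots> \<le> ennreal (C1 * real k ^ 2) * ennreal N'" by (intro mult_left_mono f(4)) simp
      also have "\<dots> = ennreal (C1 * real k ^ 2 * N')" using C1(1) f(2) by (intro ennreal_mult[symmetric]) auto
      finally have "(cmod (deriv f w))\<^sup>2 * Im w ^ (2 * k + 2) \<le> C1 * real k ^ 2 * N'"
        using C1(1) f(2) by (subst (asm) ennreal_le_iff) auto
      then show ?thesis using \<beta> by simp
    qed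
    ultimately show "curvature_bound k (C1 / \<beta> * real k ^ 2) w"
      unfolding curvature_bound_def using \<beta> g N0 nN by blast
  qed
qed

text \<open>One mode \<open>n0\<close> serves both sides: \<open>cusp_lower\<close> realises its
  size by a form, and \<open>cusp_modes\<close> bounds the derivative sum by it, so the size
  \<open>\<mu>\<close> cancels. The factor 68 is 4 times 17, from the square of
  \<open>2 * pi\<close> and from \<open>cusp_modes\<close>.\<close>

lemma curvature_bound_cusp:
  obtains C k0 where "C > 0" "k0 \<ge> (4::nat)"
    "\<And>k w. k \<ge> k0 \<Longrightarrow> Im w \<ge> exp 8 \<Longrightarrow> curvature_bound k (C * real k ^ 3) w"
    "\<And>k w. k \<ge> k0 \<Longrightarrow> Im w \<ge> exp 8 \<Longrightarrow> Im w \<ge> real k \<Longrightarrow> curvature_bound k (C * ((Im w)\<^sup>2 * exp (- 2 * pi * Im w))) w"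
proof -
  obtain C k0 where C: "C > 0" "k0 \<ge> (4::nat)"
    "\<And>k w n. k \<ge> k0 \<Longrightarrow> Im w \<ge> exp 8 \<Longrightarrow> real n * Im w < real k \<Longrightarrow>
       \<exists>g\<in>cusp_forms \<Gamma> k. \<exists>N>0. normsq k g \<le> ennreal N \<and> (cmod (g w))\<^sup>2 \<ge> cmode k (Im w) n * N / C"
    by (rule cusp_lower) (rule that)
  have main: "curvature_bound k (68 * pi\<^sup>2 * C * real k ^ 3) w \<and>
      (Im w \<ge> real k \<longrightarrow> curvature_bound k (68 * pi\<^sup>2 * C * ((Im w)\<^sup>2 * exp (- 2 * pi * Im w))) w)"
    if k: "k \<ge> k0" and w: "Im w \<ge> exp 8" for k w
  proof -
    define v where "v = Im w"
    have v: "v \<ge> 4" using w exp_ge_add_one_self[of 8] unfolding v_def by linarith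
    have wu: "w \<in> uhp" using v by (simp add: uhp_def v_def)
    have k2: "k \<ge> 2" "k \<ge> 1" using k C(2) by auto
    obtain n0 where n0: "real n0 * v < real k"
      "\<And>M. v\<^sup>2 * (\<Sum>n<M. (real n)\<^sup>2 * cmode k v n) \<le> 17 * real k ^ 3 * cmode k v n0"
      "\<And>M. v \<ge> real k \<Longrightarrow> (\<Sum>n<M. (real n)\<^sup>2 * cmode k v n) \<le> 8 * exp (- 2 * pi * v) * cmode k v n0"
      using cusp_modes[OF k2(1) v] by blast
    define \<mu> where "\<mu> = cmode k v n0"
    have \<mu>: "\<mu> > 0" unfolding \<mu>_def by (rule cmode_pos)
    obtain g N where g: "g \<in> cusp_forms \<Gamma> k" "N > 0" "normsq k g \<le> ennreal N" "(cmod (g w))\<^sup>2 \<ge> \<mu> * N / C"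
      using C(3)[OF k w, of n0] n0(1) unfolding \<mu>_def v_def by blast
    define \<beta> where "\<beta> = \<mu> * v ^ (2 * k) / C"
    have \<beta>: "\<beta> > 0" using \<mu> v C(1) by (simp add: \<beta>_def)
    have gw: "(cmod (g w))\<^sup>2 * Im w ^ (2 * k) \<ge> \<beta> * N"
      using mult_right_mono[OF g(4), of "v ^ (2 * k)"] v by (simp add: \<beta>_def v_def mult_ac)
    have up: "(cmod (deriv f w))\<^sup>2 * Im w ^ (2 * k + 2) \<le> 4 * pi\<^sup>2 * C * T * \<beta> * N'"
      if f: "f \<in> cusp_forms \<Gamma> k" "N' \<ge> 0" "f w = 0" "normsq k f \<le> ennreal N'"
        and T: "\<And>M. v\<^sup>2 * (\<Sum>n<M. (real n)\<^sup>2 * cmode k v n) \<le> T * \<mu>" for f N' T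
    proof -
      have "(\<Sum>n<M. (real n)\<^sup>2 * cmode k (Im w) n) \<le> T * \<mu> / v\<^sup>2" for M
        using T[of M] v by (subst pos_le_divide_eq) (auto simp: v_def mult.commute)
      from cusp_derivative_bound[OF f(1) k2(2) wu f(3) this f(4,2)]
      have "(cmod (deriv f w))\<^sup>2 * Im w ^ (2 * k + 2) \<le> 4 * pi\<^sup>2 * (T * \<mu> / v\<^sup>2) * N' * v ^ (2 * k + 2)"
        using v unfolding v_def by (intro mult_right_mono) auto
      also have "\<dots> = 4 * pi\<^sup>2 * C * T * \<beta> * N'"
        using v C(1) by (simp add: \<beta>_def power_add power2_eq_square)
      finally show ?thesis .
    qed
    have pos: "4 * pi\<^sup>2 * C * \<beta> \<ge> 0" using C(1) \<beta> by simp
    have "curvature_bound k (4 * pi\<^sup>2 * C * (17 * real k ^ 3)) w"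
      unfolding curvature_bound_def
    proof (intro exI[of _ \<beta>] conjI ballI allI impI)
      fix f N' assume "f \<in> cusp_forms \<Gamma> k" "0 \<le> (N'::real)" "f w = 0" "normsq k f \<le> ennreal N'"
      then show "(cmod (deriv f w))\<^sup>2 * Im w ^ (2 * k + 2) \<le> 4 * pi\<^sup>2 * C * (17 * real k ^ 3) * \<beta> * N'"
        by (rule up) (use n0(2) in \<open>simp add: \<mu>_def\<close>)
    qed (use \<beta> g gw in blast)+
    moreover have "curvature_bound k (68 * pi\<^sup>2 * C * (v\<^sup>2 * exp (- 2 * pi * v))) w" if vk: "v \<ge> real k"
      unfolding curvature_bound_def
    proof (intro exI[of _ \<beta>] conjI ballI allI impI)
      fix f N' assume f: "f \<in> cusp_forms \<Gamma> k" "0 \<le> (N'::real)" "f w = 0" "normsq k f \<le> ennreal N'"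
      have "v\<^sup>2 * (\<Sum>n<M. (real n)\<^sup>2 * cmode k v n) \<le> 17 * (v\<^sup>2 * exp (- 2 * pi * v)) * \<mu>" for M
      proof -
        have "v\<^sup>2 * (\<Sum>n<M. (real n)\<^sup>2 * cmode k v n) \<le> v\<^sup>2 * (8 * exp (- 2 * pi * v) * \<mu>)"
          unfolding \<mu>_def by (intro mult_left_mono n0(3) vk) simp
        also have "\<dots> \<le> v\<^sup>2 * (17 * exp (- 2 * pi * v) * \<mu>)"
          using \<mu> by (intro mult_left_mono mult_right_mono) auto
        finally show ?thesis by (simp add: mult_ac)
      qed
      from up[OF f this] show "(cmod (deriv f w))\<^sup>2 * Im w ^ (2 * k + 2) \<le> 68 * pi\<^sup>2 * C * (v\<^sup>2 * exp (- 2 * pi * v)) * \<beta> * N'"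
        by (simp add: mult_ac)
    qed (use \<beta> g gw in blast)+
    ultimately show ?thesis by (simp add: v_def mult_ac)
  qed
  show ?thesis
    by (rule that[of "68 * pi\<^sup>2 * C" k0]) (use C main in auto)
qed

text \<open>Every orbit meets a fixed compact set or the region above \<open>exp 8\<close>, and the
  condition is invariant.\<close>

lemma curvature_bound_everywhere:
  obtains C k0 where "C > 0" "k0 \<ge> (4::nat)"
    "\<And>k w. k \<ge> k0 \<Longrightarrow> w \<in> uhp \<Longrightarrow> curvature_bound k (C * real k ^ 3) w"
    "\<And>k w. k \<ge> k0 \<Longrightarrow> Im w \<ge> exp 8 \<Longrightarrow> Im w \<ge> real k \<Longrightarrow> curvature_bound k (C * ((Im w)\<^sup>2 * exp (- 2 * pi * Im w))) w"
proof -
  obtain C1 k1 where C1: "C1 > 0" "k1 \<ge> (4::nat)"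
    "\<And>k w. k \<ge> k1 \<Longrightarrow> Im w \<ge> exp 8 \<Longrightarrow> curvature_bound k (C1 * real k ^ 3) w"
    "\<And>k w. k \<ge> k1 \<Longrightarrow> Im w \<ge> exp 8 \<Longrightarrow> Im w \<ge> real k \<Longrightarrow> curvature_bound k (C1 * ((Im w)\<^sup>2 * exp (- 2 * pi * Im w))) w"
    by (rule curvature_bound_cusp) (rule that)
  obtain K where K: "compact K" "K \<subseteq> uhp" "\<And>z. z \<in> uhp \<Longrightarrow> \<exists>A\<in>G. moebius A z \<in> K \<or> Im (moebius A z) > exp 8"
    using cocompact_G[of "exp 8"] by blast
  obtain C2 k2 where C2: "C2 > 0" "\<And>k w. k \<ge> k2 \<Longrightarrow> w \<in> K \<Longrightarrow> curvature_bound k (C2 * real k ^ 2) w"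
    using curvature_bound_compact[OF K(1,2)] by blast
  have mono: "curvature_bound k M' w" if cb: "curvature_bound k M w" and le: "M \<le> M'" for k M M' w
  proof -
    obtain \<beta> where \<beta>: "\<beta> > 0"
     "\<And>f N. f \<in> cusp_forms \<Gamma> k \<Longrightarrow> N \<ge> 0 \<Longrightarrow> f w = 0 \<Longrightarrow> normsq k f \<le> ennreal N \<Longrightarrow> (cmod (deriv f w))\<^sup>2 * Im w ^ (2 * k + 2) \<le> M * \<beta> * N"
     "\<exists>g\<in>cusp_forms \<Gamma> k. \<exists>N>0. normsq k g \<le> ennreal N \<and> (cmod (g w))\<^sup>2 * Im w ^ (2 * k) \<ge> \<beta> * N"
      using cb unfolding curvature_bound_def by blast
    have "M * \<beta> * N \<le> M' * \<beta> * N" if "N \<ge> 0" for N using le \<beta>(1) that by (intro mult_right_mono) auto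
    then show ?thesis unfolding curvature_bound_def using \<beta> by (meson order_trans)
  qed
  show ?thesis
  proof (rule that[of "max C1 C2" "max k1 k2"])
    show "max C1 C2 > 0" using C1(1) by simp
    show "max k1 k2 \<ge> 4" using C1(2) by simp
    fix k w assume k: "k \<ge> max k1 k2"
    {
      assume w: "w \<in> uhp"
      obtain A where A: "A \<in> G" "moebius A w \<in> K \<or> Im (moebius A w) > exp 8" using K(3)[OF w] by blast
      have "curvature_bound k (max C1 C2 * real k ^ 3) (moebius A w)"
      proof (cases "moebius A w \<in> K")
        case True
        have "C2 * real k ^ 2 \<le> max C1 C2 * real k ^ 3"
        proof (rule mult_mono)
          show "real k ^ 2 \<le> real k ^ 3" using k C1(2) by (intro power_increasing) auto
        qed (use C2(1) in auto)
        then show ?thesis using mono[OF C2(2)[OF _ True]] k by simp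
      next
        case False
        then have "curvature_bound k (C1 * real k ^ 3) (moebius A w)" using C1(3) A(2) k by simp
        then show ?thesis by (rule mono) (intro mult_right_mono, auto)
      qed
      then show "curvature_bound k (max C1 C2 * real k ^ 3) w" by (rule curvature_bound_invariant[OF A(1) w])
    }
    {
      assume "Im w \<ge> exp 8" "Im w \<ge> real k"
      then have "curvature_bound k (C1 * ((Im w)\<^sup>2 * exp (- 2 * pi * Im w))) w" using C1(4) k by simp
      then show "curvature_bound k (max C1 C2 * ((Im w)\<^sup>2 * exp (- 2 * pi * Im w))) w"
        by (rule mono) (intro mult_right_mono, auto)
    }
  qed
qed

end

subsection \<open>Wirtinger calculus and the Bergman metric\<close>

lemma has_vector_derivative_line:
  assumes "(f has_field_derivative d) (at z)"
  shows "((\<lambda>t. f (z + of_real t)) has_vector_derivative d) (at 0)"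
    and "((\<lambda>t. f (z + \<i> * of_real t)) has_vector_derivative \<i> * d) (at 0)"
proof -
  have "((\<lambda>t. f (z + c * of_real t)) has_vector_derivative c * d) (at 0)" for c
  proof -
    have g: "((\<lambda>t. z + c * of_real t) has_vector_derivative c) (at (0::real))"
      by (auto intro!: derivative_eq_intros simp: has_vector_derivative_def scaleR_conv_of_real mult.commute)
    have "(f has_field_derivative d) (at (z + c * of_real (0::real)))" using assms by simp
    from field_vector_diff_chain_at[OF g this] show ?thesis by (simp add: o_def)
  qed
  from this[of 1] this[of \<i>] show "((\<lambda>t. f (z + of_real t)) has_vector_derivative d) (at 0)"
    "((\<lambda>t. f (z + \<i> * of_real t)) has_vector_derivative \<i> * d) (at 0)" by simp_all
qed

text \<open>\<open>u\<close> has Wirtinger derivatives \<open>p\<close> and \<open>q\<close> at \<open>z\<close>, as far as the lines through \<open>z\<close> see them.\<close>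

definition has_wirtinger :: "(complex \<Rightarrow> complex) \<Rightarrow> complex \<Rightarrow> complex \<Rightarrow> complex \<Rightarrow> bool" where
  "has_wirtinger u p q z \<longleftrightarrow>
     ((\<lambda>t. u (z + of_real t)) has_vector_derivative p + q) (at 0) \<and>
     ((\<lambda>t. u (z + \<i> * of_real t)) has_vector_derivative \<i> * (p - q)) (at 0)"

lemma has_wirtinger_eq:
  assumes "has_wirtinger u p q z"
  shows "wirtinger_z u z = p" "wirtinger_zbar u z = q"
proof -
  have 1: "vector_derivative (\<lambda>t. u (z + of_real t)) (at 0) = p + q"
    "vector_derivative (\<lambda>t. u (z + \<i> * of_real t)) (at 0) = \<i> * (p - q)"
    using assms by (auto simp: has_wirtinger_def vector_derivative_at)
  have "\<i> * (\<i> * (p - q)) = q - p" by (simp add: mult.assoc[symmetric])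
  then show "wirtinger_z u z = p" "wirtinger_zbar u z = q"
    unfolding wirtinger_z_def wirtinger_zbar_def 1 by simp_all
qed

lemma has_wirtinger_holomorphic: "(f has_field_derivative d) (at z) \<Longrightarrow> has_wirtinger f d 0 z"
  unfolding has_wirtinger_def using has_vector_derivative_line[of f d z] by simp

lemma has_wirtinger_cnj:
  assumes "has_wirtinger u p q z"
  shows "has_wirtinger (\<lambda>z. cnj (u z)) (cnj q) (cnj p) z"
proof -
  have "cnj (p + q) = cnj q + cnj p" "cnj (\<i> * (p - q)) = \<i> * (cnj q - cnj p)" by (simp_all add: algebra_simps)
  then show ?thesis using assms unfolding has_wirtinger_def
    by (metis (no_types) has_vector_derivative_cnj)
qed

lemma has_wirtinger_add:
  assumes "has_wirtinger u p q z" "has_wirtinger u' p' q' z"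
  shows "has_wirtinger (\<lambda>z. u z + u' z) (p + p') (q + q') z"
proof -
  have e: "p + p' + (q + q') = (p + q) + (p' + q')" "\<i> * (p + p' - (q + q')) = \<i> * (p - q) + \<i> * (p' - q')"
    by (simp_all add: algebra_simps)
  show ?thesis using assms unfolding has_wirtinger_def e by (auto intro: has_vector_derivative_add)
qed

lemma has_wirtinger_sum:
  assumes "\<And>j. j \<in> A \<Longrightarrow> has_wirtinger (u j) (p j) (q j) z"
  shows "has_wirtinger (\<lambda>z. \<Sum>j\<in>A. u j z) (\<Sum>j\<in>A. p j) (\<Sum>j\<in>A. q j) z"
  using assms
proof (induction A rule: infinite_finite_induct)
  case (insert j A)
  then show ?case using has_wirtinger_add[of "u j" "p j" "q j" z "\<lambda>z. \<Sum>j\<in>A. u j z"] by simp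
qed (simp_all add: has_wirtinger_def)

lemma has_wirtinger_mult:
  assumes "has_wirtinger u p q z" "has_wirtinger u' p' q' z"
  shows "has_wirtinger (\<lambda>z. u z * u' z) (u z * p' + p * u' z) (u z * q' + q * u' z) z"
proof -
  have 1: "((\<lambda>t. u (z + of_real t) * u' (z + of_real t)) has_vector_derivative
      u (z + of_real 0) * (p' + q') + (p + q) * u' (z + of_real 0)) (at 0)"
    using assms unfolding has_wirtinger_def by (intro has_vector_derivative_mult) auto
  have 2: "((\<lambda>t. u (z + \<i> * of_real t) * u' (z + \<i> * of_real t)) has_vector_derivative
      u (z + \<i> * of_real 0) * (\<i> * (p' - q')) + (\<i> * (p - q)) * u' (z + \<i> * of_real 0)) (at 0)"
    using assms unfolding has_wirtinger_def by (intro has_vector_derivative_mult) auto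
  show ?thesis unfolding has_wirtinger_def using 1 2 by (simp add: algebra_simps)
qed

lemma has_wirtinger_compose:
  assumes u: "has_wirtinger u p q z" and h: "(h has_field_derivative d) (at (u z))"
  shows "has_wirtinger (\<lambda>z. h (u z)) (d * p) (d * q) z"
proof -
  have "((h \<circ> (\<lambda>t. u (z + of_real t))) has_vector_derivative (p + q) * d) (at 0)"
    using u h unfolding has_wirtinger_def by (intro field_vector_diff_chain_at) auto
  moreover have "((h \<circ> (\<lambda>t. u (z + \<i> * of_real t))) has_vector_derivative (\<i> * (p - q)) * d) (at 0)"
    using u h unfolding has_wirtinger_def by (intro field_vector_diff_chain_at) auto
  ultimately show ?thesis unfolding has_wirtinger_def o_def by (simp add: algebra_simps)
qed

lemma has_wirtinger_transform:
  assumes u: "has_wirtinger u p q z" and S: "open S" "z \<in> S" and eq: "\<And>x. x \<in> S \<Longrightarrow> u x = u' x"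
  shows "has_wirtinger u' p q z"
proof -
  have tr: "((\<lambda>t. u' (z + c * of_real t)) has_vector_derivative D) (at 0)"
    if "((\<lambda>t. u (z + c * of_real t)) has_vector_derivative D) (at 0)" for c D
  proof (rule has_vector_derivative_transform_within_open[OF that])
    have "continuous_on UNIV (\<lambda>t::real. z + c * of_real t)" by (intro continuous_intros)
    then show "open ((\<lambda>t::real. z + c * of_real t) -` S)" using S(1) open_vimage by blast
    show "0 \<in> (\<lambda>t::real. z + c * of_real t) -` S" using S(2) by simp
  qed (use eq in auto)
  show ?thesis using u tr[of 1] tr[of \<i>] unfolding has_wirtinger_def by simp
qed

lemma has_wirtinger_Im: "has_wirtinger (\<lambda>z. of_real (Im z)) (- \<i> / 2) (\<i> / 2) z"
proof -
  have id: "has_wirtinger (\<lambda>z. z) 1 0 z" by (rule has_wirtinger_holomorphic) simp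
  have c: "has_wirtinger (\<lambda>z. c) 0 0 z" for c by (rule has_wirtinger_holomorphic) simp
  have "has_wirtinger (\<lambda>z. (- \<i> / 2) * z + (\<i> / 2) * cnj z) ((- \<i> / 2 * 1 + 0 * z) + (\<i> / 2 * cnj 0 + 0 * cnj z))
      ((- \<i> / 2 * 0 + 0 * z) + (\<i> / 2 * cnj 1 + 0 * cnj z)) z"
    by (intro has_wirtinger_add has_wirtinger_mult c id has_wirtinger_cnj[OF id])
  moreover have "(- \<i> / 2) * z + (\<i> / 2) * cnj z = of_real (Im z)" for z by (simp add: complex_eq_iff)
  ultimately show ?thesis by simp
qed

text \<open>The factor \<open>Im z ^ (2 * k)\<close> contributes the constant
  \<open>k / (2 * pi)\<close>. The rest is, up to sign and scaling, the pullback of the Fubini-Study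
  form under the map given by the \<open>f j\<close>, in its coordinate expression
  \<open>P / S - T * cnj T / S\<^sup>2\<close>.\<close>

lemma bergman_metric_formula:
  assumes f: "\<And>j. j < n \<Longrightarrow> f j holomorphic_on uhp" and pos: "\<And>w. w \<in> uhp \<Longrightarrow> (\<Sum>j<n. (cmod (f j w))\<^sup>2) > 0"
    and z: "z \<in> uhp"
  shows "metric_ratio k n f z = of_real (real k / (2 * pi) - (Im z)\<^sup>2 / pi *
     ((\<Sum>j<n. (cmod (deriv (f j) z))\<^sup>2) / (\<Sum>j<n. (cmod (f j z))\<^sup>2)
        - (cmod (\<Sum>j<n. deriv (f j) z * cnj (f j z)))\<^sup>2 / (\<Sum>j<n. (cmod (f j z))\<^sup>2)\<^sup>2))"
proof -
  define f' where "f' = (\<lambda>j. deriv (f j))"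
  define S where "S = (\<lambda>w. \<Sum>j<n. f j w * cnj (f j w))"
  \<comment> \<open>As the \<open>f j\<close> are holomorphic, this is the derivative of
    \<open>S\<close> with respect to the conjugate variable.\<close>
  define T where "T = (\<lambda>w. \<Sum>j<n. f j w * cnj (f' j w))"
  define Sr where "Sr = (\<lambda>w. \<Sum>j<n. (cmod (f j w))\<^sup>2)"
  have SR: "S w = of_real (Sr w)" for w
    unfolding S_def Sr_def of_real_sum by (intro sum.cong refl) (simp only: complex_norm_square)
  have posr: "Sr w > 0" if "w \<in> uhp" for w using pos[OF that] by (simp add: Sr_def)
  have df: "(f j has_field_derivative f' j w) (at w)" if "j < n" "w \<in> uhp" for j w
    unfolding f'_def by (rule holomorphic_derivI[OF f[OF that(1)] open_uhp that(2)])
  have df': "(f' j has_field_derivative deriv (f' j) w) (at w)" if "j < n" "w \<in> uhp" for j w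
    unfolding f'_def using that by (intro holomorphic_derivI[OF _ open_uhp] holomorphic_deriv f) auto
  have dS: "has_wirtinger S (cnj (T w)) (T w) w" if w: "w \<in> uhp" for w
  proof -
    have "has_wirtinger S (\<Sum>j<n. f j w * cnj 0 + f' j w * cnj (f j w)) (\<Sum>j<n. f j w * cnj (f' j w) + 0 * cnj (f j w)) w"
      unfolding S_def
      by (intro has_wirtinger_sum has_wirtinger_mult has_wirtinger_cnj has_wirtinger_holomorphic df w) auto
    then show ?thesis by (simp add: T_def mult.commute)
  qed
  define P where "P = (\<lambda>w. \<Sum>j<n. (cmod (f' j w))\<^sup>2)"
  have dT: "has_wirtinger T (of_real (P w)) (\<Sum>j<n. f j w * cnj (deriv (f' j) w)) w" if w: "w \<in> uhp" for w
  proof -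
    have "has_wirtinger T (\<Sum>j<n. f j w * cnj 0 + f' j w * cnj (f' j w)) (\<Sum>j<n. f j w * cnj (deriv (f' j) w) + 0 * cnj (f' j w)) w"
      unfolding T_def
      by (intro has_wirtinger_sum has_wirtinger_mult has_wirtinger_cnj has_wirtinger_holomorphic df df' w) auto
    moreover have "(\<Sum>j<n. f' j w * cnj (f' j w)) = of_real (P w)"
      unfolding P_def of_real_sum by (intro sum.cong refl) (simp only: complex_norm_square)
    ultimately show ?thesis by simp
  qed
  have Sp: "0 < Re (S w)" "S w \<notin> \<real>\<^sub>\<le>\<^sub>0" "S w \<noteq> 0" if "w \<in> uhp" for w
    using posr[OF that] by (auto simp: SR complex_nonpos_Reals_iff)
  have Ip: "of_real (Im w) \<notin> \<real>\<^sub>\<le>\<^sub>0" "complex_of_real (Im w) \<noteq> 0" if "w \<in> uhp" for w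
    using that by (auto simp: uhp_def complex_nonpos_Reals_iff)
  define L where "L = (\<lambda>w. of_real (ln (bergman_kernel k n f w)) :: complex)"
  \<comment> \<open>The real logarithms are written with the complex \<open>Ln\<close>, to which the
    chain rule for a holomorphic outer function applies.\<close>
  have LL: "L w = of_nat (2 * k) * Ln (of_real (Im w)) + Ln (S w)" if w: "w \<in> uhp" for w
  proof -
    have y: "Im w > 0" using w by (simp add: uhp_def)
    have "bergman_kernel k n f w = Im w ^ (2 * k) * Sr w"
      by (simp add: bergman_kernel_def pointwise_norm_sq_def sum_distrib_left Sr_def)
    also have "ln \<dots> = ln (Im w ^ (2 * k)) + ln (Sr w)"
      using posr[OF w] y by (intro ln_mult_pos) auto
    also have "ln (Im w ^ (2 * k)) = real (2 * k) * ln (Im w)"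
      by (rule ln_realpow)
    finally have "L w = of_real (real (2 * k) * ln (Im w) + ln (Sr w))" by (simp only: L_def)
    also have "\<dots> = of_nat (2 * k) * of_real (ln (Im w)) + of_real (ln (Sr w))" by simp
    also have "complex_of_real (ln (Im w)) = Ln (of_real (Im w))" using y by (rule Ln_of_real[symmetric])
    also have "complex_of_real (ln (Sr w)) = Ln (S w)" unfolding SR using posr[OF w] by (rule Ln_of_real[symmetric])
    finally show ?thesis .
  qed
  \<comment> \<open>Established on the whole half-plane, because the result is differentiated once
    more.\<close>
  have zbar: "wirtinger_zbar L w = of_nat k * \<i> / of_real (Im w) + T w / S w" if w: "w \<in> uhp" for w
  proof -
    have c: "has_wirtinger (\<lambda>z. c) 0 0 w" for c by (rule has_wirtinger_holomorphic) simp
    have 1: "has_wirtinger (\<lambda>w. Ln (of_real (Im w))) (inverse (of_real (Im w)) * (- \<i> / 2)) (inverse (of_real (Im w)) * (\<i> / 2)) w"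
      by (rule has_wirtinger_compose[OF has_wirtinger_Im has_field_derivative_Ln[OF Ip(1)[OF w]]])
    have 2: "has_wirtinger (\<lambda>w. Ln (S w)) (inverse (S w) * cnj (T w)) (inverse (S w) * T w) w"
      by (rule has_wirtinger_compose[OF dS[OF w] has_field_derivative_Ln[OF Sp(2)[OF w]]])
    have "has_wirtinger L (of_nat (2 * k) * (inverse (of_real (Im w)) * (- \<i> / 2)) + 0 * Ln (of_real (Im w)) + inverse (S w) * cnj (T w))
       (of_nat (2 * k) * (inverse (of_real (Im w)) * (\<i> / 2)) + 0 * Ln (of_real (Im w)) + inverse (S w) * T w) w"
      by (rule has_wirtinger_transform[OF has_wirtinger_add[OF has_wirtinger_mult[OF c 1] 2] open_uhp w]) (simp add: LL)
    from has_wirtinger_eq(2)[OF this] show ?thesis by (simp add: field_simps)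
  qed
  have zz: "wirtinger_z (wirtinger_zbar L) z = - of_nat k / (2 * of_real ((Im z)\<^sup>2)) + (of_real (P z) / S z - T z * cnj (T z) / (S z)\<^sup>2)"
  proof -
    have c: "has_wirtinger (\<lambda>z. c) 0 0 z" for c by (rule has_wirtinger_holomorphic) simp
    have inv: "(inverse has_field_derivative - inverse (x ^ 2)) (at x)" if "x \<noteq> 0" for x :: complex
      using DERIV_inverse[OF that] by (simp add: power2_eq_square power_inverse)
    have 1: "has_wirtinger (\<lambda>w. inverse (of_real (Im w))) (- inverse (of_real (Im z) ^ 2) * (- \<i> / 2)) (- inverse (of_real (Im z) ^ 2) * (\<i> / 2)) z"
      by (rule has_wirtinger_compose[OF has_wirtinger_Im inv[OF Ip(2)[OF z]]])
    have 2: "has_wirtinger (\<lambda>w. inverse (S w)) (- inverse (S z ^ 2) * cnj (T z)) (- inverse (S z ^ 2) * T z) z"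
      by (rule has_wirtinger_compose[OF dS[OF z] inv[OF Sp(3)[OF z]]])
    have 3: "has_wirtinger (\<lambda>w. of_nat k * \<i> * inverse (of_real (Im w)) + T w * inverse (S w))
      ((of_nat k * \<i>) * (- inverse (of_real (Im z) ^ 2) * (- \<i> / 2)) + 0 * inverse (of_real (Im z)) + (T z * (- inverse (S z ^ 2) * cnj (T z)) + of_real (P z) * inverse (S z)))
      ((of_nat k * \<i>) * (- inverse (of_real (Im z) ^ 2) * (\<i> / 2)) + 0 * inverse (of_real (Im z)) + (T z * (- inverse (S z ^ 2) * T z) + (\<Sum>j<n. f j z * cnj (deriv (f' j) z)) * inverse (S z))) z"
      by (rule has_wirtinger_add[OF has_wirtinger_mult[OF c[of "of_nat k * \<i>"] 1] has_wirtinger_mult[OF dT[OF z] 2]])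
    have 4: "has_wirtinger (wirtinger_zbar L)
      ((of_nat k * \<i>) * (- inverse (of_real (Im z) ^ 2) * (- \<i> / 2)) + 0 * inverse (of_real (Im z)) + (T z * (- inverse (S z ^ 2) * cnj (T z)) + of_real (P z) * inverse (S z)))
      ((of_nat k * \<i>) * (- inverse (of_real (Im z) ^ 2) * (\<i> / 2)) + 0 * inverse (of_real (Im z)) + (T z * (- inverse (S z ^ 2) * T z) + (\<Sum>j<n. f j z * cnj (deriv (f' j) z)) * inverse (S z))) z"
    proof (rule has_wirtinger_transform[OF 3 open_uhp z])
      fix x assume x: "x \<in> uhp"
      show "of_nat k * \<i> * inverse (of_real (Im x)) + T x * inverse (S x) = wirtinger_zbar L x"
        unfolding zbar[OF x] divide_inverse ..
    qed
    note eq = has_wirtinger_eq(1)[OF 4]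
    have alg: "(K * \<i>) * (- V * (- \<i> / 2)) + 0 * x + (t * (- W * t') + p * r) = - (V * K) / 2 + (p * r - t * t' * W)"
      for K V x t W t' p r :: complex
      by (simp add: algebra_simps)
    have half: "- K / (2 * V) = - (inverse V * K) / 2" if "V \<noteq> 0" for K V :: complex
      using that by (simp add: field_simps)
    have half': "- of_nat k / (2 * complex_of_real ((Im z)\<^sup>2)) = - (inverse (complex_of_real (Im z) ^ 2) * of_nat k) / 2"
      unfolding of_real_power by (rule half) (use Ip(2)[OF z] in simp)
    show ?thesis unfolding eq alg half' by (simp only: divide_inverse[of _ "S z"] divide_inverse[of _ "S z ^ 2"])
  qed
  have TT: "T z * cnj (T z) = of_real ((cmod (\<Sum>j<n. deriv (f j) z * cnj (f j z)))\<^sup>2)"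
  proof -
    have "cnj (T z) = (\<Sum>j<n. deriv (f j) z * cnj (f j z))" by (simp add: T_def f'_def mult.commute)
    then have eq: "(\<Sum>j<n. deriv (f j) z * cnj (f j z)) = cnj (T z)" by (rule sym)
    show ?thesis unfolding eq complex_mod_cnj by (simp only: complex_norm_square)
  qed
  define Q where "Q = (\<Sum>j<n. (cmod (deriv (f j) z))\<^sup>2) / (\<Sum>j<n. (cmod (f j z))\<^sup>2)
        - (cmod (\<Sum>j<n. deriv (f j) z * cnj (f j z)))\<^sup>2 / (\<Sum>j<n. (cmod (f j z))\<^sup>2)\<^sup>2"
  have zz': "wirtinger_z (wirtinger_zbar L) z = of_real (- real k / (2 * (Im z)\<^sup>2) + Q)"
    unfolding zz TT SR by (simp add: Q_def P_def f'_def Sr_def)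
  have y: "Im z \<noteq> 0" using z by (simp add: uhp_def)
  have "metric_ratio k n f z = (- (\<i> / (2 * of_real pi)) * of_real (- real k / (2 * (Im z)\<^sup>2) + Q)) / ((\<i> / 2) / of_real ((Im z)\<^sup>2))"
    using zz' by (simp add: metric_ratio_def bergman_metric_def hyperbolic_metric_def L_def)
  also have "\<dots> = of_real (- ((Im z)\<^sup>2 / pi * (- real k / (2 * (Im z)\<^sup>2) + Q)))"
    using y by (simp add: field_simps)
  also have "- ((Im z)\<^sup>2 / pi * (- real k / (2 * (Im z)\<^sup>2) + Q)) = real k / (2 * pi) - (Im z)\<^sup>2 / pi * Q"
    using y by (simp add: field_simps)
  finally show ?thesis by (simp add: Q_def)
qed

subsection \<open>Orthonormal bases\<close>

context cusped_surface
begin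

lemma cusp_forms_sum:
  assumes \<omega>: "\<And>j. j < n \<Longrightarrow> \<omega> j \<in> cusp_forms \<Gamma> k"
  shows "(\<lambda>z. \<Sum>j<n. c j * \<omega> j z) \<in> cusp_forms \<Gamma> k"
proof -
  have "\<exists>F. \<forall>j<n. F j holomorphic_on ball 0 1 \<and> F j 0 = 0 \<and> (\<forall>z\<in>uhp. \<omega> j z = F j (qpar z))"
    using cusp_formD(4)[OF \<omega>] by metis
  then obtain F where F: "\<And>j. j < n \<Longrightarrow> F j holomorphic_on ball 0 1" "\<And>j. j < n \<Longrightarrow> F j 0 = 0"
    "\<And>j z. j < n \<Longrightarrow> z \<in> uhp \<Longrightarrow> \<omega> j z = F j (qpar z)" by blast
  have "(\<lambda>q. \<Sum>j<n. c j * F j q) holomorphic_on ball 0 1" using F(1) by (intro holomorphic_intros) auto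
  moreover have "(\<Sum>j<n. c j * F j 0) = 0" using F(2) by simp
  moreover have "\<forall>z\<in>uhp. (\<Sum>j<n. c j * \<omega> j z) = (\<Sum>j<n. c j * F j (qpar z))" using F(3) by simp
  ultimately have "\<exists>F. F holomorphic_on ball 0 1 \<and> F 0 = 0 \<and> (\<forall>z\<in>uhp. (\<Sum>j<n. c j * \<omega> j z) = F (qpar z))"
    by (intro exI[of _ "\<lambda>q. \<Sum>j<n. c j * F j q"] conjI)
  moreover have "(\<lambda>z. \<Sum>j<n. c j * \<omega> j z) holomorphic_on uhp"
    using cusp_formD(1)[OF \<omega>] by (intro holomorphic_intros) auto
  moreover have "\<forall>z. z \<notin> uhp \<longrightarrow> (\<Sum>j<n. c j * \<omega> j z) = 0" using cusp_formD(2)[OF \<omega>] by simp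
  moreover have "\<forall>A\<in>G. \<forall>z\<in>uhp. (\<Sum>j<n. c j * \<omega> j (moebius A z)) = aut_factor A z ^ (2 * k) * (\<Sum>j<n. c j * \<omega> j z)"
    using cusp_formD(3)[OF \<omega>] by (simp add: sum_distrib_left mult.left_commute)
  ultimately show ?thesis unfolding cusp_forms_def G_eq[symmetric] aut_factor_def qpar_def by blast
qed

text \<open>Pythagoras. Orthonormality is stated through values of integrals, and these values alone
  must yield the integrability of all products.\<close>

lemma normsq_orthonormal:
  assumes ob: "orthonormal_basis \<Gamma> k n \<omega>"
  shows "normsq k (\<lambda>z. \<Sum>j<n. c j * \<omega> j z) = ennreal (\<Sum>j<n. (cmod (c j))\<^sup>2)"
proof -
  define h where "h = (\<lambda>i j z. indicator D z *\<^sub>R (of_real (Im z ^ (2 * k)) * \<omega> i z * cnj (\<omega> j z)))"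
  have \<omega>: "\<omega> j \<in> cusp_forms \<Gamma> k" if "j < n" for j using ob that by (simp add: orthonormal_basis_def)
  have I: "integral\<^sup>L hyp_measure (h i j) = (if i = j then 1 else 0)" if "i < n" "j < n" for i j
    using ob that by (simp add: orthonormal_basis_def inner_hyp_def set_lebesgue_integral_def h_def)
  have meas: "h i j \<in> borel_measurable hyp_measure" if "i < n" "j < n" for i j
  proof -
    have [measurable]: "\<omega> i \<in> borel_measurable borel" "\<omega> j \<in> borel_measurable borel"
      using cusp_form_measurable \<omega> that by auto
    have [measurable]: "cnj \<in> borel_measurable borel" by (intro borel_measurable_continuous_onI continuous_intros)
    show ?thesis unfolding h_def by measurable
  qed
  have diag: "h j j z = of_real (indicator D z * (Im z ^ (2 * k) * (cmod (\<omega> j z))\<^sup>2))" for j z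
    by (simp add: h_def mult.assoc complex_norm_square[symmetric] scaleR_conv_of_real del: of_real_power)
  \<comment> \<open>A non-integrable function has integral 0 by convention, but this integral is
    1.\<close>
  have id: "integrable hyp_measure (h j j)" if "j < n" for j
    using I[OF that that] not_integrable_integral_eq[of hyp_measure "h j j"] by fastforce
  \<comment> \<open>A product is dominated by the sum of the two diagonal terms.\<close>
  have int: "integrable hyp_measure (h i j)" if ij: "i < n" "j < n" for i j
  proof (rule Bochner_Integration.integrable_bound)
    show "integrable hyp_measure (\<lambda>z. h i i z + h j j z)" using id ij by simp
    show "AE z in hyp_measure. norm (h i j z) \<le> norm (h i i z + h j j z)"
    proof (rule AE_I2)
      fix z
      have p: "Im z ^ (2 * k) \<ge> 0" by (simp add: power_mult)
      have "cmod (\<omega> i z) * cmod (\<omega> j z) \<le> (cmod (\<omega> i z))\<^sup>2 + (cmod (\<omega> j z))\<^sup>2"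
        using sum_squares_bound[of "cmod (\<omega> i z)" "cmod (\<omega> j z)"] mult_nonneg_nonneg[OF norm_ge_zero[of "\<omega> i z"] norm_ge_zero[of "\<omega> j z"]] by linarith
      then have "indicator D z * (Im z ^ (2 * k) * (cmod (\<omega> i z) * cmod (\<omega> j z)))
        \<le> indicator D z * (Im z ^ (2 * k) * ((cmod (\<omega> i z))\<^sup>2 + (cmod (\<omega> j z))\<^sup>2))"
        using p by (intro mult_left_mono) auto
      also have "\<dots> \<le> cmod (h i i z + h j j z)"
        unfolding diag of_real_add[symmetric] norm_of_real by (simp add: distrib_left)
      finally have le: "indicator D z * (Im z ^ (2 * k) * (cmod (\<omega> i z) * cmod (\<omega> j z))) \<le> cmod (h i i z + h j j z)" .
      have "norm (h i j z) = indicator D z * (Im z ^ (2 * k) * (cmod (\<omega> i z) * cmod (\<omega> j z)))"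
        unfolding h_def norm_scaleR norm_mult norm_of_real complex_mod_cnj abs_of_nonneg[OF p]
        by (simp add: indicator_def mult.assoc)
      with le show "norm (h i j z) \<le> norm (h i i z + h j j z)" by (simp only:)
    qed
  qed (use meas ij in auto)
  define r where "r = (\<lambda>z. indicator D z * pointwise_norm_sq k (\<lambda>z. \<Sum>j<n. c j * \<omega> j z) z)"
  define H where "H = (\<lambda>z. \<Sum>i<n. \<Sum>j<n. c i * cnj (c j) * h i j z)"
  have Hr: "H z = of_real (r z)" for z
  proof -
    have "of_real ((cmod (\<Sum>j<n. c j * \<omega> j z))\<^sup>2) = (\<Sum>i<n. c i * \<omega> i z) * cnj (\<Sum>j<n. c j * \<omega> j z)"
      by (rule complex_norm_square)
    also have "\<dots> = (\<Sum>i<n. \<Sum>j<n. (c i * \<omega> i z) * (cnj (c j) * cnj (\<omega> j z)))"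
      by (simp add: sum_product)
    finally have "of_real (r z) = of_real (indicator D z) * (of_real (Im z ^ (2 * k)) * (\<Sum>i<n. \<Sum>j<n. (c i * \<omega> i z) * (cnj (c j) * cnj (\<omega> j z))))"
      by (simp only: r_def pointwise_norm_sq_def of_real_mult)
    also have "\<dots> = H z" by (simp add: H_def h_def sum_distrib_left scaleR_conv_of_real mult_ac)
    finally show ?thesis by simp
  qed
  have iH: "integrable hyp_measure H"
    unfolding H_def by (intro Bochner_Integration.integrable_sum integrable_mult_right int) auto
  have "integral\<^sup>L hyp_measure H = (\<Sum>i<n. \<Sum>j<n. c i * cnj (c j) * integral\<^sup>L hyp_measure (h i j))"
  proof -
    have "integral\<^sup>L hyp_measure H = (\<Sum>i<n. integral\<^sup>L hyp_measure (\<lambda>z. \<Sum>j<n. c i * cnj (c j) * h i j z))"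
      unfolding H_def
      by (intro Bochner_Integration.integral_sum Bochner_Integration.integrable_sum integrable_mult_right int) auto
    also have "\<dots> = (\<Sum>i<n. \<Sum>j<n. integral\<^sup>L hyp_measure (\<lambda>z. c i * cnj (c j) * h i j z))"
      by (intro sum.cong refl Bochner_Integration.integral_sum integrable_mult_right int) auto
    finally show ?thesis by simp
  qed
  also have "\<dots> = (\<Sum>i<n. of_real ((cmod (c i))\<^sup>2))"
    by (intro sum.cong refl) (simp add: I sum.delta' if_distrib[of "\<lambda>x. _ * x"] complex_norm_square del: of_real_power cong: if_cong)
  finally have sH: "integral\<^sup>L hyp_measure H = of_real (\<Sum>i<n. (cmod (c i))\<^sup>2)" by simp
  have Hr': "H = (\<lambda>z. of_real (r z))" using Hr by auto
  have ir: "integrable hyp_measure r" using integrable_Re[OF iH] by (simp add: Hr')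
  have sr: "integral\<^sup>L hyp_measure r = (\<Sum>i<n. (cmod (c i))\<^sup>2)"
    using sH unfolding Hr' integral_complex_of_real of_real_eq_iff .
  have r0: "r z \<ge> 0" for z by (simp add: r_def pointwise_nonneg)
  have "normsq k (\<lambda>z. \<Sum>j<n. c j * \<omega> j z) = (\<integral>\<^sup>+ z. ennreal (r z) \<partial>hyp_measure)"
    unfolding normsq_def r_def by (intro nn_integral_cong) (auto simp: indicator_def)
  also have "\<dots> = ennreal (integral\<^sup>L hyp_measure r)" by (rule nn_integral_eq_integral[OF ir]) (simp add: r0)
  finally show ?thesis by (simp only: sr)
qed

text \<open>Cauchy-Schwarz in the coordinates of \<open>g\<close>: the kernel on the diagonal
  dominates |g w|^2 divided by the squared norm, for every form.\<close>

lemma bergman_diagonal_pos: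
  assumes ob: "orthonormal_basis \<Gamma> k n \<omega>"
    and g: "g \<in> cusp_forms \<Gamma> k" "normsq k g \<le> ennreal N" "N > 0" "(cmod (g w))\<^sup>2 * Im w ^ (2 * k) \<ge> \<beta> * N" "\<beta> > 0"
    and w: "w \<in> uhp"
  shows "(\<Sum>j<n. (cmod (\<omega> j w))\<^sup>2) * Im w ^ (2 * k) \<ge> \<beta>"
proof -
  obtain c where c: "\<And>z. g z = (\<Sum>j<n. c j * \<omega> j z)" using ob g(1) by (auto simp: orthonormal_basis_def)
  have "g = (\<lambda>z. \<Sum>j<n. c j * \<omega> j z)" using c by auto
  then have "ennreal (\<Sum>j<n. (cmod (c j))\<^sup>2) \<le> ennreal N" using g(2) normsq_orthonormal[OF ob, of c] by simp
  then have cN: "(\<Sum>j<n. (cmod (c j))\<^sup>2) \<le> N" using g(3) by (simp add: ennreal_le_iff)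
  have "cmod (g w) \<le> (\<Sum>j<n. cmod (c j) * cmod (\<omega> j w))"
    unfolding c by (rule order_trans[OF norm_sum]) (simp add: norm_mult)
  then have "(cmod (g w))\<^sup>2 \<le> (\<Sum>j<n. cmod (c j) * cmod (\<omega> j w))\<^sup>2" by (intro power_mono) auto
  also have "\<dots> \<le> (\<Sum>j<n. (cmod (c j))\<^sup>2) * (\<Sum>j<n. (cmod (\<omega> j w))\<^sup>2)"
    by (rule Cauchy_Schwarz_ineq_sum)
  also have "\<dots> \<le> N * (\<Sum>j<n. (cmod (\<omega> j w))\<^sup>2)" by (intro mult_right_mono cN sum_nonneg) auto
  finally have "(cmod (g w))\<^sup>2 * Im w ^ (2 * k) \<le> N * (\<Sum>j<n. (cmod (\<omega> j w))\<^sup>2) * Im w ^ (2 * k)"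
    using w by (intro mult_right_mono) (auto simp: uhp_def)
  then have "N * \<beta> \<le> N * ((\<Sum>j<n. (cmod (\<omega> j w))\<^sup>2) * Im w ^ (2 * k))" using g(4) by (simp add: mult_ac)
  then show ?thesis using g(3) by simp
qed

text \<open>The curvature term is the squared length of the derivative vector after projection off
  the value vector, relative to that of the value vector. An explicit form vanishing at
  \<open>w\<close> realises this length, so \<open>curvature_bound\<close> applies to it.\<close>

lemma metric_ratio_bound:
  assumes ob: "orthonormal_basis \<Gamma> k n \<omega>" and w: "w \<in> uhp"
    and cb: "\<And>z. z \<in> uhp \<Longrightarrow> \<exists>M. curvature_bound k M z" and cM: "curvature_bound k M w"
  shows "cmod (metric_ratio k n \<omega> w - of_real (real k / (2 * pi))) \<le> M / pi"
proof -
  have \<omega>: "\<omega> j \<in> cusp_forms \<Gamma> k" if "j < n" for j using ob that by (simp add: orthonormal_basis_def)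
  \<comment> \<open>Positivity is used on the entire half-plane, because the logarithm is
    differentiated in a neighbourhood.\<close>
  have pos: "(\<Sum>j<n. (cmod (\<omega> j z))\<^sup>2) > 0" if z: "z \<in> uhp" for z
  proof -
    obtain M where "curvature_bound k M z" using cb[OF z] by blast
    then obtain \<beta> g N where "\<beta> > 0" "g \<in> cusp_forms \<Gamma> k" "N > 0" "normsq k g \<le> ennreal N" "(cmod (g z))\<^sup>2 * Im z ^ (2 * k) \<ge> \<beta> * N"
      unfolding curvature_bound_def by blast
    then have "(\<Sum>j<n. (cmod (\<omega> j z))\<^sup>2) * Im z ^ (2 * k) > 0" using bergman_diagonal_pos[OF ob _ _ _ _ _ z, of g N \<beta>] by linarith
    then show ?thesis using z by (simp add: uhp_def zero_less_mult_iff)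
  qed
  define v where "v = Im w"
  have v: "v > 0" using w by (simp add: v_def uhp_def)
  define A where "A = (\<Sum>j<n. (cmod (\<omega> j w))\<^sup>2)"
  define B where "B = (\<Sum>j<n. (cmod (deriv (\<omega> j) w))\<^sup>2)"
  define X where "X = (\<Sum>j<n. deriv (\<omega> j) w * cnj (\<omega> j w))"
  have A: "A > 0" using pos[OF w] by (simp add: A_def)
  have Ac: "(\<Sum>j<n. \<omega> j w * cnj (\<omega> j w)) = of_real A"
    unfolding A_def of_real_sum by (intro sum.cong refl) (simp only: complex_norm_square)
  have Bc: "(\<Sum>j<n. deriv (\<omega> j) w * cnj (deriv (\<omega> j) w)) = of_real B"
    unfolding B_def of_real_sum by (intro sum.cong refl) (simp only: complex_norm_square)
  \<comment> \<open>The conjugate of the derivative vector projected off the value vector. The form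
    with these coordinates vanishes at \<open>w\<close>, and both its derivative there and its
    squared norm equal \<open>R\<close>.\<close>
  define c where "c = (\<lambda>j. cnj (deriv (\<omega> j) w - X / of_real A * \<omega> j w))"
  define R where "R = (\<Sum>j<n. (cmod (c j))\<^sup>2)"
  define f where "f = (\<lambda>z. \<Sum>j<n. c j * \<omega> j z)"
  have f: "f \<in> cusp_forms \<Gamma> k" unfolding f_def by (rule cusp_forms_sum[OF \<omega>])
  have nf: "normsq k f = ennreal R" unfolding f_def R_def by (rule normsq_orthonormal[OF ob])
  have Xc: "cnj X = (\<Sum>j<n. cnj (deriv (\<omega> j) w) * \<omega> j w)" by (simp add: X_def)
  have fw: "f w = 0"
  proof -
    have "f w = (\<Sum>j<n. cnj (deriv (\<omega> j) w) * \<omega> j w) - cnj X / of_real A * (\<Sum>j<n. \<omega> j w * cnj (\<omega> j w))"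
      unfolding f_def c_def sum_distrib_left sum_subtractf[symmetric] by (intro sum.cong refl) (simp add: algebra_simps)
    also have "\<dots> = cnj X - cnj X / of_real A * (\<Sum>j<n. \<omega> j w * cnj (\<omega> j w))" by (simp only: Xc)
    finally have "f w = cnj X - cnj X / of_real A * (\<Sum>j<n. \<omega> j w * cnj (\<omega> j w))" .
    then show ?thesis using A by (simp add: Ac)
  qed
  have df: "deriv f w = (\<Sum>j<n. c j * deriv (\<omega> j) w)"
    unfolding f_def
    by (intro DERIV_imp_deriv DERIV_sum DERIV_cmult holomorphic_derivI[OF cusp_formD(1)[OF \<omega>] open_uhp w]) auto
  have orth: "(\<Sum>j<n. c j * \<omega> j w) = 0" using fw by (simp add: f_def)
  have dR: "deriv f w = of_real R"
  proof -
    have "of_real R = (\<Sum>j<n. c j * cnj (c j))"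
      unfolding R_def of_real_sum by (intro sum.cong refl) (simp only: complex_norm_square)
    also have "\<dots> = deriv f w - X / of_real A * (\<Sum>j<n. c j * \<omega> j w)"
      unfolding df sum_distrib_left sum_subtractf[symmetric] by (intro sum.cong refl) (simp add: c_def algebra_simps)
    finally show ?thesis using orth by simp
  qed
  have RB: "R = B - (cmod X)\<^sup>2 / A"
  proof -
    have "of_real R = (\<Sum>j<n. c j * deriv (\<omega> j) w)" using dR df by simp
    also have "\<dots> = (\<Sum>j<n. deriv (\<omega> j) w * cnj (deriv (\<omega> j) w)) - cnj X / of_real A * (\<Sum>j<n. deriv (\<omega> j) w * cnj (\<omega> j w))"
      unfolding c_def sum_distrib_left sum_subtractf[symmetric] by (intro sum.cong refl) (simp add: algebra_simps)
    also have "\<dots> = of_real B - cnj X / of_real A * X" by (simp only: Bc X_def[symmetric])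
    also have "\<dots> = of_real (B - (cmod X)\<^sup>2 / A)"
      unfolding of_real_diff of_real_divide complex_norm_square by (simp add: mult.commute)
    finally show ?thesis by (simp only: of_real_eq_iff)
  qed
  have R0: "R \<ge> 0" by (simp add: R_def sum_nonneg)
  obtain \<beta> g N where \<beta>: "\<beta> > 0"
     "\<And>f N. f \<in> cusp_forms \<Gamma> k \<Longrightarrow> N \<ge> 0 \<Longrightarrow> f w = 0 \<Longrightarrow> normsq k f \<le> ennreal N \<Longrightarrow>
        (cmod (deriv f w))\<^sup>2 * Im w ^ (2 * k + 2) \<le> M * \<beta> * N"
     and g: "g \<in> cusp_forms \<Gamma> k" "N > 0" "normsq k g \<le> ennreal N" "(cmod (g w))\<^sup>2 * Im w ^ (2 * k) \<ge> \<beta> * N"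
    using cM unfolding curvature_bound_def by blast
  have Ab: "A * v ^ (2 * k) \<ge> \<beta>"
    unfolding A_def v_def by (rule bergman_diagonal_pos[OF ob g(1,3,2,4) \<beta>(1) w])
  have "(cmod (deriv f w))\<^sup>2 * v ^ (2 * k + 2) \<le> M * \<beta> * R"
    unfolding v_def by (rule \<beta>(2)[OF f R0 fw]) (simp add: nf)
  then have Rb: "R * (R * v ^ (2 * k + 2)) \<le> R * (M * \<beta>)" using R0 by (simp add: dR power2_eq_square mult_ac)
  have M0: "M \<ge> 0"
  proof -
    have z: "(\<lambda>z. 0) \<in> cusp_forms \<Gamma> k" using cusp_forms_sum[of 0 \<omega> k] by simp
    have "normsq k (\<lambda>z. 0) = 0" using normsq_orthonormal[OF ob, of "\<lambda>_. 0"] by simp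
    then have "0 \<le> M * \<beta>" using \<beta>(2)[OF z, of 1] by simp
    then show ?thesis using \<beta>(1) by (simp add: zero_le_mult_iff)
  qed
  \<comment> \<open>The estimate is quadratic in \<open>R\<close>, so one factor is cancelled when
    \<open>R\<close> is nonzero; otherwise the claim is \<open>M \<ge> 0\<close>.\<close>
  have main: "v\<^sup>2 * (R / A) \<le> M"
  proof (cases "R = 0")
    case True then show ?thesis using M0 by simp
  next
    case False
    then have "R * v ^ (2 * k + 2) \<le> M * \<beta>" using Rb R0 by simp
    also have "\<dots> \<le> M * (A * v ^ (2 * k))" using Ab M0 by (intro mult_left_mono)
    finally have "(v\<^sup>2 * R) * v ^ (2 * k) \<le> (M * A) * v ^ (2 * k)" by (simp add: power_add power2_eq_square mult_ac)
    then have "v\<^sup>2 * R \<le> M * A" using v by simp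
    then show ?thesis using A by (simp add: field_simps)
  qed
  have "metric_ratio k n \<omega> w = of_real (real k / (2 * pi) - v\<^sup>2 / pi * (B / A - (cmod X)\<^sup>2 / A\<^sup>2))"
    unfolding v_def A_def B_def X_def by (rule bergman_metric_formula[OF cusp_formD(1)[OF \<omega>] pos w])
  also have "B / A - (cmod X)\<^sup>2 / A\<^sup>2 = R / A"
    using A by (simp add: RB field_simps power2_eq_square)
  finally have "metric_ratio k n \<omega> w - of_real (real k / (2 * pi)) = of_real (- (v\<^sup>2 * (R / A) / pi))" by simp
  then have "cmod (metric_ratio k n \<omega> w - of_real (real k / (2 * pi))) = v\<^sup>2 * (R / A) / pi"
    using R0 A by (simp only: norm_of_real) simp
  also have "\<dots> \<le> M / pi" using main by (intro divide_right_mono) auto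
  finally show ?thesis .
qed

text \<open>In the half-plane the constant \<open>k / (2 * pi)\<close> is itself below the cube of
  \<open>k\<close>. At the cusp the exponential form of the bound identifies the limit as
  \<open>k / (2 * pi)\<close>.\<close>

theorem metric_ratio_Xbar_bound:
  obtains C k0 where
    "\<And>k n \<omega> p. k \<ge> k0 \<Longrightarrow> orthonormal_basis \<Gamma> k n \<omega> \<Longrightarrow> p \<in> topspace (Xbar \<Gamma>) \<Longrightarrow>
       cmod (metric_ratio_Xbar k n \<omega> p) \<le> C * real k ^ 3"
proof -
  obtain C k0 where C: "C > 0" "k0 \<ge> (4::nat)"
    "\<And>k w. k \<ge> k0 \<Longrightarrow> w \<in> uhp \<Longrightarrow> curvature_bound k (C * real k ^ 3) w"
    "\<And>k w. k \<ge> k0 \<Longrightarrow> Im w \<ge> exp 8 \<Longrightarrow> Im w \<ge> real k \<Longrightarrow>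
       curvature_bound k (C * ((Im w)\<^sup>2 * exp (- 2 * pi * Im w))) w"
    by (rule curvature_bound_everywhere) (rule that)
  show ?thesis
  proof (rule that[of k0 "1 + C"])
    fix k n \<omega> p
    assume k: "k \<ge> k0" and ob: "orthonormal_basis \<Gamma> k n \<omega>" and p: "p \<in> topspace (Xbar \<Gamma>)"
    have cb: "\<exists>M. curvature_bound k M z" if "z \<in> uhp" for z using C(3)[OF k that] by blast
    have k1: "real k \<ge> 1" using k C(2) by simp
    have pi1: "1 \<le> pi" using pi_gt3 by simp
    have kk: "real k / (2 * pi) \<le> real k ^ 3"
    proof -
      have "real k / (2 * pi) \<le> real k / 1" using pi1 by (intro frac_le) auto
      also have "\<dots> \<le> real k ^ 3" using self_le_power[OF k1, of 3] by simp
      finally show ?thesis .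
    qed
    have inner: "cmod (metric_ratio k n \<omega> w) \<le> (1 + C) * real k ^ 3" if w: "w \<in> uhp" for w
    proof -
      have "cmod (metric_ratio k n \<omega> w) \<le> cmod (of_real (real k / (2 * pi))) + cmod (metric_ratio k n \<omega> w - of_real (real k / (2 * pi)))"
        by (rule norm_triangle_sub)
      also have "\<dots> \<le> real k ^ 3 + C * real k ^ 3 / 1"
      proof (rule add_mono)
        show "cmod (of_real (real k / (2 * pi))) \<le> real k ^ 3" unfolding norm_of_real using kk by simp
        have "cmod (metric_ratio k n \<omega> w - of_real (real k / (2 * pi))) \<le> C * real k ^ 3 / pi"
          by (rule metric_ratio_bound[OF ob w cb C(3)[OF k w]])
        also have "\<dots> \<le> C * real k ^ 3 / 1" using pi1 C(1) by (intro frac_le) auto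
        finally show "cmod (metric_ratio k n \<omega> w - of_real (real k / (2 * pi))) \<le> C * real k ^ 3 / 1" .
      qed
      finally show ?thesis by (simp add: distrib_right)
    qed
    show "cmod (metric_ratio_Xbar k n \<omega> p) \<le> (1 + C) * real k ^ 3"
    proof (cases p)
      case (Some P)
      then obtain z where z: "z \<in> uhp" "P = orbit \<Gamma> z" using p by (auto simp: topspace_Xbar)
      have sub: "P \<subseteq> uhp" unfolding z(2) orbit_def G_eq[symmetric] using moebius_G_uhp z(1) by blast
      have "moebius (mat 1) z \<in> P" unfolding z(2) orbit_def G_eq[symmetric] using one_G by blast
      \<comment> \<open>The bound holds at every point of the half-plane, hence at whichever
        representative is selected.\<close>
      then have "(SOME z. z \<in> P) \<in> P" by (rule someI[where P = "\<lambda>z. z \<in> P"])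
      then show ?thesis using sub inner Some by (auto simp: metric_ratio_Xbar_def)
    next
      case None
      let ?F = "filtercomap Im (at_top :: real filter)"
      have "((\<lambda>y::real. C * (y\<^sup>2 * exp (- 2 * pi * y)) / pi) \<longlongrightarrow> 0) at_top" by real_asymp
      then have lim0: "((\<lambda>w. C * ((Im w)\<^sup>2 * exp (- 2 * pi * Im w)) / pi) \<longlongrightarrow> 0) ?F"
        by (rule filterlim_compose[OF _ filterlim_filtercomap])
      have "((\<lambda>w. metric_ratio k n \<omega> w - of_real (real k / (2 * pi))) \<longlongrightarrow> 0) ?F"
      proof (rule Lim_null_comparison[OF _ lim0])
        have "eventually (\<lambda>y::real. y \<ge> exp 8 \<and> y \<ge> real k) at_top"
          by (intro eventually_conj eventually_ge_at_top)
        then have "eventually (\<lambda>w. Im w \<ge> exp 8 \<and> Im w \<ge> real k) ?F" by (rule eventually_filtercomapI)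
        then show "eventually (\<lambda>w. cmod (metric_ratio k n \<omega> w - of_real (real k / (2 * pi))) \<le> C * ((Im w)\<^sup>2 * exp (- 2 * pi * Im w)) / pi) ?F"
        proof (rule eventually_mono)
          fix w assume "Im w \<ge> exp 8 \<and> Im w \<ge> real k"
          then have w: "Im w \<ge> exp 8" "Im w \<ge> real k" by auto
          have "w \<in> uhp" using w(2) k1 by (simp add: uhp_def)
          then show "cmod (metric_ratio k n \<omega> w - of_real (real k / (2 * pi))) \<le> C * ((Im w)\<^sup>2 * exp (- 2 * pi * Im w)) / pi"
            by (rule metric_ratio_bound[OF ob _ cb C(4)[OF k w]])
        qed
      qed
      then have lim: "(metric_ratio k n \<omega> \<longlongrightarrow> of_real (real k / (2 * pi))) ?F" by (rule LIM_zero_cancel)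
      \<comment> \<open>Surjectivity makes the filter proper, so that \<open>Lim\<close> is the
        limit just found.\<close>
      have "surj Im" by (rule surjI[of _ "\<lambda>y. Complex 0 y"]) simp
      then have "?F \<noteq> bot" by (intro filtercomap_neq_bot_surj) auto
      then have "Lim ?F (metric_ratio k n \<omega>) = of_real (real k / (2 * pi))" by (rule tendsto_Lim[OF _ lim])
      then have "cmod (metric_ratio_Xbar k n \<omega> p) = \<bar>real k / (2 * pi)\<bar>"
        unfolding None metric_ratio_Xbar_def by (simp only: option.case norm_of_real)
      also have "\<dots> \<le> real k ^ 3" using kk by simp
      also have "\<dots> \<le> (1 + C) * real k ^ 3" using C(1) by (simp add: distrib_right)
      finally show ?thesis .
    qed
  qed
qed

end

lemma cusped_surface_Union:
  assumes "fuchsian \<Gamma>" "acts_freely \<Gamma>" "finite_covolume \<Gamma>" "only_puncture_infinity \<Gamma>"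
  shows "cusped_surface (\<Union>\<Gamma>) \<Gamma>"
proof -
  have ex: "\<exists>D. fundamental_domain \<Gamma> D" and vol: "emeasure hyp_measure (fund_dom \<Gamma>) < \<infinity>"
    using assms(3) unfolding finite_covolume_def by (rule conjunct1, rule conjunct2)
  have "fundamental_domain \<Gamma> (fund_dom \<Gamma>)" unfolding fund_dom_def using ex by (rule someI_ex)
  then show ?thesis
    by (intro cusped_surface.intro cusped_surface_axioms.intro cusped_group_Union[OF assms(1,2,4)] vol) (rule refl)
qed

theorem theorem1:
  fixes \<Gamma> :: "(real^2^2) set set" and g :: nat
  assumes "fuchsian \<Gamma>" and "acts_freely \<Gamma>" and "finite_covolume \<Gamma>"
    and "only_puncture_infinity \<Gamma>"
    and "has_genus (Xbar \<Gamma>) g" and "g \<ge> 2"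
  shows "\<exists>(C::real) (k0::nat). \<forall>k\<ge>k0. \<forall>n \<omega>. orthonormal_basis \<Gamma> k n \<omega> \<longrightarrow>
           (SUP p\<in>topspace (Xbar \<Gamma>). ereal (cmod (metric_ratio_Xbar k n \<omega> p)))
             \<le> ereal (C * real k ^ 3)"
proof -
  have "cusped_surface (\<Union>\<Gamma>) \<Gamma>" by (rule cusped_surface_Union[OF assms(1-4)])
  then obtain C k0 where C: "\<And>k n \<omega> p. k \<ge> k0 \<Longrightarrow> orthonormal_basis \<Gamma> k n \<omega> \<Longrightarrow> p \<in> topspace (Xbar \<Gamma>) \<Longrightarrow>
       cmod (metric_ratio_Xbar k n \<omega> p) \<le> C * real k ^ 3"
    by (rule cusped_surface.metric_ratio_Xbar_bound) (rule that)
  show ?thesis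
    by (rule exI[of _ C], rule exI[of _ k0]) (intro allI impI SUP_least, simp add: C)
qed

end
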